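(* Let $\{(\mathbf n_\varepsilon,g_\varepsilon)\}\subset\mathcal Y$ be a sequence of minimizers of $G_\varepsilon$. Then there exists a sequence $\{c_\varepsilon\}\subset(-l,l)$ such that, as $\varepsilon\to0$, $$(\tilde{\mathbf n}_\varepsilon,\tilde g_\varepsilon)\to(\mathbf n,g)\quad\text{in } L^1(\mathbb T^2,\mathbb S^2)\times L^2(\mathbb T^2),$$ where $$\tilde{\mathbf n}_\varepsilon(x,y)=\mathbf n_\varepsilon(x+c_\varepsilon,y),\qquad \tilde g_\varepsilon(x,y)=g_\varepsilon(x+c_\varepsilon,y),$$ $$\mathbf n=\mathbf n^-\chi_{L^-}+\mathbf n^+\chi_{L^+},\qquad g_x=\bar n_1\chi_{L^-}-\bar n_1\chi_{L^+},$$ with $L^-=\{x:\ l/2<|x|<l\}$ and $L^+=\{x:\ |x|<l/2\}$. Furthermore, $G_0(\mathbf n,g)=8c_0\,l$, where $c_0=\frac{2}{\sqrt A}(\sin\alpha-\alpha\cos\alpha)$.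
   Context: Fix constants $\sigma>0$ and $l>0$. Put $A=(1+\sigma)^{-1}\in(0,1)$, $\alpha=\arccos A$, $\bar n_1=\sqrt{1-A^2}$, and $\mathbf n^{\pm}=(\pm\bar n_1,0,A)\in\mathbb S^2$. Let $\mathbb T^2=\mathbb R^2/(2l\mathbb Z)^2$ be the flat torus, i.e. the square $[-l,l)^2$ with periodic boundary conditions (translations are understood on the torus). For $\mathbf n=(n_1,n_2,n_3)\in\mathbb S^2$ let $$W(\mathbf n)=\sigma n_2^2+\frac1A(n_3-A)^2\ \ge 0,$$ whose zero set on $\mathbb S^2$ is $\{\mathbf n^+,\mathbf n^-\}$. For $\varepsilon>0$ let $$F_\varepsilon(\mathbf n,g)=\int_{\mathbb T^2}\Big[\varepsilon|\nabla\mathbf n|^2+\frac1\varepsilon W(\mathbf n)+\frac1\varepsilon(g_x+n_1)^2+\frac1\varepsilon(g_y+n_2)^2\Big]\,dx\,dy .$$ Let $\mathcal Y=W^{1,2}(\mathbb T^2,\mathbb S^2)\times W^{1,2}(\mathbb T^2)$ and $$\mathcal A=\Big\{(\mathbf n,g)\in BV(\mathbb T^2,\{\mathbf n^{\pm}\})\times W^{1,2}(\mathbb T^2):\ g_x\in BV(\mathbb T^2,\{\pm\bar n_1\}),\ g=g(x),\ \mathbf n=\mathbf n(x),\ g_x+n_1=0\text{ a.e.},\ n_2=0\text{ a.e.},\ \int_{\mathbb T^2}n_1=0\Big\}$$ (here $g=g(x)$, $\mathbf n=\mathbf n(x)$ mean dependence on $x$ only). On $L^1(\mathbb T^2,\mathbb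 S^2)\times L^2(\mathbb T^2)$ define $G_\varepsilon(\mathbf n,g)=F_\varepsilon(\mathbf n,g)$ if $(\mathbf n,g)\in\mathcal Y$ and $+\infty$ otherwise; and $G_0(\mathbf n,g)=2c_0P_{\mathbb T^2}(A_{\mathbf n^-})$ if $(\mathbf n,g)\in\mathcal A$ and $+\infty$ otherwise, where $A_{\mathbf n^-}=\{(x,y)\in\mathbb T^2:\mathbf n(x)=\mathbf n^-\}$, $P_{\mathbb T^2}$ is the perimeter in the torus, and $$c_0=\inf\Big\{\int_0^1\sqrt{W(\gamma(t))}\,|\gamma'(t)|\,dt:\ \gamma\in C^1([0,1],\mathbb S^2),\ \gamma(0)=\mathbf n^-,\ \gamma(1)=\mathbf n^+\Big\}=\frac{2}{\sqrt A}(\sin\alpha-\alpha\cos\alpha).$$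
   Formalization: The convergence of the translated g_ε is stated for g_ε minus its mean over the torus: G_ε is unchanged when a constant is added to g, so with g_ε + 1/ε in place of g_ε the printed L² convergence fails. *)

theory Defs
  imports "HOL-Analysis.Analysis"
begin

section \<open>Functions on the torus\<close>

text \<open>
  A function on the torus \<open>\<real>\<^sup>2 / (2l\<int>)\<^sup>2\<close> is represented by its lift, a function on the plane that is
  \<open>2l\<close>-periodic in both variables; integrals over the torus are integrals over the fundamental
  domain \<open>[-l,l)\<^sup>2\<close>. Elements of the function spaces are Borel representatives; all constraints on
  them are imposed almost everywhere only.
\<close>

definition periodic :: "real \<Rightarrow> (real \<times> real \<Rightarrow> 'a) \<Rightarrow> bool" where
  "periodic l f \<longleftrightarrow> (\<forall>x y. f (x + 2 * l, y) = f (x, y) \<and> f (x, y + 2 * l) = f (x, y))"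

definition cell :: "real \<Rightarrow> (real \<times> real) set" where
  "cell l = {-l..<l} \<times> {-l..<l}"

definition shift_x :: "real \<Rightarrow> (real \<times> real \<Rightarrow> 'a) \<Rightarrow> real \<times> real \<Rightarrow> 'a" where
  "shift_x c f = (\<lambda>p. f (fst p + c, snd p))"

definition torus_mean :: "real \<Rightarrow> (real \<times> real \<Rightarrow> real) \<Rightarrow> real" where
  "torus_mean l u = (LINT p:cell l|lborel. u p) / (4 * l\<^sup>2)"

text \<open>
  The energies below depend on \<open>g\<close> only through its gradient, so a minimizing \<open>g\<close> is determined at
  best up to an additive constant. \<open>mean_free\<close> selects the representative with mean zero.
\<close>

definition mean_free :: "real \<Rightarrow> (real \<times> real \<Rightarrow> real) \<Rightarrow> real \<times> real \<Rightarrow> real" where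
  "mean_free l u = (\<lambda>p. u p - torus_mean l u)"

definition only_x :: "(real \<times> real \<Rightarrow> 'a) \<Rightarrow> bool" where
  "only_x f \<longleftrightarrow> (\<exists>h. AE p in lborel. f p = h (fst p))"

definition L1 :: "real \<Rightarrow> (real \<times> real \<Rightarrow> 'a::{banach, second_countable_topology}) set" where
  "L1 l = {f. periodic l f \<and> f \<in> borel_measurable borel \<and> set_integrable lborel (cell l) f}"

definition L2 :: "real \<Rightarrow> (real \<times> real \<Rightarrow> 'a::{banach, second_countable_topology}) set" where
  "L2 l = {f. periodic l f \<and> f \<in> borel_measurable borel \<and>
              set_integrable lborel (cell l) (\<lambda>p. (norm (f p))\<^sup>2)}"

definition L1_norm :: "real \<Rightarrow> (real \<times> real \<Rightarrow> 'a::{banach, second_countable_topology}) \<Rightarrow> real" where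
  "L1_norm l f = (LINT p:cell l|lborel. norm (f p))"

definition L2_norm :: "real \<Rightarrow> (real \<times> real \<Rightarrow> 'a::{banach, second_countable_topology}) \<Rightarrow> real" where
  "L2_norm l f = sqrt (LINT p:cell l|lborel. (norm (f p))\<^sup>2)"

text \<open>
  Membership in the space is part of convergence, because the Bochner integral of a
  non-integrable function is \<open>0\<close>.
\<close>

definition tendsto_L1 ::
  "real \<Rightarrow> ('i \<Rightarrow> real \<times> real \<Rightarrow> 'a::{banach, second_countable_topology}) \<Rightarrow>
   (real \<times> real \<Rightarrow> 'a) \<Rightarrow> 'i filter \<Rightarrow> bool" where
  "tendsto_L1 l f f0 \<F> \<longleftrightarrow> (\<forall>\<^sub>F i in \<F>. f i \<in> L1 l) \<and> f0 \<in> L1 l \<and>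
     ((\<lambda>i. L1_norm l (\<lambda>p. f i p - f0 p)) \<longlongrightarrow> 0) \<F>"

definition tendsto_L2 ::
  "real \<Rightarrow> ('i \<Rightarrow> real \<times> real \<Rightarrow> 'a::{banach, second_countable_topology}) \<Rightarrow>
   (real \<times> real \<Rightarrow> 'a) \<Rightarrow> 'i filter \<Rightarrow> bool" where
  "tendsto_L2 l f f0 \<F> \<longleftrightarrow> (\<forall>\<^sub>F i in \<F>. f i \<in> L2 l) \<and> f0 \<in> L2 l \<and>
     ((\<lambda>i. L2_norm l (\<lambda>p. f i p - f0 p)) \<longlongrightarrow> 0) \<F>"


section \<open>Sobolev and BV functions, perimeter\<close>

definition C1_torus ::
  "real \<Rightarrow> (real \<times> real \<Rightarrow> real) \<Rightarrow> (real \<times> real \<Rightarrow> real \<times> real) \<Rightarrow> bool" where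
  "C1_torus l \<phi> D \<longleftrightarrow>
     periodic l \<phi> \<and> (\<forall>p. GDERIV \<phi> p :> D p) \<and> continuous_on UNIV D"

text \<open>
  Weak derivatives are tested against \<open>C\<^sup>1\<close> functions, as in Gilbarg and Trudinger. Since the torus
  has no boundary, no support condition is needed.
\<close>

definition has_weak_grad ::
  "real \<Rightarrow> (real \<times> real \<Rightarrow> real) \<Rightarrow> (real \<times> real \<Rightarrow> real \<times> real) \<Rightarrow> bool" where
  "has_weak_grad l u V \<longleftrightarrow> V \<in> L1 l \<and>
     (\<forall>\<phi> D. C1_torus l \<phi> D \<longrightarrow>
        (LINT p:cell l|lborel. u p *\<^sub>R D p) = - (LINT p:cell l|lborel. \<phi> p *\<^sub>R V p))"

text \<open>The choice is immaterial: weak gradients are unique almost everywhere.\<close>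

definition weak_grad :: "real \<Rightarrow> (real \<times> real \<Rightarrow> real) \<Rightarrow> real \<times> real \<Rightarrow> real \<times> real" where
  "weak_grad l u = (SOME V. has_weak_grad l u V)"

definition weak_dx :: "real \<Rightarrow> (real \<times> real \<Rightarrow> real) \<Rightarrow> real \<times> real \<Rightarrow> real" where
  "weak_dx l u p = fst (weak_grad l u p)"

definition weak_dy :: "real \<Rightarrow> (real \<times> real \<Rightarrow> real) \<Rightarrow> real \<times> real \<Rightarrow> real" where
  "weak_dy l u p = snd (weak_grad l u p)"

definition W12 :: "real \<Rightarrow> (real \<times> real \<Rightarrow> real) set" where
  "W12 l = {u \<in> L2 l. \<exists>V \<in> L2 l. has_weak_grad l u V}"

definition total_variation :: "real \<Rightarrow> (real \<times> real \<Rightarrow> real) \<Rightarrow> ereal" where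
  "total_variation l u =
     Sup {ereal (LINT p:cell l|lborel. u p * (fst (D p) + snd (E p))) | \<phi> \<psi> D E.
            C1_torus l \<phi> D \<and> C1_torus l \<psi> E \<and> (\<forall>p. norm (\<phi> p, \<psi> p) \<le> 1)}"

definition BV :: "real \<Rightarrow> (real \<times> real \<Rightarrow> real) set" where
  "BV l = {u \<in> L1 l. total_variation l u < \<infinity>}"

definition perimeter :: "real \<Rightarrow> (real \<times> real) set \<Rightarrow> ereal" where
  "perimeter l S = total_variation l (indicator S)"

text \<open>Sphere-valued classes; Sobolev and BV regularity of a vector field is componentwise.\<close>

definition L1_sphere :: "real \<Rightarrow> (real \<times> real \<Rightarrow> real^3) set" where
  "L1_sphere l = {n \<in> L1 l. AE p in lborel. n p \<in> sphere 0 1}"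

definition W12_sphere :: "real \<Rightarrow> (real \<times> real \<Rightarrow> real^3) set" where
  "W12_sphere l = {n. (\<forall>i. (\<lambda>p. n p $ i) \<in> W12 l) \<and> (AE p in lborel. n p \<in> sphere 0 1)}"

definition BV_vec :: "real \<Rightarrow> (real^3) set \<Rightarrow> (real \<times> real \<Rightarrow> real^3) set" where
  "BV_vec l K = {n. (\<forall>i. (\<lambda>p. n p $ i) \<in> BV l) \<and> (AE p in lborel. n p \<in> K)}"


section \<open>The energies\<close>

definition A0 :: "real \<Rightarrow> real" where
  "A0 \<sigma> = 1 / (1 + \<sigma>)"

definition alpha :: "real \<Rightarrow> real" where
  "alpha \<sigma> = arccos (A0 \<sigma>)"

definition nbar :: "real \<Rightarrow> real" where
  "nbar \<sigma> = sqrt (1 - (A0 \<sigma>)\<^sup>2)"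

definition n_plus :: "real \<Rightarrow> real^3" where
  "n_plus \<sigma> = vector [nbar \<sigma>, 0, A0 \<sigma>]"

definition n_minus :: "real \<Rightarrow> real^3" where
  "n_minus \<sigma> = vector [- nbar \<sigma>, 0, A0 \<sigma>]"

definition W :: "real \<Rightarrow> real^3 \<Rightarrow> real" where
  "W \<sigma> v = \<sigma> * (v $ 2)\<^sup>2 + 1 / A0 \<sigma> * (v $ 3 - A0 \<sigma>)\<^sup>2"

definition F_energy ::
  "real \<Rightarrow> real \<Rightarrow> real \<Rightarrow> (real \<times> real \<Rightarrow> real^3) \<Rightarrow> (real \<times> real \<Rightarrow> real) \<Rightarrow> real" where
  "F_energy \<sigma> l \<epsilon> n g =
     (LINT p:cell l|lborel.
        \<epsilon> * (\<Sum>i\<in>UNIV. (norm (weak_grad l (\<lambda>q. n q $ i) p))\<^sup>2)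
        + 1 / \<epsilon> * W \<sigma> (n p)
        + 1 / \<epsilon> * (weak_dx l g p + n p $ 1)\<^sup>2
        + 1 / \<epsilon> * (weak_dy l g p + n p $ 2)\<^sup>2)"

definition Y_space :: "real \<Rightarrow> ((real \<times> real \<Rightarrow> real^3) \<times> (real \<times> real \<Rightarrow> real)) set" where
  "Y_space l = W12_sphere l \<times> W12 l"

definition A_space :: "real \<Rightarrow> real \<Rightarrow> ((real \<times> real \<Rightarrow> real^3) \<times> (real \<times> real \<Rightarrow> real)) set" where
  "A_space \<sigma> l = {(n, g).
     n \<in> BV_vec l {n_plus \<sigma>, n_minus \<sigma>} \<and> g \<in> W12 l \<and>
     weak_dx l g \<in> BV l \<and> (AE p in lborel. weak_dx l g p \<in> {nbar \<sigma>, - nbar \<sigma>}) \<and>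
     only_x g \<and> only_x n \<and>
     (AE p in lborel. weak_dx l g p + n p $ 1 = 0) \<and>
     (AE p in lborel. n p $ 2 = 0) \<and>
     (LINT p:cell l|lborel. n p $ 1) = 0}"

definition c0 :: "real \<Rightarrow> real" where
  "c0 \<sigma> = Inf {integral {0..1} (\<lambda>t. sqrt (W \<sigma> (\<gamma> t)) * norm (\<gamma>' t)) | \<gamma> \<gamma>'.
     (\<forall>t\<in>{0..1}. (\<gamma> has_vector_derivative \<gamma>' t) (at t within {0..1})) \<and>
     continuous_on {0..1} \<gamma>' \<and> \<gamma> ` {0..1} \<subseteq> sphere 0 1 \<and>
     \<gamma> 0 = n_minus \<sigma> \<and> \<gamma> 1 = n_plus \<sigma>}"

definition G_energy ::
  "real \<Rightarrow> real \<Rightarrow> real \<Rightarrow> (real \<times> real \<Rightarrow> real^3) \<times> (real \<times> real \<Rightarrow> real) \<Rightarrow> ereal" where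
  "G_energy \<sigma> l \<epsilon> z = (if z \<in> Y_space l then ereal (F_energy \<sigma> l \<epsilon> (fst z) (snd z)) else \<infinity>)"

definition G0_energy ::
  "real \<Rightarrow> real \<Rightarrow> (real \<times> real \<Rightarrow> real^3) \<times> (real \<times> real \<Rightarrow> real) \<Rightarrow> ereal" where
  "G0_energy \<sigma> l z =
     (if z \<in> A_space \<sigma> l then ereal (2 * c0 \<sigma>) * perimeter l {p. fst z p = n_minus \<sigma>} else \<infinity>)"

definition minimizes_G ::
  "real \<Rightarrow> real \<Rightarrow> real \<Rightarrow> (real \<times> real \<Rightarrow> real^3) \<times> (real \<times> real \<Rightarrow> real) \<Rightarrow> bool" where
  "minimizes_G \<sigma> l \<epsilon> z \<longleftrightarrow> z \<in> L1_sphere l \<times> L2 l \<and>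
     (\<forall>z' \<in> L1_sphere l \<times> L2 l. G_energy \<sigma> l \<epsilon> z \<le> G_energy \<sigma> l \<epsilon> z')"

definition L_minus :: "real \<Rightarrow> real set" where
  "L_minus l = {x. l / 2 < \<bar>x\<bar> \<and> \<bar>x\<bar> < l}"

definition L_plus :: "real \<Rightarrow> real set" where
  "L_plus l = {x. \<bar>x\<bar> < l / 2}"

end

theory Submission
  imports Defs "HOL-Real_Asymp.Real_Asymp"
begin

text \<open>
  A wall is a transition of \<open>n\<^sub>1\<close> between \<open>- nbar\<close> and \<open>nbar\<close>. A competitor with two walls in which the
  angle of the director is linear already costs less than four optimal walls. A minimizer therefore
  has a horizontal slice whose energy is below that of four walls. On this slice \<open>n\<^sub>1\<close> has mean almost
  zero, being close to \<open>- g\<^sub>x\<close>, so it has exactly two walls, at distance almost \<open>l\<close>: up to translation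
  it is close to \<open>nbar\<close> times a square wave. The potential \<open>g\<close> carries this information to the other
  slices, because \<open>g\<^sub>y\<close> is small. Hence the correlation of \<open>n\<^sub>1\<close> with the square wave is almost maximal
  on the torus, which gives closeness in \<open>L\<^sup>2\<close> since \<open>n\<^sub>1\<^sup>2 \<le> 1 - n\<^sub>3\<^sup>2\<close> and \<open>n\<^sub>3\<close> is close to \<open>A\<close>. The convergence
  of \<open>g\<close> follows by the Poincare inequality. All estimates carry an explicit rate in \<open>\<epsilon>\<close>; no compactness is
  used, and an optimal wall profile is needed only for the value of \<open>c\<^sub>0\<close>.
\<close>

section \<open>Periodic functions on the circle and the torus\<close>

text \<open>The energy bound only has to exclude four walls, so neither side needs the sharp
  constant. Four walls cost at least \<open>8 * (f s - f (- s))\<close> on a slice, where f has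
  derivative \<open>reduced_root\<close>; linear walls cost at most \<open>8 * \<kappa>\<close> per
  slice, with \<open>\<kappa> = \<alpha> * (1 - A) / sqrt A\<close>. As s tends to
  \<open>nbar\<close>, the difference tends to
  \<open>(\<alpha> - A * sin \<alpha>) / sqrt A\<close>, so everything rests on sin \<alpha> <
  \<alpha>. Keeping only the x-derivative of the first component reduces a slice to a scalar
  function. By periodicity walls come in pairs, and the small mean of \<open>n\<^sub>1\<close>
  excludes a slice without walls. Low energy is known for one slice only, so walls cannot be counted
  on the others; the correlation is linear in \<open>n\<^sub>1\<close> and can be transported by g.
  This requires the integral of the modulus of \<open>g\<^sub>y\<close> to be small along the two
  vertical lines through the jumps, which may fail at their original position. On average over x
  that integral is of order \<open>\<delta>\<^sup>2\<close>, where
  \<open>\<delta> ^ 4 = \<epsilon>\<close>. Moving the wave by at most \<delta> therefore reaches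
  lines where it is of order \<delta>.\<close>

definition circle :: "real \<Rightarrow> real measure" where
  "circle l = density lborel (indicator {-l..<l})"

text \<open>Integration over a fundamental domain is expressed by a finite measure on the whole
  plane. Fubini and the integrability rules then apply to lifts directly, since the measure is the
  product of two copies of \<open>circle\<close>.\<close>

definition torus :: "real \<Rightarrow> (real \<times> real) measure" where
  "torus l = density lborel (indicator (cell l))"

lemma fst_borel_measurable [measurable]: "fst \<in> borel_measurable (borel :: (real \<times> real) measure)"
  and snd_borel_measurable [measurable]: "snd \<in> borel_measurable (borel :: (real \<times> real) measure)"
  by (auto intro!: borel_measurable_continuous_onI continuous_intros)

lemma cell_borel [measurable]: "cell l \<in> sets borel"
  unfolding cell_def by (simp add: borel_prod[symmetric])

lemma sets_circle [simp, measurable_cong]: "sets (circle l) = sets borel"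
  and space_circle [simp]: "space (circle l) = UNIV"
  and sets_torus [simp, measurable_cong]: "sets (torus l) = sets borel"
  and space_torus [simp]: "space (torus l) = UNIV"
  by (auto simp: circle_def torus_def)

lemma measurable_circle: "measurable (circle l) N = measurable borel N"
  and measurable_torus: "measurable (torus l) N = measurable borel N"
  by (auto intro!: measurable_cong_sets)

lemma emeasure_circle: "l > 0 \<Longrightarrow> emeasure (circle l) UNIV = ennreal (2 * l)"
  by (simp add: circle_def emeasure_density)

lemma finite_measure_circle: "finite_measure (circle l)"
proof (cases "l > 0")
  case True then show ?thesis by (intro finite_measureI) (simp add: emeasure_circle)
next
  case False then show ?thesis by (intro finite_measureI) (simp add: circle_def emeasure_density)
qed

interpretation circle: finite_measure "circle l" for l
  by (rule finite_measure_circle)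

interpretation torus: pair_sigma_finite "circle l" "circle l" for l
  by (intro pair_sigma_finite.intro circle.sigma_finite_measure_axioms)

lemma torus_eq_pair: "torus l = circle l \<Otimes>\<^sub>M circle l"
proof -
  have "circle l \<Otimes>\<^sub>M circle l = density (lborel \<Otimes>\<^sub>M lborel) (\<lambda>(x, y). indicator {-l..<l} x * indicator {-l..<l} y)"
    unfolding circle_def
    by (rule pair_measure_density)
       (simp_all add: sigma_finite_lborel circle.sigma_finite_measure_axioms[unfolded circle_def])
  also have "\<dots> = torus l" unfolding torus_def lborel_prod cell_def
    by (intro arg_cong2[where f=density] refl ext) (auto simp: indicator_def)
  finally show ?thesis ..
qed

lemma finite_measure_torus: "finite_measure (torus l)"
  unfolding torus_eq_pair by (rule finite_measure_pair_measure) (rule finite_measure_circle)+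

interpretation torus_fin: finite_measure "torus l" for l
  by (rule finite_measure_torus)

lemma measure_circle: "l > 0 \<Longrightarrow> measure (circle l) UNIV = 2 * l"
  using emeasure_circle[of l] by (simp add: measure_def)

lemma measure_torus: "l > 0 \<Longrightarrow> measure (torus l) UNIV = 4 * l\<^sup>2"
proof -
  assume l: "l > 0"
  have "emeasure (torus l) (UNIV \<times> UNIV) = ennreal (2*l) * ennreal (2*l)"
    unfolding torus_eq_pair using l by (subst circle.emeasure_pair_measure_Times) (auto simp: emeasure_circle)
  also have "\<dots> = ennreal (4 * l\<^sup>2)" using l by (simp add: ennreal_mult' [symmetric] power2_eq_square)
  finally show ?thesis using l by (simp add: measure_def)
qed

lemma
  fixes f :: "'a \<Rightarrow> 'b::{banach, second_countable_topology}"
  assumes [measurable]: "f \<in> borel_measurable M" "S \<in> sets M"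
  shows integral_density_indicator: "integral\<^sup>L (density M (indicator S)) f = (LINT x:S|M. f x)"
    and integrable_density_indicator: "integrable (density M (indicator S)) f \<longleftrightarrow> set_integrable M S f"
proof -
  have eq: "(indicator S :: 'a \<Rightarrow> ennreal) = (\<lambda>x. ennreal (indicator S x))"
    by (auto simp: indicator_def)
  show "integral\<^sup>L (density M (indicator S)) f = (LINT x:S|M. f x)"
    unfolding eq set_lebesgue_integral_def by (subst integral_density) auto
  show "integrable (density M (indicator S)) f \<longleftrightarrow> set_integrable M S f"
    unfolding eq set_integrable_def by (subst integrable_density) auto
qed

lemma
  fixes f :: "real \<times> real \<Rightarrow> 'a::{banach, second_countable_topology}"
  assumes [measurable]: "f \<in> borel_measurable borel"
  shows set_integral_cell: "(LINT p:cell l|lborel. f p) = integral\<^sup>L (torus l) f"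
    and set_integrable_cell: "set_integrable lborel (cell l) f \<longleftrightarrow> integrable (torus l) f"
  unfolding torus_def by (simp_all add: integral_density_indicator integrable_density_indicator)

lemma
  fixes f :: "real \<Rightarrow> 'a::{banach, second_countable_topology}"
  assumes [measurable]: "f \<in> borel_measurable borel"
  shows set_integral_circle: "(LINT x:{-l..<l}|lborel. f x) = integral\<^sup>L (circle l) f"
    and set_integrable_circle: "set_integrable lborel {-l..<l} f \<longleftrightarrow> integrable (circle l) f"
  unfolding circle_def by (simp_all add: integral_density_indicator integrable_density_indicator)

lemma AE_torus_iff: "(AE p in torus l. P p) \<longleftrightarrow> (AE p in lborel. p \<in> cell l \<longrightarrow> P p)"
  unfolding torus_def by (subst AE_density) (auto simp: indicator_def)

lemma AE_circle_iff: "(AE x in circle l. P x) \<longleftrightarrow> (AE x in lborel. x \<in> {-l..<l} \<longrightarrow> P x)"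
  unfolding circle_def by (subst AE_density) (auto simp: indicator_def)

lemma nn_integral_circle:
  "f \<in> borel_measurable borel \<Longrightarrow> (\<integral>\<^sup>+x. f x \<partial>circle l) = (\<integral>\<^sup>+x. f x * indicator {-l..<l} x \<partial>lborel)"
  unfolding circle_def by (subst nn_integral_density) (auto simp: mult.commute)

section \<open>Reduction modulo the period\<close>

lemma periodic_int_multiple:
  assumes "\<And>x. f (x + d) = f x"
  shows "f (x + d * of_int m) = f (x::real)"
proof (induction m rule: int_induct[where k=0])
  case base then show ?case by simp
next
  case (step1 i)
  have "f (x + d * of_int (i+1)) = f (x + d * of_int i + d)" by (simp add: algebra_simps)
  then show ?case using assms step1 by simp
next
  case (step2 i)
  have "f (x + d * of_int i) = f (x + d * of_int (i-1) + d)" by (simp add: algebra_simps)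
  then show ?case using assms step2 by simp
qed

definition to_circle :: "real \<Rightarrow> real \<Rightarrow> real" where
  "to_circle l x = x - 2 * l * of_int \<lfloor>(x + l) / (2 * l)\<rfloor>"

lemma to_circle_measurable [measurable]: "to_circle l \<in> borel_measurable borel"
  unfolding to_circle_def by measurable

lemma to_circle_in: "l > 0 \<Longrightarrow> to_circle l x \<in> {-l..<l}"
proof -
  assume l: "l > 0"
  define z where "z = (x + l) / (2 * l)"
  have x: "x = 2 * l * z - l" using l by (simp add: z_def)
  have "of_int \<lfloor>z\<rfloor> \<le> z" "z < of_int \<lfloor>z\<rfloor> + 1" by linarith+
  then have "2 * l * of_int \<lfloor>z\<rfloor> \<le> 2 * l * z" "2 * l * z < 2 * l * (of_int \<lfloor>z\<rfloor> + 1)"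
    using l by (auto intro: mult_left_mono mult_strict_left_mono)
  then show ?thesis unfolding to_circle_def z_def[symmetric] by (simp add: x algebra_simps)
qed

lemma to_circle_periodic: "l > 0 \<Longrightarrow> to_circle l (x + 2 * l) = to_circle l x"
proof -
  assume l: "l > 0"
  have "(x + 2 * l + l) / (2 * l) = (x + l) / (2 * l) + 1" using l by (simp add: field_simps)
  then show ?thesis by (simp add: to_circle_def algebra_simps)
qed

lemma to_circle_id: "x \<in> {-l..<l} \<Longrightarrow> to_circle l x = x"
proof -
  assume x: "x \<in> {-l..<l}"
  then have "\<lfloor>(x + l) / (2 * l)\<rfloor> = 0" by (subst floor_eq_iff) (auto simp: field_simps)
  then show ?thesis by (simp add: to_circle_def)
qed

lemma periodic_to_circle:
  assumes "\<And>x. f (x + 2 * l) = f x" shows "f (to_circle l x) = f x"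
  using periodic_int_multiple[of f "2*l" x "- \<lfloor>(x + l) / (2 * l)\<rfloor>", OF assms]
  by (simp add: to_circle_def)

text \<open>A window starting inside the fundamental interval is cut at \<open>l\<close>, and the
  part beyond \<open>l\<close> is moved back by one period. An arbitrary starting point is brought
  into the interval by a whole number of periods.\<close>

lemma nn_integral_period:
  fixes f :: "real \<Rightarrow> ennreal"
  assumes l: "l > 0" and [measurable]: "f \<in> borel_measurable borel" and per: "\<And>x. f (x + 2 * l) = f x"
  shows "(\<integral>\<^sup>+x. f x * indicator {a..<a + 2 * l} x \<partial>lborel) = (\<integral>\<^sup>+x. f x \<partial>circle l)"
proof -
  have base: "(\<integral>\<^sup>+x. f x * indicator {b..<b + 2 * l} x \<partial>lborel) = (\<integral>\<^sup>+x. f x \<partial>circle l)"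
    if b: "b \<in> {-l..<l}" for b
  proof -
    have "(\<integral>\<^sup>+x. f x * indicator {l..<b + 2 * l} x \<partial>lborel)
       = (\<integral>\<^sup>+x. f (2 * l + 1 * x) * indicator {l..<b + 2 * l} (2 * l + 1 * x) \<partial>lborel)"
      by (subst nn_integral_real_affine[where c=1 and t="2*l"]) auto
    also have "\<dots> = (\<integral>\<^sup>+x. f x * indicator {-l..<b} x \<partial>lborel)"
      by (intro nn_integral_cong) (auto simp: indicator_def per add.commute)
    finally have eq: "(\<integral>\<^sup>+x. f x * indicator {l..<b + 2 * l} x \<partial>lborel) = (\<integral>\<^sup>+x. f x * indicator {-l..<b} x \<partial>lborel)" .
    have "(\<integral>\<^sup>+x. f x * indicator {b..<b + 2 * l} x \<partial>lborel)
        = (\<integral>\<^sup>+x. f x * indicator {b..<l} x + f x * indicator {l..<b + 2 * l} x \<partial>lborel)"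
      using b by (intro nn_integral_cong) (auto simp: indicator_def)
    also have "\<dots> = (\<integral>\<^sup>+x. f x * indicator {b..<l} x \<partial>lborel) + (\<integral>\<^sup>+x. f x * indicator {-l..<b} x \<partial>lborel)"
      by (subst nn_integral_add) (auto simp: eq)
    also have "\<dots> = (\<integral>\<^sup>+x. f x * indicator {b..<l} x + f x * indicator {-l..<b} x \<partial>lborel)"
      by (subst nn_integral_add) auto
    also have "\<dots> = (\<integral>\<^sup>+x. f x \<partial>circle l)"
      using b by (subst nn_integral_circle) (auto intro!: nn_integral_cong simp: indicator_def)
    finally show ?thesis .
  qed
  define k where "k = 2 * l * of_int \<lfloor>(a + l) / (2 * l)\<rfloor>"
  have k: "a = to_circle l a + k" by (simp add: to_circle_def k_def)
  have fk: "f (k + x) = f x" for x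
    using periodic_int_multiple[of f "2*l", OF per] by (simp add: k_def add.commute)
  have "(\<integral>\<^sup>+x. f x * indicator {a..<a + 2 * l} x \<partial>lborel)
     = (\<integral>\<^sup>+x. f (k + 1 * x) * indicator {a..<a + 2 * l} (k + 1 * x) \<partial>lborel)"
    by (subst nn_integral_real_affine[where c=1 and t=k]) auto
  also have "\<dots> = (\<integral>\<^sup>+x. f x * indicator {to_circle l a..<to_circle l a + 2 * l} x \<partial>lborel)"
    using k by (intro nn_integral_cong) (auto simp: indicator_def fk)
  also have "\<dots> = (\<integral>\<^sup>+x. f x \<partial>circle l)" by (rule base[OF to_circle_in[OF l]])
  finally show ?thesis .
qed

text \<open>In terms of image measures, so that integrals and integrability of Banach-valued
  functions follow from the nonnegative case by \<open>integral_distr\<close> and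
  \<open>integrable_distr_eq\<close>.\<close>

lemma distr_to_circle:
  assumes l: "l > 0"
  shows "distr (density lborel (indicator {a..<a + 2 * l})) borel (to_circle l) = circle l"
proof (rule measure_eqI)
  fix A assume "A \<in> sets (distr (density lborel (indicator {a..<a + 2 * l})) borel (to_circle l))"
  then have [measurable]: "A \<in> sets borel" by simp
  have "emeasure (distr (density lborel (indicator {a..<a + 2 * l})) borel (to_circle l)) A
     = (\<integral>\<^sup>+x. indicator (to_circle l -` A) x * indicator {a..<a + 2 * l} x \<partial>lborel)"
    by (subst emeasure_distr)
       (auto simp: emeasure_density measurable_sets_borel[OF to_circle_measurable] mult.commute intro!: nn_integral_cong)
  also have "\<dots> = (\<integral>\<^sup>+x. indicator (to_circle l -` A) x \<partial>circle l)"
    using l by (intro nn_integral_period) (auto simp: indicator_def to_circle_periodic)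
  also have "\<dots> = (\<integral>\<^sup>+x. indicator A x \<partial>circle l)"
    by (simp only: nn_integral_circle borel_measurable_indicator \<open>A \<in> sets borel\<close> measurable_sets_borel[OF to_circle_measurable])
       (intro nn_integral_cong, auto simp: indicator_def to_circle_id)
  finally show "emeasure (distr (density lborel (indicator {a..<a + 2 * l})) borel (to_circle l)) A = emeasure (circle l) A"
    by simp
qed simp

lemma distr_circle_shift:
  assumes l: "l > 0"
  shows "distr (circle l) borel (\<lambda>x. to_circle l (x + c)) = circle l"
proof (rule measure_eqI)
  fix A assume "A \<in> sets (distr (circle l) borel (\<lambda>x. to_circle l (x + c)))"
  then have [measurable]: "A \<in> sets borel" by simp
  have "emeasure (distr (circle l) borel (\<lambda>x. to_circle l (x + c))) A
     = (\<integral>\<^sup>+x. indicator (to_circle l -` A) (x + c) \<partial>circle l)"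
    by (subst emeasure_distr) (auto simp: vimage_def simp flip: nn_integral_indicator intro!: nn_integral_cong split: split_indicator)
  also have "\<dots> = (\<integral>\<^sup>+x. indicator (to_circle l -` A) (c + 1 * x) * indicator {-l + c..<-l + c + 2 * l} (c + 1 * x) \<partial>lborel)"
    by (subst nn_integral_circle) (auto intro!: nn_integral_cong simp: indicator_def add.commute)
  also have "\<dots> = (\<integral>\<^sup>+x. indicator (to_circle l -` A) x * indicator {-l + c..<-l + c + 2 * l} x \<partial>lborel)"
    by (subst (2) nn_integral_real_affine[where c=1 and t=c]) auto
  also have "\<dots> = (\<integral>\<^sup>+x. indicator (to_circle l -` A) x \<partial>circle l)"
    using l by (intro nn_integral_period) (auto simp: indicator_def to_circle_periodic)
  also have "\<dots> = (\<integral>\<^sup>+x. indicator A x \<partial>circle l)"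
    by (simp only: nn_integral_circle borel_measurable_indicator \<open>A \<in> sets borel\<close> measurable_sets_borel[OF to_circle_measurable])
       (intro nn_integral_cong, auto simp: indicator_def to_circle_id)
  finally show "emeasure (distr (circle l) borel (\<lambda>x. to_circle l (x + c))) A = emeasure (circle l) A"
    by simp
qed simp

lemma
  fixes f :: "real \<Rightarrow> 'a::{banach, second_countable_topology}"
  assumes l: "l > 0" and [measurable]: "f \<in> borel_measurable borel" and per: "\<And>x. f (x + 2 * l) = f x"
  shows integral_circle_shift: "(\<integral>x. f (x + c) \<partial>circle l) = (\<integral>x. f x \<partial>circle l)"
    and integrable_circle_shift: "integrable (circle l) (\<lambda>x. f (x + c)) \<longleftrightarrow> integrable (circle l) f"
    and integral_period: "(LINT x:{a..<a + 2 * l}|lborel. f x) = (\<integral>x. f x \<partial>circle l)"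
    and set_integrable_period: "set_integrable lborel {a..<a + 2 * l} f \<longleftrightarrow> integrable (circle l) f"
proof -
  show "(\<integral>x. f (x + c) \<partial>circle l) = (\<integral>x. f x \<partial>circle l)"
    by (subst (2) distr_circle_shift[OF l, of c, symmetric], subst integral_distr)
       (auto simp: periodic_to_circle per measurable_circle)
  show "integrable (circle l) (\<lambda>x. f (x + c)) \<longleftrightarrow> integrable (circle l) f"
    by (subst (2) distr_circle_shift[OF l, of c, symmetric], subst integrable_distr_eq)
       (auto simp: periodic_to_circle per measurable_circle)
  show "(LINT x:{a..<a + 2 * l}|lborel. f x) = (\<integral>x. f x \<partial>circle l)"
    by (subst distr_to_circle[OF l, of a, symmetric], subst integral_distr)
       (auto simp: periodic_to_circle per integral_density_indicator)
  show "set_integrable lborel {a..<a + 2 * l} f \<longleftrightarrow> integrable (circle l) f"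
    by (subst distr_to_circle[OF l, of a, symmetric], subst integrable_distr_eq)
       (auto simp: periodic_to_circle per integrable_density_indicator)
qed

section \<open>Null sets under translations and slicing\<close>

lemma AE_lborel_translate:
  fixes d :: "'a::euclidean_space"
  assumes "AE x in lborel. P x" shows "AE x in lborel. P (d + x)"
proof -
  have "lborel = distr lborel borel ((+) d)"
    using lborel_affine[of 1 d] by (simp add: density_1)
  then have "AE x in distr lborel borel ((+) d). P x"
    using assms by metis
  then show ?thesis by (rule AE_distrD[rotated]) simp
qed

text \<open>Countably many translates of the cell cover the line, and null sets are stable under
  countable unions. Properties verified on one period thus become available at translated points
  outside the cell.\<close>

lemma AE_lborel_periodic1:
  assumes l: "l > 0" and "AE x in circle l. P x" and per: "\<And>x. P (x + 2 * l) = P x"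
  shows "AE x in lborel. P x"
proof -
  have "AE x in lborel. d + x \<in> {-l..<l} \<longrightarrow> P (d + x)" for d
    using assms(2) unfolding AE_circle_iff by (rule AE_lborel_translate)
  then have "AE x in lborel. \<forall>m::int. (2 * l * of_int m) + x \<in> {-l..<l} \<longrightarrow> P ((2 * l * of_int m) + x)"
    by (simp add: AE_all_countable)
  then show ?thesis
  proof eventually_elim
    case (elim x)
    have "(2 * l * of_int (- \<lfloor>(x + l) / (2 * l)\<rfloor>)) + x = to_circle l x"
      by (simp add: to_circle_def)
    then show ?case
      using elim[rule_format, of "- \<lfloor>(x + l) / (2 * l)\<rfloor>"] to_circle_in[OF l, of x]
      by (simp only: periodic_to_circle[of P, OF per])
  qed
qed

lemma AE_lborel_periodic2:
  assumes l: "l > 0" and ae: "AE p in torus l. P p" and per: "periodic l P"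
  shows "AE p in lborel. P p"
proof -
  have per1: "P (x + 2 * l, y) = P (x, y)" and per2: "P (x, y + 2 * l) = P (x, y)" for x y
    using per by (auto simp: periodic_def)
  have "AE p in lborel. d + p \<in> cell l \<longrightarrow> P (d + p)" for d
    using ae unfolding AE_torus_iff by (rule AE_lborel_translate)
  then have "AE p in lborel. \<forall>(m::int) (k::int). (2 * l * of_int m, 2 * l * of_int k) + p \<in> cell l
      \<longrightarrow> P ((2 * l * of_int m, 2 * l * of_int k) + p)"
    by (simp add: AE_all_countable)
  then show ?thesis
  proof eventually_elim
    case (elim p)
    obtain x y where p: "p = (x, y)" by fastforce
    have "(2 * l * of_int (- \<lfloor>(x + l) / (2 * l)\<rfloor>), 2 * l * of_int (- \<lfloor>(y + l) / (2 * l)\<rfloor>)) + p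
        = (to_circle l x, to_circle l y)"
      by (simp add: to_circle_def p)
    moreover have "(to_circle l x, to_circle l y) \<in> cell l"
      using to_circle_in[OF l, of x] to_circle_in[OF l, of y] by (auto simp: cell_def)
    ultimately have "P (to_circle l x, to_circle l y)"
      using elim by metis
    then show ?case
      using periodic_to_circle[of "\<lambda>x. P (x, to_circle l y)" l x, OF per1]
        periodic_to_circle[of "\<lambda>y. P (x, y)" l y, OF per2]
      by (simp add: p)
  qed
qed

lemma AE_circle_lborel: "AE x in lborel. P x \<Longrightarrow> AE x in circle l. P x"
  unfolding AE_circle_iff by (auto elim: eventually_mono)

lemma AE_torus_lborel: "AE x in lborel. P x \<Longrightarrow> AE x in torus l. P x"
  unfolding AE_torus_iff by (auto elim: eventually_mono)

lemma distr_torus_shift: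
  assumes l: "l > 0"
  shows "distr (torus l) borel (\<lambda>(x, y). (to_circle l (x + c), y)) = torus l"
proof -
  have id: "distr (circle l) borel (\<lambda>y. y) = circle l"
    by (rule distr_id2) simp
  have "distr (circle l) borel (\<lambda>x. to_circle l (x + c)) \<Otimes>\<^sub>M distr (circle l) borel (\<lambda>y. y)
      = distr (circle l \<Otimes>\<^sub>M circle l) (borel \<Otimes>\<^sub>M borel) (\<lambda>(x, y). (to_circle l (x + c), y))"
    by (rule pair_measure_distr) (simp_all add: id circle.sigma_finite_measure_axioms measurable_circle)
  then show ?thesis unfolding id distr_circle_shift[OF l] torus_eq_pair[symmetric] borel_prod by simp
qed

lemma
  fixes f :: "real \<times> real \<Rightarrow> 'a::{banach, second_countable_topology}"
  assumes l: "l > 0" and [measurable]: "f \<in> borel_measurable borel" and per: "periodic l f"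
  shows integral_torus_shift: "(\<integral>p. f (fst p + c, snd p) \<partial>torus l) = (\<integral>p. f p \<partial>torus l)"
    and integrable_torus_shift: "integrable (torus l) (\<lambda>p. f (fst p + c, snd p)) \<longleftrightarrow> integrable (torus l) f"
proof -
  have f: "f (case p of (x, y) \<Rightarrow> (to_circle l (x + c), y)) = f (fst p + c, snd p)" for p
    using periodic_to_circle[of "\<lambda>x. f (x, snd p)" l "fst p + c"] per by (auto simp: periodic_def split: prod.split)
  have [measurable]: "(\<lambda>(x, y). (to_circle l (x + c), y)) \<in> torus l \<rightarrow>\<^sub>M borel"
    unfolding measurable_torus borel_prod[symmetric] by measurable
  show "(\<integral>p. f (fst p + c, snd p) \<partial>torus l) = (\<integral>p. f p \<partial>torus l)"
    by (subst (2) distr_torus_shift[OF l, of c, symmetric], subst integral_distr) (auto simp: f)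
  show "integrable (torus l) (\<lambda>p. f (fst p + c, snd p)) \<longleftrightarrow> integrable (torus l) f"
    by (subst (2) distr_torus_shift[OF l, of c, symmetric], subst integrable_distr_eq) (auto simp: f)
qed

text \<open>The exceptional set need not be Borel, so it is enclosed in a Borel null set before the
  product measure is used.\<close>

lemma AE_torus_fst: "AE x in circle l. P x \<Longrightarrow> AE p in torus l. P (fst p)"
  and AE_torus_snd: "AE y in circle l. P y \<Longrightarrow> AE p in torus l. P (snd p)"
proof -
  assume "AE x in circle l. P x"
  then obtain N where N: "{x. \<not> P x} \<subseteq> N" "emeasure (circle l) N = 0" "N \<in> sets borel"
    by (auto elim!: AE_E)
  from N have N': "AE x in circle l. x \<notin> N" by (intro AE_not_in) auto
  have "fst -` (- N) \<in> sets (borel :: (real \<times> real) measure)" "snd -` (- N) \<in> sets (borel :: (real \<times> real) measure)"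
    using N(3) by (auto intro!: measurable_sets_borel borel_measurable_continuous_onI continuous_intros)
  then have "{p \<in> space (circle l \<Otimes>\<^sub>M circle l). fst p \<notin> N} \<in> sets (circle l \<Otimes>\<^sub>M circle l)"
    "{p \<in> space (circle l \<Otimes>\<^sub>M circle l). snd p \<notin> N} \<in> sets (circle l \<Otimes>\<^sub>M circle l)"
    unfolding torus_eq_pair[symmetric] by (simp_all add: vimage_def)
  note meas = this
  have 1: "AE p in torus l. fst p \<notin> N"
    unfolding torus_eq_pair by (rule torus.AE_pair_measure[OF meas(1)]) (use N' in \<open>auto elim!: eventually_mono\<close>)
  have 2: "AE p in torus l. snd p \<notin> N"
    unfolding torus_eq_pair by (rule torus.AE_pair_measure[OF meas(2)]) (use N' in simp)
  from 1 show "AE p in torus l. P (fst p)" by eventually_elim (use N in auto)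
  from 2 show "AE p in torus l. P (snd p)" by eventually_elim (use N in auto)
qed

lemma AE_torus_pair:
  assumes "AE p in torus l. P p"
  shows "AE x in circle l. AE y in circle l. P (x, y)" "AE y in circle l. AE x in circle l. P (x, y)"
proof -
  show "AE x in circle l. AE y in circle l. P (x, y)"
    using assms unfolding torus_eq_pair by (rule torus.AE_pair)
  \<comment> \<open>Exchanging the two quantifiers requires a measurable predicate, which
    \<open>P\<close> itself need not be.\<close>
  obtain N where N: "{x. \<not> P x} \<subseteq> N" "emeasure (torus l) N = 0" "N \<in> sets borel"
    using assms by (auto elim!: AE_E)
  then have "AE p in torus l. p \<notin> N" by (intro AE_not_in) auto
  then have "AE x in circle l. AE y in circle l. (x, y) \<notin> N"
    unfolding torus_eq_pair by (rule torus.AE_pair)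
  then have "AE y in circle l. AE x in circle l. (x, y) \<notin> N"
  proof (subst torus.AE_commute[symmetric])
    have "- N \<in> sets (torus l)" using N(3) by auto
    then show "{x \<in> space (circle l \<Otimes>\<^sub>M circle l). (fst x, snd x) \<notin> N} \<in> sets (circle l \<Otimes>\<^sub>M circle l)"
      unfolding torus_eq_pair[symmetric] by (simp add: Compl_eq)
  qed
  then show "AE y in circle l. AE x in circle l. P (x, y)"
    using N(1) by (auto elim!: eventually_mono)
qed

section \<open>Periodic test functions\<close>

definition C1_circle :: "real \<Rightarrow> (real \<Rightarrow> real) \<Rightarrow> (real \<Rightarrow> real) \<Rightarrow> bool" where
  "C1_circle l f f' \<longleftrightarrow>
     (\<forall>x. f (x + 2 * l) = f x) \<and> (\<forall>x. (f has_real_derivative f' x) (at x)) \<and> continuous_on UNIV f'"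

lemma C1_circle_continuous:
  assumes "C1_circle l f f'" shows "continuous_on S f" "continuous_on S f'"
proof -
  show "continuous_on S f"
    using assms unfolding C1_circle_def
    by (intro continuous_at_imp_continuous_on ballI) (auto intro: DERIV_isCont)
  show "continuous_on S f'"
    using assms unfolding C1_circle_def by (auto intro: continuous_on_subset)
qed

lemma C1_circle_measurable [measurable_dest]:
  assumes "C1_circle l f f'"
  shows "f \<in> borel_measurable borel" "f' \<in> borel_measurable borel"
  using C1_circle_continuous[OF assms] by (auto intro!: borel_measurable_continuous_onI)

text \<open>Tensor products are the test functions through which a given weak gradient is exploited:
  they separate the variables and still determine an integrable function up to a null set.\<close>

lemma C1_torus_prod:
  assumes a: "C1_circle l a a'" and b: "C1_circle l b b'"
  shows "C1_torus l (\<lambda>p. a (fst p) * b (snd p)) (\<lambda>p. (a' (fst p) * b (snd p), a (fst p) * b' (snd p)))"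
proof -
  have da: "((\<lambda>p::real\<times>real. a (fst p)) has_derivative (\<lambda>h. fst h * a' (fst p))) (at p)"
    and db: "((\<lambda>p::real\<times>real. b (snd p)) has_derivative (\<lambda>h. snd h * b' (snd p))) (at p)" for p
    using a b unfolding C1_circle_def
    by (auto intro!: DERIV_compose_FDERIV[where f=a and g=fst] DERIV_compose_FDERIV[where f=b and g=snd]
      has_derivative_fst has_derivative_snd has_derivative_ident)
  have G: "GDERIV (\<lambda>p. a (fst p) * b (snd p)) p :> (a' (fst p) * b (snd p), a (fst p) * b' (snd p))" for p
    unfolding gderiv_def
    by (rule has_derivative_eq_rhs[OF has_derivative_mult[OF da db]])
       (auto simp: fun_eq_iff algebra_simps)
  have cp: "continuous_on UNIV (\<lambda>p::real\<times>real. f (fst p))" "continuous_on UNIV (\<lambda>p::real\<times>real. f (snd p))"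
    if "continuous_on UNIV f" for f :: "real \<Rightarrow> real"
    by (rule continuous_on_compose2[OF that], intro continuous_intros, simp)+
  have "continuous_on UNIV (\<lambda>p. (a' (fst p) * b (snd p), a (fst p) * b' (snd p)))"
    by (intro continuous_on_Pair continuous_on_mult cp C1_circle_continuous[OF a] C1_circle_continuous[OF b])
  with G show ?thesis
    using a b unfolding C1_torus_def by (auto simp: periodic_def C1_circle_def)
qed

section \<open>Products of test functions determine integrable functions\<close>

lemma AE_torus_neq_line: "AE p in torus l. fst p \<noteq> c \<and> snd p \<noteq> c"
proof -
  have "AE x in circle l. x \<noteq> c" by (intro AE_circle_lborel AE_lborel_singleton)
  from AE_torus_fst[OF this] AE_torus_snd[OF this] show ?thesis by eventually_elim simp
qed

text \<open>Dynkin argument: open boxes are stable under intersection and generate the Borel sets,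
  so the integral of \<open>w\<close> over every Borel set vanishes, in particular over the sets
  where \<open>w\<close> is positive or negative.\<close>

lemma AE_eq_0_if_box_integrals_0:
  fixes w :: "real \<times> real \<Rightarrow> real"
  assumes l: "l > 0" and w: "integrable (torus l) w"
    and box0: "\<And>p q r s. \<lbrakk>p \<in> {-l..l}; q \<in> {-l..l}; r \<in> {-l..l}; s \<in> {-l..l}; p < q; r < s\<rbrakk>
       \<Longrightarrow> (LINT z:{p<..<q}\<times>{r<..<s}|torus l. w z) = 0"
  shows "AE z in torus l. w z = 0"
proof -
  have [measurable]: "w \<in> borel_measurable borel"
    using borel_measurable_integrable[OF w] by (simp add: measurable_torus)
  have si: "set_integrable (torus l) A w" if "A \<in> sets borel" for A
    using that w unfolding set_integrable_def by (intro integrable_mult_indicator) auto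
  have "AE z in torus l. z \<in> cell l" by (simp add: AE_torus_iff)
  then have in_cell: "AE z in torus l. fst z \<in> {-l<..<l} \<and> snd z \<in> {-l<..<l}"
    using AE_torus_neq_line[of "-l" l] by eventually_elim (auto simp: cell_def)
  have prod_meas: "{p<..<q::real}\<times>{r<..<s::real} \<in> sets borel" for p q r s
    by (simp add: borel_prod[symmetric])
  have boxes: "(LINT z:box a b|torus l. w z) = 0" for a b :: "real \<times> real"
  proof -
    \<comment> \<open>The box is clipped to the cell, where the hypothesis applies; the torus
      measure sees neither what is cut off nor the boundary lines.\<close>
    define p q r s where "p = max (-l) (fst a)" and "q = min l (fst b)"
      and "r = max (-l) (snd a)" and "s = min l (snd b)"
    note d = this
    have eq: "(LINT z:box a b|torus l. w z) = (LINT z:{p<..<q}\<times>{r<..<s}|torus l. w z)"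
      unfolding set_lebesgue_integral_def
    proof (rule integral_cong_AE)
      show "AE z in torus l. indicat_real (box a b) z *\<^sub>R w z = indicat_real ({p<..<q} \<times> {r<..<s}) z *\<^sub>R w z"
        using in_cell by eventually_elim (auto simp: indicator_def box_def d Basis_prod_def inner_prod_def)
    qed (use prod_meas in auto)
    show ?thesis
    proof (cases "p < q \<and> r < s")
      case True
      then show ?thesis unfolding eq using l by (intro box0) (auto simp: d)
    next
      case False
      then have empty: "{p<..<q}\<times>{r<..<s} = {}" by auto
      show ?thesis unfolding eq empty by (simp add: set_lebesgue_integral_def)
    qed
  qed
  have univ: "(LINT z:UNIV|torus l. w z) = 0"
  proof -
    have "(LINT z:UNIV|torus l. w z) = (LINT z:box (-l,-l) (l,l)|torus l. w z)"
      unfolding set_lebesgue_integral_def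
    proof (rule integral_cong_AE)
      show "AE z in torus l. indicat_real UNIV z *\<^sub>R w z = indicat_real (box (-l,-l) (l,l)) z *\<^sub>R w z"
        using in_cell by eventually_elim (auto simp: indicator_def box_def Basis_prod_def inner_prod_def)
    qed auto
    then show ?thesis by (simp add: boxes)
  qed
  have Int: "Int_stable (range (\<lambda>(a, b). box a b :: (real \<times> real) set))"
    by (auto simp: Int_stable_def box_Int_box)
  have all: "(LINT z:A|torus l. w z) = 0" if "A \<in> sets borel" for A
  proof -
    have A: "A \<in> sigma_sets UNIV (range (\<lambda>(a, b). box a b :: (real \<times> real) set))"
      using that unfolding borel_eq_box by simp
    have meas: "B \<in> sets borel" if "B \<in> sigma_sets UNIV (range (\<lambda>(a, b). box a b :: (real \<times> real) set))" for B
      using that unfolding borel_eq_box by simp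
    have Pow: "range (\<lambda>(a, b). box a b :: (real \<times> real) set) \<subseteq> Pow UNIV" by simp
    show ?thesis using Int Pow A
    proof (induction rule: sigma_sets_induct_disjoint)
      case (basic A) then show ?case by (auto simp: boxes)
    next
      case empty then show ?case by (simp add: set_lebesgue_integral_def)
    next
      case (compl A)
      have "(LINT z:UNIV|torus l. w z) = (LINT z:A|torus l. w z) + (LINT z:UNIV - A|torus l. w z)"
        using meas[OF compl(1)] by (subst set_integral_Un[symmetric]) (auto intro!: si)
      then show ?case using compl univ by simp
    next
      case (union A)
      have Ai: "A i \<in> sets borel" for i
        using union(2) by (intro meas) auto
      then have "(\<Union>i. A i) \<in> sets borel" by auto
      with Ai have "(LINT z:(\<Union>i. A i)|torus l. w z) = (\<Sum>i. (LINT z:A i|torus l. w z))"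
        using union(1) by (intro lebesgue_integral_countable_add si) (auto simp: disjoint_family_on_def)
      then show ?case using union by simp
    qed
  qed
  have "(LINT z:{z. w z > 0}|torus l. w z) = 0" "(LINT z:{z. w z < 0}|torus l. w z) = 0"
    by (intro all; measurable)+
  moreover have "(\<lambda>z. max 0 (w z)) = (\<lambda>z. indicator {z. w z > 0} z *\<^sub>R w z)"
    "(\<lambda>z. max 0 (- w z)) = (\<lambda>z. - (indicator {z. w z < 0} z *\<^sub>R w z))"
    by (auto simp: fun_eq_iff indicator_def max_def)
  ultimately have "integral\<^sup>L (torus l) (\<lambda>z. max 0 (w z)) = 0" "integral\<^sup>L (torus l) (\<lambda>z. max 0 (- w z)) = 0"
    by (simp_all add: set_lebesgue_integral_def)
  moreover have "integrable (torus l) (\<lambda>z. max 0 (w z))" "integrable (torus l) (\<lambda>z. max 0 (- w z))"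
    using w by (intro integrable_max integrable_zero Bochner_Integration.integrable_minus; assumption)+
  ultimately have "AE z in torus l. max 0 (w z) = 0" "AE z in torus l. max 0 (- w z) = 0"
    by (simp_all add: integral_nonneg_eq_0_iff_AE)
  then show ?thesis by eventually_elim auto
qed

text \<open>\<open>S\<close> is a product of two sines of half the basic frequency. Each changes
  sign under a shift by \<open>2 * l\<close>, so \<open>S\<close> is periodic, and on the cell it is
  positive exactly between \<open>p\<close> and \<open>q\<close>. The logistic function of
  \<open>k * S\<close> therefore tends to the indicator away from finitely many points.\<close>

lemma C1_circle_approx_indicator:
  assumes l: "l > 0" and p: "p \<in> {-l..l}" and q: "q \<in> {-l..l}" and pq: "p < q"
  obtains f f' where "\<And>k::nat. C1_circle l (f k) (f' k)" "\<And>k x. f k x \<in> {0..1::real}"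
    "AE x in circle l. (\<lambda>k. f k x) \<longlonglongrightarrow> indicator {p<..<q} x"
proof
  define S where "S x = sin ((x - p) * (pi / (2 * l))) * sin ((q - x) * (pi / (2 * l)))" for x
  define S' where "S' x = cos ((x - p) * (pi / (2 * l))) * (pi / (2 * l)) * sin ((q - x) * (pi / (2 * l)))
    - sin ((x - p) * (pi / (2 * l))) * (cos ((q - x) * (pi / (2 * l))) * (pi / (2 * l)))" for x
  define f where "f k x = 1 / (1 + exp (- (real k * S x)))" for k x
  define f' where "f' k x = exp (- (real k * S x)) * (real k * S' x) / (1 + exp (- (real k * S x)))\<^sup>2" for k x
  have pos: "1 + exp (t::real) > 0" for t by (simp add: add_pos_pos)
  have pos': "1 + exp (t::real) \<noteq> 0" for t using pos[of t] by linarith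
  have S: "(S has_real_derivative S' x) (at x)" for x
    unfolding S_def S'_def using l by (auto intro!: derivative_eq_intros)
  have df: "(f k has_real_derivative f' k x) (at x)" for k x
    unfolding f_def f'_def
    by (rule derivative_eq_intros S pos' refl | simp add: power2_eq_square pos')+
  have S'cont: "continuous_on UNIV S'" and Scont: "continuous_on UNIV S"
    unfolding S'_def S_def by (intro continuous_intros; use l in simp)+
  have "continuous_on UNIV (f' k)" for k
    unfolding f'_def by (intro continuous_intros S'cont Scont) (simp add: pos')
  moreover have "f k (x + 2 * l) = f k x" for k x
  proof -
    have "(x + 2 * l - p) * (pi / (2 * l)) = (x - p) * (pi / (2 * l)) + pi"
      "(q - (x + 2 * l)) * (pi / (2 * l)) = (q - x) * (pi / (2 * l)) - pi"
      using l by (auto simp: field_simps)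
    then have "S (x + 2 * l) = S x"
      unfolding S_def by (simp add: sin_diff)
    then show ?thesis by (simp add: f_def)
  qed
  ultimately show "C1_circle l (f k) (f' k)" for k
    using df by (auto simp: C1_circle_def)
  show "f k x \<in> {0..1}" for k x
    using pos[of "- (real k * S x)"] by (auto simp: f_def field_simps)
  have sgn: "0 < sin (t * (pi / (2 * l)))" if "0 < t" "t < 2 * l" for t
    using that l by (intro sin_gt_zero) (auto simp: field_simps)
  have sgn': "sin (t * (pi / (2 * l))) < 0" if "t < 0" "-2 * l < t" for t
    using sgn[of "-t"] that by simp
  have "AE x in circle l. x \<noteq> p \<and> x \<noteq> q \<and> x \<noteq> -l \<and> x \<in> {-l..<l}"
    using AE_lborel_singleton[of p] AE_lborel_singleton[of q] AE_lborel_singleton[of "-l"]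
    unfolding AE_circle_iff by eventually_elim auto
  then show "AE x in circle l. (\<lambda>k. f k x) \<longlonglongrightarrow> indicator {p<..<q} x"
  proof eventually_elim
    case (elim x)
    show ?case
    proof (cases "x \<in> {p<..<q}")
      case True
      then have "S x > 0" unfolding S_def by (intro mult_pos_pos sgn; use elim p q True in auto)
      then have "(\<lambda>k. exp (- (real k * S x))) \<longlonglongrightarrow> 0"
        by real_asymp
      then have "(\<lambda>k. f k x) \<longlonglongrightarrow> 1 / (1 + 0)"
        unfolding f_def by (intro tendsto_intros) auto
      then show ?thesis using True by simp
    next
      case False
      have "S x < 0"
      proof (cases "x < p")
        case True
        then have "sin ((x - p) * (pi / (2 * l))) < 0" "sin ((q - x) * (pi / (2 * l))) > 0"
          by (intro sgn' sgn; use elim p q pq True in auto)+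
        then show ?thesis by (simp add: S_def mult_neg_pos)
      next
        case F: False
        then have "sin ((x - p) * (pi / (2 * l))) > 0" "sin ((q - x) * (pi / (2 * l))) < 0"
          by (intro sgn' sgn; use elim p q pq F False in auto)+
        then show ?thesis by (simp add: S_def mult_pos_neg)
      qed
      then have "(\<lambda>k. f k x) \<longlonglongrightarrow> 0"
        unfolding f_def by real_asymp
      then show ?thesis using False by simp
    qed
  qed
qed

text \<open>Box indicators are almost everywhere limits of products of test functions with values
  between zero and one; dominated convergence with the bound \<open>\<bar>w z\<bar>\<close> reduces
  the claim to integrals over boxes.\<close>

lemma AE_eq_0_if_orthogonal_products:
  fixes w :: "real \<times> real \<Rightarrow> real"
  assumes l: "l > 0" and w: "integrable (torus l) w"
    and orth: "\<And>a a' b b'. C1_circle l a a' \<Longrightarrow> C1_circle l b b' \<Longrightarrow>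
       (\<integral>z. w z * (a (fst z) * b (snd z)) \<partial>torus l) = 0"
  shows "AE z in torus l. w z = 0"
proof (rule AE_eq_0_if_box_integrals_0[OF l w])
  fix p q r s assume pq: "p \<in> {-l..l}" "q \<in> {-l..l}" "p < q" and rs: "r \<in> {-l..l}" "s \<in> {-l..l}" "r < s"
  obtain f f' where f: "\<And>k::nat. C1_circle l (f k) (f' k)" "\<And>k x. f k x \<in> {0..1::real}"
      "AE x in circle l. (\<lambda>k. f k x) \<longlonglongrightarrow> indicator {p<..<q} x"
    by (rule C1_circle_approx_indicator[OF l pq]) blast
  obtain g g' where g: "\<And>k::nat. C1_circle l (g k) (g' k)" "\<And>k x. g k x \<in> {0..1::real}"
      "AE x in circle l. (\<lambda>k. g k x) \<longlonglongrightarrow> indicator {r<..<s} x"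
    by (rule C1_circle_approx_indicator[OF l rs]) blast
  have [measurable]: "w \<in> borel_measurable borel"
    using borel_measurable_integrable[OF w] by (simp add: measurable_torus)
  have [measurable]: "f k \<in> borel_measurable borel" "g k \<in> borel_measurable borel" for k
    using f(1) g(1) by (auto dest: C1_circle_measurable)
  have "(\<lambda>k. \<integral>z. w z * (f k (fst z) * g k (snd z)) \<partial>torus l) \<longlonglongrightarrow>
     (\<integral>z. w z * (indicator {p<..<q} (fst z) * indicator {r<..<s} (snd z)) \<partial>torus l)"
  proof (rule integral_dominated_convergence)
    show "integrable (torus l) (\<lambda>z. \<bar>w z\<bar>)" using w by auto
    show "AE z in torus l. (\<lambda>k. w z * (f k (fst z) * g k (snd z)))
        \<longlonglongrightarrow> w z * (indicator {p<..<q} (fst z) * indicator {r<..<s} (snd z))"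
      using AE_torus_fst[OF f(3)] AE_torus_snd[OF g(3)] by eventually_elim (intro tendsto_intros)
    show "AE z in torus l. norm (w z * (f k (fst z) * g k (snd z))) \<le> \<bar>w z\<bar>" for k
    proof (rule AE_I2)
      fix z
      have "\<bar>f k (fst z) * g k (snd z)\<bar> \<le> 1"
        using f(2)[of k "fst z"] g(2)[of k "snd z"] by (auto simp: abs_mult intro!: mult_le_one)
      then show "norm (w z * (f k (fst z) * g k (snd z))) \<le> \<bar>w z\<bar>"
        using mult_left_mono[of "\<bar>f k (fst z) * g k (snd z)\<bar>" 1 "\<bar>w z\<bar>"] by (simp add: abs_mult)
    qed
  qed (auto simp: measurable_torus)
  then have "(\<integral>z. w z * (indicator {p<..<q} (fst z) * indicator {r<..<s} (snd z)) \<partial>torus l) = 0"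
    by (simp add: orth[OF f(1) g(1)] LIMSEQ_const_iff)
  then show "(LINT z:{p<..<q}\<times>{r<..<s}|torus l. w z) = 0"
    unfolding set_lebesgue_integral_def
    by (simp add: indicator_times mult.commute)
qed

section \<open>Bounded multipliers and Fubini\<close>

lemma integrable_mult_bounded:
  fixes f g :: "'a \<Rightarrow> real"
  assumes "integrable M f" and [measurable]: "g \<in> borel_measurable M" and "AE x in M. \<bar>g x\<bar> \<le> C"
  shows "integrable M (\<lambda>x. f x * g x)"
proof (rule Bochner_Integration.integrable_bound)
  show "integrable M (\<lambda>x. C * f x)" using assms by auto
  show "AE x in M. norm (f x * g x) \<le> norm (C * f x)"
    using assms(3)
  proof eventually_elim
    case (elim x)
    have "\<bar>g x\<bar> * \<bar>f x\<bar> \<le> \<bar>C\<bar> * \<bar>f x\<bar>" using elim by (intro mult_right_mono) auto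
    then show ?case by (simp add: abs_mult mult.commute)
  qed
  show "(\<lambda>x. f x * g x) \<in> borel_measurable M"
    using borel_measurable_integrable[OF assms(1)] by measurable
qed

lemma
  fixes f :: "real \<times> real \<Rightarrow> 'a::{banach, second_countable_topology}"
  assumes "integrable (torus l) f"
  shows AE_integrable_torus_snd: "AE y in circle l. integrable (circle l) (\<lambda>x. f (x, y))"
    and integrable_torus_snd: "integrable (circle l) (\<lambda>y. \<integral>x. f (x, y) \<partial>circle l)"
    and integral_torus_snd: "(\<integral>y. \<integral>x. f (x, y) \<partial>circle l \<partial>circle l) = integral\<^sup>L (torus l) f"
    and integral_torus_fst: "(\<integral>x. \<integral>y. f (x, y) \<partial>circle l \<partial>circle l) = integral\<^sup>L (torus l) f"
proof -
  have *: "integrable (circle l \<Otimes>\<^sub>M circle l) (\<lambda>(x, y). f (x, y))"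
    using assms by (simp add: torus_eq_pair)
  show "AE y in circle l. integrable (circle l) (\<lambda>x. f (x, y))"
    "integrable (circle l) (\<lambda>y. \<integral>x. f (x, y) \<partial>circle l)"
    "(\<integral>y. \<integral>x. f (x, y) \<partial>circle l \<partial>circle l) = integral\<^sup>L (torus l) f"
    using torus.AE_integrable_snd[OF *] torus.integrable_snd[OF *] torus.integral_snd[OF *]
    by (auto simp: torus_eq_pair)
  show "(\<integral>x. \<integral>y. f (x, y) \<partial>circle l \<partial>circle l) = integral\<^sup>L (torus l) f"
    using torus.integral_fst[OF *] by (simp add: torus_eq_pair)
qed

lemma
  fixes h :: "real \<Rightarrow> real"
  assumes "integrable (circle l) h"
  shows integrable_torus_of_fst: "integrable (torus l) (\<lambda>z. h (fst z))"
    and integrable_torus_of_snd: "integrable (torus l) (\<lambda>z. h (snd z))"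
proof -
  have [measurable]: "h \<in> borel_measurable borel"
    using borel_measurable_integrable[OF assms] by (simp add: measurable_circle)
  have m: "(\<lambda>z. h (fst z)) \<in> borel_measurable (circle l \<Otimes>\<^sub>M circle l)"
    "(\<lambda>z. h (snd z)) \<in> borel_measurable (circle l \<Otimes>\<^sub>M circle l)"
    by measurable
  show "integrable (torus l) (\<lambda>z. h (fst z))"
    unfolding torus_eq_pair using m(1) by (rule torus.Fubini_integrable) (use assms in auto)
  show "integrable (torus l) (\<lambda>z. h (snd z))"
    unfolding torus_eq_pair using m(2) by (rule torus.Fubini_integrable) (use assms in auto)
qed

lemma integral_torus_prod:
  fixes f g :: "real \<Rightarrow> real"
  assumes "integrable (circle l) f" "integrable (circle l) g" "AE x in circle l. \<bar>f x\<bar> \<le> C"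
  shows "(\<integral>z. f (fst z) * g (snd z) \<partial>torus l) = (\<integral>x. f x \<partial>circle l) * (\<integral>y. g y \<partial>circle l)"
proof -
  have "integrable (torus l) (\<lambda>z. f (fst z) * g (snd z))"
    using integrable_mult_bounded[OF integrable_torus_of_snd[OF assms(2)] _ AE_torus_fst[OF assms(3)]]
      borel_measurable_integrable[OF integrable_torus_of_fst[OF assms(1)]] by (simp add: mult.commute)
  from integral_torus_snd[OF this] show ?thesis by (simp add: mult.commute)
qed

lemma integral_torus_swap:
  fixes f :: "real \<times> real \<Rightarrow> 'a::{banach, second_countable_topology}"
  assumes "f \<in> borel_measurable borel"
  shows "(\<integral>z. f (snd z, fst z) \<partial>torus l) = integral\<^sup>L (torus l) f"
  using torus.integral_product_swap[of f l] assms
  by (simp add: torus_eq_pair[symmetric] measurable_torus case_prod_unfold)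

lemma integrable_torus_swap:
  fixes f :: "real \<times> real \<Rightarrow> 'a::{banach, second_countable_topology}"
  assumes "integrable (torus l) f"
  shows "integrable (torus l) (\<lambda>z. f (snd z, fst z))"
  using torus.integrable_product_swap[of l f] assms
  by (simp add: torus_eq_pair[symmetric] measurable_torus case_prod_unfold)

lemma C1_circle_deriv_periodic: "C1_circle l f f' \<Longrightarrow> f' (x + 2 * l) = f' x"
proof -
  assume C: "C1_circle l f f'"
  then have "((\<lambda>x. f (x + 2 * l)) has_real_derivative f' (x + 2 * l)) (at x)"
    by (subst DERIV_shift[symmetric]) (auto simp: C1_circle_def)
  then have "(f has_real_derivative f' (x + 2 * l)) (at x)"
    using C by (simp add: C1_circle_def)
  with C show ?thesis unfolding C1_circle_def by (metis DERIV_unique)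
qed

lemma periodic_continuous_bounded:
  fixes f :: "real \<Rightarrow> real"
  assumes l: "l > 0" and "continuous_on {-l..l} f" "\<And>x. f (x + 2 * l) = f x"
  obtains C where "\<forall>x. \<bar>f x\<bar> \<le> C"
proof -
  have "compact (f ` {-l..l})" using assms(2) by (intro compact_continuous_image) auto
  then obtain C where C: "\<forall>x\<in>{-l..l}. \<bar>f x\<bar> \<le> C"
    by (auto dest!: compact_imp_bounded simp: bounded_iff)
  have "\<bar>f x\<bar> \<le> C" for x
  proof -
    have "f (to_circle l x) = f x" using assms(3) by (rule periodic_to_circle)
    moreover have "to_circle l x \<in> {-l..l}" using to_circle_in[OF l, of x] by auto
    ultimately show ?thesis using C by metis
  qed
  then show ?thesis using that[of C] by simp
qed

lemma C1_circle_bounded: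
  assumes "l > 0" "C1_circle l f f'"
  obtains C where "\<forall>x. \<bar>f x\<bar> \<le> C \<and> \<bar>f' x\<bar> \<le> C"
proof -
  have per: "\<And>x. f (x + 2 * l) = f x" using assms(2) by (simp add: C1_circle_def)
  obtain C1 where C1: "\<forall>x. \<bar>f x\<bar> \<le> C1"
    by (rule periodic_continuous_bounded[OF assms(1) C1_circle_continuous(1)[OF assms(2)] per])
  obtain C2 where C2: "\<forall>x. \<bar>f' x\<bar> \<le> C2"
    by (rule periodic_continuous_bounded[OF assms(1) C1_circle_continuous(2)[OF assms(2)]
       C1_circle_deriv_periodic[OF assms(2)]])
  from C1 C2 have "\<forall>x. \<bar>f x\<bar> \<le> max C1 C2 \<and> \<bar>f' x\<bar> \<le> max C1 C2"
    by (simp add: le_max_iff_disj)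
  then show ?thesis by (rule that)
qed

lemma integrable_circle_bounded:
  fixes f :: "real \<Rightarrow> real"
  assumes "f \<in> borel_measurable borel" "\<And>x. \<bar>f x\<bar> \<le> C"
  shows "integrable (circle l) f"
  using assms by (intro circle.integrable_const_bound[where B=C]) (auto simp: measurable_circle)

section \<open>Fundamental theorem of calculus and periodic primitives\<close>

lemma integral_circle_tail:
  assumes l: "l > 0" and t: "t \<in> {-l..<l}"
    and F: "\<And>x. (F has_real_derivative f x) (at x)" and f: "continuous_on UNIV f"
  shows "(\<integral>x. indicator {t<..} x * f x \<partial>circle l) = F l - F t"
proof -
  have [measurable]: "f \<in> borel_measurable borel" using f by (rule borel_measurable_continuous_onI)
  have "(\<integral>x. indicator {t<..} x * f x \<partial>circle l) = (LINT x:{-l..<l}|lborel. indicator {t<..} x * f x)"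
    by (subst set_integral_circle) auto
  also have "\<dots> = (\<integral>x. f x * indicator {t..l} x \<partial>lborel)"
    unfolding set_lebesgue_integral_def
  proof (rule integral_cong_AE)
    show "AE x in lborel. indicat_real {- l..<l} x *\<^sub>R (indicat_real {t<..} x * f x) = f x * indicat_real {t..l} x"
      using AE_lborel_singleton[of t] AE_lborel_singleton[of l]
      by eventually_elim (use t in \<open>auto simp: indicator_def\<close>)
  qed auto
  also have "\<dots> = F l - F t"
    using t F f by (intro integral_FTC_Icc_real) (auto simp: continuous_on_eq_continuous_at)
  finally show ?thesis .
qed

text \<open>The finite exceptional set makes room for the corners of piecewise smooth profiles such
  as clipped angles and triangle waves.\<close>

lemma integral_circle_FTC:
  fixes F f :: "real \<Rightarrow> real"
  assumes l: "l > 0" and S: "finite S" and cont: "continuous_on {-l..l} F"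
    and deriv: "\<And>x. x \<in> {-l<..<l} - S \<Longrightarrow> (F has_real_derivative f x) (at x)"
    and f: "f \<in> borel_measurable borel" "\<And>x. x \<in> {-l..l} \<Longrightarrow> \<bar>f x\<bar> \<le> C"
  shows "(\<integral>x. f x \<partial>circle l) = F l - F (-l)"
proof -
  have si: "set_integrable lborel {-l..l} f"
    unfolding set_integrable_def
  proof (rule integrableI_bounded_set[where A="{-l..l}" and B=C])
    show "AE x in lborel. x \<in> {-l..l} \<longrightarrow> norm (indicat_real {- l..l} x *\<^sub>R f x) \<le> C"
      using f(2) by auto
  qed (use f(1) l in auto)
  have "(\<integral>x. f x \<partial>circle l) = (LINT x:{-l..<l}|lborel. f x)"
    using set_integral_circle[OF f(1)] by simp
  also have "\<dots> = (LINT x:{-l..l}|lborel. f x)"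
    unfolding set_lebesgue_integral_def
  proof (rule integral_cong_AE)
    show "AE x in lborel. indicat_real {- l..<l} x *\<^sub>R f x = indicat_real {- l..l} x *\<^sub>R f x"
      using AE_lborel_singleton[of l] by eventually_elim (auto simp: indicator_def)
  qed (use f(1) in auto)
  also have "\<dots> = integral {-l..l} f" by (rule set_borel_integral_eq_integral(2)[OF si])
  also have "\<dots> = F l - F (-l)"
  proof (rule integral_unique, rule fundamental_theorem_of_calculus_interior_strong[OF S])
    show "(F has_vector_derivative f x) (at x)" if "x \<in> {-l<..<l} - S" for x
      using deriv[OF that] by (simp add: has_real_derivative_iff_has_vector_derivative)
  qed (use l cont in auto)
  finally show ?thesis .
qed

lemma antiderivative_exists:
  fixes q :: "real \<Rightarrow> real"
  assumes "continuous_on UNIV q"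
  shows "\<exists>f. \<forall>t. (f has_real_derivative q t) (at t)"
  using einterval_antiderivative[of "-\<infinity>" \<infinity> q] assms
  by (auto simp: has_real_derivative_iff_has_vector_derivative continuous_on_eq_continuous_at)

text \<open>\<open>F (x + 2 * l) - F x\<close> has derivative zero because \<open>f\<close> is
  periodic, and its value at \<open>- l\<close> is the integral of \<open>f\<close> over the circle,
  which vanishes.\<close>

lemma periodic_antiderivative:
  assumes l: "l > 0" and f: "continuous_on UNIV f" and per: "\<And>x. f (x + 2 * l) = f x"
    and mean: "(\<integral>x. f x \<partial>circle l) = 0"
  obtains F where "C1_circle l F f"
proof -
  obtain F where "\<forall>t. (F has_real_derivative f t) (at t)"
    using antiderivative_exists[OF f] by (rule exE)
  then have F: "(F has_real_derivative f t) (at t)" for t by blast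
  have fm: "f \<in> borel_measurable borel" by (rule borel_measurable_continuous_onI[OF f])
  obtain C where C: "\<forall>x. \<bar>f x\<bar> \<le> C"
    by (rule periodic_continuous_bounded[OF l continuous_on_subset[OF f] per]) auto
  have "0 = F l - F (-l)"
    using integral_circle_FTC[OF l, of "{}" F f C] F fm C mean
    by (auto intro!: continuous_at_imp_continuous_on DERIV_isCont)
  moreover have "((\<lambda>x. F (x + 2 * l) - F x) has_real_derivative 0) (at x)" for x
    using DERIV_diff[OF F[of "x + 2 * l", unfolded DERIV_shift] F[of x]] per by simp
  then have "F (x + 2 * l) - F x = F (-l + 2 * l) - F (-l)" for x
    using DERIV_isconst_all[of "\<lambda>x. F (x + 2 * l) - F x" x "-l"] by blast
  ultimately have "F (x + 2 * l) = F x" for x by (simp add: algebra_simps)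
  then have "C1_circle l F f" using F f by (simp add: C1_circle_def)
  then show ?thesis by (rule that)
qed

text \<open>Every test function is thus a constant plus the derivative of another test function.
  This is what turns a vanishing weak derivative into independence of the variable.\<close>

lemma C1_circle_antiderivative:
  assumes l: "l > 0" and f: "C1_circle l f f'"
  obtains F where "C1_circle l F (\<lambda>x. f x - (\<integral>x. f x \<partial>circle l) / (2 * l))"
proof -
  define m where "m = (\<integral>x. f x \<partial>circle l) / (2 * l)"
  obtain C where "\<forall>x. \<bar>f x\<bar> \<le> C \<and> \<bar>f' x\<bar> \<le> C"
    by (rule C1_circle_bounded[OF l f])
  then have C: "\<bar>f x\<bar> \<le> C" for x by auto
  have "integrable (circle l) f"
    by (rule integrable_circle_bounded[OF C1_circle_measurable(1)[OF f] C])
  then have "(\<integral>x. f x - m \<partial>circle l) = 0" using l by (simp add: m_def measure_circle)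
  moreover have "f (x + 2 * l) - m = f x - m" for x using f by (simp add: C1_circle_def)
  moreover have "continuous_on UNIV (\<lambda>x. f x - m)" by (intro continuous_intros C1_circle_continuous[OF f])
  ultimately obtain F where "C1_circle l F (\<lambda>x. f x - m)"
    using periodic_antiderivative[OF l, of "\<lambda>x. f x - m"] by blast
  then show ?thesis unfolding m_def by (rule that)
qed

section \<open>Slices of functions with weak derivatives\<close>

lemma AE_circle_const:
  assumes l: "l > 0" and "AE x in circle l. P" shows P
proof (rule ccontr)
  assume "\<not> P"
  with assms(2) have "AE x in circle l. \<not> True" by simp
  then have "emeasure (circle l) {x \<in> space (circle l). True} = 0" by (rule emeasure_eq_0_AE)
  then show False using emeasure_circle[OF l] l by simp
qed

text \<open>Du Bois-Reymond lemma with a parameter. Testing with functions of the second variable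
  alone shows that \<open>v\<close> has mean zero on almost every slice, so its primitive
  \<open>U\<close> from \<open>- l\<close> has weak derivative \<open>v\<close> on the circle. The
  difference \<open>u - U\<close> then has weak derivative zero; since constants and derivatives
  together exhaust the test functions, it equals its slice mean \<open>h\<close>.\<close>

lemma slice_representation:
  fixes u v :: "real \<times> real \<Rightarrow> real"
  assumes l: "l > 0" and u: "integrable (torus l) u" and v: "integrable (torus l) v"
    and weak: "\<And>a a' b b'. C1_circle l a a' \<Longrightarrow> C1_circle l b b' \<Longrightarrow>
       (\<integral>z. u z * (a' (fst z) * b (snd z)) \<partial>torus l) = - (\<integral>z. v z * (a (fst z) * b (snd z)) \<partial>torus l)"
  obtains h where "h \<in> borel_measurable borel"
    "AE y in circle l. (\<integral>x. v (x, y) \<partial>circle l) = 0"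
    "AE z in torus l. u z = h (snd z) + (\<integral>t. indicator {..<fst z} t * v (t, snd z) \<partial>circle l)"
proof -
  have um: "u \<in> borel_measurable borel" and vm: "v \<in> borel_measurable borel"
    using borel_measurable_integrable[OF u] borel_measurable_integrable[OF v] by (auto simp: measurable_torus)
  have vp [measurable]: "v \<in> borel_measurable (borel \<Otimes>\<^sub>M borel)"
    using vm by (simp add: borel_prod)
  note C1m = C1_circle_measurable
  define V where "V y = (\<integral>x. v (x, y) \<partial>circle l)" for y
  have Vint: "integrable (circle l) V"
    unfolding V_def by (rule integrable_torus_snd[OF v])
  have const: "C1_circle l (\<lambda>_. 1) (\<lambda>_. 0)" by (simp add: C1_circle_def)
  have prod_int: "integrable (torus l) (\<lambda>z. f z * (a (fst z) * b (snd z)))"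
    if f: "integrable (torus l) f" and a: "a \<in> borel_measurable borel" "\<And>x. \<bar>a x\<bar> \<le> Ca"
      and b: "b \<in> borel_measurable borel" "\<And>x. \<bar>b x\<bar> \<le> Cb" for f :: "real \<times> real \<Rightarrow> real" and a b :: "real \<Rightarrow> real" and Ca Cb
  proof (rule integrable_mult_bounded[OF f])
    show "AE z in torus l. \<bar>a (fst z) * b (snd z)\<bar> \<le> Ca * Cb"
      using a(2) b(2) by (auto simp: abs_mult intro!: mult_mono intro: order_trans[OF abs_ge_zero])
  qed (use a(1) b(1) in \<open>simp add: measurable_torus\<close>)
  have Vb: "(\<integral>y. V y * b y \<partial>circle l) = 0" if b: "C1_circle l b b'" for b b'
  proof -
    obtain C where "\<forall>x. \<bar>b x\<bar> \<le> C \<and> \<bar>b' x\<bar> \<le> C"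
      by (rule C1_circle_bounded[OF l b])
    then have C: "\<And>x. \<bar>b x\<bar> \<le> C" "\<And>x. \<bar>b' x\<bar> \<le> C" by auto
    have i: "integrable (torus l) (\<lambda>z. v z * (1 * b (snd z)))"
      using prod_int[OF v, of "\<lambda>_. 1" 1 b C] C1m(1)[OF b] C(1) by simp
    have "(\<integral>y. V y * b y \<partial>circle l) = (\<integral>y. \<integral>x. v (x, y) * (1 * b y) \<partial>circle l \<partial>circle l)"
      by (simp add: V_def)
    also have "\<dots> = (\<integral>z. v z * (1 * b (snd z)) \<partial>torus l)"
      using integral_torus_snd[OF i] by simp
    also have "\<dots> = 0" using weak[OF const b] by simp
    finally show ?thesis .
  qed
  have "AE z in torus l. V (snd z) = 0"
  proof (rule AE_eq_0_if_orthogonal_products[OF l integrable_torus_of_snd[OF Vint]])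
    fix a a' b b' assume a: "C1_circle l a a'" and b: "C1_circle l b b'"
    obtain Ca where "\<forall>x. \<bar>a x\<bar> \<le> Ca \<and> \<bar>a' x\<bar> \<le> Ca"
      by (rule C1_circle_bounded[OF l a])
    then have Ca: "\<And>x. \<bar>a x\<bar> \<le> Ca" "\<And>x. \<bar>a' x\<bar> \<le> Ca" by auto
    obtain Cb where "\<forall>x. \<bar>b x\<bar> \<le> Cb \<and> \<bar>b' x\<bar> \<le> Cb"
      by (rule C1_circle_bounded[OF l b])
    then have Cb: "\<And>x. \<bar>b x\<bar> \<le> Cb" "\<And>x. \<bar>b' x\<bar> \<le> Cb" by auto
    have "integrable (circle l) (\<lambda>y. V y * b y)"
      by (rule integrable_mult_bounded[OF Vint]) (use C1m(1)[OF b] Cb in \<open>auto simp: measurable_circle\<close>)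
    then have "(\<integral>z. a (fst z) * (V (snd z) * b (snd z)) \<partial>torus l)
      = (\<integral>x. a x \<partial>circle l) * (\<integral>y. V y * b y \<partial>circle l)"
      by (intro integral_torus_prod[OF integrable_circle_bounded[OF C1m(1)[OF a] Ca(1)]]) (use Ca in auto)
    then show "(\<integral>z. V (snd z) * (a (fst z) * b (snd z)) \<partial>torus l) = 0"
      using Vb[OF b] by (simp add: mult_ac)
  qed
  from AE_torus_pair(1)[OF this] have "AE x in circle l. AE y in circle l. V y = 0" by simp
  then have V0: "AE y in circle l. V y = 0" by (rule AE_circle_const[OF l])
  define U where "U z = (\<integral>t. indicator {..<fst z} t * v (t, snd z) \<partial>circle l)" for z
  have Um [measurable]: "U \<in> borel_measurable borel"
  proof -
    have "U = (\<lambda>z. \<integral>t. (if t < fst z then v (t, snd z) else 0) \<partial>circle l)"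
      by (auto simp: U_def fun_eq_iff indicator_def intro!: Bochner_Integration.integral_cong)
    moreover have "\<dots> \<in> borel_measurable (borel \<Otimes>\<^sub>M borel)"
      by measurable
    ultimately have "U \<in> borel_measurable (borel \<Otimes>\<^sub>M borel)" by simp
    then show ?thesis by (simp add: borel_prod)
  qed
  have Uint: "integrable (torus l) U"
  proof (rule Bochner_Integration.integrable_bound)
    show "integrable (torus l) (\<lambda>z. \<integral>t. \<bar>v (t, snd z)\<bar> \<partial>circle l)"
      using integrable_torus_of_snd[OF integrable_torus_snd[of l "\<lambda>z. \<bar>v z\<bar>"]] v by auto
    show "AE z in torus l. norm (U z) \<le> norm (\<integral>t. \<bar>v (t, snd z)\<bar> \<partial>circle l)"
      using AE_torus_snd[OF AE_integrable_torus_snd[OF v]]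
    proof eventually_elim
      case (elim z)
      have "norm (U z) \<le> (\<integral>t. norm (indicator {..<fst z} t * v (t, snd z)) \<partial>circle l)"
        unfolding U_def by (rule integral_norm_bound)
      also have "\<dots> \<le> (\<integral>t. \<bar>v (t, snd z)\<bar> \<partial>circle l)"
        using elim by (intro integral_mono' integrable_abs) (auto simp: indicator_def)
      finally show ?case by simp
    qed
  qed (simp add: measurable_torus)
  define w where "w z = u z - U z" for z
  have wint: "integrable (torus l) w" unfolding w_def using u Uint by auto
  have w_deriv: "(\<integral>z. w z * (a' (fst z) * b (snd z)) \<partial>torus l) = 0"
    if a: "C1_circle l a a'" and b: "C1_circle l b b'" for a a' b b'
  proof -
    obtain Ca where "\<forall>x. \<bar>a x\<bar> \<le> Ca \<and> \<bar>a' x\<bar> \<le> Ca"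
      by (rule C1_circle_bounded[OF l a])
    then have Ca: "\<And>x. \<bar>a x\<bar> \<le> Ca" "\<And>x. \<bar>a' x\<bar> \<le> Ca" by auto
    obtain Cb where "\<forall>x. \<bar>b x\<bar> \<le> Cb \<and> \<bar>b' x\<bar> \<le> Cb"
      by (rule C1_circle_bounded[OF l b])
    then have Cb: "\<And>x. \<bar>b x\<bar> \<le> Cb" "\<And>x. \<bar>b' x\<bar> \<le> Cb" by auto
    note [measurable] = C1m[OF a] C1m[OF b]
    have iU: "integrable (torus l) (\<lambda>z. U z * (a' (fst z) * b (snd z)))"
      by (rule prod_int[OF Uint C1m(2)[OF a] Ca(2) C1m(1)[OF b] Cb(1)])
    have iu: "integrable (torus l) (\<lambda>z. u z * (a' (fst z) * b (snd z)))"
      by (rule prod_int[OF u C1m(2)[OF a] Ca(2) C1m(1)[OF b] Cb(1)])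
    have iv: "integrable (torus l) (\<lambda>z. v z * (a (fst z) * b (snd z)))"
      by (rule prod_int[OF v C1m(1)[OF a] Ca(1) C1m(1)[OF b] Cb(1)])
    have inner: "AE y in circle l. (\<integral>x. U (x, y) * (a' x * b y) \<partial>circle l)
        = - (\<integral>t. v (t, y) * (a t * b y) \<partial>circle l)"
      using V0 AE_integrable_torus_snd[OF v]
    proof eventually_elim
      case (elim y)
      \<comment> \<open>With \<open>y\<close> fixed, the coordinates of \<open>z\<close> are the
        outer variable \<open>x\<close> and the integration variable \<open>t\<close>. Integrability
        justifies exchanging the two integrals over the triangle \<open>t < x\<close>.\<close>
      have "integrable (torus l) (\<lambda>z. v (snd z, y) * (indicator {..<fst z} (snd z) * a' (fst z)))"
      proof (rule integrable_mult_bounded[OF integrable_torus_of_snd[OF elim(2)]])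
        have "(\<lambda>z. indicat_real {..<fst z} (snd z) * a' (fst z)) = (\<lambda>z. if snd z < fst z then a' (fst z) else 0)"
          by (auto simp: indicator_def)
        moreover have "\<dots> \<in> borel_measurable (borel \<Otimes>\<^sub>M borel)"
          by measurable
        ultimately show "(\<lambda>z. indicat_real {..<fst z} (snd z) * a' (fst z)) \<in> borel_measurable (torus l)"
          by (simp add: measurable_torus borel_prod)
        show "AE z in torus l. \<bar>indicat_real {..<fst z} (snd z) * a' (fst z)\<bar> \<le> Ca"
          using Ca(2) by (auto simp: indicator_def intro: order_trans[OF abs_ge_zero])
      qed
      note F = this
      have "(\<integral>x. U (x, y) * a' x \<partial>circle l)
         = (\<integral>x. \<integral>t. v (t, y) * (indicator {..<x} t * a' x) \<partial>circle l \<partial>circle l)"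
        unfolding U_def by (simp flip: integral_mult_left_zero add: mult_ac)
      also have "\<dots> = (\<integral>t. \<integral>x. v (t, y) * (indicator {..<x} t * a' x) \<partial>circle l \<partial>circle l)"
        using integral_torus_snd[OF F] integral_torus_fst[OF F] by simp
      also have "\<dots> = (\<integral>t. v (t, y) * (a l - a t) \<partial>circle l)"
      proof (rule integral_cong_AE)
        have "AE t in circle l. t \<in> {-l..<l}" by (simp add: AE_circle_iff)
        then show "AE t in circle l. (\<integral>x. v (t, y) * (indicator {..<x} t * a' x) \<partial>circle l) = v (t, y) * (a l - a t)"
        proof eventually_elim
          case (elim t)
          have "(\<integral>x. indicator {t<..} x * a' x \<partial>circle l) = a l - a t"
            using a elim by (intro integral_circle_tail[OF l]) (auto simp: C1_circle_def)
          moreover have "indicator {..<x} t = (indicator {t<..} x :: real)" for x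
            by (auto simp: indicator_def)
          ultimately show ?case by simp
        qed
        show "(\<lambda>t. \<integral>x. v (t, y) * (indicator {..<x} t * a' x) \<partial>circle l) \<in> borel_measurable (circle l)"
          using borel_measurable_integrable[OF integrable_torus_snd[OF F]] by simp
        show "(\<lambda>t. v (t, y) * (a l - a t)) \<in> borel_measurable (circle l)"
          by measurable
      qed
      \<comment> \<open>The boundary term is \<open>a l\<close> times the slice mean of
        \<open>v\<close>, which is zero.\<close>
      also have "\<dots> = (\<integral>t. a l * v (t, y) - v (t, y) * a t \<partial>circle l)"
        by (simp add: algebra_simps)
      also have "\<dots> = a l * V y - (\<integral>t. v (t, y) * a t \<partial>circle l)"
        unfolding V_def using elim(2) Ca
        by (subst Bochner_Integration.integral_diff)
           (auto intro!: integrable_mult_bounded[OF elim(2)])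
      finally have "(\<integral>x. U (x, y) * a' x \<partial>circle l) = - (\<integral>t. v (t, y) * a t \<partial>circle l)"
        using elim(1) by simp
      then have "(\<integral>x. (U (x, y) * a' x) * b y \<partial>circle l) = - (\<integral>t. (v (t, y) * a t) * b y \<partial>circle l)"
        by simp
      then show ?case by (simp add: mult_ac)
    qed
    have "(\<integral>z. U z * (a' (fst z) * b (snd z)) \<partial>torus l)
        = (\<integral>y. \<integral>x. U (x, y) * (a' x * b y) \<partial>circle l \<partial>circle l)"
      using integral_torus_snd[OF iU] by simp
    also have "\<dots> = (\<integral>y. - (\<integral>t. v (t, y) * (a t * b y) \<partial>circle l) \<partial>circle l)"
    proof (rule integral_cong_AE[OF _ _ inner])
      show "(\<lambda>y. \<integral>x. U (x, y) * (a' x * b y) \<partial>circle l) \<in> borel_measurable (circle l)"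
        using borel_measurable_integrable[OF integrable_torus_snd[OF iU]] by simp
      show "(\<lambda>y. - (\<integral>x. v (x, y) * (a x * b y) \<partial>circle l)) \<in> borel_measurable (circle l)"
        using borel_measurable_integrable[OF integrable_torus_snd[OF iv]] by simp
    qed
    also have "\<dots> = - (\<integral>z. v z * (a (fst z) * b (snd z)) \<partial>torus l)"
      using integral_torus_snd[OF iv] by simp
    also have "\<dots> = (\<integral>z. u z * (a' (fst z) * b (snd z)) \<partial>torus l)"
      using weak[OF a b] by simp
    finally show ?thesis
      unfolding w_def using iu iU by (simp add: left_diff_distrib)
  qed
  define h where "h y = (\<integral>x. w (x, y) \<partial>circle l) / (2 * l)" for y
  have hint: "integrable (circle l) h"
    unfolding h_def by (intro integrable_divide_zero integrable_torus_snd wint)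
  have "AE z in torus l. w z - h (snd z) = 0"
  proof (rule AE_eq_0_if_orthogonal_products[OF l])
    show "integrable (torus l) (\<lambda>z. w z - h (snd z))"
      using wint integrable_torus_of_snd[OF hint] by auto
    fix f f' b b' assume f: "C1_circle l f f'" and b: "C1_circle l b b'"
    obtain Cf where "\<forall>x. \<bar>f x\<bar> \<le> Cf \<and> \<bar>f' x\<bar> \<le> Cf"
      by (rule C1_circle_bounded[OF l f])
    then have Cf: "\<And>x. \<bar>f x\<bar> \<le> Cf" "\<And>x. \<bar>f' x\<bar> \<le> Cf" by auto
    obtain Cb where "\<forall>x. \<bar>b x\<bar> \<le> Cb \<and> \<bar>b' x\<bar> \<le> Cb"
      by (rule C1_circle_bounded[OF l b])
    then have Cb: "\<And>x. \<bar>b x\<bar> \<le> Cb" "\<And>x. \<bar>b' x\<bar> \<le> Cb" by auto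
    define m where "m = (\<integral>x. f x \<partial>circle l) / (2 * l)"
    \<comment> \<open>\<open>f - m\<close> is the derivative of a test function, so pairing
      \<open>w\<close> with \<open>f\<close> gives the same as pairing it with the mean
      \<open>m\<close>. For \<open>h\<close>, which does not depend on the first variable, this
      holds by separation of variables.\<close>
    obtain F where F: "C1_circle l F (\<lambda>x. f x - m)"
      by (rule C1_circle_antiderivative[OF l f, folded m_def])
    have iwf: "integrable (torus l) (\<lambda>z. w z * (f (fst z) * b (snd z)))"
      by (rule prod_int[OF wint C1m(1)[OF f] Cf(1) C1m(1)[OF b] Cb(1)])
    have iwb: "integrable (torus l) (\<lambda>z. w z * (1 * b (snd z)))"
      using prod_int[OF wint, of "\<lambda>_. 1" 1 b Cb] C1m(1)[OF b] Cb(1) by simp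
    have ihf: "integrable (torus l) (\<lambda>z. h (snd z) * (f (fst z) * b (snd z)))"
      by (rule prod_int[OF integrable_torus_of_snd[OF hint] C1m(1)[OF f] Cf(1) C1m(1)[OF b] Cb(1)])
    have "(\<integral>z. w z * (f (fst z) * b (snd z)) \<partial>torus l) - m * (\<integral>z. w z * (1 * b (snd z)) \<partial>torus l)
       = (\<integral>z. w z * (f (fst z) * b (snd z)) - m * (w z * (1 * b (snd z))) \<partial>torus l)"
      by (subst Bochner_Integration.integral_diff) (use iwf iwb in auto)
    also have "\<dots> = (\<integral>z. w z * ((f (fst z) - m) * b (snd z)) \<partial>torus l)"
      by (simp add: algebra_simps)
    also have "\<dots> = 0" by (rule w_deriv[OF F b])
    finally have 1: "(\<integral>z. w z * (f (fst z) * b (snd z)) \<partial>torus l) = m * (\<integral>z. w z * (1 * b (snd z)) \<partial>torus l)"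
      by simp
    have ihb: "integrable (circle l) (\<lambda>y. h y * b y)"
      by (rule integrable_mult_bounded[OF hint]) (use C1m(1)[OF b] Cb in \<open>auto simp: measurable_circle\<close>)
    have "(\<integral>z. h (snd z) * (f (fst z) * b (snd z)) \<partial>torus l) = (\<integral>z. f (fst z) * (h (snd z) * b (snd z)) \<partial>torus l)"
      by (simp add: mult_ac)
    also have "\<dots> = (\<integral>x. f x \<partial>circle l) * (\<integral>y. h y * b y \<partial>circle l)"
      by (intro integral_torus_prod[OF integrable_circle_bounded[OF C1m(1)[OF f] Cf(1)] ihb]) (use Cf in auto)
    also have "(\<integral>y. h y * b y \<partial>circle l) = (\<integral>y. (\<integral>x. w (x, y) * (1 * b y) \<partial>circle l) / (2 * l) \<partial>circle l)"
      by (simp add: h_def)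
    also have "\<dots> = (\<integral>z. w z * (1 * b (snd z)) \<partial>torus l) / (2 * l)"
      using integral_torus_snd[OF iwb] by simp
    finally have 2: "(\<integral>z. h (snd z) * (f (fst z) * b (snd z)) \<partial>torus l) = m * (\<integral>z. w z * (1 * b (snd z)) \<partial>torus l)"
      by (simp add: m_def)
    show "(\<integral>z. (w z - h (snd z)) * (f (fst z) * b (snd z)) \<partial>torus l) = 0"
      using iwf ihf 1 2 by (simp add: left_diff_distrib)
  qed
  then have "AE z in torus l. u z = h (snd z) + U z"
    by eventually_elim (simp add: w_def)
  moreover have "h \<in> borel_measurable borel"
    using borel_measurable_integrable[OF hint] by (simp add: measurable_circle)
  ultimately show ?thesis
    using V0 unfolding V_def U_def by (intro that[of h])
qed

section \<open>Weak gradients on the torus\<close>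

lemma L1_iff:
  fixes f :: "real \<times> real \<Rightarrow> 'a::{banach, second_countable_topology}"
  shows "f \<in> L1 l \<longleftrightarrow> periodic l f \<and> f \<in> borel_measurable borel \<and> integrable (torus l) f"
  unfolding L1_def by (auto simp: set_integrable_cell)

lemma L2_iff:
  fixes f :: "real \<times> real \<Rightarrow> 'a::{banach, second_countable_topology}"
  shows "f \<in> L2 l \<longleftrightarrow> periodic l f \<and> f \<in> borel_measurable borel \<and> integrable (torus l) (\<lambda>p. (norm (f p))\<^sup>2)"
  unfolding L2_def by (auto simp: set_integrable_cell)

lemma integrable_of_square_integrable:
  fixes f :: "'a \<Rightarrow> 'b::{banach, second_countable_topology}"
  assumes "finite_measure M" and [measurable]: "f \<in> borel_measurable M"
    and "integrable M (\<lambda>x. (norm (f x))\<^sup>2)"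
  shows "integrable M f"
proof (rule Bochner_Integration.integrable_bound)
  interpret finite_measure M by fact
  show "integrable M (\<lambda>x. 1 + (norm (f x))\<^sup>2)" using assms(3) by auto
  have "t \<le> 1 + t\<^sup>2" for t :: real
    using zero_le_power2[of "t - 1 / 2"] by (simp add: power2_eq_square field_simps)
  then show "AE x in M. norm (f x) \<le> norm (1 + (norm (f x))\<^sup>2)"
    by (intro AE_I2) simp
qed simp

lemma L2_imp_L1:
  fixes f :: "real \<times> real \<Rightarrow> 'a::{banach, second_countable_topology}"
  shows "f \<in> L2 l \<Longrightarrow> f \<in> L1 l"
  unfolding L1_iff L2_iff
  by (auto intro!: integrable_of_square_integrable[OF finite_measure_torus] simp: measurable_torus)

lemma C1_torus_continuous:
  assumes "C1_torus l \<phi> D"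
  shows "continuous_on S \<phi>" "continuous_on S D"
proof -
  show "continuous_on S \<phi>"
    using assms unfolding C1_torus_def gderiv_def
    by (intro continuous_at_imp_continuous_on ballI has_derivative_continuous) blast
  show "continuous_on S D"
    using assms unfolding C1_torus_def by (auto intro: continuous_on_subset)
qed

lemma C1_torus_measurable:
  assumes "C1_torus l \<phi> D"
  shows "\<phi> \<in> borel_measurable borel" "D \<in> borel_measurable borel"
  using C1_torus_continuous[OF assms] by (auto intro!: borel_measurable_continuous_onI)

lemma continuous_bounded_on_cell:
  fixes f :: "real \<times> real \<Rightarrow> 'a::real_normed_vector"
  assumes "continuous_on UNIV f"
  shows "\<exists>C. \<forall>p \<in> {-l..l} \<times> {-l..l}. norm (f p) \<le> C"
proof -
  have "compact (f ` ({-l..l} \<times> {-l..l}))"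
    using assms by (intro compact_continuous_image compact_Times) (auto intro: continuous_on_subset)
  then show ?thesis by (auto dest!: compact_imp_bounded simp: bounded_iff)
qed

lemma C1_torus_bounded:
  assumes "C1_torus l \<phi> D"
  obtains C where "\<forall>p \<in> {-l..l} \<times> {-l..l}. \<bar>\<phi> p\<bar> \<le> C \<and> norm (D p) \<le> C"
proof -
  obtain C1 where C1: "\<forall>p \<in> {-l..l} \<times> {-l..l}. norm (\<phi> p) \<le> C1"
    using continuous_bounded_on_cell[OF C1_torus_continuous(1)[OF assms]] by meson
  obtain C2 where C2: "\<forall>p \<in> {-l..l} \<times> {-l..l}. norm (D p) \<le> C2"
    using continuous_bounded_on_cell[OF C1_torus_continuous(2)[OF assms]] by meson
  have "\<forall>p \<in> {-l..l} \<times> {-l..l}. \<bar>\<phi> p\<bar> \<le> max C1 C2 \<and> norm (D p) \<le> max C1 C2"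
    using C1 C2 by (auto simp: le_max_iff_disj)
  then show ?thesis by (rule that)
qed

lemma AE_torus_cell: "AE p in torus l. p \<in> {-l..<l} \<times> {-l..<l}"
  by (simp add: AE_torus_iff cell_def)

lemma AE_circle_segment: "AE x in circle l. x \<in> {-l..<l}"
  by (simp add: AE_circle_iff)

lemma integrable_scaleR_bounded:
  fixes f :: "'a \<Rightarrow> real" and g :: "'a \<Rightarrow> 'b::{banach, second_countable_topology}"
  assumes "integrable M f" and [measurable]: "g \<in> borel_measurable M" and "AE x in M. norm (g x) \<le> C"
  shows "integrable M (\<lambda>x. f x *\<^sub>R g x)"
proof (rule Bochner_Integration.integrable_bound)
  show "integrable M (\<lambda>x. C * f x)" using assms by auto
  show "AE x in M. norm (f x *\<^sub>R g x) \<le> norm (C * f x)"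
    using assms(3)
  proof eventually_elim
    case (elim x)
    have "norm (g x) * \<bar>f x\<bar> \<le> \<bar>C\<bar> * \<bar>f x\<bar>" using elim by (intro mult_right_mono) auto
    then show ?case by (simp add: abs_mult mult.commute)
  qed
  show "(\<lambda>x. f x *\<^sub>R g x) \<in> borel_measurable M"
    using borel_measurable_integrable[OF assms(1)] by measurable
qed

lemma C1_torus_integrable:
  fixes u :: "real \<times> real \<Rightarrow> real" and V :: "real \<times> real \<Rightarrow> 'a::{banach, second_countable_topology}"
  assumes \<phi>: "C1_torus l \<phi> D"
  shows "integrable (torus l) u \<Longrightarrow> integrable (torus l) (\<lambda>p. u p *\<^sub>R D p)"
    and "integrable (torus l) V \<Longrightarrow> integrable (torus l) (\<lambda>p. \<phi> p *\<^sub>R V p)"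
proof -
  obtain C where C: "\<forall>p \<in> {-l..l} \<times> {-l..l}. \<bar>\<phi> p\<bar> \<le> C \<and> norm (D p) \<le> C"
    by (rule C1_torus_bounded[OF \<phi>])
  have AC: "AE p in torus l. norm (D p) \<le> C" "AE p in torus l. \<bar>\<phi> p\<bar> \<le> C"
    using AE_torus_cell by (eventually_elim, use C in force)+
  show "integrable (torus l) u \<Longrightarrow> integrable (torus l) (\<lambda>p. u p *\<^sub>R D p)"
    using integrable_scaleR_bounded[OF _ _ AC(1)] C1_torus_measurable[OF \<phi>] by (simp add: measurable_torus)
  assume V: "integrable (torus l) V"
  show "integrable (torus l) (\<lambda>p. \<phi> p *\<^sub>R V p)"
  proof (rule Bochner_Integration.integrable_bound)
    show "integrable (torus l) (\<lambda>x. C * norm (V x))" using V by auto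
    show "AE x in torus l. norm (\<phi> x *\<^sub>R V x) \<le> norm (C * norm (V x))"
      using AC(2)
    proof eventually_elim
      case (elim x)
      then show ?case by (auto intro!: mult_right_mono intro: order_trans[OF _ abs_ge_self] simp: abs_mult)
    qed
    show "(\<lambda>p. \<phi> p *\<^sub>R V p) \<in> borel_measurable (torus l)"
      using borel_measurable_integrable[OF V] C1_torus_measurable[OF \<phi>]
      by (intro borel_measurable_scaleR) (auto simp: measurable_torus)
  qed
qed

text \<open>The Bochner integral commutes with the two projections for integrable integrands;
  integrability comes from the boundedness of test functions and their gradients on the
  cell.\<close>

lemma has_weak_grad_iff:
  assumes u: "u \<in> L1 l"
  shows "has_weak_grad l u V \<longleftrightarrow> V \<in> L1 l \<and>
    (\<forall>\<phi> D. C1_torus l \<phi> D \<longrightarrow>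
       (\<integral>p. u p * fst (D p) \<partial>torus l) = - (\<integral>p. \<phi> p * fst (V p) \<partial>torus l) \<and>
       (\<integral>p. u p * snd (D p) \<partial>torus l) = - (\<integral>p. \<phi> p * snd (V p) \<partial>torus l))"
proof -
  have "(LINT p:cell l|lborel. u p *\<^sub>R D p) = - (LINT p:cell l|lborel. \<phi> p *\<^sub>R V p) \<longleftrightarrow>
       (\<integral>p. u p * fst (D p) \<partial>torus l) = - (\<integral>p. \<phi> p * fst (V p) \<partial>torus l) \<and>
       (\<integral>p. u p * snd (D p) \<partial>torus l) = - (\<integral>p. \<phi> p * snd (V p) \<partial>torus l)"
    if V: "V \<in> L1 l" and \<phi>: "C1_torus l \<phi> D" for \<phi> D
  proof -
    have i1: "integrable (torus l) (\<lambda>p. u p *\<^sub>R D p)" and i2: "integrable (torus l) (\<lambda>p. \<phi> p *\<^sub>R V p)"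
      using C1_torus_integrable[OF \<phi>] u V by (auto simp: L1_iff)
    then have m: "(\<lambda>p. u p *\<^sub>R D p) \<in> borel_measurable borel" "(\<lambda>p. \<phi> p *\<^sub>R V p) \<in> borel_measurable borel"
      by (auto dest!: borel_measurable_integrable simp: measurable_torus)
    have "fst (\<integral>p. u p *\<^sub>R D p \<partial>torus l) = (\<integral>p. u p * fst (D p) \<partial>torus l)"
      "snd (\<integral>p. u p *\<^sub>R D p \<partial>torus l) = (\<integral>p. u p * snd (D p) \<partial>torus l)"
      "fst (\<integral>p. \<phi> p *\<^sub>R V p \<partial>torus l) = (\<integral>p. \<phi> p * fst (V p) \<partial>torus l)"
      "snd (\<integral>p. \<phi> p *\<^sub>R V p \<partial>torus l) = (\<integral>p. \<phi> p * snd (V p) \<partial>torus l)"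
      using integral_bounded_linear[OF bounded_linear_fst i1] integral_bounded_linear[OF bounded_linear_snd i1]
        integral_bounded_linear[OF bounded_linear_fst i2] integral_bounded_linear[OF bounded_linear_snd i2]
      by simp_all
    then show ?thesis
      unfolding set_integral_cell[OF m(1)] set_integral_cell[OF m(2)] prod_eq_iff by simp
  qed
  then show ?thesis unfolding has_weak_grad_def by (metis (no_types, lifting))
qed

lemma has_weak_grad_products:
  assumes u: "u \<in> L1 l" and V: "has_weak_grad l u V" and a: "C1_circle l a a'" and b: "C1_circle l b b'"
  shows "(\<integral>z. u z * (a' (fst z) * b (snd z)) \<partial>torus l) = - (\<integral>z. fst (V z) * (a (fst z) * b (snd z)) \<partial>torus l)"
    and "(\<integral>z. u z * (a (fst z) * b' (snd z)) \<partial>torus l) = - (\<integral>z. snd (V z) * (a (fst z) * b (snd z)) \<partial>torus l)"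
  using V C1_torus_prod[OF a b] unfolding has_weak_grad_iff[OF u]
  by (fastforce simp: mult_ac)+

lemma L1_components:
  fixes V :: "real \<times> real \<Rightarrow> real \<times> real"
  assumes "V \<in> L1 l"
  shows "(\<lambda>p. fst (V p)) \<in> L1 l" "(\<lambda>p. snd (V p)) \<in> L1 l"
proof -
  have V [measurable]: "V \<in> borel_measurable borel" and i: "integrable (torus l) V" and p: "periodic l V"
    using assms by (auto simp: L1_iff)
  have "(\<lambda>p. fst (V p)) \<in> borel_measurable borel" "(\<lambda>p. snd (V p)) \<in> borel_measurable borel"
    by measurable
  then show "(\<lambda>p. fst (V p)) \<in> L1 l" "(\<lambda>p. snd (V p)) \<in> L1 l"
    using p integrable_bounded_linear[OF bounded_linear_fst i] integrable_bounded_linear[OF bounded_linear_snd i]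
    by (auto simp: L1_iff periodic_def)
qed

text \<open>In each component, two weak gradients have the same pairing with every product of test
  functions.\<close>

lemma has_weak_grad_unique:
  assumes l: "l > 0" and u: "u \<in> L1 l" and V: "has_weak_grad l u V" and V': "has_weak_grad l u V'"
  shows "AE p in torus l. V p = V' p"
proof -
  note c = L1_components[of V l] L1_components[of V' l]
  have i: "integrable (torus l) (\<lambda>p. fst (V p))" "integrable (torus l) (\<lambda>p. snd (V p))"
     "integrable (torus l) (\<lambda>p. fst (V' p))" "integrable (torus l) (\<lambda>p. snd (V' p))"
    using c V V' by (auto simp: L1_iff has_weak_grad_def)
  have eq0: "AE z in torus l. f z - g z = 0"
    if f: "integrable (torus l) f" and g: "integrable (torus l) g"
      and eq: "\<And>a a' b b'. C1_circle l a a' \<Longrightarrow> C1_circle l b b' \<Longrightarrow>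
        (\<integral>z. f z * (a (fst z) * b (snd z)) \<partial>torus l) = (\<integral>z. g z * (a (fst z) * b (snd z)) \<partial>torus l)"
    for f g :: "real \<times> real \<Rightarrow> real"
  proof (rule AE_eq_0_if_orthogonal_products[OF l Bochner_Integration.integrable_diff[OF f g]])
    fix a a' b b' assume a: "C1_circle l a a'" and b: "C1_circle l b b'"
    have "integrable (torus l) (\<lambda>z. f z * (a (fst z) * b (snd z)))" "integrable (torus l) (\<lambda>z. g z * (a (fst z) * b (snd z)))"
      using C1_torus_integrable(2)[OF C1_torus_prod[OF a b] f] C1_torus_integrable(2)[OF C1_torus_prod[OF a b] g]
      by (simp_all add: mult_ac)
    then show "(\<integral>z. (f z - g z) * (a (fst z) * b (snd z)) \<partial>torus l) = 0"
      using eq[OF a b] by (simp add: left_diff_distrib)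
  qed
  have "AE z in torus l. fst (V z) - fst (V' z) = 0"
  proof (rule eq0[OF i(1) i(3)])
    fix a a' b b' assume a: "C1_circle l a a'" and b: "C1_circle l b b'"
    show "(\<integral>z. fst (V z) * (a (fst z) * b (snd z)) \<partial>torus l) = (\<integral>z. fst (V' z) * (a (fst z) * b (snd z)) \<partial>torus l)"
      using has_weak_grad_products(1)[OF u V a b] has_weak_grad_products(1)[OF u V' a b] by linarith
  qed
  moreover have "AE z in torus l. snd (V z) - snd (V' z) = 0"
  proof (rule eq0[OF i(2) i(4)])
    fix a a' b b' assume a: "C1_circle l a a'" and b: "C1_circle l b b'"
    show "(\<integral>z. snd (V z) * (a (fst z) * b (snd z)) \<partial>torus l) = (\<integral>z. snd (V' z) * (a (fst z) * b (snd z)) \<partial>torus l)"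
      using has_weak_grad_products(2)[OF u V a b] has_weak_grad_products(2)[OF u V' a b] by linarith
  qed
  ultimately show ?thesis
    by eventually_elim (simp add: prod_eq_iff)
qed

text \<open>The choice behind \<open>weak_grad\<close> ranges over gradients in \<open>L1\<close>.
  Square integrability is carried over from some gradient in \<open>L2\<close> by
  uniqueness.\<close>

lemma
  assumes l: "l > 0" and u: "u \<in> W12 l"
  shows weak_grad_W12: "has_weak_grad l u (weak_grad l u)" and weak_grad_L2: "weak_grad l u \<in> L2 l"
    and W12_L1: "u \<in> L1 l"
proof -
  show L1: "u \<in> L1 l" using u by (auto simp: W12_def intro: L2_imp_L1)
  obtain V where V: "has_weak_grad l u V" "V \<in> L2 l" using u by (auto simp: W12_def)
  show w: "has_weak_grad l u (weak_grad l u)" unfolding weak_grad_def using V(1) by (rule someI[of "has_weak_grad l u"])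
  have L: "weak_grad l u \<in> L1 l" using w by (simp add: has_weak_grad_def)
  have ae: "AE p in torus l. V p = weak_grad l u p" by (rule has_weak_grad_unique[OF l L1 V(1) w])
  have "integrable (torus l) (\<lambda>p. (norm (V p))\<^sup>2) \<longleftrightarrow> integrable (torus l) (\<lambda>p. (norm (weak_grad l u p))\<^sup>2)"
  proof (rule integrable_cong_AE)
    show "AE x in torus l. (norm (V x))\<^sup>2 = (norm (weak_grad l u x))\<^sup>2" using ae by eventually_elim simp
  qed (use V L in \<open>auto simp: L1_iff L2_iff measurable_torus\<close>)
  then show "weak_grad l u \<in> L2 l" using V L by (auto simp: L1_iff L2_iff)
qed

lemma weak_grad_AE_eq:
  assumes l: "l > 0" and u: "u \<in> W12 l" and V: "has_weak_grad l u V"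
  shows "AE p in torus l. weak_grad l u p = V p"
  by (rule has_weak_grad_unique[OF l W12_L1[OF l u] weak_grad_W12[OF l u] V])

lemma has_weak_grad_diff:
  assumes "u \<in> L1 l" "u' \<in> L1 l" "has_weak_grad l u V" "has_weak_grad l u' V'"
  shows "(\<lambda>p. u p - u' p) \<in> L1 l" "has_weak_grad l (\<lambda>p. u p - u' p) (\<lambda>p. V p - V' p)"
proof -
  have VL: "V \<in> L1 l" "V' \<in> L1 l" using assms by (auto simp: has_weak_grad_def)
  show L: "(\<lambda>p. u p - u' p) \<in> L1 l" using assms(1,2) by (auto simp: L1_iff periodic_def)
  have L': "(\<lambda>p. V p - V' p) \<in> L1 l" using VL by (auto simp: L1_iff periodic_def)
  have "(\<integral>p. (u p - u' p) * fst (D p) \<partial>torus l) = - (\<integral>p. \<phi> p * fst (V p - V' p) \<partial>torus l)"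
    "(\<integral>p. (u p - u' p) * snd (D p) \<partial>torus l) = - (\<integral>p. \<phi> p * snd (V p - V' p) \<partial>torus l)"
    if \<phi>: "C1_torus l \<phi> D" for \<phi> D
  proof -
    have "integrable (torus l) (\<lambda>p. u p *\<^sub>R D p)" "integrable (torus l) (\<lambda>p. u' p *\<^sub>R D p)"
      "integrable (torus l) (\<lambda>p. \<phi> p *\<^sub>R V p)" "integrable (torus l) (\<lambda>p. \<phi> p *\<^sub>R V' p)"
      using C1_torus_integrable[OF \<phi>] assms VL by (auto simp: L1_iff)
    note i = this[THEN integrable_bounded_linear[OF bounded_linear_fst]] this[THEN integrable_bounded_linear[OF bounded_linear_snd]]
    show "(\<integral>p. (u p - u' p) * fst (D p) \<partial>torus l) = - (\<integral>p. \<phi> p * fst (V p - V' p) \<partial>torus l)"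
      "(\<integral>p. (u p - u' p) * snd (D p) \<partial>torus l) = - (\<integral>p. \<phi> p * snd (V p - V' p) \<partial>torus l)"
      using i assms(3,4) \<phi> unfolding has_weak_grad_iff[OF assms(1)] has_weak_grad_iff[OF assms(2)]
      by (auto simp: left_diff_distrib right_diff_distrib)
  qed
  then show "has_weak_grad l (\<lambda>p. u p - u' p) (\<lambda>p. V p - V' p)"
    unfolding has_weak_grad_iff[OF L] using L' by blast
qed

section \<open>Gradients of functions of the first variable\<close>

lemma C1_torus_partial:
  assumes "C1_torus l \<phi> D"
  shows "((\<lambda>x. \<phi> (x, y)) has_real_derivative fst (D (x, y))) (at x)"
    and "((\<lambda>y. \<phi> (x, y)) has_real_derivative snd (D (x, y))) (at y)"
proof -
  have D: "(\<phi> has_derivative (\<lambda>h. inner h (D (x, y)))) (at (x, y))"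
    using assms by (simp add: C1_torus_def gderiv_def)
  have "((\<lambda>x. \<phi> (x, y)) has_derivative (\<lambda>h. inner (h, 0) (D (x, y)))) (at x)"
    by (rule has_derivative_compose[of "\<lambda>x. (x, y)" "\<lambda>h. (h, 0)" x UNIV \<phi>, OF _ D])
       (auto intro!: derivative_eq_intros)
  then show "((\<lambda>x. \<phi> (x, y)) has_real_derivative fst (D (x, y))) (at x)"
    unfolding has_field_derivative_def by (rule has_derivative_eq_rhs) (auto simp: inner_prod_def mult.commute)
  have "((\<lambda>y. \<phi> (x, y)) has_derivative (\<lambda>h. inner (0, h) (D (x, y)))) (at y)"
    by (rule has_derivative_compose[of "\<lambda>y. (x, y)" "\<lambda>h. (0, h)" y UNIV \<phi>, OF _ D])
       (auto intro!: derivative_eq_intros)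
  then show "((\<lambda>y. \<phi> (x, y)) has_real_derivative snd (D (x, y))) (at y)"
    unfolding has_field_derivative_def by (rule has_derivative_eq_rhs) (auto simp: inner_prod_def mult.commute)
qed

text \<open>The source of all explicit Sobolev functions here: the competitor and the limit depend
  on the first variable only. On a slice the derivative of the product of \<open>u\<close> and
  \<phi> integrates to zero by periodicity, and the partial derivative of \<phi> in the second
  variable integrates to zero in that variable.\<close>

lemma has_weak_grad_of_fst:
  assumes l: "l > 0" and S: "finite S" and cont: "continuous_on {-l..l} u"
    and deriv: "\<And>x. x \<in> {-l<..<l} - S \<Longrightarrow> (u has_real_derivative u' x) (at x)"
    and um: "u \<in> borel_measurable borel" and u'm: "u' \<in> borel_measurable borel" "\<And>x. \<bar>u' x\<bar> \<le> C"
    and per: "\<And>x. u (x + 2 * l) = u x" "\<And>x. u' (x + 2 * l) = u' x"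
  shows "(\<lambda>p. u (fst p)) \<in> W12 l" "has_weak_grad l (\<lambda>p. u (fst p)) (\<lambda>p. (u' (fst p), 0))"
proof -
  note [measurable] = um u'm(1)
  obtain Cu where Cu: "\<forall>x. \<bar>u x\<bar> \<le> Cu"
    by (rule periodic_continuous_bounded[OF l cont per(1)])
  have V2: "(\<lambda>p::real\<times>real. (u' (fst p), 0::real)) \<in> L2 l"
    unfolding L2_iff
  proof (intro conjI)
    show "integrable (torus l) (\<lambda>p. (norm (u' (fst p), 0::real))\<^sup>2)"
      by (rule torus_fin.integrable_const_bound[where B="C\<^sup>2"])
         (use u'm(2) in \<open>auto simp: measurable_torus abs_le_square_iff[symmetric] intro: order_trans[OF _ abs_ge_self]\<close>)
  qed (use per in \<open>auto simp: periodic_def\<close>)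
  have u2: "(\<lambda>p::real\<times>real. u (fst p)) \<in> L2 l"
    unfolding L2_iff
  proof (intro conjI)
    show "integrable (torus l) (\<lambda>p. (norm (u (fst p)))\<^sup>2)"
      by (rule torus_fin.integrable_const_bound[where B="Cu\<^sup>2"])
         (use Cu in \<open>auto simp: measurable_torus abs_le_square_iff[symmetric] intro: order_trans[OF _ abs_ge_self]\<close>)
  qed (use per in \<open>auto simp: periodic_def\<close>)
  have u1: "(\<lambda>p::real\<times>real. u (fst p)) \<in> L1 l" by (rule L2_imp_L1[OF u2])
  have V1: "(\<lambda>p::real\<times>real. (u' (fst p), 0::real)) \<in> L1 l" by (rule L2_imp_L1[OF V2])
  have "(\<integral>p. u (fst p) * fst (D p) \<partial>torus l) = - (\<integral>p. \<phi> p * u' (fst p) \<partial>torus l) \<and>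
        (\<integral>p. u (fst p) * snd (D p) \<partial>torus l) = 0" if \<phi>: "C1_torus l \<phi> D" for \<phi> D
  proof
    obtain B where B: "\<forall>p \<in> {-l..l} \<times> {-l..l}. \<bar>\<phi> p\<bar> \<le> B \<and> norm (D p) \<le> B"
      by (rule C1_torus_bounded[OF \<phi>])
    have Bf: "\<bar>fst (D p)\<bar> \<le> B" "\<bar>snd (D p)\<bar> \<le> B" if "p \<in> {-l..l} \<times> {-l..l}" for p
      using B that norm_fst_le[of "fst (D p)" "snd (D p)"] norm_snd_le[of "snd (D p)" "fst (D p)"]
      by (auto intro: order_trans)
    have meas: "\<phi> \<in> borel_measurable (borel \<Otimes>\<^sub>M borel)" "D \<in> borel_measurable (borel \<Otimes>\<^sub>M borel)"
      using C1_torus_measurable[OF \<phi>] by (auto simp: borel_prod)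
    have [measurable]: "(\<lambda>x. \<phi> (x, y)) \<in> borel_measurable borel" "(\<lambda>x. D (x, y)) \<in> borel_measurable borel"
      "(\<lambda>y. \<phi> (x, y)) \<in> borel_measurable borel" "(\<lambda>y. D (x, y)) \<in> borel_measurable borel" for x y
      using meas by measurable
    have p\<phi>: "\<phi> (x + 2 * l, y) = \<phi> (x, y)" "\<phi> (x, y + 2 * l) = \<phi> (x, y)" for x y
      using \<phi> by (auto simp: C1_torus_def periodic_def)
    have iu: "integrable (torus l) (\<lambda>p. u (fst p) *\<^sub>R D p)"
      "integrable (torus l) (\<lambda>p. \<phi> p *\<^sub>R (u' (fst p), 0::real))"
      using C1_torus_integrable(1)[OF \<phi>, of "\<lambda>p. u (fst p)"]
        C1_torus_integrable(2)[OF \<phi>, of "\<lambda>p. (u' (fst p), 0::real)"] u1 V1 unfolding L1_iff by blast+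
    have i1: "integrable (torus l) (\<lambda>p. u (fst p) * fst (D p))"
      and i2: "integrable (torus l) (\<lambda>p. u (fst p) * snd (D p))"
      and i3: "integrable (torus l) (\<lambda>p. \<phi> p * u' (fst p))"
      using integrable_bounded_linear[OF bounded_linear_fst iu(1)] integrable_bounded_linear[OF bounded_linear_snd iu(1)]
        integrable_bounded_linear[OF bounded_linear_fst iu(2)] by simp_all
    have "AE y in circle l. (\<integral>x. u x * fst (D (x, y)) + \<phi> (x, y) * u' x \<partial>circle l) = 0"
      using AE_circle_segment
    proof eventually_elim
      case (elim y)
      have "(\<integral>x. u x * fst (D (x, y)) + \<phi> (x, y) * u' x \<partial>circle l) = u l * \<phi> (l, y) - u (-l) * \<phi> (-l, y)"
      proof (rule integral_circle_FTC[OF l S, where F="\<lambda>x. u x * \<phi> (x, y)" and C="Cu * B + B * C"])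
        show "continuous_on {-l..l} (\<lambda>x. u x * \<phi> (x, y))"
          using C1_torus_partial(1)[OF \<phi>]
          by (intro continuous_intros cont continuous_at_imp_continuous_on) (auto intro: DERIV_isCont)
        show "((\<lambda>x. u x * \<phi> (x, y)) has_real_derivative u x * fst (D (x, y)) + \<phi> (x, y) * u' x) (at x)"
          if "x \<in> {-l<..<l} - S" for x
          using DERIV_mult[OF deriv[OF that] C1_torus_partial(1)[OF \<phi>, of y x]]
          by (simp add: mult_ac add_ac)
        show "\<bar>u x * fst (D (x, y)) + \<phi> (x, y) * u' x\<bar> \<le> Cu * B + B * C" if "x \<in> {-l..l}" for x
        proof -
          have "\<bar>u x * fst (D (x, y))\<bar> \<le> Cu * B" "\<bar>\<phi> (x, y) * u' x\<bar> \<le> B * C"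
            unfolding abs_mult using Cu u'm(2) Bf[of "(x, y)"] B that elim
            by (auto intro!: mult_mono intro: order_trans[OF abs_ge_zero])
          then show ?thesis by linarith
        qed
      qed measurable
      then show ?case using per(1)[of "-l"] p\<phi>(1)[of "-l" y] by simp
    qed
    moreover have "integrable (torus l) (\<lambda>p. u (fst p) * fst (D p) + \<phi> p * u' (fst p))"
      using i1 i3 by auto
    note integral_torus_snd[OF this]
    ultimately have "(\<integral>p. u (fst p) * fst (D p) + \<phi> p * u' (fst p) \<partial>torus l) = 0"
      by (simp add: integral_eq_zero_AE)
    then show "(\<integral>p. u (fst p) * fst (D p) \<partial>torus l) = - (\<integral>p. \<phi> p * u' (fst p) \<partial>torus l)"
      using i1 i3 by simp
    have "AE x in circle l. (\<integral>y. u x * snd (D (x, y)) \<partial>circle l) = 0"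
      using AE_circle_segment
    proof eventually_elim
      case (elim x)
      have "(\<integral>y. snd (D (x, y)) \<partial>circle l) = \<phi> (x, l) - \<phi> (x, -l)"
      proof (rule integral_circle_FTC[OF l, where S="{}" and C=B])
        show "continuous_on {-l..l} (\<lambda>y. \<phi> (x, y))"
          using C1_torus_partial(2)[OF \<phi>]
          by (intro continuous_at_imp_continuous_on) (auto intro: DERIV_isCont)
      qed (use C1_torus_partial(2)[OF \<phi>] Bf elim in auto)
      then show ?case using p\<phi>(2)[of x "-l"] by simp
    qed
    with integral_torus_fst[OF i2] show "(\<integral>p. u (fst p) * snd (D p) \<partial>torus l) = 0"
      by (simp add: integral_eq_zero_AE)
  qed
  then show "has_weak_grad l (\<lambda>p. u (fst p)) (\<lambda>p. (u' (fst p), 0))"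
    unfolding has_weak_grad_iff[OF u1] using V1 by auto
  with u2 V2 show "(\<lambda>p. u (fst p)) \<in> W12 l" unfolding W12_def by blast
qed

text \<open>A periodic absolutely continuous function \<open>U\<close> with derivative
  \<open>v\<close>, described through its increments, without pointwise derivatives. Applied to a
  full period, the identity says that \<open>v\<close> has mean zero.\<close>

definition circle_primitive :: "real \<Rightarrow> (real \<Rightarrow> real) \<Rightarrow> (real \<Rightarrow> real) \<Rightarrow> bool" where
  "circle_primitive l U v \<longleftrightarrow> v \<in> borel_measurable borel \<and> (\<forall>x. v (x + 2 * l) = v x) \<and> integrable (circle l) v \<and>
     (\<forall>x. U (x + 2 * l) = U x) \<and>
     (\<forall>a b. a \<le> b \<longrightarrow> b \<le> a + 2 * l \<longrightarrow> U b - U a = (LINT x:{a..<b}|lborel. v x))"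

lemma set_integral_split:
  fixes v :: "real \<Rightarrow> real"
  assumes "set_integrable lborel {a..<c} v" "a \<le> b" "b \<le> c"
  shows "(LINT x:{a..<c}|lborel. v x) = (LINT x:{a..<b}|lborel. v x) + (LINT x:{b..<c}|lborel. v x)"
proof -
  have "{a..<c} = {a..<b} \<union> {b..<c}" using assms by auto
  then show ?thesis
    using assms by (simp, subst set_integral_Un) (auto intro: set_integrable_subset)
qed

text \<open>Since \<open>v\<close> has mean zero, its primitive from \<open>- l\<close> vanishes at
  both ends of the cell and extends periodically without a jump. Once \<open>a\<close> is reduced
  into the cell, the interval either stays inside or crosses \<open>l\<close> once, and the part
  beyond \<open>l\<close> wraps round to \<open>- l\<close>.\<close>

lemma circle_primitive_to_circle:
  assumes l: "l > 0" and v: "v \<in> borel_measurable borel" "\<And>x. v (x + 2 * l) = v x"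
    and i: "integrable (circle l) v" and mean: "(\<integral>x. v x \<partial>circle l) = 0"
  shows "circle_primitive l (\<lambda>x. h + (\<integral>t. indicator {..<to_circle l x} t * v t \<partial>circle l)) v"
proof -
  note [measurable] = v(1)
  define P where "P x = (\<integral>t. indicator {..<x} t * v t \<partial>circle l)" for x
  have si: "set_integrable lborel {c..<c + 2 * l} v" for c
    using i by (simp add: set_integrable_period[OF l v])
  have P: "P x = (LINT t:{-l..<x}|lborel. v t)" if "x \<in> {-l..l}" for x
  proof -
    have "P x = (LINT t:{-l..<l}|lborel. indicator {..<x} t * v t)"
      unfolding P_def by (subst set_integral_circle) auto
    also have "\<dots> = (LINT t:{-l..<x}|lborel. v t)"
      unfolding set_lebesgue_integral_def using that
      by (intro Bochner_Integration.integral_cong) (auto simp: indicator_def)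
    finally show ?thesis .
  qed
  have diff: "(LINT t:{a..<b}|lborel. v t) = P b - P a" if "-l \<le> a" "a \<le> b" "b \<le> l" for a b
  proof -
    have "set_integrable lborel {-l..<b} v"
      using that by (intro set_integrable_subset[OF si[of "-l"]]) auto
    from set_integral_split[OF this, of a] show ?thesis using P[of a] P[of b] that by simp
  qed
  have Pl: "P l = 0"
    using P[of l] l mean set_integral_circle[OF v(1), of l] by simp
  have Pml: "P (-l) = 0" using P[of "-l"] l by (simp add: set_lebesgue_integral_def)
  have "P (to_circle l b) - P (to_circle l a) = (LINT x:{a..<b}|lborel. v x)"
    if ab: "a \<le> b" "b \<le> a + 2 * l" for a b
  proof -
    define a' b' where "a' = to_circle l a" and "b' = a' + (b - a)"
    define k where "k = 2 * l * of_int \<lfloor>(a + l) / (2 * l)\<rfloor>"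
    have k: "a = k + a'" "b = k + b'" by (auto simp: a'_def b'_def to_circle_def k_def)
    have a': "a' \<in> {-l..<l}" unfolding a'_def by (rule to_circle_in[OF l])
    have vk: "v (k + x) = v x" for x
      using periodic_int_multiple[of v "2*l", OF v(2)] by (simp add: k_def add.commute)
    have tb: "to_circle l b = to_circle l b'"
    proof -
      have "to_circle l (b' + (2 * l) * of_int \<lfloor>(a + l) / (2 * l)\<rfloor>) = to_circle l b'"
        by (rule periodic_int_multiple) (rule to_circle_periodic[OF l])
      moreover have "b = b' + (2 * l) * of_int \<lfloor>(a + l) / (2 * l)\<rfloor>"
        by (simp add: b'_def a'_def to_circle_def)
      ultimately show ?thesis by metis
    qed
    have "(LINT x:{a..<b}|lborel. v x) = (\<integral>x. indicator {a..<b} (k + 1 * x) *\<^sub>R v (k + 1 * x) \<partial>lborel)"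
      unfolding set_lebesgue_integral_def by (subst lborel_integral_real_affine[where c=1 and t=k]) auto
    also have "\<dots> = (LINT x:{a'..<b'}|lborel. v x)"
      unfolding set_lebesgue_integral_def
      by (intro Bochner_Integration.integral_cong) (auto simp: vk indicator_def k)
    finally have eq: "(LINT x:{a..<b}|lborel. v x) = (LINT x:{a'..<b'}|lborel. v x)" .
    have ab': "a' \<le> b'" "b' \<le> a' + 2 * l" using ab by (auto simp: b'_def)
    show ?thesis
    proof (cases "b' < l")
      case True
      then have "to_circle l b' = b'" using a' ab' by (intro to_circle_id) auto
      then show ?thesis unfolding eq tb using diff[of a' b'] True a' ab' by (simp add: a'_def)
    next
      case False
      have "to_circle l b' = to_circle l (b' - 2 * l)"
        using to_circle_periodic[OF l, of "b' - 2 * l"] by simp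
      also have "\<dots> = b' - 2 * l" using False a' ab' by (intro to_circle_id) auto
      finally have tb': "to_circle l b' = b' - 2 * l" .
      have "set_integrable lborel {a'..<b'} v"
        using ab' by (intro set_integrable_subset[OF si[of a']]) auto
      then have "(LINT x:{a'..<b'}|lborel. v x) = (LINT x:{a'..<l}|lborel. v x) + (LINT x:{l..<b'}|lborel. v x)"
        using a' False by (intro set_integral_split) auto
      also have "(LINT x:{l..<b'}|lborel. v x)
          = (\<integral>x. indicator {l..<b'} (2 * l + 1 * x) *\<^sub>R v (2 * l + 1 * x) \<partial>lborel)"
        unfolding set_lebesgue_integral_def by (subst lborel_integral_real_affine[where c=1 and t="2*l"]) auto
      also have "\<dots> = (LINT x:{-l..<b' - 2 * l}|lborel. v x)"
        unfolding set_lebesgue_integral_def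
        by (intro Bochner_Integration.integral_cong) (auto simp: v(2)[simplified add.commute] indicator_def add.commute)
      also have "\<dots> = P (b' - 2 * l)" using diff[of "-l" "b' - 2 * l"] False a' ab' Pml by simp
      also have "(LINT x:{a'..<l}|lborel. v x) = - P a'" using diff[of a' l] a' Pl by simp
      finally show ?thesis unfolding eq tb tb' by (simp add: a'_def)
    qed
  qed
  then show ?thesis
    unfolding circle_primitive_def using v i to_circle_periodic[OF l] by (auto simp: P_def)
qed

section \<open>Oscillation and Poincare inequalities\<close>

text \<open>Cauchy-Schwarz against the constant one, read off from the nonnegative integral of
  \<open>(m * f x - I)\<^sup>2\<close>. Measure zero is treated separately because a factor
  \<open>m\<close> is cancelled.\<close>

lemma integral_square_le:
  fixes f :: "'a \<Rightarrow> real"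
  assumes M: "finite_measure M" and f: "integrable M f" and f2: "integrable M (\<lambda>x. (f x)\<^sup>2)"
  shows "(\<integral>x. f x \<partial>M)\<^sup>2 \<le> measure M (space M) * (\<integral>x. (f x)\<^sup>2 \<partial>M)"
proof -
  interpret finite_measure M by fact
  define m I J where "m = measure M (space M)" and "I = (\<integral>x. f x \<partial>M)" and "J = (\<integral>x. (f x)\<^sup>2 \<partial>M)"
  have "0 \<le> (\<integral>x. (m * f x - I)\<^sup>2 \<partial>M)" by (rule integral_nonneg_AE) simp
  also have "\<dots> = (\<integral>x. m\<^sup>2 * (f x)\<^sup>2 - 2 * m * I * f x + I\<^sup>2 \<partial>M)"
    by (simp add: power2_eq_square algebra_simps)
  also have "\<dots> = m\<^sup>2 * J - 2 * m * I * I + I\<^sup>2 * m"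
    using f f2 by (simp add: m_def I_def J_def)
  also have "\<dots> = m * (m * J - I\<^sup>2)" by (simp add: power2_eq_square algebra_simps)
  finally have *: "0 \<le> m * (m * J - I\<^sup>2)" .
  show ?thesis
  proof (cases "m = 0")
    case True
    then have "emeasure M (space M) = 0" by (simp add: m_def measure_eq_0_null_sets emeasure_eq_measure)
    then have "AE x in M. False" by (auto simp: AE_iff_null)
    then have "AE x in M. f x = 0" by (rule eventually_mono) simp
    then have "I = 0" unfolding I_def by (rule integral_eq_zero_AE)
    then show ?thesis using True by (simp add: m_def I_def)
  next
    case False
    then have "m > 0" unfolding m_def using measure_nonneg[of M "space M"] by linarith
    with * have "0 \<le> m * J - I\<^sup>2" by (simp add: zero_le_mult_iff)
    then show ?thesis by (simp add: m_def I_def J_def)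
  qed
qed

text \<open>Serves to choose a slice that is no worse than average and at the same time avoids a
  prescribed null set.\<close>

lemma exists_le_average:
  fixes f :: "real \<Rightarrow> real"
  assumes l: "l > 0" and f: "integrable (circle l) f" and P: "AE x in circle l. P x"
  obtains x where "P x" "x \<in> {-l..<l}" "f x \<le> (\<integral>x. f x \<partial>circle l) / (2 * l)"
proof -
  define m where "m = (\<integral>x. f x \<partial>circle l) / (2 * l)"
  have "\<exists>x. P x \<and> x \<in> {-l..<l} \<and> f x \<le> m"
  proof (rule ccontr)
    assume "\<not> ?thesis"
    then have neg: "f x > m" if "P x" "x \<in> {-l..<l}" for x using that by force
    have pos: "AE x in circle l. f x - m > 0"
      using P AE_circle_segment by eventually_elim (use neg in force)
    then have "AE x in circle l. 0 \<le> f x - m" by eventually_elim simp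
    moreover have i: "integrable (circle l) (\<lambda>x. f x - m)" using f by simp
    moreover have "(\<integral>x. f x - m \<partial>circle l) = 0"
      using f l by (simp add: m_def measure_circle)
    ultimately have "AE x in circle l. f x - m = 0"
      using integral_nonneg_eq_0_iff_AE[OF i] by blast
    with pos have "AE x in circle l. False" by eventually_elim simp
    then show False by (rule AE_circle_const[OF l])
  qed
  then show ?thesis using that unfolding m_def by blast
qed

lemma AE_torus_swap:
  assumes "AE z in torus l. P z" shows "AE z in torus l. P (snd z, fst z)"
proof -
  have d: "distr (torus l) (torus l) (\<lambda>(x, y). (y, x)) = torus l"
    using torus.distr_pair_swap[of l] by (simp add: torus_eq_pair[symmetric])
  have "(\<lambda>(x, y). (y, x)) \<in> measurable (torus l) (torus l)"
    unfolding torus_eq_pair by (rule measurable_pair_swap')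
  from AE_distrD[OF this, of P] show ?thesis unfolding d using assms by (simp add: case_prod_unfold)
qed

text \<open>Provides an absolutely continuous representative on almost every horizontal slice, so
  that values at single points make sense.\<close>

lemma weak_grad_slices:
  assumes l: "l > 0" and u: "u \<in> L1 l" and V: "has_weak_grad l u V"
  obtains U where "AE y in circle l. circle_primitive l (U y) (\<lambda>x. fst (V (x, y)))"
    "AE z in torus l. u z = U (snd z) (fst z)"
proof -
  have v: "(\<lambda>p. fst (V p)) \<in> L1 l" using V by (auto simp: has_weak_grad_def intro: L1_components)
  then have vi: "integrable (torus l) (\<lambda>p. fst (V p))" and vp: "fst (V (x + 2 * l, y)) = fst (V (x, y))" for x y
    by (auto simp: L1_iff periodic_def)
  obtain h where h: "h \<in> borel_measurable borel"
    "AE y in circle l. (\<integral>x. fst (V (x, y)) \<partial>circle l) = 0"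
    "AE z in torus l. u z = h (snd z) + (\<integral>t. indicator {..<fst z} t * fst (V (t, snd z)) \<partial>circle l)"
    by (rule slice_representation[OF l _ vi has_weak_grad_products(1)[OF u V]])
       (use u in \<open>auto simp: L1_iff\<close>)
  define U where "U y x = h y + (\<integral>t. indicator {..<to_circle l x} t * fst (V (t, y)) \<partial>circle l)" for y x
  have vm: "(\<lambda>x. fst (V (x, y))) \<in> borel_measurable borel" for y
  proof -
    have "(\<lambda>p. fst (V p)) \<in> borel_measurable (borel \<Otimes>\<^sub>M borel)" using v by (simp add: L1_iff borel_prod)
    then show ?thesis by measurable
  qed
  have "AE y in circle l. circle_primitive l (U y) (\<lambda>x. fst (V (x, y)))"
    using h(2) AE_integrable_torus_snd[OF vi]
    unfolding U_def[abs_def] by eventually_elim (rule circle_primitive_to_circle[OF l vm vp])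
  moreover have "AE z in torus l. u z = U (snd z) (fst z)"
    using h(3) AE_torus_cell by eventually_elim (auto simp: U_def to_circle_id)
  ultimately show ?thesis by (rule that)
qed

lemma slice_oscillation:
  fixes v :: "real \<times> real \<Rightarrow> real"
  assumes v: "integrable (torus l) v"
    and rep: "AE z in torus l. u z = h (snd z) + (\<integral>t. indicator {..<fst z} t * v (t, snd z) \<partial>circle l)"
  shows "AE z in torus l. \<bar>u z - h (snd z)\<bar> \<le> (\<integral>t. \<bar>v (t, snd z)\<bar> \<partial>circle l)"
  using rep AE_torus_snd[OF AE_integrable_torus_snd[OF v]]
proof eventually_elim
  case (elim z)
  have "norm (\<integral>t. indicator {..<fst z} t * v (t, snd z) \<partial>circle l)
      \<le> (\<integral>t. norm (indicator {..<fst z} t * v (t, snd z)) \<partial>circle l)"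
    by (rule integral_norm_bound)
  also have "\<dots> \<le> (\<integral>t. \<bar>v (t, snd z)\<bar> \<partial>circle l)"
    using elim by (intro integral_mono' integrable_abs) (auto simp: indicator_def)
  finally show ?case using elim by simp
qed

text \<open>The second estimate is the first one for the transposed function. Its reference value
  \<open>k\<close> is shared by all horizontal slices, which makes their values at the same abscissa
  comparable.\<close>

lemma weak_grad_oscillation:
  assumes l: "l > 0" and u: "u \<in> L1 l" and V: "has_weak_grad l u V"
  obtains h k where "AE z in torus l. \<bar>u z - h (snd z)\<bar> \<le> (\<integral>t. \<bar>fst (V (t, snd z))\<bar> \<partial>circle l)"
    "AE z in torus l. \<bar>u z - k (fst z)\<bar> \<le> (\<integral>t. \<bar>snd (V (fst z, t))\<bar> \<partial>circle l)"
proof -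
  have "V \<in> L1 l" using V by (auto simp: has_weak_grad_def)
  note L = L1_components[OF this]
  have ui: "integrable (torus l) u" and um: "u \<in> borel_measurable borel" using u by (auto simp: L1_iff)
  have i: "integrable (torus l) (\<lambda>p. fst (V p))" "integrable (torus l) (\<lambda>p. snd (V p))"
    using L by (auto simp: L1_iff)
  obtain h where h: "AE z in torus l. u z = h (snd z) + (\<integral>t. indicator {..<fst z} t * fst (V (t, snd z)) \<partial>circle l)"
    by (rule slice_representation[OF l ui i(1) has_weak_grad_products(1)[OF u V]]) auto
  define v where "v = (\<lambda>z. snd (V (snd z, fst z)))"
  have iv: "integrable (torus l) v"
    unfolding v_def using integrable_torus_swap[OF i(2)] by simp
  have weak: "(\<integral>z. u (snd z, fst z) * (a' (fst z) * b (snd z)) \<partial>torus l) = - (\<integral>z. v z * (a (fst z) * b (snd z)) \<partial>torus l)"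
    if a: "C1_circle l a a'" and b: "C1_circle l b b'" for a a' b b'
  proof -
    note [measurable] = C1_circle_measurable[OF a] C1_circle_measurable[OF b]
    have m: "(\<lambda>z. u z * (b (fst z) * a' (snd z))) \<in> borel_measurable borel"
      "(\<lambda>z. snd (V z) * (b (fst z) * a (snd z))) \<in> borel_measurable borel"
      using um L(2) by (auto simp: L1_iff)
    show ?thesis
      using has_weak_grad_products(2)[OF u V b a] integral_torus_swap[OF m(1), of l] integral_torus_swap[OF m(2), of l]
      by (simp add: v_def mult_ac)
  qed
  obtain k where k: "AE z in torus l. u (snd z, fst z) = k (snd z) + (\<integral>t. indicator {..<fst z} t * v (t, snd z) \<partial>circle l)"
    by (rule slice_representation[OF l integrable_torus_swap[OF ui] iv weak]) auto
  have "AE z in torus l. \<bar>u z - k (fst z)\<bar> \<le> (\<integral>t. \<bar>snd (V (fst z, t))\<bar> \<partial>circle l)"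
    using AE_torus_swap[OF slice_oscillation[OF iv k]] by (simp add: v_def)
  with slice_oscillation[OF i(1) h] show ?thesis by (rule that)
qed

text \<open>Cauchy-Schwarz on each slice, followed by Fubini.\<close>

lemma slice_L1_square:
  fixes v :: "real \<times> real \<Rightarrow> real"
  assumes l: "l > 0" and v: "v \<in> borel_measurable borel" and v2: "integrable (torus l) (\<lambda>z. (v z)\<^sup>2)"
  defines "B \<equiv> \<lambda>y. \<integral>t. \<bar>v (t, y)\<bar> \<partial>circle l"
  shows "integrable (circle l) B" "integrable (circle l) (\<lambda>y. (B y)\<^sup>2)"
    "(\<integral>y. (B y)\<^sup>2 \<partial>circle l) \<le> 2 * l * (\<integral>z. (v z)\<^sup>2 \<partial>torus l)"
proof -
  have vi: "integrable (torus l) v"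
    by (rule integrable_of_square_integrable[OF finite_measure_torus]) (use v v2 in \<open>auto simp: measurable_torus\<close>)
  show Bi: "integrable (circle l) B"
    unfolding B_def by (rule integrable_torus_snd[of l "\<lambda>z. \<bar>v z\<bar>"]) (use vi in auto)
  have bound: "AE y in circle l. (B y)\<^sup>2 \<le> 2 * l * (\<integral>t. (v (t, y))\<^sup>2 \<partial>circle l)"
    using AE_integrable_torus_snd[OF v2] AE_integrable_torus_snd[OF vi]
  proof eventually_elim
    case (elim y)
    then show ?case
      using integral_square_le[OF finite_measure_circle[of l], of "\<lambda>t. \<bar>v (t, y)\<bar>"] l
      by (simp add: B_def measure_circle)
  qed
  have i2: "integrable (circle l) (\<lambda>y. 2 * l * (\<integral>t. (v (t, y))\<^sup>2 \<partial>circle l))"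
    using integrable_torus_snd[OF v2] by auto
  show B2: "integrable (circle l) (\<lambda>y. (B y)\<^sup>2)"
  proof (rule Bochner_Integration.integrable_bound[OF i2])
    show "(\<lambda>y. (B y)\<^sup>2) \<in> borel_measurable (circle l)" using borel_measurable_integrable[OF Bi] by measurable
    show "AE y in circle l. norm ((B y)\<^sup>2) \<le> norm (2 * l * (\<integral>t. (v (t, y))\<^sup>2 \<partial>circle l))"
      using bound by eventually_elim simp
  qed
  have "(\<integral>y. (B y)\<^sup>2 \<partial>circle l) \<le> (\<integral>y. 2 * l * (\<integral>t. (v (t, y))\<^sup>2 \<partial>circle l) \<partial>circle l)"
    by (rule integral_mono_AE[OF B2 i2 bound])
  also have "\<dots> = 2 * l * (\<integral>z. (v z)\<^sup>2 \<partial>torus l)"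
    using integral_torus_snd[OF v2] by simp
  finally show "(\<integral>y. (B y)\<^sup>2 \<partial>circle l) \<le> 2 * l * (\<integral>z. (v z)\<^sup>2 \<partial>torus l)" .
qed

lemma norm_pair_square: "(norm (p :: real \<times> real))\<^sup>2 = (fst p)\<^sup>2 + (snd p)\<^sup>2"
  by (simp add: norm_prod_def)

lemma L2_components:
  fixes V :: "real \<times> real \<Rightarrow> real \<times> real"
  assumes "V \<in> L2 l"
  shows "(\<lambda>p. fst (V p)) \<in> L2 l" "(\<lambda>p. snd (V p)) \<in> L2 l"
proof -
  have L1: "(\<lambda>p. fst (V p)) \<in> L1 l" "(\<lambda>p. snd (V p)) \<in> L1 l"
    using L1_components[OF L2_imp_L1[OF assms]] by auto
  have i: "integrable (torus l) (\<lambda>p. (norm (V p))\<^sup>2)" using assms by (simp add: L2_iff)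
  have "integrable (torus l) (\<lambda>p. (norm (fst (V p)))\<^sup>2)" "integrable (torus l) (\<lambda>p. (norm (snd (V p)))\<^sup>2)"
    using L1 by (intro Bochner_Integration.integrable_bound[OF i];
        auto simp: L1_iff measurable_torus norm_pair_square intro!: AE_I2 borel_measurable_power)+
  with L1 show "(\<lambda>p. fst (V p)) \<in> L2 l" "(\<lambda>p. snd (V p)) \<in> L2 l"
    by (auto simp: L1_iff L2_iff)
qed

text \<open>Along horizontal lines \<open>u\<close> stays near \<open>h\<close>, along vertical
  lines near \<open>k\<close>. Fixing one abscissa with small oscillation turns \<open>k\<close>
  into a constant \<open>C\<close>, and the mean \<open>m\<close> minimizes the quadratic deviation
  among all constants. The factor 32 is not optimized.\<close>

lemma torus_poincare:
  assumes l: "l > 0" and u: "u \<in> L2 l" and V: "has_weak_grad l u V" and V2: "V \<in> L2 l"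
  defines "m \<equiv> (\<integral>z. u z \<partial>torus l) / (4 * l\<^sup>2)"
  shows "(\<integral>z. (u z - m)\<^sup>2 \<partial>torus l) \<le> 32 * l\<^sup>2 * (\<integral>z. (norm (V z))\<^sup>2 \<partial>torus l)"
proof -
  have u1: "u \<in> L1 l" by (rule L2_imp_L1[OF u])
  have ui: "integrable (torus l) u" and u2i: "integrable (torus l) (\<lambda>z. (u z)\<^sup>2)" using u u1 by (auto simp: L1_iff L2_iff)
  note Vc = L2_components[OF V2]
  define v w where "v = (\<lambda>z. fst (V z))" and "w = (\<lambda>z. snd (V (snd z, fst z)))"
  have vm: "v \<in> borel_measurable borel" and vi2: "integrable (torus l) (\<lambda>z. (v z)\<^sup>2)"
    using Vc(1) by (auto simp: v_def L2_iff)
  have sm: "(\<lambda>z. snd (V z)) \<in> borel_measurable borel" and si2: "integrable (torus l) (\<lambda>z. (snd (V z))\<^sup>2)"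
    using Vc(2) by (auto simp: L2_iff)
  have wm: "w \<in> borel_measurable borel"
  proof -
    have "(\<lambda>z::real\<times>real. (snd z, fst z)) \<in> borel_measurable borel"
      by (auto intro!: borel_measurable_continuous_onI continuous_intros)
    from measurable_compose[OF this sm] show ?thesis by (simp add: w_def)
  qed
  have wi2: "integrable (torus l) (\<lambda>z. (w z)\<^sup>2)" and weq: "(\<integral>z. (w z)\<^sup>2 \<partial>torus l) = (\<integral>z. (snd (V z))\<^sup>2 \<partial>torus l)"
    using integrable_torus_swap[OF si2] integral_torus_swap[of "\<lambda>z. (snd (V z))\<^sup>2" l] sm by (auto simp: w_def)
  define B1 B2 where "B1 y = (\<integral>t. \<bar>v (t, y)\<bar> \<partial>circle l)" and "B2 x = (\<integral>t. \<bar>w (t, x)\<bar> \<partial>circle l)" for x y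
  note b1 = slice_L1_square[OF l vm vi2, folded B1_def] and b2 = slice_L1_square[OF l wm wi2, folded B2_def]
  obtain h k where h: "AE z in torus l. \<bar>u z - h (snd z)\<bar> \<le> B1 (snd z)"
    and k: "AE z in torus l. \<bar>u z - k (fst z)\<bar> \<le> B2 (fst z)"
    by (rule weak_grad_oscillation[OF l u1 V]) (simp add: B1_def B2_def v_def w_def)
  have "AE z in torus l. \<bar>h (snd z) - k (fst z)\<bar> \<le> B1 (snd z) + B2 (fst z)"
    using h k by eventually_elim linarith
  from AE_torus_pair(1)[OF this]
  have "AE x in circle l. AE y in circle l. \<bar>h y - k x\<bar> \<le> B1 y + B2 x" by simp
  then obtain x1 where x1: "AE y in circle l. \<bar>h y - k x1\<bar> \<le> B1 y + B2 x1"
      "B2 x1 \<le> (\<integral>x. B2 x \<partial>circle l) / (2 * l)"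
    by (rule exists_le_average[OF l b2(1)]) auto
  define C where "C = k x1"
  define b where "b = (\<integral>x. B2 x \<partial>circle l) / (2 * l)"
  have bb: "b\<^sup>2 \<le> (\<integral>z. (snd (V z))\<^sup>2 \<partial>torus l)"
  proof -
    have "(\<integral>x. B2 x \<partial>circle l)\<^sup>2 \<le> 2 * l * (\<integral>x. (B2 x)\<^sup>2 \<partial>circle l)"
      using integral_square_le[OF finite_measure_circle b2(1,2)] l by (simp add: measure_circle)
    also have "\<dots> \<le> 2 * l * (2 * l * (\<integral>z. (w z)\<^sup>2 \<partial>torus l))"
      using b2(3) l by (intro mult_left_mono) auto
    also have "\<dots> = (2 * l)\<^sup>2 * (\<integral>z. (snd (V z))\<^sup>2 \<partial>torus l)"
      unfolding weq by (simp add: power2_eq_square)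
    finally show ?thesis unfolding b_def power_divide using l by (simp add: divide_le_eq mult.commute)
  qed
  \<comment> \<open>\<open>B1\<close> enters twice: once between \<open>u\<close> and
    \<open>h\<close>, and once between \<open>h\<close> and \<open>k x1\<close>.\<close>
  have "AE z in torus l. \<bar>u z - C\<bar> \<le> 2 * B1 (snd z) + b"
    using h AE_torus_snd[OF x1(1)] by eventually_elim (use x1(2) in \<open>simp add: C_def b_def\<close>)
  then have bound: "AE z in torus l. (u z - C)\<^sup>2 \<le> 8 * (B1 (snd z))\<^sup>2 + 2 * b\<^sup>2"
  proof eventually_elim
    case (elim z)
    have "(u z - C)\<^sup>2 \<le> (2 * B1 (snd z) + b)\<^sup>2"
      using elim power_mono[of "\<bar>u z - C\<bar>" "2 * B1 (snd z) + b" 2] by simp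
    also have "\<dots> \<le> 8 * (B1 (snd z))\<^sup>2 + 2 * b\<^sup>2"
      using zero_le_power2[of "2 * B1 (snd z) - b"] by (simp add: power2_eq_square algebra_simps)
    finally show ?case .
  qed
  have i1: "integrable (torus l) (\<lambda>z. (B1 (snd z))\<^sup>2)"
    by (rule integrable_torus_of_snd[OF b1(2)])
  have i2: "integrable (torus l) (\<lambda>z. (u z - C)\<^sup>2)"
    using ui u2i by (simp add: power2_diff)
  have B1int: "(\<integral>z. (B1 (snd z))\<^sup>2 \<partial>torus l) = 2 * l * (\<integral>y. (B1 y)\<^sup>2 \<partial>circle l)"
    using integral_torus_snd[OF i1] l by (simp add: measure_circle mult.commute)
  have "(\<integral>z. (u z - C)\<^sup>2 \<partial>torus l) \<le> (\<integral>z. 8 * (B1 (snd z))\<^sup>2 + 2 * b\<^sup>2 \<partial>torus l)"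
    using i1 by (intro integral_mono_AE[OF i2 _ bound]) auto
  also have "\<dots> = 8 * (2 * l * (\<integral>y. (B1 y)\<^sup>2 \<partial>circle l)) + 2 * b\<^sup>2 * (4 * l\<^sup>2)"
    using i1 l by (simp add: B1int measure_torus)
  also have "\<dots> \<le> 8 * (2 * l * (2 * l * (\<integral>z. (v z)\<^sup>2 \<partial>torus l))) + 2 * (\<integral>z. (snd (V z))\<^sup>2 \<partial>torus l) * (4 * l\<^sup>2)"
    using b1(3) bb l by (intro add_mono mult_left_mono mult_right_mono) auto
  also have "\<dots> \<le> 32 * l\<^sup>2 * ((\<integral>z. (v z)\<^sup>2 \<partial>torus l) + (\<integral>z. (snd (V z))\<^sup>2 \<partial>torus l))"
    using l by (simp add: power2_eq_square algebra_simps)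
  also have "(\<integral>z. (v z)\<^sup>2 \<partial>torus l) + (\<integral>z. (snd (V z))\<^sup>2 \<partial>torus l) = (\<integral>z. (norm (V z))\<^sup>2 \<partial>torus l)"
    using vi2 si2 by (simp add: norm_pair_square v_def)
  finally have fin: "(\<integral>z. (u z - C)\<^sup>2 \<partial>torus l) \<le> 32 * l\<^sup>2 * (\<integral>z. (norm (V z))\<^sup>2 \<partial>torus l)" .
  have um: "(\<integral>z. u z \<partial>torus l) = 4 * l\<^sup>2 * m" using l by (simp add: m_def)
  have i3: "integrable (torus l) (\<lambda>z. (u z - m)\<^sup>2)"
    using ui u2i by (simp add: power2_diff)
  have "(\<integral>z. (u z - C)\<^sup>2 \<partial>torus l) = (\<integral>z. (u z - m)\<^sup>2 + (2 * (m - C) * u z + (C\<^sup>2 - m\<^sup>2)) \<partial>torus l)"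
    by (simp add: power2_eq_square algebra_simps)
  also have "\<dots> = (\<integral>z. (u z - m)\<^sup>2 \<partial>torus l) + (2 * (m - C) * (4 * l\<^sup>2 * m) + (C\<^sup>2 - m\<^sup>2) * (4 * l\<^sup>2))"
    using ui i3 l by (simp add: measure_torus um)
  also have "\<dots> = (\<integral>z. (u z - m)\<^sup>2 \<partial>torus l) + (m - C)\<^sup>2 * (4 * l\<^sup>2)"
    by (simp add: power2_eq_square algebra_simps)
  finally have "(\<integral>z. (u z - m)\<^sup>2 \<partial>torus l) \<le> (\<integral>z. (u z - C)\<^sup>2 \<partial>torus l)"
    by simp
  with fin show ?thesis by linarith
qed

section \<open>Periodic functions with two transitions\<close>

lemma circle_primitive_diff:
  "circle_primitive l U v \<Longrightarrow> a \<le> b \<Longrightarrow> b \<le> a + 2 * l \<Longrightarrow> U b - U a = (LINT x:{a..<b}|lborel. v x)"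
  by (simp add: circle_primitive_def)

lemma set_integrable_circle_primitive:
  assumes l: "l > 0" and U: "circle_primitive l U v" and ab: "b \<le> a + 2 * l"
  shows "set_integrable lborel {a..<b} v"
proof -
  have "set_integrable lborel {a..<a + 2 * l} v"
    using U by (subst set_integrable_period[OF l]) (auto simp: circle_primitive_def)
  then show ?thesis by (rule set_integrable_subset) (use ab in auto)
qed

text \<open>On a window of length \<open>l\<close> around a point the increments are indefinite
  integrals of an integrable function, hence continuous.\<close>

lemma circle_primitive_continuous:
  assumes l: "l > 0" and U: "circle_primitive l U v"
  shows "continuous_on S U"
proof -
  have "isCont U x" for x
  proof -
    have vm [measurable]: "v \<in> borel_measurable borel" using U by (simp add: circle_primitive_def)
    have si: "set_integrable lborel {a..b} v" if "b \<le> a + l" for a b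
      by (rule set_integrable_subset[OF set_integrable_circle_primitive[OF l U, of "a + 2 * l" a]])
         (use that l in auto)
    have eq: "(LINT t:{a..<b}|lborel. v t) = integral {a..b} v" if "b \<le> a + l" for a b
    proof -
      have "(LINT t:{a..<b}|lborel. v t) = (LINT t:{a..b}|lborel. v t)"
        unfolding set_lebesgue_integral_def
      proof (rule integral_cong_AE)
        show "AE x in lborel. indicat_real {a..<b} x *\<^sub>R v x = indicat_real {a..b} x *\<^sub>R v x"
          using AE_lborel_singleton[of b] by eventually_elim (auto simp: indicator_def)
      qed auto
      then show ?thesis using set_borel_integral_eq_integral(2)[OF si[OF that]] by simp
    qed
    have "continuous_on {x - l / 2..x + l / 2} (\<lambda>t. U (x - l / 2) + integral {x - l / 2..t} v)"
      using set_borel_integral_eq_integral(1)[OF si[of "x + l / 2" "x - l / 2"]]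
      by (intro continuous_intros indefinite_integral_continuous_1) auto
    moreover have "U t = U (x - l / 2) + integral {x - l / 2..t} v" if "t \<in> {x - l / 2..x + l / 2}" for t
      using circle_primitive_diff[OF U, of "x - l / 2" t] that eq[of t "x - l / 2"] l by simp
    ultimately have "continuous_on {x - l / 2..x + l / 2} U"
      by (rule continuous_on_eq[OF _ sym])
    then show "isCont U x"
      using l by (intro continuous_on_interior) auto
  qed
  then show ?thesis by (intro continuous_at_imp_continuous_on) auto
qed

text \<open>Replaces the chain rule, without differentiating \<open>U\<close> at any point. On a
  short interval the mean value theorem for \<open>f\<close> and the intermediate value theorem for
  \<open>U\<close> give a point \<open>t\<close> with \<open>f (U \<beta>) - f (U \<alpha>) = q (U
  t) * (U \<beta> - U \<alpha>)\<close>, and \<open>q (U x)\<close> hardly varies there. The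
  bisection principle \<open>Bolzano\<close> combines the short intervals.\<close>

lemma chain_inequality:
  assumes l: "l > 0" and U: "circle_primitive l U v" and ab: "a \<le> b" "b \<le> a + 2 * l"
    and f: "\<And>t. (f has_real_derivative q t) (at t)" and q: "continuous_on UNIV q"
  shows "\<bar>f (U b) - f (U a)\<bar> \<le> (LINT x:{a..<b}|lborel. \<bar>q (U x)\<bar> * \<bar>v x\<bar>)"
proof -
  have vm [measurable]: "v \<in> borel_measurable borel" using U by (simp add: circle_primitive_def)
  have Uc: "continuous_on S U" for S by (rule circle_primitive_continuous[OF l U])
  have qU: "continuous_on UNIV (\<lambda>x. q (U x))"
    using continuous_on_compose2[OF q Uc] by simp
  have [measurable]: "(\<lambda>x. q (U x)) \<in> borel_measurable borel"
    by (rule borel_measurable_continuous_onI[OF qU])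
  have "compact ((\<lambda>x. q (U x)) ` {a..b})"
    by (intro compact_continuous_image continuous_on_subset[OF qU]) auto
  then have "\<exists>B. \<forall>x\<in>{a..b}. \<bar>q (U x)\<bar> \<le> B"
    by (auto dest!: compact_imp_bounded simp: bounded_iff)
  then obtain B where B: "\<forall>x\<in>{a..b}. \<bar>q (U x)\<bar> \<le> B" by (rule exE)
  have vi: "set_integrable lborel {a..<b} (\<lambda>x. \<bar>v x\<bar>)"
    using set_integrable_circle_primitive[OF l U ab(2)] by (rule set_integrable_abs)
  have iq: "set_integrable lborel {\<alpha>..<\<beta>} (\<lambda>x. (\<bar>q (U x)\<bar> + \<eta>) * \<bar>v x\<bar>)"
    if "a \<le> \<alpha>" "\<beta> \<le> b" for \<alpha> \<beta> \<eta>
  proof (rule set_integrable_subset)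
    show "set_integrable lborel {a..<b} (\<lambda>x. (\<bar>q (U x)\<bar> + \<eta>) * \<bar>v x\<bar>)"
      unfolding set_integrable_def
    proof (rule Bochner_Integration.integrable_bound)
      show "integrable lborel (\<lambda>x. (\<bar>B\<bar> + \<bar>\<eta>\<bar>) * (indicator {a..<b} x *\<^sub>R \<bar>v x\<bar>))"
        using vi unfolding set_integrable_def by auto
      show "AE x in lborel. norm (indicat_real {a..<b} x *\<^sub>R ((\<bar>q (U x)\<bar> + \<eta>) * \<bar>v x\<bar>))
        \<le> norm ((\<bar>B\<bar> + \<bar>\<eta>\<bar>) * (indicat_real {a..<b} x *\<^sub>R \<bar>v x\<bar>))"
      proof (rule AE_I2)
        fix x
        show "norm (indicat_real {a..<b} x *\<^sub>R ((\<bar>q (U x)\<bar> + \<eta>) * \<bar>v x\<bar>))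
          \<le> norm ((\<bar>B\<bar> + \<bar>\<eta>\<bar>) * (indicat_real {a..<b} x *\<^sub>R \<bar>v x\<bar>))"
        proof (cases "x \<in> {a..<b}")
          case True
          then have "\<bar>q (U x)\<bar> \<le> B" using B by auto
          then have "\<bar>\<bar>q (U x)\<bar> + \<eta>\<bar> \<le> \<bar>B\<bar> + \<bar>\<eta>\<bar>" by linarith
          then show ?thesis using True by (auto simp: abs_mult intro!: mult_right_mono)
        qed simp
      qed
    qed auto
  qed (use that in auto)
  \<comment> \<open>The slack \<eta> absorbs the oscillation of \<open>q (U x)\<close> over a short
    interval. It is removed at the end, since the resulting error is \<eta> times the integral of
    \<open>\<bar>v x\<bar>\<close>.\<close>
  have step: "\<bar>f (U b) - f (U a)\<bar> \<le> (LINT x:{a..<b}|lborel. (\<bar>q (U x)\<bar> + \<eta>) * \<bar>v x\<bar>)" if \<eta>: "\<eta> > 0" for \<eta>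
  proof -
    define P where "P \<alpha> \<beta> \<longleftrightarrow> (a \<le> \<alpha> \<and> \<beta> \<le> b \<longrightarrow>
       \<bar>f (U \<beta>) - f (U \<alpha>)\<bar> \<le> (LINT x:{\<alpha>..<\<beta>}|lborel. (\<bar>q (U x)\<bar> + \<eta>) * \<bar>v x\<bar>))" for \<alpha> \<beta>
    have "P a b"
    proof (rule Bolzano[OF ab(1)])
      fix \<alpha> \<beta> \<gamma> assume h: "P \<alpha> \<beta>" "P \<beta> \<gamma>" "\<alpha> \<le> \<beta>" "\<beta> \<le> \<gamma>"
      show "P \<alpha> \<gamma>"
        unfolding P_def
      proof
        assume c: "a \<le> \<alpha> \<and> \<gamma> \<le> b"
        with h have "\<bar>f (U \<beta>) - f (U \<alpha>)\<bar> \<le> (LINT x:{\<alpha>..<\<beta>}|lborel. (\<bar>q (U x)\<bar> + \<eta>) * \<bar>v x\<bar>)"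
          "\<bar>f (U \<gamma>) - f (U \<beta>)\<bar> \<le> (LINT x:{\<beta>..<\<gamma>}|lborel. (\<bar>q (U x)\<bar> + \<eta>) * \<bar>v x\<bar>)"
          unfolding P_def by auto
        moreover have "(LINT x:{\<alpha>..<\<gamma>}|lborel. (\<bar>q (U x)\<bar> + \<eta>) * \<bar>v x\<bar>)
          = (LINT x:{\<alpha>..<\<beta>}|lborel. (\<bar>q (U x)\<bar> + \<eta>) * \<bar>v x\<bar>) + (LINT x:{\<beta>..<\<gamma>}|lborel. (\<bar>q (U x)\<bar> + \<eta>) * \<bar>v x\<bar>)"
          using c h by (intro set_integral_split iq) auto
        ultimately show "\<bar>f (U \<gamma>) - f (U \<alpha>)\<bar> \<le> (LINT x:{\<alpha>..<\<gamma>}|lborel. (\<bar>q (U x)\<bar> + \<eta>) * \<bar>v x\<bar>)"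
          by linarith
      qed
    next
      fix x assume x: "a \<le> x" "x \<le> b"
      have "isCont (\<lambda>x. q (U x)) x" using qU by (simp add: continuous_on_eq_continuous_at)
      \<comment> \<open>Half of \<eta>, because \<open>t\<close> and the integration variable are
        both compared with \<open>x\<close>.\<close>
      then obtain d where d: "d > 0" "\<And>y. \<bar>y - x\<bar> < d \<Longrightarrow> \<bar>q (U y) - q (U x)\<bar> < \<eta> / 2"
        using \<eta> unfolding continuous_at_eps_delta dist_real_def by (meson half_gt_zero)
      show "\<exists>d>0. \<forall>\<alpha> \<beta>. \<alpha> \<le> x \<and> x \<le> \<beta> \<and> \<beta> - \<alpha> < d \<longrightarrow> P \<alpha> \<beta>"
      proof (intro exI[of _ d] conjI allI impI d(1))
        fix \<alpha> \<beta> assume h: "\<alpha> \<le> x \<and> x \<le> \<beta> \<and> \<beta> - \<alpha> < d"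
        show "P \<alpha> \<beta>"
          unfolding P_def
        proof
          assume c: "a \<le> \<alpha> \<and> \<beta> \<le> b"
          have near: "\<bar>q (U y) - q (U x)\<bar> < \<eta> / 2" if "y \<in> {\<alpha>..\<beta>}" for y
            using h that by (intro d(2)) auto
          obtain t where t: "t \<in> {\<alpha>..\<beta>}" "f (U \<beta>) - f (U \<alpha>) = q (U t) * (U \<beta> - U \<alpha>)"
          proof -
            have "\<exists>t\<in>{\<alpha>..\<beta>}. f (U \<beta>) - f (U \<alpha>) = q (U t) * (U \<beta> - U \<alpha>)"
            proof (cases "U \<alpha>" "U \<beta>" rule: linorder_cases)
              case less
              then obtain z where z: "z > U \<alpha>" "z < U \<beta>" "f (U \<beta>) - f (U \<alpha>) = (U \<beta> - U \<alpha>) * q z"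
                using MVT2[of "U \<alpha>" "U \<beta>" f q] f by blast
              have "\<exists>t. \<alpha> \<le> t \<and> t \<le> \<beta> \<and> U t = z"
                by (rule IVT') (use z h Uc in auto)
              then show ?thesis using z(3) by (auto simp: mult.commute)
            next
              case equal
              then show ?thesis using h by (auto intro!: bexI[of _ \<alpha>])
            next
              case greater
              then obtain z where z: "z > U \<beta>" "z < U \<alpha>" "f (U \<alpha>) - f (U \<beta>) = (U \<alpha> - U \<beta>) * q z"
                using MVT2[of "U \<beta>" "U \<alpha>" f q] f by blast
              have "\<exists>t. \<alpha> \<le> t \<and> t \<le> \<beta> \<and> U t = z"
                by (rule IVT2') (use z h Uc in auto)
              then obtain t where t: "t \<in> {\<alpha>..\<beta>}" "U t = z" by auto
              have "f (U \<beta>) - f (U \<alpha>) = q z * (U \<beta> - U \<alpha>)"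
                using z(3) by (simp add: algebra_simps)
              then show ?thesis using t by blast
            qed
            then show ?thesis using that by blast
          qed
          have vab: "set_integrable lborel {\<alpha>..<\<beta>} v"
            using c by (intro set_integrable_subset[OF set_integrable_circle_primitive[OF l U ab(2)]]) auto
          have "U \<beta> - U \<alpha> = (LINT x:{\<alpha>..<\<beta>}|lborel. v x)"
            using U h c ab unfolding circle_primitive_def by auto
          then have "\<bar>f (U \<beta>) - f (U \<alpha>)\<bar> = \<bar>q (U t)\<bar> * \<bar>LINT x:{\<alpha>..<\<beta>}|lborel. v x\<bar>"
            using t(2) by (simp add: abs_mult)
          also have "\<dots> \<le> \<bar>q (U t)\<bar> * (LINT x:{\<alpha>..<\<beta>}|lborel. \<bar>v x\<bar>)"
            using set_integral_norm_bound[OF vab] by (intro mult_left_mono) auto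
          also have "\<dots> = (LINT x:{\<alpha>..<\<beta>}|lborel. \<bar>q (U t)\<bar> * \<bar>v x\<bar>)" by simp
          also have "\<dots> \<le> (LINT x:{\<alpha>..<\<beta>}|lborel. (\<bar>q (U x)\<bar> + \<eta>) * \<bar>v x\<bar>)"
          proof (rule set_integral_mono)
            show "set_integrable lborel {\<alpha>..<\<beta>} (\<lambda>x. \<bar>q (U t)\<bar> * \<bar>v x\<bar>)"
              using vab by (intro set_integrable_mult_right set_integrable_abs) auto
            show "set_integrable lborel {\<alpha>..<\<beta>} (\<lambda>x. (\<bar>q (U x)\<bar> + \<eta>) * \<bar>v x\<bar>)"
              using c by (intro iq) auto
            show "\<bar>q (U t)\<bar> * \<bar>v y\<bar> \<le> (\<bar>q (U y)\<bar> + \<eta>) * \<bar>v y\<bar>" if "y \<in> {\<alpha>..<\<beta>}" for y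
            proof (rule mult_right_mono)
              have "y \<in> {\<alpha>..\<beta>}" using that by auto
              from near[OF t(1)] near[OF this] show "\<bar>q (U t)\<bar> \<le> \<bar>q (U y)\<bar> + \<eta>" by linarith
            qed simp
          qed
          finally show "\<bar>f (U \<beta>) - f (U \<alpha>)\<bar> \<le> (LINT x:{\<alpha>..<\<beta>}|lborel. (\<bar>q (U x)\<bar> + \<eta>) * \<bar>v x\<bar>)" .
        qed
      qed
    qed
    then show ?thesis by (simp add: P_def)
  qed
  define I J where "I = (LINT x:{a..<b}|lborel. \<bar>q (U x)\<bar> * \<bar>v x\<bar>)" and "J = (LINT x:{a..<b}|lborel. \<bar>v x\<bar>)"
  have J0: "0 \<le> J" unfolding J_def set_lebesgue_integral_def by (rule integral_nonneg_AE) simp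
  have IJ: "(LINT x:{a..<b}|lborel. (\<bar>q (U x)\<bar> + \<eta>) * \<bar>v x\<bar>) = I + \<eta> * J" for \<eta>
    using iq[of a b 0] vi by (simp add: distrib_right I_def J_def set_integral_add)
  show ?thesis
  proof (rule field_le_epsilon)
    fix e :: real assume e: "e > 0"
    have "\<bar>f (U b) - f (U a)\<bar> \<le> I + e / (J + 1) * J"
      using step[of "e / (J + 1)"] IJ e J0 by simp
    also have "e / (J + 1) * J \<le> e"
      using e J0 by (simp add: field_simps)
    finally show "\<bar>f (U b) - f (U a)\<bar> \<le> (LINT x:{a..<b}|lborel. \<bar>q (U x)\<bar> * \<bar>v x\<bar>) + e"
      by (simp add: I_def)
  qed
qed

section \<open>Square waves\<close>

definition square_wave :: "real \<Rightarrow> real \<Rightarrow> real \<Rightarrow> real" where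
  "square_wave l c x = sgn (cos (pi * (x - c) / l))"

lemma square_wave_measurable [measurable]: "square_wave l c \<in> borel_measurable borel"
  unfolding square_wave_def sgn_if by measurable

lemma square_wave_bound: "\<bar>square_wave l c x\<bar> \<le> 1"
  by (simp add: square_wave_def sgn_if)

lemma square_wave_half_period: "l > 0 \<Longrightarrow> square_wave l c (x + l) = - square_wave l c x"
proof -
  assume l: "l > 0"
  have "pi * (x + l - c) / l = pi * (x - c) / l + pi" using l by (simp add: field_simps)
  then show ?thesis by (simp add: square_wave_def sgn_minus)
qed

lemma square_wave_periodic: "l > 0 \<Longrightarrow> square_wave l c (x + 2 * l) = square_wave l c x"
  using square_wave_half_period[of l c "x + l"] square_wave_half_period[of l c x]
  by (simp add: add.assoc)

lemma integrable_square_wave: "integrable (circle l) (square_wave l c)"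
  by (rule integrable_circle_bounded[OF square_wave_measurable square_wave_bound])

lemma integral_square_wave: "l > 0 \<Longrightarrow> (\<integral>x. square_wave l c x \<partial>circle l) = 0"
proof -
  assume l: "l > 0"
  have "(\<integral>x. square_wave l c (x + l) \<partial>circle l) = (\<integral>x. square_wave l c x \<partial>circle l)"
    by (rule integral_circle_shift[OF l]) (simp_all add: square_wave_periodic[OF l])
  then show ?thesis by (simp add: square_wave_half_period[OF l])
qed

lemma square_wave_eq_1: "l > 0 \<Longrightarrow> \<bar>x - c\<bar> < l / 2 \<Longrightarrow> square_wave l c x = 1"
proof -
  assume l: "l > 0" and x: "\<bar>x - c\<bar> < l / 2"
  have "\<bar>x - c\<bar> / l < 1 / 2" using l x by (simp add: field_simps)
  then have "pi * (\<bar>x - c\<bar> / l) < pi * (1 / 2)" by (rule mult_strict_left_mono) simp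
  then have "\<bar>pi * (x - c) / l\<bar> < pi / 2" using l by (simp add: abs_mult)
  then have "cos (pi * (x - c) / l) > 0"
    by (intro cos_gt_zero_pi) linarith+
  then show ?thesis by (simp add: square_wave_def)
qed

lemma square_wave_eq_neg_1: "l > 0 \<Longrightarrow> l / 2 < \<bar>x - c\<bar> \<Longrightarrow> \<bar>x - c\<bar> < 3 * l / 2 \<Longrightarrow> square_wave l c x = - 1"
proof -
  assume l: "l > 0" and x: "l / 2 < \<bar>x - c\<bar>" "\<bar>x - c\<bar> < 3 * l / 2"
  show ?thesis
  proof (cases "x \<ge> c")
    case True
    then have "\<bar>x - l - c\<bar> < l / 2" using x by linarith
    then have "square_wave l c (x - l) = 1" by (rule square_wave_eq_1[OF l])
    then show ?thesis using square_wave_half_period[OF l, of c "x - l"] by simp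
  next
    case False
    then have "\<bar>x + l - c\<bar> < l / 2" using x by linarith
    then have "square_wave l c (x + l) = 1" by (rule square_wave_eq_1[OF l])
    then show ?thesis using square_wave_half_period[OF l, of c x] by simp
  qed
qed

lemma AE_square_wave_nonzero: "l > 0 \<Longrightarrow> AE x in lborel. square_wave l c x \<noteq> 0"
proof -
  assume l: "l > 0"
  have "{x. square_wave l c x = 0} \<subseteq> range (\<lambda>i::int. c + l * of_int i / 2)"
  proof
    fix x assume "x \<in> {x. square_wave l c x = 0}"
    then have "cos (pi * (x - c) / l) = 0" by (simp add: square_wave_def sgn_zero_iff)
    then obtain i :: int where "pi * (x - c) / l = of_int i * (pi / 2)"
      unfolding cos_zero_iff_int by blast
    then have "pi * ((x - c) / l) = pi * (of_int i / 2)" by simp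
    then have "(x - c) / l = of_int i / 2" by (subst (asm) mult_left_cancel) auto
    then have "x = c + l * of_int i / 2" using l by (simp add: field_simps)
    then show "x \<in> range (\<lambda>i::int. c + l * of_int i / 2)" by blast
  qed
  then have "countable {x. square_wave l c x = 0}" by (rule countable_subset) simp
  then have "{x. square_wave l c x = 0} \<in> null_sets lborel" by (rule countable_imp_null_set_lborel)
  from AE_not_in[OF this] show ?thesis by simp
qed

lemma AE_square_wave_square: "l > 0 \<Longrightarrow> AE x in circle l. (square_wave l c x)\<^sup>2 = 1"
proof -
  assume l: "l > 0"
  have "AE x in circle l. square_wave l c x \<noteq> 0"
    by (rule AE_circle_lborel[OF AE_square_wave_nonzero[OF l]])
  then show ?thesis by eventually_elim (auto simp: square_wave_def sgn_if)
qed

text \<open>\<open>a\<close> and \<open>b\<close> are the first and the last point of the period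
  starting at \<open>x0\<close> where \<open>U\<close> is at least \<open>s\<close>. A point
  \<open>z\<close> between them with \<open>U z \<le> -s\<close> would produce four transitions,
  along \<open>x0\<close>, \<open>a\<close>, \<open>z\<close>, \<open>b\<close>,
  \<open>x0 + 2 * l\<close>, each costing at least \<open>f s - f (-s)\<close>.\<close>

lemma no_four_transitions:
  fixes U f :: "real \<Rightarrow> real"
  assumes l: "l > 0" and U: "continuous_on UNIV U" and per: "\<And>x. U (x + 2 * l) = U x"
    and w: "w \<in> borel_measurable borel" "\<And>x. w (x + 2 * l) = w x" "integrable (circle l) w"
    and cost: "\<And>a b. a \<le> b \<Longrightarrow> b \<le> a + 2 * l \<Longrightarrow> \<bar>f (U b) - f (U a)\<bar> \<le> (LINT x:{a..<b}|lborel. w x)"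
    and f: "mono f" and small: "(\<integral>x. w x \<partial>circle l) < 4 * (f s - f (-s))"
    and lo: "U x0 \<le> -s" and hi: "U x1 \<ge> s"
  obtains a b where "x0 \<le> a" "a \<le> b" "b \<le> x0 + 2 * l" "\<forall>x \<in> {a..b}. U x > -s"
    "\<forall>x \<in> {x0..<x0 + 2 * l} - {a..b}. U x < s"
proof -
  define H where "H = {x0..x0 + 2 * l} \<inter> U -` {s..}"
  have Hc: "closed H"
    unfolding H_def by (intro closed_Int closed_vimage closed_atLeast closed_atLeastAtMost U)
  have Hb: "bdd_below H" "bdd_above H"
    unfolding H_def by (auto intro: bdd_belowI[of _ x0] bdd_aboveI[of _ "x0 + 2 * l"])
  \<comment> \<open>\<open>x1\<close> is moved into the period that starts at \<open>x0\<close>: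
    reduction lands in an interval starting at \<open>- l\<close>, hence the offset
    \<open>l + x0\<close>.\<close>
  have "U (x + 2 * l + l + x0) = U (x + l + x0)" for x
    using per[of "x + l + x0"] by (simp add: algebra_simps)
  then have "U (to_circle l (x1 - x0 - l) + l + x0) = U ((x1 - x0 - l) + l + x0)"
    by (rule periodic_to_circle[of "\<lambda>x. U (x + l + x0)"])
  then have "to_circle l (x1 - x0 - l) + l + x0 \<in> H"
    unfolding H_def using to_circle_in[OF l, of "x1 - x0 - l"] hi by auto
  then have Hn: "H \<noteq> {}" by blast
  define a b where "a = Inf H" and "b = Sup H"
  have aH: "a \<in> H" and bH: "b \<in> H"
    unfolding a_def b_def using closed_contains_Inf[OF Hn Hb(1) Hc] closed_contains_Sup[OF Hn Hb(2) Hc] by auto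
  have ab: "a \<le> b" unfolding b_def using aH Hb(2) by (rule cSup_upper)
  have out: "U x < s" if "x \<in> {x0..<x0 + 2 * l} - {a..b}" for x
  proof (rule ccontr)
    assume "\<not> U x < s"
    then have "x \<in> H" using that by (auto simp: H_def)
    then have "a \<le> x" "x \<le> b"
      unfolding a_def b_def using Hb by (auto intro: cInf_lower cSup_upper)
    then show False using that by auto
  qed
  have "U z > -s" if z: "z \<in> {a..b}" for z
  proof (rule ccontr)
    assume "\<not> U z > -s"
    then have zlo: "U z \<le> -s" by simp
    have x: "x0 \<le> a" "a \<le> z" "z \<le> b" "b \<le> x0 + 2 * l" and hi': "U a \<ge> s" "U b \<ge> s"
      using aH bH z by (auto simp: H_def)
    define g where "g = f s - f (-s)"
    have jump: "g \<le> \<bar>f p - f q\<bar>" if "p \<le> -s \<and> q \<ge> s \<or> q \<le> -s \<and> p \<ge> s" for p q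
      using that monoD[OF f, of p "-s"] monoD[OF f, of s q] monoD[OF f, of q "-s"] monoD[OF f, of s p]
      unfolding g_def by auto
    have si: "set_integrable lborel {x0..<x0 + 2 * l} w"
      using w by (simp add: set_integrable_period[OF l])
    have s2: "set_integrable lborel {a..<x0 + 2 * l} w" "set_integrable lborel {z..<x0 + 2 * l} w"
      by (rule set_integrable_subset[OF si]; use x in auto)+
    have "(\<integral>x. w x \<partial>circle l) = (LINT x:{x0..<x0 + 2 * l}|lborel. w x)"
      by (rule integral_period[OF l w(1,2), symmetric])
    also have "\<dots> = (LINT x:{x0..<a}|lborel. w x) + ((LINT x:{a..<z}|lborel. w x)
        + ((LINT x:{z..<b}|lborel. w x) + (LINT x:{b..<x0 + 2 * l}|lborel. w x)))"
      using set_integral_split[OF si, of a] set_integral_split[OF s2(1), of z] set_integral_split[OF s2(2), of b] x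
      by simp
    also have "\<dots> \<ge> g + (g + (g + g))"
    proof (intro add_mono)
      show "g \<le> (LINT x:{x0..<a}|lborel. w x)"
        using cost[of x0 a] jump[of "U a" "U x0"] lo hi' x by (auto intro: order_trans)
      show "g \<le> (LINT x:{a..<z}|lborel. w x)"
        using cost[of a z] jump[of "U z" "U a"] zlo hi' x by (auto intro: order_trans)
      show "g \<le> (LINT x:{z..<b}|lborel. w x)"
        using cost[of z b] jump[of "U b" "U z"] zlo hi' x by (auto intro: order_trans)
      show "g \<le> (LINT x:{b..<x0 + 2 * l}|lborel. w x)"
        using cost[of b "x0 + 2 * l"] jump[of "U (x0 + 2 * l)" "U b"] lo hi' x
        by (auto simp: per intro: order_trans)
    qed
    finally show False using small by (simp add: g_def)
  qed
  then show ?thesis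
    using that[of a b] out ab aH bH by (auto simp: H_def)
qed

text \<open>Origin of \<open>K\<close>: the distance of \<open>\<bar>U x\<bar>\<close> to
  \<open>m\<close> is at most \<open>1 / m\<close> times
  \<open>\<bar>m\<^sup>2 - (U x)\<^sup>2\<bar>\<close>. Where \<open>\<bar>U x\<bar> < s\<close> the
  sign may be the wrong one, and an error of at most \<open>2 * m\<close> is charged to the term
  \<open>2 / (m\<^sup>2 - s\<^sup>2)\<close>. The step function \<open>p\<close> is \<open>m\<close>
  on the interval found by counting walls and \<open>- m\<close> elsewhere; the mean of
  \<open>U\<close> fixes the length of that interval up to an error governed by \<open>R\<close>, so
  \<open>p\<close> is close to the square wave with the same centre.\<close>

lemma close_to_square_wave:
  fixes U f :: "real \<Rightarrow> real"
  assumes l: "l > 0" and U: "continuous_on UNIV U" and per: "\<And>x. U (x + 2 * l) = U x"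
    and w: "w \<in> borel_measurable borel" "\<And>x. w (x + 2 * l) = w x" "integrable (circle l) w"
    and cost: "\<And>a b. a \<le> b \<Longrightarrow> b \<le> a + 2 * l \<Longrightarrow> \<bar>f (U b) - f (U a)\<bar> \<le> (LINT x:{a..<b}|lborel. w x)"
    and f: "mono f" and small: "(\<integral>x. w x \<partial>circle l) < 4 * (f s - f (-s))"
    and s: "0 < s" "s < m" "m \<le> 1"
  defines "K \<equiv> 1 / m + 2 / (m\<^sup>2 - s\<^sup>2)"
  defines "R \<equiv> K * (\<integral>x. \<bar>m\<^sup>2 - (U x)\<^sup>2\<bar> \<partial>circle l) + \<bar>\<integral>x. U x \<partial>circle l\<bar>"
  assumes R: "R < 2 * l * m"
  shows "\<exists>c. (\<integral>x. \<bar>U x - m * square_wave l c x\<bar> \<partial>circle l) \<le> 2 * R"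
proof -
  have [measurable]: "U \<in> borel_measurable borel" by (rule borel_measurable_continuous_onI[OF U])
  obtain B where B: "\<forall>x. \<bar>U x\<bar> \<le> B"
    by (rule periodic_continuous_bounded[OF l continuous_on_subset[OF U] per]) auto
  define \<delta> where "\<delta> x = \<bar>m\<^sup>2 - (U x)\<^sup>2\<bar>" for x
  have [measurable]: "\<delta> \<in> borel_measurable borel" unfolding \<delta>_def by measurable
  define D where "D = (\<integral>x. \<delta> x \<partial>circle l)"
  define I where "I = (\<integral>x. U x \<partial>circle l)"
  have Ui: "integrable (circle l) U" by (rule integrable_circle_bounded[of _ B]) (use B in auto)
  have \<delta>i: "integrable (circle l) \<delta>"
  proof (rule integrable_circle_bounded[of _ "m\<^sup>2 + B\<^sup>2"])
    fix x
    have "(U x)\<^sup>2 \<le> B\<^sup>2" using B power_mono[of "\<bar>U x\<bar>" B 2] by auto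
    then show "\<bar>\<delta> x\<bar> \<le> m\<^sup>2 + B\<^sup>2"
      unfolding \<delta>_def using zero_le_power2[of m] zero_le_power2[of "U x"] by linarith
  qed simp
  have R': "R = K * D + \<bar>I\<bar>" by (simp add: R_def D_def I_def \<delta>_def)
  have sm: "m\<^sup>2 - s\<^sup>2 > 0" using s by (simp add: power_strict_mono)
  have K: "K > 0" using s sm by (simp add: K_def add_pos_pos)
  have away: "\<bar>\<bar>U x\<bar> - m\<bar> \<le> \<delta> x / m" for x
  proof -
    have "\<bar>\<bar>U x\<bar> - m\<bar> * m \<le> \<bar>\<bar>U x\<bar> - m\<bar> * (\<bar>U x\<bar> + m)" using s by (intro mult_left_mono) auto
    also have "\<dots> = \<delta> x"
    proof -
      have "\<delta> x = \<bar>(\<bar>U x\<bar> - m) * (\<bar>U x\<bar> + m)\<bar>" unfolding \<delta>_def by (simp add: algebra_simps power2_eq_square abs_minus_commute)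
      then show ?thesis using s by (simp add: abs_mult)
    qed
    finally show ?thesis using s by (simp add: field_simps)
  qed
  have mid: "2 * m \<le> 2 * \<delta> x / (m\<^sup>2 - s\<^sup>2)" if "\<bar>U x\<bar> < s" for x
  proof -
    have "(U x)\<^sup>2 \<le> s\<^sup>2" using that by (simp add: abs_le_square_iff[symmetric])
    then have "m\<^sup>2 - s\<^sup>2 \<le> \<delta> x" by (simp add: \<delta>_def)
    then have "1 \<le> \<delta> x / (m\<^sup>2 - s\<^sup>2)" using sm by simp
    then have "2 * 1 \<le> 2 * (\<delta> x / (m\<^sup>2 - s\<^sup>2))" by (rule mult_left_mono) simp
    with s show ?thesis by simp
  qed
  have \<delta>0: "0 \<le> \<delta> x" for x by (simp add: \<delta>_def)
  have K\<delta>: "K * \<delta> x = \<delta> x / m + 2 * \<delta> x / (m\<^sup>2 - s\<^sup>2)" for x by (simp add: K_def algebra_simps)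
  have K\<delta>1: "\<delta> x / m \<le> K * \<delta> x" for x unfolding K\<delta> using sm \<delta>0[of x] by simp
  have pos: "\<bar>U x - m\<bar> \<le> K * \<delta> x" if "U x > -s" for x
  proof (cases "U x \<ge> 0")
    case True then show ?thesis using away[of x] K\<delta>1[of x] by simp
  next
    case False
    then have "\<bar>U x - m\<bar> = \<bar>\<bar>U x\<bar> - m\<bar> + 2 * \<bar>U x\<bar> \<or> \<bar>U x - m\<bar> \<le> 2 * m" using that s by auto
    moreover have "\<bar>U x\<bar> < s" using that False by auto
    moreover have "\<bar>U x - m\<bar> \<le> 2 * m" using that False s by auto
    ultimately show ?thesis unfolding K\<delta> using mid[of x] \<delta>0[of x] s by (smt (verit) divide_nonneg_pos)
  qed
  have neg: "\<bar>U x + m\<bar> \<le> K * \<delta> x" if "U x < s" for x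
  proof (cases "U x \<le> 0")
    case True then show ?thesis using away[of x] K\<delta>1[of x] by simp
  next
    case False
    then have "\<bar>U x\<bar> < s" using that by auto
    moreover have "\<bar>U x + m\<bar> \<le> 2 * m" using that False s by auto
    ultimately show ?thesis unfolding K\<delta> using mid[of x] \<delta>0[of x] s by (smt (verit) divide_nonneg_pos)
  qed
  \<comment> \<open>If \<open>U\<close> stayed below \<open>s\<close>, it would be close to
    \<open>- m\<close> throughout, and its mean would contradict
    \<open>R < 2 * l * m\<close>.\<close>
  have exhi: "\<exists>x. U x \<ge> s"
  proof (rule ccontr)
    assume "\<not> ?thesis"
    then have "\<bar>U x + m\<bar> \<le> K * \<delta> x" for x by (intro neg) (auto simp: not_le)
    then have "m - K * \<delta> x \<le> - U x" for x by (smt (verit))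
    then have "(\<integral>x. m - K * \<delta> x \<partial>circle l) \<le> (\<integral>x. - U x \<partial>circle l)"
      using Ui \<delta>i by (intro integral_mono) auto
    then have "2 * l * m - K * D \<le> - I" using Ui \<delta>i l by (simp add: measure_circle D_def I_def)
    then show False using R R' by simp
  qed
  have exlo: "\<exists>x. U x \<le> -s"
  proof (rule ccontr)
    assume "\<not> ?thesis"
    then have "\<bar>U x - m\<bar> \<le> K * \<delta> x" for x by (intro pos) (auto simp: not_le)
    then have "m - K * \<delta> x \<le> U x" for x by (smt (verit))
    then have "(\<integral>x. m - K * \<delta> x \<partial>circle l) \<le> (\<integral>x. U x \<partial>circle l)"
      using Ui \<delta>i by (intro integral_mono) auto
    then have "2 * l * m - K * D \<le> I" using Ui \<delta>i l by (simp add: measure_circle D_def I_def)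
    then show False using R R' by simp
  qed
  obtain x0 where x0: "U x0 \<le> -s" using exlo by (rule exE)
  obtain x1 where x1: "U x1 \<ge> s" using exhi by (rule exE)
  obtain a b where ab: "x0 \<le> a" "a \<le> b" "b \<le> x0 + 2 * l" and inn: "\<forall>x \<in> {a..b}. U x > -s"
    and out: "\<forall>x \<in> {x0..<x0 + 2 * l} - {a..b}. U x < s"
    by (rule no_four_transitions[OF l U per w cost f small x0 x1]) auto
  define p where "p x = (if x \<in> {a..b} then m else - m)" for x
  have [measurable]: "p \<in> borel_measurable borel" unfolding p_def by measurable
  define c where "c = (a + b) / 2"
  define P where "P = {x0..<x0 + 2 * l}"
  have pU: "\<bar>U x - p x\<bar> \<le> K * \<delta> x" if "x \<in> P" for x
    using pos[of x] neg[of x] inn out that by (auto simp: p_def P_def)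
  have PI: "(LINT x:P|lborel. h x) = (\<integral>x. h x \<partial>circle l)" and PS: "set_integrable lborel P h"
    if "h \<in> borel_measurable borel" "\<And>x. h (x + 2 * l) = h x" "integrable (circle l) h" for h :: "real \<Rightarrow> real"
    using that unfolding P_def by (simp_all add: integral_period[OF l] set_integrable_period[OF l])
  have \<delta>per: "\<delta> (x + 2 * l) = \<delta> x" for x by (simp add: \<delta>_def per)
  have \<delta>P: "(LINT x:P|lborel. \<delta> x) = D" "set_integrable lborel P \<delta>"
    unfolding D_def using \<delta>i \<delta>per by (auto intro!: PI PS)
  have UP: "(LINT x:P|lborel. U x) = I" "set_integrable lborel P U"
    unfolding I_def using Ui per by (auto intro!: PI PS)
  have qP: "(LINT x:P|lborel. square_wave l c x) = 0" "set_integrable lborel P (square_wave l c)"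
    using integral_square_wave[OF l, of c] PI[OF square_wave_measurable square_wave_periodic[OF l] integrable_square_wave]
      PS[OF square_wave_measurable square_wave_periodic[OF l] integrable_square_wave] by auto
  have pS: "set_integrable lborel P p"
    unfolding set_integrable_def
    by (rule integrableI_bounded_set[where A=P and B=m])
       (use s l in \<open>auto simp: P_def p_def indicator_def\<close>)
  have I1: "(LINT x:P|lborel. \<bar>U x - p x\<bar>) \<le> K * D"
  proof -
    have "(LINT x:P|lborel. \<bar>U x - p x\<bar>) \<le> (LINT x:P|lborel. K * \<delta> x)"
      using UP(2) pS \<delta>P(2) pU by (intro set_integral_mono set_integrable_abs set_integral_diff set_integrable_mult_right) auto
    then show ?thesis by (simp add: \<delta>P)
  qed
  have I2: "\<bar>LINT x:P|lborel. p x\<bar> \<le> R"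
  proof -
    have "(LINT x:P|lborel. p x) = I - (LINT x:P|lborel. U x - p x)"
      using UP pS by simp
    moreover have "\<bar>LINT x:P|lborel. U x - p x\<bar> \<le> (LINT x:P|lborel. \<bar>U x - p x\<bar>)"
      using set_integral_norm_bound[of lborel P "\<lambda>x. U x - p x"] UP(2) pS by simp
    ultimately show ?thesis using I1 R' by linarith
  qed
  \<comment> \<open>\<open>p\<close> and the square wave are centred at the same \<open>c\<close>,
    so on the period one of them lies above the other almost everywhere. As the square wave has mean
    zero, their L1 distance is the modulus of the integral of \<open>p\<close>.\<close>
  have I3: "(LINT x:P|lborel. \<bar>p x - m * square_wave l c x\<bar>) = \<bar>LINT x:P|lborel. p x\<bar>"
  proof -
    have mq: "set_integrable lborel P (\<lambda>x. m * square_wave l c x)" using qP(2) by auto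
    have eq: "(LINT x:P|lborel. p x - m * square_wave l c x) = (LINT x:P|lborel. p x)"
      using pS mq qP(1) by simp
    have bnd: "\<bar>m * square_wave l c x\<bar> \<le> m" for x
      using square_wave_bound[of l c x] s by (simp add: abs_mult mult_left_le)
    show ?thesis
    proof (cases "b - a < l")
      case True
      have le: "p x \<le> m * square_wave l c x" for x
      proof (cases "x \<in> {a..b}")
        case t: True
        then have "\<bar>x - c\<bar> < l / 2" using True by (auto simp: c_def abs_if field_simps)
        then show ?thesis using t by (simp add: p_def square_wave_eq_1[OF l])
      next
        case False
        then show ?thesis using bnd[of x] by (auto simp: p_def)
      qed
      have "(LINT x:P|lborel. \<bar>p x - m * square_wave l c x\<bar>) = (LINT x:P|lborel. - (p x - m * square_wave l c x))"
        using le by (intro set_lebesgue_integral_cong) (auto simp: P_def)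
      also have "\<dots> = - (LINT x:P|lborel. p x)"
        using eq pS mq by (simp only: set_integral_uminus[OF set_integral_diff(1)[OF pS mq]])
      finally have e: "(LINT x:P|lborel. \<bar>p x - m * square_wave l c x\<bar>) = - (LINT x:P|lborel. p x)" .
      have "0 \<le> (LINT x:P|lborel. \<bar>p x - m * square_wave l c x\<bar>)"
        unfolding set_lebesgue_integral_def by (rule integral_nonneg_AE) simp
      with e show ?thesis by simp
    next
      case False
      \<comment> \<open>At \<open>x0\<close> the distance to \<open>c\<close> may be exactly
        \<open>3 * l / 2\<close>, where the square wave jumps.\<close>
      have ge: "m * square_wave l c x \<le> p x" if "x \<in> P" "x \<noteq> x0" for x
      proof (cases "x \<in> {a..b}")
        case True
        then show ?thesis using bnd[of x] by (auto simp: p_def)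
      next
        case out: False
        then have "l / 2 < \<bar>x - c\<bar>" using False by (auto simp: c_def abs_if field_simps)
        moreover have "\<bar>x - c\<bar> < 3 * l / 2" using that False ab by (auto simp: c_def P_def abs_if field_simps)
        ultimately show ?thesis using out by (auto simp: p_def square_wave_eq_neg_1[OF l])
      qed
      have "(LINT x:P|lborel. \<bar>p x - m * square_wave l c x\<bar>) = (LINT x:P|lborel. p x - m * square_wave l c x)"
      proof (rule set_lebesgue_integral_cong_AE)
        show "AE x\<in>P in lborel. \<bar>p x - m * square_wave l c x\<bar> = p x - m * square_wave l c x"
          using AE_lborel_singleton[of x0] by eventually_elim (use ge in force)
      qed (auto simp: P_def)
      then have e: "(LINT x:P|lborel. \<bar>p x - m * square_wave l c x\<bar>) = (LINT x:P|lborel. p x)" using eq by simp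
      have "0 \<le> (LINT x:P|lborel. \<bar>p x - m * square_wave l c x\<bar>)"
        unfolding set_lebesgue_integral_def by (rule integral_nonneg_AE) simp
      with e show ?thesis by simp
    qed
  qed
  have sS: "set_integrable lborel P (\<lambda>x. \<bar>U x - p x\<bar>)" "set_integrable lborel P (\<lambda>x. \<bar>p x - m * square_wave l c x\<bar>)"
    using UP(2) pS qP(2) by (auto intro!: set_integrable_abs set_integral_diff set_integrable_mult_right)
  have "(\<integral>x. \<bar>U x - m * square_wave l c x\<bar> \<partial>circle l) = (LINT x:P|lborel. \<bar>U x - m * square_wave l c x\<bar>)"
    using Ui integrable_square_wave[of l c]
    by (intro PI[symmetric]) (auto simp: per square_wave_periodic[OF l])
  also have "\<dots> \<le> (LINT x:P|lborel. \<bar>U x - p x\<bar> + \<bar>p x - m * square_wave l c x\<bar>)"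
    using UP(2) pS qP(2) sS
    by (intro set_integral_mono set_integral_add set_integrable_abs set_integral_diff set_integrable_mult_right) auto
  also have "\<dots> = (LINT x:P|lborel. \<bar>U x - p x\<bar>) + (LINT x:P|lborel. \<bar>p x - m * square_wave l c x\<bar>)"
    by (rule set_integral_add(2)[OF sS])
  also have "\<dots> \<le> K * D + R" using I1 I2 I3 by simp
  also have "\<dots> \<le> 2 * R" using R' by simp
  finally show ?thesis by blast
qed

section \<open>The potential and the cost of a wall\<close>

lemma A0_bounds: "\<sigma> > 0 \<Longrightarrow> 0 < A0 \<sigma> \<and> A0 \<sigma> < 1"
  by (simp add: A0_def)

lemma sigma_eq: "\<sigma> > 0 \<Longrightarrow> \<sigma> = 1 / A0 \<sigma> - 1"
  by (simp add: A0_def)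

lemma
  assumes \<sigma>: "\<sigma> > 0"
  shows cos_alpha: "cos (alpha \<sigma>) = A0 \<sigma>" and sin_alpha: "sin (alpha \<sigma>) = nbar \<sigma>"
    and alpha_pos: "0 < alpha \<sigma>" and alpha_less: "alpha \<sigma> < pi / 2"
    and nbar_pos: "0 < nbar \<sigma>" and nbar_less_1: "nbar \<sigma> < 1"
    and nbar_square: "(nbar \<sigma>)\<^sup>2 = 1 - (A0 \<sigma>)\<^sup>2" and arcsin_nbar: "arcsin (nbar \<sigma>) = alpha \<sigma>"
proof -
  have A: "0 < A0 \<sigma>" "A0 \<sigma> < 1" using A0_bounds[OF \<sigma>] by auto
  have A2: "(A0 \<sigma>)\<^sup>2 < 1" using A by (simp add: power_less_one_iff)
  show c: "cos (alpha \<sigma>) = A0 \<sigma>" using A by (simp add: alpha_def)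
  show s: "sin (alpha \<sigma>) = nbar \<sigma>" using A by (simp add: alpha_def nbar_def sin_arccos)
  show p: "0 < alpha \<sigma>" unfolding alpha_def using arccos_less_mono[of 1 "A0 \<sigma>"] A by simp
  show q: "alpha \<sigma> < pi / 2" unfolding alpha_def using arccos_less_mono[of "A0 \<sigma>" 0] A by simp
  show "0 < nbar \<sigma>" using A2 by (simp add: nbar_def)
  show "nbar \<sigma> < 1" using A by (simp add: nbar_def)
  show "(nbar \<sigma>)\<^sup>2 = 1 - (A0 \<sigma>)\<^sup>2" using A2 by (simp add: nbar_def)
  show "arcsin (nbar \<sigma>) = alpha \<sigma>" unfolding s[symmetric] using p q by (intro arcsin_sin) auto
qed

text \<open>Evaluates an antiderivative that is only known to exist by an explicit one that is valid
  inside the interval.\<close>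

lemma antiderivative_diff:
  fixes f G :: "real \<Rightarrow> real"
  assumes ab: "a < b" and f: "\<And>t. (f has_real_derivative q t) (at t)"
    and G: "continuous_on {a..b} G" "\<And>t. a < t \<Longrightarrow> t < b \<Longrightarrow> (G has_real_derivative q t) (at t)"
  shows "f b - f a = G b - G a"
proof -
  have "continuous_on {a..b} f"
    using f by (intro continuous_at_imp_continuous_on) (auto intro: DERIV_isCont)
  then have "continuous_on {a..b} (\<lambda>t. f t - G t)" using G(1) by (intro continuous_intros)
  moreover have "((\<lambda>t. f t - G t) has_real_derivative 0) (at t)" if "a < t" "t < b" for t
    using DERIV_diff[OF f[of t] G(2)[OF that]] by simp
  ultimately have "f b - G b = f a - G a" by (rule DERIV_isconst_end[OF ab])
  then show ?thesis by simp
qed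

text \<open>
  Square root of the reduced potential \<open>(sqrt (1 - t\<^sup>2) - A)\<^sup>2 / A\<close>, which bounds \<open>W\<close> from below on
  the sphere when \<open>t\<close> is the first component.
\<close>

definition reduced_root :: "real \<Rightarrow> real \<Rightarrow> real" where
  "reduced_root A t = max 0 (sqrt (1 - min 1 (t\<^sup>2)) - A) / sqrt A"

lemma reduced_root_continuous: "A > 0 \<Longrightarrow> continuous_on S (reduced_root A)"
  unfolding reduced_root_def by (intro continuous_intros) auto

lemma reduced_root_nonneg: "A > 0 \<Longrightarrow> 0 \<le> reduced_root A t"
  by (simp add: reduced_root_def)

text \<open>Halving the angle makes the inequality strict, as the cosine of the half angle is below
  one. This strictness is the energy gap between the competitor and four walls.\<close>

lemma sin_less_self:
  assumes "0 < x" "x < pi" shows "sin x < (x :: real)"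
proof -
  have "cos (x / 2) < cos 0" using assms by (intro cos_monotone_0_pi) auto
  then have "sin (x / 2) * cos (x / 2) < sin (x / 2) * 1"
    using assms by (intro mult_strict_left_mono sin_gt_zero) auto
  then have "sin x < 2 * sin (x / 2)" using sin_double[of "x / 2"] by simp
  also have "\<dots> \<le> x" using sin_x_le_x[of "x / 2"] assms by simp
  finally show ?thesis .
qed

text \<open>Between \<open>- m\<close> and \<open>m = sin \<alpha>\<close> the reduced root
  integrates to \<open>(\<alpha> - A * m) / sqrt A\<close>, which exceeds the competitor's constant
  because \<open>sin \<alpha> < \<alpha>\<close>. By continuity the strict inequality survives for a
  level \<open>s\<close> slightly below \<open>nbar\<close>; a level strictly between the wells is
  what makes wall counting robust.\<close>

lemma transition_potential:
  assumes \<sigma>: "\<sigma> > 0"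
  obtains f s where "\<And>t. (f has_real_derivative reduced_root (A0 \<sigma>) t) (at t)" "mono f" "0 < s" "s < nbar \<sigma>"
    "alpha \<sigma> * (1 - A0 \<sigma>) / sqrt (A0 \<sigma>) < f s - f (- s)"
proof -
  define A m \<alpha> where "A = A0 \<sigma>" and "m = nbar \<sigma>" and "\<alpha> = alpha \<sigma>"
  have A: "0 < A" "A < 1" using A0_bounds[OF \<sigma>] by (auto simp: A_def)
  have m: "0 < m" "m < 1" "m\<^sup>2 = 1 - A\<^sup>2" "sin \<alpha> = m" "cos \<alpha> = A" "arcsin m = \<alpha>" "0 < \<alpha>" "\<alpha> < pi / 2"
    using nbar_pos[OF \<sigma>] nbar_less_1[OF \<sigma>] nbar_square[OF \<sigma>] sin_alpha[OF \<sigma>] cos_alpha[OF \<sigma>]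
      arcsin_nbar[OF \<sigma>] alpha_pos[OF \<sigma>] alpha_less[OF \<sigma>] by (auto simp: A_def m_def \<alpha>_def)
  obtain f where f: "\<forall>t. (f has_real_derivative reduced_root A t) (at t)"
    using antiderivative_exists[OF reduced_root_continuous[OF A(1)]] by (rule exE)
  have mono: "mono f"
  proof (rule monoI)
    fix x y :: real assume "x \<le> y"
    then show "f x \<le> f y"
      using f reduced_root_nonneg[OF A(1)] by (intro DERIV_nonneg_imp_nondecreasing[of x y f]) blast+
  qed
  \<comment> \<open>Area under the unit circle minus a rectangle: an explicit antiderivative of
    \<open>(sqrt (1 - t\<^sup>2) - A) / sqrt A\<close>.\<close>
  define G where "G t = ((t * sqrt (1 - t\<^sup>2) + arcsin t) / 2 - A * t) / sqrt A" for t
  have lt1: "t\<^sup>2 < 1" if "-m < t" "t < m" for t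
    using that m by (simp add: abs_square_less_1)
  have "f m - f (-m) = G m - G (-m)"
  proof (rule antiderivative_diff)
    show "-m < m" using m by simp
    show "continuous_on {-m..m} G"
      unfolding G_def using m A by (intro continuous_intros) auto
    fix t assume t: "-m < t" "t < m"
    have t1: "-1 < t" "t < 1" using t m by auto
    have sq: "sqrt (1 - t\<^sup>2) > 0" using lt1[OF t] by simp
    have "(G has_real_derivative ((1 * sqrt (1 - t\<^sup>2) + t * ((- (2 * t)) * inverse (sqrt (1 - t\<^sup>2)) / 2)
        + inverse (sqrt (1 - t\<^sup>2))) / 2 - A) / sqrt A) (at t)"
      unfolding G_def using t1 lt1[OF t] A
      by (auto intro!: derivative_eq_intros simp: field_simps power2_eq_square)
    also have "(1 * sqrt (1 - t\<^sup>2) + t * ((- (2 * t)) * inverse (sqrt (1 - t\<^sup>2)) / 2) + inverse (sqrt (1 - t\<^sup>2))) / 2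
       = sqrt (1 - t\<^sup>2)"
    proof -
      have "sqrt (1 - t\<^sup>2) * sqrt (1 - t\<^sup>2) = 1 - t\<^sup>2" using lt1[OF t] by simp
      then show ?thesis using sq by (simp add: field_simps power2_eq_square)
    qed
    also have "(sqrt (1 - t\<^sup>2) - A) / sqrt A = reduced_root A t"
    proof -
      have "\<bar>t\<bar> \<le> \<bar>m\<bar>" using t m by auto
      then have "t\<^sup>2 \<le> m\<^sup>2" by (simp only: abs_le_square_iff)
      then have "A\<^sup>2 \<le> 1 - t\<^sup>2" using m by simp
      then have "A \<le> sqrt (1 - t\<^sup>2)" by (rule real_le_rsqrt)
      then show ?thesis using lt1[OF t] by (simp add: reduced_root_def)
    qed
    finally show "(G has_real_derivative reduced_root A t) (at t)" .
  qed (use f in auto)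
  also have "\<dots> = (\<alpha> - A * m) / sqrt A"
  proof -
    have h: "sqrt (1 - m\<^sup>2) = A" using m A by simp
    have "G m = ((m * A + \<alpha>) / 2 - A * m) / sqrt A" by (simp add: G_def h m(6))
    moreover have "G (-m) = (- ((m * A + \<alpha>) / 2 - A * m)) / sqrt A"
    proof -
      have am: "arcsin (- m) = - \<alpha>" using m by (simp add: arcsin_minus)
      have "(- m * A + - \<alpha>) / 2 - A * (- m) = - ((m * A + \<alpha>) / 2 - A * m)"
        by (simp add: field_simps)
      then show ?thesis by (simp only: G_def power2_minus h am)
    qed
    moreover have "((m * A + \<alpha>) / 2 - A * m) - - ((m * A + \<alpha>) / 2 - A * m) = \<alpha> - A * m"
      by (simp add: field_simps)
    ultimately show ?thesis by (metis diff_divide_distrib)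
  qed
  finally have fm: "f m - f (-m) = (\<alpha> - A * m) / sqrt A" .
  have "A * sin \<alpha> < A * \<alpha>" using A m sin_less_self[of \<alpha>] by (intro mult_strict_left_mono) auto
  then have gap: "\<alpha> * (1 - A) / sqrt A < f m - f (-m)"
    unfolding fm using A m by (intro divide_strict_right_mono) (auto simp: algebra_simps)
  have "isCont (\<lambda>s. f s - f (-s)) m"
  proof -
    have "isCont f t" for t using f by (auto intro: DERIV_isCont)
    then show ?thesis by (intro continuous_intros isCont_o2[where f=uminus and g=f]) auto
  qed
  then have "((\<lambda>s. f s - f (-s)) \<longlongrightarrow> f m - f (-m)) (at_left m)"
    unfolding isCont_def by (rule filterlim_mono) (auto simp: at_le)
  from order_tendstoD(1)[OF this gap]
  have "\<forall>\<^sub>F s in at_left m. \<alpha> * (1 - A) / sqrt A < f s - f (-s)" .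
  moreover have "\<forall>\<^sub>F s in at_left m. s \<in> {0<..<m}"
    using m by (intro eventually_at_left_real) auto
  ultimately have "\<forall>\<^sub>F s in at_left m. \<alpha> * (1 - A) / sqrt A < f s - f (-s) \<and> s \<in> {0<..<m}"
    by (rule eventually_conj)
  then obtain s where "\<alpha> * (1 - A) / sqrt A < f s - f (-s)" "s \<in> {0<..<m}"
    using eventually_happens'[of "at_left m"] by (auto simp: trivial_limit_at_left_real)
  with f mono show ?thesis by (intro that[of f s]) (auto simp: A_def m_def \<alpha>_def)
qed

section \<open>The potential on the sphere and the value of \<open>c0\<close>\<close>

lemma norm_real3: "norm (v :: real^3) = sqrt ((v $ 1)\<^sup>2 + (v $ 2)\<^sup>2 + (v $ 3)\<^sup>2)"
  by (simp add: norm_vec_def L2_set_def sum_3)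

lemma inner_real3: "inner (v :: real^3) w = v $ 1 * w $ 1 + v $ 2 * w $ 2 + v $ 3 * w $ 3"
  by (simp add: inner_vec_def sum_3)

lemma sphere_components:
  assumes "(v :: real^3) \<in> sphere 0 1"
  shows "(v $ 1)\<^sup>2 + (v $ 2)\<^sup>2 + (v $ 3)\<^sup>2 = 1"
  using assms by (simp add: norm_real3)

text \<open>
  With \<open>r\<^sup>2 = n\<^sub>2\<^sup>2 + n\<^sub>3\<^sup>2\<close> the claim amounts to \<open>n\<^sub>2\<^sup>2 \<le> 2 (r - n\<^sub>3)\<close>, which holds because
  \<open>n\<^sub>2\<^sup>2 = (r - n\<^sub>3) (r + n\<^sub>3)\<close> and \<open>r \<le> 1\<close>.
\<close>

lemma W_ge_reduced:
  assumes \<sigma>: "\<sigma> > 0" and v: "v \<in> sphere 0 1"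
  shows "(sqrt (1 - (v $ 1)\<^sup>2) - A0 \<sigma>)\<^sup>2 / A0 \<sigma> \<le> W \<sigma> v"
proof -
  define A where "A = A0 \<sigma>"
  have A: "0 < A" "A < 1" using A0_bounds[OF \<sigma>] by (auto simp: A_def)
  define r where "r = sqrt (1 - (v $ 1)\<^sup>2)"
  have s: "(v $ 2)\<^sup>2 + (v $ 3)\<^sup>2 = 1 - (v $ 1)\<^sup>2" using sphere_components[OF v] by simp
  then have r2: "r\<^sup>2 = (v $ 2)\<^sup>2 + (v $ 3)\<^sup>2"
    unfolding r_def by (metis real_sqrt_pow2 sum_power2_ge_zero)
  have "0 \<le> 1 - (v $ 1)\<^sup>2" using s sum_power2_ge_zero[of "v $ 2" "v $ 3"] by linarith
  then have r1: "0 \<le> r" "r \<le> 1" unfolding r_def by simp_all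
  have "v $ 3 \<le> r"
    using r2 r1 by (intro power2_le_imp_le[of "v $ 3" r]) auto
  moreover have "r + v $ 3 \<le> 2" using r1 \<open>v $ 3 \<le> r\<close> by simp
  ultimately have "(r - v $ 3) * (r + v $ 3) \<le> (r - v $ 3) * 2" by (intro mult_left_mono) auto
  moreover have "(v $ 2)\<^sup>2 = (r - v $ 3) * (r + v $ 3)" using r2 by (simp add: algebra_simps power2_eq_square)
  ultimately have "A * (v $ 2)\<^sup>2 \<le> A * (2 * (r - v $ 3))" using A by (intro mult_left_mono) auto
  then have "(r - A)\<^sup>2 \<le> (1 - A) * (v $ 2)\<^sup>2 + (v $ 3 - A)\<^sup>2"
    using r2 by (simp add: power2_eq_square algebra_simps)
  then have "(r - A)\<^sup>2 / A \<le> ((1 - A) * (v $ 2)\<^sup>2 + (v $ 3 - A)\<^sup>2) / A"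
    using A by (intro divide_right_mono) auto
  also have "\<dots> = (1 / A - 1) * (v $ 2)\<^sup>2 + 1 / A * (v $ 3 - A)\<^sup>2"
    using A by (simp add: field_simps)
  also have "\<dots> = W \<sigma> v" using sigma_eq[OF \<sigma>] by (simp add: W_def A_def)
  finally show ?thesis by (simp add: r_def A_def)
qed

lemma W_nonneg: "\<sigma> > 0 \<Longrightarrow> 0 \<le> W \<sigma> v"
  using A0_bounds[of \<sigma>] by (simp add: W_def)

text \<open>Tangency expresses \<open>v $ 1 * w $ 1\<close> through the other two components, to
  which Cauchy-Schwarz applies. Along a path on the sphere this bounds the speed from below by that
  of the first component divided by the root, wherever the root is positive.\<close>

lemma tangent_component:
  assumes v: "(v :: real^3) \<in> sphere 0 1" and w: "inner v w = 0"
  shows "\<bar>w $ 1\<bar> \<le> sqrt (1 - (v $ 1)\<^sup>2) * norm w"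
proof -
  have s: "(v $ 2)\<^sup>2 + (v $ 3)\<^sup>2 = 1 - (v $ 1)\<^sup>2" using sphere_components[OF v] by simp
  have "v $ 1 * w $ 1 = - (v $ 2 * w $ 2 + v $ 3 * w $ 3)" using w by (simp add: inner_real3)
  then have "(v $ 1 * w $ 1)\<^sup>2 = (v $ 2 * w $ 2 + v $ 3 * w $ 3)\<^sup>2" by (metis power2_minus)
  also have "\<dots> \<le> ((v $ 2)\<^sup>2 + (v $ 3)\<^sup>2) * ((w $ 2)\<^sup>2 + (w $ 3)\<^sup>2)"
    using zero_le_power2[of "v $ 2 * w $ 3 - v $ 3 * w $ 2"] by (simp add: power2_eq_square algebra_simps)
  finally have "(v $ 1)\<^sup>2 * (w $ 1)\<^sup>2 \<le> (1 - (v $ 1)\<^sup>2) * ((w $ 2)\<^sup>2 + (w $ 3)\<^sup>2)"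
    by (simp add: s power_mult_distrib)
  then have "(w $ 1)\<^sup>2 \<le> (1 - (v $ 1)\<^sup>2) * ((w $ 1)\<^sup>2 + (w $ 2)\<^sup>2 + (w $ 3)\<^sup>2)"
    by (simp add: algebra_simps)
  then have "sqrt ((w $ 1)\<^sup>2) \<le> sqrt ((1 - (v $ 1)\<^sup>2) * ((w $ 1)\<^sup>2 + (w $ 2)\<^sup>2 + (w $ 3)\<^sup>2))"
    by (rule real_sqrt_le_mono)
  then show ?thesis by (simp add: norm_real3 real_sqrt_mult)
qed

text \<open>Calibration. With \<open>R = sqrt (1 - (\<gamma> t $ 1)\<^sup>2)\<close> at least
  \<open>A\<close>, the root of the potential is at least \<open>(R - A) / sqrt A\<close> and the
  speed is at least \<open>\<bar>\<gamma>' t $ 1\<bar> / R\<close>. Their product dominates the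
  derivative of \<open>f (\<gamma> t $ 1)\<close>, so the cost is at least the increment of
  \<open>f\<close> between the wells, which is the claimed value.\<close>

lemma c0_path_ge:
  assumes \<sigma>: "\<sigma> > 0"
    and \<gamma>: "\<And>t. t \<in> {0..1} \<Longrightarrow> (\<gamma> has_vector_derivative \<gamma>' t) (at t within {0..1})"
    and \<gamma>': "continuous_on {0..1} \<gamma>'" and sph: "\<gamma> ` {0..1} \<subseteq> sphere 0 1"
    and ends: "\<gamma> 0 = n_minus \<sigma>" "\<gamma> 1 = n_plus \<sigma>"
  shows "2 / sqrt (A0 \<sigma>) * (sin (alpha \<sigma>) - alpha \<sigma> * cos (alpha \<sigma>))
    \<le> integral {0..1} (\<lambda>t. sqrt (W \<sigma> (\<gamma> t)) * norm (\<gamma>' t))"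
proof -
  define A m \<alpha> where "A = A0 \<sigma>" and "m = nbar \<sigma>" and "\<alpha> = alpha \<sigma>"
  have A: "0 < A" "A < 1" using A0_bounds[OF \<sigma>] by (auto simp: A_def)
  have m: "0 < m" "m < 1" "m\<^sup>2 = 1 - A\<^sup>2" "sin \<alpha> = m" "cos \<alpha> = A" "arcsin m = \<alpha>"
    using nbar_pos[OF \<sigma>] nbar_less_1[OF \<sigma>] nbar_square[OF \<sigma>] sin_alpha[OF \<sigma>] cos_alpha[OF \<sigma>]
      arcsin_nbar[OF \<sigma>] by (auto simp: A_def m_def \<alpha>_def)
  define r where "r t = sqrt (1 - min 1 (t\<^sup>2))" for t :: real
  \<comment> \<open>For \<open>r t \<ge> A\<close> this is
    \<open>(r t - A) / (r t * sqrt A)\<close>. The maximum makes it vanish elsewhere and keeps it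
    continuous where \<open>r t\<close> is zero.\<close>
  define q where "q t = (1 - A / max (r t) A) / sqrt A" for t
  have "max (r t) A \<noteq> 0" for t using A by (simp add: max_def)
  then have qc: "continuous_on UNIV q"
    unfolding q_def r_def using A by (intro continuous_intros) (auto simp: r_def)
  obtain f where f: "\<forall>t. (f has_real_derivative q t) (at t)"
    using antiderivative_exists[OF qc] by (rule exE)
  define G where "G t = (t - A * arcsin t) / sqrt A" for t
  have "f m - f (-m) = G m - G (-m)"
  proof (rule antiderivative_diff)
    show "-m < m" using m by simp
    show "continuous_on {-m..m} G"
      unfolding G_def using m A by (intro continuous_intros) auto
    fix t assume t: "-m < t" "t < m"
    have t1: "-1 < t" "t < 1" using t m by auto
    then have lt1: "t\<^sup>2 < 1" by (simp add: abs_square_less_1)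
    have "\<bar>t\<bar> \<le> \<bar>m\<bar>" using t m by auto
    then have "t\<^sup>2 \<le> m\<^sup>2" by (simp only: abs_le_square_iff)
    then have "A\<^sup>2 \<le> 1 - t\<^sup>2" using m by simp
    then have "A \<le> sqrt (1 - t\<^sup>2)" by (rule real_le_rsqrt)
    then have q: "q t = (1 - A * inverse (sqrt (1 - t\<^sup>2))) / sqrt A"
      using lt1 by (simp add: q_def r_def max_def divide_inverse)
    show "(G has_real_derivative q t) (at t)"
      unfolding G_def q using t1 by (intro DERIV_cdivide) (auto intro!: derivative_eq_intros)
  qed (use f in auto)
  also have "\<dots> = 2 / sqrt A * (m - A * \<alpha>)"
  proof -
    have am: "arcsin (- m) = - \<alpha>" using m by (simp add: arcsin_minus)
    have "G (-m) = - G m" by (simp add: G_def am m(6) minus_divide_left)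
    then show ?thesis by (simp add: G_def m(6))
  qed
  finally have fm: "f m - f (-m) = 2 / sqrt A * (sin \<alpha> - \<alpha> * cos \<alpha>)" using m by (simp add: mult.commute)
  have sph1: "\<gamma> t \<in> sphere 0 1" if "t \<in> {0..1}" for t using sph that by blast
  have \<gamma>1: "((\<lambda>t. \<gamma> t $ 1) has_real_derivative \<gamma>' t $ 1) (at t within {0..1})" if "t \<in> {0..1}" for t
    unfolding has_real_derivative_iff_has_vector_derivative
    by (rule bounded_linear.has_vector_derivative[OF bounded_linear_vec_nth \<gamma>[OF that]])
  have "((\<lambda>t. f (\<gamma> t $ 1)) has_vector_derivative q (\<gamma> t $ 1) * \<gamma>' t $ 1) (at t within {0..1})" if "t \<in> {0..1}" for t
    using DERIV_chain2[OF f[rule_format] \<gamma>1[OF that]] by (simp add: has_real_derivative_iff_has_vector_derivative)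
  then have ftc: "((\<lambda>t. q (\<gamma> t $ 1) * \<gamma>' t $ 1) has_integral f (\<gamma> 1 $ 1) - f (\<gamma> 0 $ 1)) {0..1}"
    by (intro fundamental_theorem_of_calculus) auto
  have ends1: "\<gamma> 1 $ 1 = m" "\<gamma> 0 $ 1 = -m"
    using ends by (simp_all add: n_plus_def n_minus_def m_def)
  have \<gamma>c: "continuous_on {0..1} \<gamma>"
    unfolding continuous_on_eq_continuous_within
    using \<gamma> has_vector_derivative_continuous by blast
  have int: "(\<lambda>t. sqrt (W \<sigma> (\<gamma> t)) * norm (\<gamma>' t)) integrable_on {0..1}"
    unfolding W_def by (intro integrable_continuous_interval continuous_intros \<gamma>c \<gamma>')
  \<comment> \<open>The path has constant norm one; differentiate its square.\<close>
  have tangent: "inner (\<gamma> t) (\<gamma>' t) = 0" if t: "t \<in> {0..1}" for t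
  proof -
    have "((\<lambda>t. inner (\<gamma> t) (\<gamma> t)) has_vector_derivative inner (\<gamma> t) (\<gamma>' t) + inner (\<gamma>' t) (\<gamma> t)) (at t within {0..1})"
      using bounded_bilinear.has_vector_derivative[OF bounded_bilinear_inner \<gamma>[OF t] \<gamma>[OF t]] .
    moreover have "((\<lambda>t. inner (\<gamma> t) (\<gamma> t)) has_vector_derivative 0) (at t within {0..1})"
    proof (rule has_vector_derivative_transform[OF t _ has_vector_derivative_const[of 1]])
      show "inner (\<gamma> s) (\<gamma> s) = 1" if "s \<in> {0..1}" for s
        using sph1[OF that] by (simp add: norm_eq_1)
    qed
    ultimately have "inner (\<gamma> t) (\<gamma>' t) + inner (\<gamma>' t) (\<gamma> t) = 0"
      using t by (intro vector_derivative_unique_within_closed_interval[of 0 1 t]) auto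
    then show ?thesis by (simp add: inner_commute)
  qed
  have le: "q (\<gamma> t $ 1) * \<gamma>' t $ 1 \<le> sqrt (W \<sigma> (\<gamma> t)) * norm (\<gamma>' t)" if t: "t \<in> {0..1}" for t
  proof -
    define R where "R = sqrt (1 - (\<gamma> t $ 1)\<^sup>2)"
    have le1: "(\<gamma> t $ 1)\<^sup>2 \<le> 1"
      using sphere_components[OF sph1[OF t]] sum_power2_ge_zero[of "\<gamma> t $ 2" "\<gamma> t $ 3"] by linarith
    have rR: "r (\<gamma> t $ 1) = R" using le1 by (simp add: r_def R_def)
    have g: "\<bar>\<gamma>' t $ 1\<bar> \<le> R * norm (\<gamma>' t)"
      unfolding R_def by (rule tangent_component[OF sph1[OF t] tangent[OF t]])
    show ?thesis
    proof (cases "R \<ge> A")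
      case True
      have "(R - A)\<^sup>2 / A \<le> W \<sigma> (\<gamma> t)"
        using W_ge_reduced[OF \<sigma> sph1[OF t]] by (simp add: R_def A_def)
      then have "sqrt ((R - A)\<^sup>2 / A) \<le> sqrt (W \<sigma> (\<gamma> t))" by (rule real_sqrt_le_mono)
      then have w: "(R - A) / sqrt A \<le> sqrt (W \<sigma> (\<gamma> t))" using True by (simp add: real_sqrt_divide)
      have q: "q (\<gamma> t $ 1) = (R - A) / sqrt A / R" "0 \<le> q (\<gamma> t $ 1)"
        using True A by (auto simp: q_def rR max_def field_simps)
      have "q (\<gamma> t $ 1) * \<gamma>' t $ 1 \<le> q (\<gamma> t $ 1) * (R * norm (\<gamma>' t))"
        using g q(2) by (intro mult_left_mono) auto
      also have "\<dots> = (R - A) / sqrt A * norm (\<gamma>' t)" using True A by (simp add: q(1))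
      also have "\<dots> \<le> sqrt (W \<sigma> (\<gamma> t)) * norm (\<gamma>' t)" using w by (intro mult_right_mono) auto
      finally show ?thesis .
    next
      case False
      then have "q (\<gamma> t $ 1) = 0" using A by (simp add: q_def rR max_def)
      then show ?thesis using W_nonneg[OF \<sigma>] by simp
    qed
  qed
  have "f m - f (-m) \<le> integral {0..1} (\<lambda>t. sqrt (W \<sigma> (\<gamma> t)) * norm (\<gamma>' t))"
    using has_integral_le[OF ftc integrable_integral[OF int] le] by (simp add: ends1)
  then show ?thesis unfolding fm by (simp add: A_def \<alpha>_def)
qed

text \<open>The infimum is attained on the great circle arc through the wells in the plane of the
  first and third axes, along which both inequalities behind the lower bound are equalities.\<close>

lemma c0_eq:
  assumes \<sigma>: "\<sigma> > 0"
  shows "c0 \<sigma> = 2 / sqrt (A0 \<sigma>) * (sin (alpha \<sigma>) - alpha \<sigma> * cos (alpha \<sigma>))"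
proof -
  define A \<alpha> where "A = A0 \<sigma>" and "\<alpha> = alpha \<sigma>"
  have A: "0 < A" "A < 1" using A0_bounds[OF \<sigma>] by (auto simp: A_def)
  have \<alpha>: "0 < \<alpha>" "\<alpha> < pi / 2" "cos \<alpha> = A" "sin \<alpha> = nbar \<sigma>"
    using alpha_pos[OF \<sigma>] alpha_less[OF \<sigma>] cos_alpha[OF \<sigma>] sin_alpha[OF \<sigma>] by (auto simp: A_def \<alpha>_def)
  \<comment> \<open>The angle runs linearly from \<open>- \<alpha>\<close> to
    \<open>\<alpha>\<close>, so the speed is the constant \<open>2 * \<alpha>\<close>.\<close>
  define \<theta> where "\<theta> t = \<alpha> * (2 * t - 1)" for t
  define \<gamma> \<gamma>' where "\<gamma> t = sin (\<theta> t) *\<^sub>R axis 1 1 + cos (\<theta> t) *\<^sub>R (axis 3 1 :: real^3)"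
    and "\<gamma>' t = (2 * \<alpha> * cos (\<theta> t)) *\<^sub>R axis 1 1 + (- (2 * \<alpha> * sin (\<theta> t))) *\<^sub>R (axis 3 1 :: real^3)" for t
  have comp: "\<gamma> t $ 1 = sin (\<theta> t)" "\<gamma> t $ 2 = 0" "\<gamma> t $ 3 = cos (\<theta> t)"
    "\<gamma>' t $ 1 = 2 * \<alpha> * cos (\<theta> t)" "\<gamma>' t $ 2 = 0" "\<gamma>' t $ 3 = - (2 * \<alpha> * sin (\<theta> t))" for t
    by (simp_all add: \<gamma>_def \<gamma>'_def axis_def)
  have n\<gamma>': "norm (\<gamma>' t) = 2 * \<alpha>" for t
  proof -
    have "(2 * \<alpha> * cos (\<theta> t))\<^sup>2 + 0\<^sup>2 + (- (2 * \<alpha> * sin (\<theta> t)))\<^sup>2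
        = (2 * \<alpha>)\<^sup>2 * ((cos (\<theta> t))\<^sup>2 + (sin (\<theta> t))\<^sup>2)"
      by (simp only: power2_minus power_mult_distrib distrib_left zero_power2 add_0_right)
    then have "norm (\<gamma>' t) = sqrt ((2 * \<alpha>)\<^sup>2 * ((cos (\<theta> t))\<^sup>2 + (sin (\<theta> t))\<^sup>2))"
      unfolding norm_real3 comp by (rule arg_cong)
    also have "\<dots> = sqrt ((2 * \<alpha>)\<^sup>2)" by (simp only: sin_cos_squared_add2 mult_1_right)
    also have "\<dots> = 2 * \<alpha>" unfolding real_sqrt_abs using \<alpha>(1) by simp
    finally show ?thesis .
  qed
  have W\<gamma>: "sqrt (W \<sigma> (\<gamma> t)) = (cos (\<theta> t) - A) / sqrt A" if "t \<in> {0..1}" for t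
  proof -
    have "\<bar>2 * t - 1\<bar> \<le> 1" using that by auto
    then have "\<bar>\<theta> t\<bar> \<le> \<alpha>" using \<alpha> by (simp add: \<theta>_def abs_mult mult_left_le)
    then have "cos \<alpha> \<le> cos \<bar>\<theta> t\<bar>" using \<alpha> by (intro cos_monotone_0_pi_le) auto
    then have "A \<le> cos (\<theta> t)" using \<alpha> by simp
    then show ?thesis unfolding W_def comp by (simp add: A_def[symmetric] real_sqrt_divide)
  qed
  have \<theta>d: "(\<theta> has_real_derivative 2 * \<alpha>) (at t within S)" for t S
    unfolding \<theta>_def by (auto intro!: derivative_eq_intros)
  have int: "integral {0..1} (\<lambda>t. sqrt (W \<sigma> (\<gamma> t)) * norm (\<gamma>' t)) = 2 / sqrt A * (sin \<alpha> - \<alpha> * cos \<alpha>)"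
  proof -
    define F where "F t = (sin (\<theta> t) - A * \<theta> t) / sqrt A" for t
    have "((\<lambda>t. (cos (\<theta> t) - A) / sqrt A * (2 * \<alpha>)) has_integral F 1 - F 0) {0..1}"
    proof (rule fundamental_theorem_of_calculus)
      show "(F has_vector_derivative (cos (\<theta> t) - A) / sqrt A * (2 * \<alpha>)) (at t within {0..1})" for t
      proof -
        have "((\<lambda>t. sin (\<theta> t) - A * \<theta> t) has_real_derivative cos (\<theta> t) * (2 * \<alpha>) - A * (2 * \<alpha>)) (at t within {0..1})"
          by (auto intro!: derivative_eq_intros \<theta>d)
        from DERIV_cdivide[OF this, of "sqrt A"] show ?thesis
          unfolding F_def has_real_derivative_iff_has_vector_derivative[symmetric] by (simp add: left_diff_distrib)
      qed
    qed simp
    then have "((\<lambda>t. sqrt (W \<sigma> (\<gamma> t)) * norm (\<gamma>' t)) has_integral F 1 - F 0) {0..1}"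
      by (rule has_integral_eq[rotated]) (simp add: W\<gamma> n\<gamma>')
    then have "integral {0..1} (\<lambda>t. sqrt (W \<sigma> (\<gamma> t)) * norm (\<gamma>' t)) = F 1 - F 0" by (rule integral_unique)
    also have "\<dots> = 2 / sqrt A * (sin \<alpha> - \<alpha> * cos \<alpha>)"
    proof -
      have "\<theta> 1 = \<alpha>" "\<theta> 0 = - \<alpha>" by (auto simp: \<theta>_def)
      then have "F 0 = - F 1" "F 1 = (sin \<alpha> - \<alpha> * cos \<alpha>) / sqrt A"
        by (simp_all add: F_def minus_divide_left \<alpha>(3) mult.commute)
      then show ?thesis by simp
    qed
    finally show ?thesis .
  qed
  define X where "X = {integral {0..1} (\<lambda>t. sqrt (W \<sigma> (\<gamma> t)) * norm (\<gamma>' t)) | \<gamma> \<gamma>'.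
     (\<forall>t\<in>{0..1}. (\<gamma> has_vector_derivative \<gamma>' t) (at t within {0..1})) \<and>
     continuous_on {0..1} \<gamma>' \<and> \<gamma> ` {0..1} \<subseteq> sphere 0 1 \<and>
     \<gamma> 0 = n_minus \<sigma> \<and> \<gamma> 1 = n_plus \<sigma>}"
  have "2 / sqrt A * (sin \<alpha> - \<alpha> * cos \<alpha>) \<in> X"
    unfolding X_def
  proof (intro CollectI exI conjI)
    show "2 / sqrt A * (sin \<alpha> - \<alpha> * cos \<alpha>) = integral {0..1} (\<lambda>t. sqrt (W \<sigma> (\<gamma> t)) * norm (\<gamma>' t))"
      using int by simp
    show "\<forall>t\<in>{0..1}. (\<gamma> has_vector_derivative \<gamma>' t) (at t within {0..1})"
      unfolding \<gamma>_def \<gamma>'_def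
      by (auto intro!: derivative_eq_intros \<theta>d simp: mult.commute)
    show "continuous_on {0..1} \<gamma>'" unfolding \<gamma>'_def \<theta>_def by (intro continuous_intros)
    show "\<gamma> ` {0..1} \<subseteq> sphere 0 1" by (auto simp: norm_real3 comp)
    show "\<gamma> 0 = n_minus \<sigma>" "\<gamma> 1 = n_plus \<sigma>"
      using \<alpha> by (auto simp: vec_eq_iff forall_3 comp n_plus_def n_minus_def \<theta>_def A_def)
  qed
  moreover have "2 / sqrt A * (sin \<alpha> - \<alpha> * cos \<alpha>) \<le> x" if "x \<in> X" for x
    using that c0_path_ge[OF \<sigma>] unfolding X_def A_def \<alpha>_def by auto
  ultimately have "Inf X = 2 / sqrt A * (sin \<alpha> - \<alpha> * cos \<alpha>)"
    by (rule cInf_eq_minimum)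
  then show ?thesis by (simp add: c0_def X_def A_def \<alpha>_def)
qed

section \<open>The limit configuration\<close>

text \<open>The zigzag of period \<open>2 * l\<close> that equals \<open>x\<close> for
  \<open>\<bar>x\<bar> \<le> l / 2\<close>: a periodic primitive of
  \<open>square_wave l 0\<close>.\<close>

definition triangle_wave :: "real \<Rightarrow> real \<Rightarrow> real" where
  "triangle_wave l x = l / pi * arcsin (sin (pi * x / l))"

lemma triangle_wave_half_period: "l > 0 \<Longrightarrow> triangle_wave l (x + l) = - triangle_wave l x"
proof -
  assume l: "l > 0"
  have "pi * (x + l) / l = pi * x / l + pi" using l by (simp add: field_simps)
  then show ?thesis by (simp add: triangle_wave_def arcsin_minus)
qed

lemma triangle_wave_periodic: "l > 0 \<Longrightarrow> triangle_wave l (x + 2 * l) = triangle_wave l x"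
  using triangle_wave_half_period[of l "x + l"] triangle_wave_half_period[of l x]
  by (simp add: add.assoc)

lemma triangle_wave_continuous: "l > 0 \<Longrightarrow> continuous_on S (triangle_wave l)"
  unfolding triangle_wave_def by (intro continuous_intros) auto

lemma triangle_wave_measurable [measurable]: "l > 0 \<Longrightarrow> triangle_wave l \<in> borel_measurable borel"
  by (intro borel_measurable_continuous_onI triangle_wave_continuous)

text \<open>The derivative of the arcsine contributes one over the modulus of the cosine, the inner
  derivative the cosine; the quotient is its sign.\<close>

lemma triangle_wave_deriv:
  assumes l: "l > 0" and x: "square_wave l 0 x \<noteq> 0"
  shows "(triangle_wave l has_real_derivative square_wave l 0 x) (at x)"
proof -
  have c: "cos (pi * x / l) \<noteq> 0" using x by (auto simp: square_wave_def)
  have sc: "1 - (sin (pi * x / l))\<^sup>2 = (cos (pi * x / l))\<^sup>2" by (simp add: cos_squared_eq)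
  have "(cos (pi * x / l))\<^sup>2 > 0" using c by simp
  then have "(sin (pi * x / l))\<^sup>2 < 1" using sc by linarith
  then have s: "-1 < sin (pi * x / l)" "sin (pi * x / l) < 1"
    by (auto simp: abs_square_less_1 abs_less_iff)
  have "(triangle_wave l has_real_derivative
     l / pi * (inverse (sqrt (1 - (sin (pi * x / l))\<^sup>2)) * (cos (pi * x / l) * (pi / l)))) (at x)"
    unfolding triangle_wave_def using s l
    by (intro DERIV_cmult DERIV_chain2[OF DERIV_arcsin]) (auto intro!: derivative_eq_intros)
  also have "l / pi * (inverse (sqrt (1 - (sin (pi * x / l))\<^sup>2)) * (cos (pi * x / l) * (pi / l))) = square_wave l 0 x"
    unfolding sc using l c by (simp add: square_wave_def real_sgn_eq field_simps)
  finally show ?thesis .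
qed

lemma square_wave_nonzero:
  assumes l: "l > 0" and x: "x \<in> {-l<..<l} - {l / 2, - l / 2}"
  shows "square_wave l 0 x \<noteq> 0"
proof (cases "\<bar>x\<bar> < l / 2")
  case True then show ?thesis using square_wave_eq_1[OF l, of x 0] by simp
next
  case False
  then have "l / 2 < \<bar>x\<bar>" using x by (auto simp: abs_if split: if_splits)
  then show ?thesis using square_wave_eq_neg_1[OF l, of x 0] x by (auto simp: abs_if split: if_splits)
qed

text \<open>On the jump lines the square wave is zero and the vector leaves the sphere; the
  constraints hold almost everywhere.\<close>

definition limit_director :: "real \<Rightarrow> real \<Rightarrow> real \<times> real \<Rightarrow> real^3" where
  "limit_director \<sigma> l p = vector [nbar \<sigma> * square_wave l 0 (fst p), 0, A0 \<sigma>]"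

definition limit_layer :: "real \<Rightarrow> real \<Rightarrow> real \<times> real \<Rightarrow> real" where
  "limit_layer \<sigma> l p = - nbar \<sigma> * triangle_wave l (fst p)"

lemma limit_director_nth:
  "limit_director \<sigma> l p $ 1 = nbar \<sigma> * square_wave l 0 (fst p)"
  "limit_director \<sigma> l p $ 2 = 0" "limit_director \<sigma> l p $ 3 = A0 \<sigma>"
  by (simp_all add: limit_director_def)

lemma measurable_real3:
  fixes f :: "'a \<Rightarrow> real^3"
  assumes "\<And>i. (\<lambda>x. f x $ i) \<in> borel_measurable M"
  shows "f \<in> borel_measurable M"
  using assms by (subst borel_measurable_euclidean_space) (auto simp: Basis_vec_def inner_axis)

lemma measurable_vec_nth:
  fixes f :: "'a \<Rightarrow> real^3"
  assumes "f \<in> borel_measurable M"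
  shows "(\<lambda>x. f x $ i) \<in> borel_measurable M"
  using borel_measurable_continuous_on[OF _ assms, of "\<lambda>v. v $ i"] by (simp add: continuous_on_component)

lemma limit_director_measurable [measurable]: "limit_director \<sigma> l \<in> borel_measurable borel"
proof (rule measurable_real3)
  fix i :: 3
  show "(\<lambda>p. limit_director \<sigma> l p $ i) \<in> borel_measurable borel"
    using exhaust_3[of i] by (auto simp: limit_director_nth)
qed

text \<open>The translation \<open>c\<close> allows the limit to be shifted towards a minimizer,
  whose gradient then stays as it is. The exceptional points are zeros of a cosine in a bounded
  interval, hence finite in number.\<close>

lemma limit_layer_weak_grad:
  assumes l: "l > 0"
  shows "(\<lambda>p. - m * triangle_wave l (fst p + c)) \<in> W12 l"
    "has_weak_grad l (\<lambda>p. - m * triangle_wave l (fst p + c)) (\<lambda>p. (- m * square_wave l (- c) (fst p), 0))"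
proof -
  define S where "S = {x \<in> {-l<..<l}. square_wave l 0 (x + c) = 0}"
  have sq: "square_wave l (- c) x = square_wave l 0 (x + c)" for x by (simp add: square_wave_def)
  have fin: "finite S"
  proof -
    have "S \<subseteq> (\<lambda>i::int. l * of_int i / 2 - c) ` {\<lfloor>2 * (c - l) / l\<rfloor>..\<lceil>2 * (c + l) / l\<rceil>}"
    proof
      fix x assume x: "x \<in> S"
      then have "cos (pi * (x + c) / l) = 0" by (auto simp: S_def square_wave_def sgn_zero_iff)
      then obtain i :: int where "pi * (x + c) / l = of_int i * (pi / 2)"
        unfolding cos_zero_iff_int by blast
      then have "pi * ((x + c) / l) = pi * (of_int i / 2)" by simp
      then have "(x + c) / l = of_int i / 2" by (subst (asm) mult_left_cancel) auto
      then have i: "of_int i = 2 * (x + c) / l" "x = l * of_int i / 2 - c" using l by (auto simp: field_simps)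
      have "2 * (c - l) / l \<le> of_int i" "of_int i \<le> 2 * (c + l) / l"
        unfolding i(1) using x l by (auto simp: S_def intro!: divide_right_mono)
      then have "i \<in> {\<lfloor>2 * (c - l) / l\<rfloor>..\<lceil>2 * (c + l) / l\<rceil>}"
        by (auto simp: floor_le_iff le_ceiling_iff)
      with i(2) show "x \<in> (\<lambda>i::int. l * of_int i / 2 - c) ` {\<lfloor>2 * (c - l) / l\<rfloor>..\<lceil>2 * (c + l) / l\<rceil>}" by blast
    qed
    then show ?thesis by (rule finite_subset) simp
  qed
  note [measurable] = triangle_wave_measurable[OF l]
  have cont: "continuous_on {-l..l} (\<lambda>x. - m * triangle_wave l (x + c))"
    by (intro continuous_intros continuous_on_compose2[OF triangle_wave_continuous[OF l, of UNIV]]) auto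
  have der: "((\<lambda>x. - m * triangle_wave l (x + c)) has_real_derivative - m * square_wave l (- c) x) (at x)"
    if "x \<in> {-l<..<l} - S" for x
  proof -
    have "((\<lambda>x. triangle_wave l (x + c)) has_real_derivative square_wave l 0 (x + c)) (at x)"
      using triangle_wave_deriv[OF l, of "x + c"] that unfolding DERIV_shift[symmetric] by (simp add: S_def)
    then show ?thesis unfolding sq by (rule DERIV_cmult)
  qed
  have b: "\<bar>- m * square_wave l (- c) x\<bar> \<le> \<bar>m\<bar>" for x
    using square_wave_bound[of l "- c" x] by (simp add: abs_mult mult_left_le)
  have per: "- m * triangle_wave l (x + 2 * l + c) = - m * triangle_wave l (x + c)"
    "- m * square_wave l (- c) (x + 2 * l) = - m * square_wave l (- c) x" for x
    using triangle_wave_periodic[OF l, of "x + c"] square_wave_periodic[OF l, of "- c" x] by (auto simp: add_ac)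
  have m: "(\<lambda>x. - m * triangle_wave l (x + c)) \<in> borel_measurable borel"
    "(\<lambda>x. - m * square_wave l (- c) x) \<in> borel_measurable borel"
    by measurable
  note * = has_weak_grad_of_fst[OF l fin cont der m(1) m(2) b per]
  from *(1) show "(\<lambda>p. - m * triangle_wave l (fst p + c)) \<in> W12 l" by simp
  from *(2) show "has_weak_grad l (\<lambda>p. - m * triangle_wave l (fst p + c)) (\<lambda>p. (- m * square_wave l (- c) (fst p), 0))"
    by simp
qed

text \<open>The pairing sees only the jumps. In the second variable everything integrates to zero by
  periodicity. In the first, the constant \<open>a\<close> drops out, and the jumps of height
  \<open>2 * b\<close> at \<open>l / 2\<close> and \<open>- l / 2\<close> leave the values of \<phi>
  there.\<close>

lemma step_divergence_pairing:
  assumes l: "l > 0" and u: "u \<in> borel_measurable borel" "AE p in torus l. u p = a + b * square_wave l 0 (fst p)"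
    and \<phi>: "C1_torus l \<phi> D" and \<psi>: "C1_torus l \<psi> E"
  shows "(LINT p:cell l|lborel. u p * (fst (D p) + snd (E p))) = 2 * b * (\<integral>y. \<phi> (l / 2, y) - \<phi> (- l / 2, y) \<partial>circle l)"
proof -
  note [measurable] = u(1) C1_torus_measurable[OF \<phi>] C1_torus_measurable[OF \<psi>]
  obtain B where B: "\<forall>p \<in> {-l..l} \<times> {-l..l}. \<bar>\<phi> p\<bar> \<le> B \<and> norm (D p) \<le> B"
    by (rule C1_torus_bounded[OF \<phi>])
  obtain B' where B': "\<forall>p \<in> {-l..l} \<times> {-l..l}. \<bar>\<psi> p\<bar> \<le> B' \<and> norm (E p) \<le> B'"
    by (rule C1_torus_bounded[OF \<psi>])
  have Bf: "\<bar>fst (D p)\<bar> \<le> B" "\<bar>snd (E p)\<bar> \<le> B'" if "p \<in> {-l..l} \<times> {-l..l}" for p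
    using B B' that norm_fst_le[of "fst (D p)" "snd (D p)"] norm_snd_le[of "snd (E p)" "fst (E p)"]
    by (auto intro: order_trans)
  have p\<phi>: "\<phi> (x + 2 * l, y) = \<phi> (x, y)" "\<psi> (x, y + 2 * l) = \<psi> (x, y)" for x y
    using \<phi> \<psi> by (auto simp: C1_torus_def periodic_def)
  define h where "h x = a + b * square_wave l 0 x" for x
  have hm [measurable]: "h \<in> borel_measurable borel" unfolding h_def by measurable
  have hb: "\<bar>h x\<bar> \<le> \<bar>a\<bar> + \<bar>b\<bar>" for x
  proof -
    have "\<bar>b * square_wave l 0 x\<bar> \<le> \<bar>b\<bar>" using square_wave_bound[of l 0 x] by (simp add: abs_mult mult_left_le)
    then show ?thesis unfolding h_def by linarith
  qed
  have meas: "D \<in> borel_measurable (borel \<Otimes>\<^sub>M borel)" "E \<in> borel_measurable (borel \<Otimes>\<^sub>M borel)"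
    using C1_torus_measurable[OF \<phi>] C1_torus_measurable[OF \<psi>] by (auto simp: borel_prod)
  have [measurable]: "(\<lambda>x. D (x, y)) \<in> borel_measurable borel" "(\<lambda>y. E (x, y)) \<in> borel_measurable borel" for x y
    using meas by measurable
  have ih: "integrable (torus l) (\<lambda>p. h (fst p))"
    by (rule integrable_torus_of_fst[OF integrable_circle_bounded[OF hm hb]])
  have i1: "integrable (torus l) (\<lambda>p. h (fst p) * fst (D p))"
    using integrable_bounded_linear[OF bounded_linear_fst C1_torus_integrable(1)[OF \<phi> ih]] by simp
  have i2: "integrable (torus l) (\<lambda>p. h (fst p) * snd (E p))"
    using integrable_bounded_linear[OF bounded_linear_snd C1_torus_integrable(1)[OF \<psi> ih]] by simp
  have um: "(\<lambda>p. u p * (fst (D p) + snd (E p))) \<in> borel_measurable borel" by measurable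
  have "(LINT p:cell l|lborel. u p * (fst (D p) + snd (E p))) = (\<integral>p. u p * (fst (D p) + snd (E p)) \<partial>torus l)"
    by (rule set_integral_cell[OF um])
  also have "\<dots> = (\<integral>p. h (fst p) * fst (D p) + h (fst p) * snd (E p) \<partial>torus l)"
  proof (rule integral_cong_AE)
    show "AE p in torus l. u p * (fst (D p) + snd (E p)) = h (fst p) * fst (D p) + h (fst p) * snd (E p)"
      using u(2) by eventually_elim (simp add: h_def algebra_simps)
  qed (use um borel_measurable_integrable[OF Bochner_Integration.integrable_add[OF i1 i2]] in \<open>auto simp: measurable_torus\<close>)
  also have "\<dots> = (\<integral>p. h (fst p) * fst (D p) \<partial>torus l) + (\<integral>p. h (fst p) * snd (E p) \<partial>torus l)"
    by (rule Bochner_Integration.integral_add[OF i1 i2])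
  also have "(\<integral>p. h (fst p) * snd (E p) \<partial>torus l) = 0"
  proof -
    have "AE x in circle l. (\<integral>y. h x * snd (E (x, y)) \<partial>circle l) = 0"
      using AE_circle_segment
    proof eventually_elim
      case (elim x)
      have "(\<integral>y. snd (E (x, y)) \<partial>circle l) = \<psi> (x, l) - \<psi> (x, -l)"
      proof (rule integral_circle_FTC[OF l, where S="{}" and C=B'])
        show "continuous_on {-l..l} (\<lambda>y. \<psi> (x, y))"
          using C1_torus_partial(2)[OF \<psi>]
          by (intro continuous_at_imp_continuous_on) (auto intro: DERIV_isCont)
      qed (use C1_torus_partial(2)[OF \<psi>] Bf elim in auto)
      then show ?case using p\<phi>(2)[of x "-l"] by simp
    qed
    with integral_torus_fst[OF i2] show ?thesis by (simp add: integral_eq_zero_AE)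
  qed
  also have "(\<integral>p. h (fst p) * fst (D p) \<partial>torus l) = (\<integral>y. \<integral>x. h x * fst (D (x, y)) \<partial>circle l \<partial>circle l)"
    using integral_torus_snd[OF i1] by simp
  also have "\<dots> = (\<integral>y. 2 * b * (\<phi> (l / 2, y) - \<phi> (- l / 2, y)) \<partial>circle l)"
  proof (rule integral_cong_AE)
    show "AE y in circle l. (\<integral>x. h x * fst (D (x, y)) \<partial>circle l) = 2 * b * (\<phi> (l / 2, y) - \<phi> (- l / 2, y))"
      using AE_circle_segment
    proof eventually_elim
      case (elim y)
      \<comment> \<open>Clamping to the middle interval. Composed with \<open>r\<close>, \<phi>
        keeps its x-derivative inside and has derivative zero outside, so
        \<open>2 * \<phi> (r x, y) - \<phi> (x, y)\<close> has the derivative of \<phi> multiplied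
        by the square wave.\<close>
      define r where "r x = max (- l / 2) (min (l / 2) x)" for x
      define F where "F x = a * \<phi> (x, y) + b * (2 * \<phi> (r x, y) - \<phi> (x, y))" for x
      have cont\<phi>: "continuous_on UNIV (\<lambda>x. \<phi> (x, y))"
        using C1_torus_partial(1)[OF \<phi>] by (intro continuous_at_imp_continuous_on) (auto intro: DERIV_isCont)
      have d\<phi>: "((\<lambda>x. \<phi> (x, y)) has_real_derivative fst (D (x, y))) (at x)" for x
        by (rule C1_torus_partial(1)[OF \<phi>])
      have "(\<integral>x. h x * fst (D (x, y)) \<partial>circle l) = F l - F (-l)"
      proof (rule integral_circle_FTC[OF l, where S="{l / 2, - l / 2}" and C="(\<bar>a\<bar> + \<bar>b\<bar>) * B"])
        show "continuous_on {-l..l} F"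
          unfolding F_def r_def
          by (intro continuous_intros continuous_on_subset[OF cont\<phi>] continuous_on_compose2[OF cont\<phi>]) auto
        show "(F has_real_derivative h x * fst (D (x, y))) (at x)" if x: "x \<in> {-l<..<l} - {l / 2, - l / 2}" for x
        proof -
          have inner: "((\<lambda>x. \<phi> (r x, y)) has_real_derivative (if \<bar>x\<bar> < l / 2 then fst (D (x, y)) else 0)) (at x)"
          proof (cases "\<bar>x\<bar> < l / 2")
            case True
            have "((\<lambda>x. \<phi> (r x, y)) has_real_derivative fst (D (x, y))) (at x)"
              by (rule DERIV_cong_ev[THEN iffD1, OF refl _ refl d\<phi>])
                 (use True in \<open>auto simp: r_def eventually_nhds intro!: exI[of _ "{- l / 2<..<l / 2}"]\<close>)
            then show ?thesis using True by simp
          next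
            case False
            then consider "x > l / 2" | "x < - l / 2" using x by (auto simp: abs_if split: if_splits)
            then have "((\<lambda>x. \<phi> (r x, y)) has_real_derivative 0) (at x)"
            proof cases
              case 1
              show ?thesis
                by (rule DERIV_cong_ev[THEN iffD1, OF refl _ refl DERIV_const[of "\<phi> (l / 2, y)"]])
                   (use 1 l in \<open>auto simp: r_def eventually_nhds intro!: exI[of _ "{l / 2<..}"]\<close>)
            next
              case 2
              show ?thesis
                by (rule DERIV_cong_ev[THEN iffD1, OF refl _ refl DERIV_const[of "\<phi> (- l / 2, y)"]])
                   (use 2 l in \<open>auto simp: r_def eventually_nhds intro!: exI[of _ "{..< - l / 2}"]\<close>)
            qed
            then show ?thesis using False by simp
          qed
          have sq: "square_wave l 0 x = (if \<bar>x\<bar> < l / 2 then 1 else - 1)"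
            using x square_wave_eq_1[OF l, of x 0] square_wave_eq_neg_1[OF l, of x 0] by (auto simp: abs_if split: if_splits)
          have "(F has_real_derivative a * fst (D (x, y)) + b * (2 * (if \<bar>x\<bar> < l / 2 then fst (D (x, y)) else 0) - fst (D (x, y)))) (at x)"
            unfolding F_def by (intro DERIV_add DERIV_cmult DERIV_diff inner d\<phi>)
          then show ?thesis by (rule DERIV_cong) (simp add: h_def sq algebra_simps)
        qed
        show "\<bar>h x * fst (D (x, y))\<bar> \<le> (\<bar>a\<bar> + \<bar>b\<bar>) * B" if "x \<in> {-l..l}" for x
          unfolding abs_mult using hb[of x] Bf(1)[of "(x, y)"] that elim by (intro mult_mono) auto
      qed (simp, measurable)
      also have "\<dots> = 2 * b * (\<phi> (l / 2, y) - \<phi> (- l / 2, y))"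
        using p\<phi>(1)[of "-l" y] l by (simp add: F_def r_def max_def min_def algebra_simps)
      finally show ?case .
    qed
    show "(\<lambda>y. \<integral>x. h x * fst (D (x, y)) \<partial>circle l) \<in> borel_measurable (circle l)"
      using borel_measurable_integrable[OF integrable_torus_snd[OF i1]] by simp
    have "\<phi> \<in> borel_measurable (borel \<Otimes>\<^sub>M borel)" using C1_torus_measurable[OF \<phi>] by (simp add: borel_prod)
    then show "(\<lambda>y. 2 * b * (\<phi> (l / 2, y) - \<phi> (- l / 2, y))) \<in> borel_measurable (circle l)" by measurable
  qed
  finally show ?thesis by simp
qed

text \<open>\<phi> is bounded by one, so its values on the two jump lines differ by at most two, and
  the lines have length \<open>2 * l\<close>.\<close>

lemma step_variation_le:
  assumes l: "l > 0" and u: "u \<in> borel_measurable borel" "AE p in torus l. u p = a + b * square_wave l 0 (fst p)"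
    and \<phi>: "C1_torus l \<phi> D" and \<psi>: "C1_torus l \<psi> E" and le: "\<forall>p. norm (\<phi> p, \<psi> p) \<le> 1"
  shows "(LINT p:cell l|lborel. u p * (fst (D p) + snd (E p))) \<le> 8 * l * \<bar>b\<bar>"
proof -
  have p1: "\<bar>\<phi> p\<bar> \<le> 1" for p
    using le[rule_format, of p] norm_fst_le[of "\<phi> p" "\<psi> p"] by simp
  have m: "(\<lambda>y. \<phi> (x, y)) \<in> borel_measurable borel" for x
  proof -
    have "\<phi> \<in> borel_measurable (borel \<Otimes>\<^sub>M borel)" using C1_torus_measurable[OF \<phi>] by (simp add: borel_prod)
    then show ?thesis by measurable
  qed
  have i: "integrable (circle l) (\<lambda>y. \<phi> (x, y))" for x
    by (rule integrable_circle_bounded[OF m p1])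
  have "\<bar>\<integral>y. \<phi> (l / 2, y) - \<phi> (- l / 2, y) \<partial>circle l\<bar> \<le> (\<integral>y. \<bar>\<phi> (l / 2, y) - \<phi> (- l / 2, y)\<bar> \<partial>circle l)"
    using integral_norm_bound[of "circle l" "\<lambda>y. \<phi> (l / 2, y) - \<phi> (- l / 2, y)"] by simp
  also have "\<dots> \<le> (\<integral>y. 2 \<partial>circle l)"
  proof (rule integral_mono)
    show "\<bar>\<phi> (l / 2, y) - \<phi> (- l / 2, y)\<bar> \<le> 2" for y using p1[of "(l / 2, y)"] p1[of "(- l / 2, y)"] by linarith
  qed (use i in auto)
  also have "\<dots> = 4 * l" using l by (simp add: measure_circle)
  finally have *: "\<bar>\<integral>y. \<phi> (l / 2, y) - \<phi> (- l / 2, y) \<partial>circle l\<bar> \<le> 4 * l" .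
  have "2 * b * (\<integral>y. \<phi> (l / 2, y) - \<phi> (- l / 2, y) \<partial>circle l)
      \<le> \<bar>2 * b\<bar> * \<bar>\<integral>y. \<phi> (l / 2, y) - \<phi> (- l / 2, y) \<partial>circle l\<bar>"
    unfolding abs_mult[symmetric] by (rule abs_ge_self)
  also have "\<dots> \<le> \<bar>2 * b\<bar> * (4 * l)" using * by (intro mult_left_mono) auto
  finally show ?thesis unfolding step_divergence_pairing[OF l u \<phi> \<psi>] by (simp add: abs_mult mult_ac)
qed

lemma step_BV:
  assumes l: "l > 0" and u: "u \<in> L1 l" "AE p in torus l. u p = a + b * square_wave l 0 (fst p)"
  shows "u \<in> BV l"
proof -
  have m: "u \<in> borel_measurable borel" using u(1) by (simp add: L1_iff)
  have "total_variation l u \<le> ereal (8 * l * \<bar>b\<bar>)"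
    unfolding total_variation_def using step_variation_le[OF l m u(2)] by (auto intro!: Sup_least)
  also have "\<dots> < \<infinity>" by simp
  finally show ?thesis using u(1) by (simp add: BV_def)
qed

lemma C1_circle_neg_sin: "l > 0 \<Longrightarrow> C1_circle l (\<lambda>x. - sin (pi * x / l)) (\<lambda>x. - (cos (pi * x / l) * (pi / l)))"
proof -
  assume l: "l > 0"
  have "pi * (x + 2 * l) / l = pi * x / l + 2 * pi" for x using l by (simp add: field_simps)
  then have "sin (pi * (x + 2 * l) / l) = sin (pi * x / l)" for x by simp
  moreover have "continuous_on UNIV (\<lambda>x. - (cos (pi * x / l) * (pi / l)))"
    using l by (intro continuous_intros) auto
  moreover have "((\<lambda>x. - sin (pi * x / l)) has_real_derivative - (cos (pi * x / l) * (pi / l))) (at x)" for x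
    using l by (auto intro!: derivative_eq_intros)
  ultimately show ?thesis by (simp add: C1_circle_def)
qed

lemma limit_director_eq_minus:
  "\<sigma> > 0 \<Longrightarrow> limit_director \<sigma> l p = n_minus \<sigma> \<longleftrightarrow> square_wave l 0 (fst p) = - 1"
  using nbar_pos[of \<sigma>] mult_cancel_left[of "nbar \<sigma>" "square_wave l 0 (fst p)" "- 1"]
  by (simp add: vec_eq_iff forall_3 limit_director_nth n_minus_def)

lemma limit_director_eq_plus:
  "\<sigma> > 0 \<Longrightarrow> limit_director \<sigma> l p = n_plus \<sigma> \<longleftrightarrow> square_wave l 0 (fst p) = 1"
  using nbar_pos[of \<sigma>] by (auto simp: vec_eq_iff forall_3 limit_director_nth n_plus_def)

lemma square_wave_cases: "square_wave l c x = 1 \<or> square_wave l c x = - 1 \<or> square_wave l c x = 0"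
  by (auto simp: square_wave_def sgn_if)

lemma AE_torus_square_wave: "l > 0 \<Longrightarrow> AE p::real\<times>real in lborel. square_wave l c (fst p) = 1 \<or> square_wave l c (fst p) = - 1"
proof -
  assume l: "l > 0"
  have "AE x in circle l. square_wave l c x \<noteq> 0" by (rule AE_circle_lborel[OF AE_square_wave_nonzero[OF l]])
  from AE_torus_fst[OF this] have "AE p in torus l. square_wave l c (fst p) = 1 \<or> square_wave l c (fst p) = - 1"
    by eventually_elim (use square_wave_cases in blast)
  then show ?thesis
    by (rule AE_lborel_periodic2[OF l]) (simp add: periodic_def square_wave_periodic[OF l])
qed

text \<open>The indicator is one half minus half the square wave, which bounds the variation by
  \<open>4 * l\<close>. The field with first component \<open>- sin (pi * x / l)\<close> takes the
  values \<open>- 1\<close> and \<open>1\<close> on the two jump lines and attains the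
  bound.\<close>

lemma perimeter_limit:
  assumes l: "l > 0" and \<sigma>: "\<sigma> > 0"
  shows "perimeter l {p. limit_director \<sigma> l p = n_minus \<sigma>} = ereal (4 * l)"
proof -
  define S where "S = {p :: real \<times> real. square_wave l 0 (fst p) = - 1}"
  have [measurable]: "S \<in> sets borel" unfolding S_def by measurable
  have m: "(indicator S :: real \<times> real \<Rightarrow> real) \<in> borel_measurable borel" by simp
  have ae: "AE p in torus l. indicator S p = 1 / 2 + (- 1 / 2) * square_wave l 0 (fst p)"
    using AE_torus_lborel[OF AE_torus_square_wave[OF l, of 0]] by eventually_elim (auto simp: S_def indicator_def)
  have "total_variation l (indicator S) = ereal (4 * l)"
    unfolding total_variation_def
  proof (rule Sup_eqI)
    fix y assume "y \<in> {ereal (LINT p:cell l|lborel. indicator S p * (fst (D p) + snd (E p))) | \<phi> \<psi> D E.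
            C1_torus l \<phi> D \<and> C1_torus l \<psi> E \<and> (\<forall>p. norm (\<phi> p, \<psi> p) \<le> 1)}"
    then show "y \<le> ereal (4 * l)" using step_variation_le[OF l m ae] by auto
  next
    fix y assume y: "\<And>z. z \<in> {ereal (LINT p:cell l|lborel. indicator S p * (fst (D p) + snd (E p))) | \<phi> \<psi> D E.
            C1_torus l \<phi> D \<and> C1_torus l \<psi> E \<and> (\<forall>p. norm (\<phi> p, \<psi> p) \<le> 1)} \<Longrightarrow> z \<le> y"
    define \<phi> where "\<phi> = (\<lambda>p::real\<times>real. - sin (pi * fst p / l) * 1)"
    define D where "D = (\<lambda>p::real\<times>real. (- (cos (pi * fst p / l) * (pi / l)) * 1, - sin (pi * fst p / l) * (0::real)))"
    have const: "C1_circle l (\<lambda>_. 1) (\<lambda>_. 0)" by (simp add: C1_circle_def)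
    have \<phi>: "C1_torus l \<phi> D" unfolding \<phi>_def D_def by (rule C1_torus_prod[OF C1_circle_neg_sin[OF l] const])
    have zero: "C1_torus l (\<lambda>_. 0) (\<lambda>_. 0)"
      by (auto simp: C1_torus_def periodic_def gderiv_def)
    have "(LINT p:cell l|lborel. indicator S p * (fst (D p) + snd (0, 0)))
      = 2 * (- 1 / 2) * (\<integral>y. \<phi> (l / 2, y) - \<phi> (- l / 2, y) \<partial>circle l)"
      using step_divergence_pairing[OF l m ae \<phi> zero] by (simp add: zero_prod_def)
    also have "\<dots> = 4 * l" using l by (simp add: \<phi>_def measure_circle)
    finally have e: "(LINT p:cell l|lborel. indicator S p * (fst (D p) + snd (0, 0))) = 4 * l" .
    have "ereal (4 * l) \<in> {ereal (LINT p:cell l|lborel. indicator S p * (fst (D p) + snd (E p))) | \<phi> \<psi> D E.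
            C1_torus l \<phi> D \<and> C1_torus l \<psi> E \<and> (\<forall>p. norm (\<phi> p, \<psi> p) \<le> 1)}"
      by (rule CollectI, rule exI[of _ \<phi>], rule exI[of _ "\<lambda>_. 0"], rule exI[of _ D], rule exI[of _ "\<lambda>_. (0, 0)"])
         (use \<phi> zero e in \<open>auto simp: \<phi>_def zero_prod_def norm_prod_def\<close>)
    then show "ereal (4 * l) \<le> y" by (rule y)
  qed
  then show ?thesis unfolding perimeter_def limit_director_eq_minus[OF \<sigma>] S_def .
qed

section \<open>Admissibility and energy of the limit\<close>

lemma limit_director_L1_sphere:
  assumes l: "l > 0" and \<sigma>: "\<sigma> > 0"
  shows "limit_director \<sigma> l \<in> L1_sphere l"
proof -
  have n: "norm (limit_director \<sigma> l p) = sqrt ((nbar \<sigma>)\<^sup>2 * (square_wave l 0 (fst p))\<^sup>2 + (A0 \<sigma>)\<^sup>2)" for p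
    by (simp add: norm_real3 limit_director_nth power_mult_distrib)
  have sq: "(square_wave l 0 x)\<^sup>2 \<le> 1" for x
    using square_wave_bound[of l 0 x] by (simp add: abs_square_le_1)
  have le: "norm (limit_director \<sigma> l p) \<le> 1" for p
  proof -
    have "(nbar \<sigma>)\<^sup>2 * (square_wave l 0 (fst p))\<^sup>2 \<le> (nbar \<sigma>)\<^sup>2 * 1" by (intro mult_left_mono sq) auto
    then show ?thesis unfolding n using nbar_square[OF \<sigma>] by simp
  qed
  have "AE p in lborel. norm (limit_director \<sigma> l p) = 1"
    using AE_torus_square_wave[OF l, of 0] by eventually_elim (auto simp: n nbar_square[OF \<sigma>])
  moreover have "integrable (torus l) (limit_director \<sigma> l)"
    by (rule torus_fin.integrable_const_bound[where B=1]) (use le in \<open>auto simp: measurable_torus\<close>)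
  moreover have "periodic l (limit_director \<sigma> l)"
    by (simp add: periodic_def limit_director_def square_wave_periodic[OF l])
  ultimately show ?thesis by (simp add: L1_sphere_def L1_iff)
qed

lemma limit_layer_W12: "l > 0 \<Longrightarrow> limit_layer \<sigma> l \<in> W12 l"
  using limit_layer_weak_grad(1)[of l "nbar \<sigma>" 0] by (simp add: limit_layer_def[abs_def])

lemma weak_dx_limit_layer:
  assumes l: "l > 0"
  shows "AE p in lborel. weak_dx l (limit_layer \<sigma> l) p = - nbar \<sigma> * square_wave l 0 (fst p)"
proof (rule AE_lborel_periodic2[OF l])
  have V: "has_weak_grad l (limit_layer \<sigma> l) (\<lambda>p. (- nbar \<sigma> * square_wave l 0 (fst p), 0))"
    using limit_layer_weak_grad(2)[OF l, of "nbar \<sigma>" 0] by (simp add: limit_layer_def[abs_def])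
  show "AE p in torus l. weak_dx l (limit_layer \<sigma> l) p = - nbar \<sigma> * square_wave l 0 (fst p)"
    using weak_grad_AE_eq[OF l limit_layer_W12[OF l] V] by eventually_elim (simp add: weak_dx_def)
  have "periodic l (weak_grad l (limit_layer \<sigma> l))"
    using weak_grad_L2[OF l limit_layer_W12[OF l]] by (simp add: L2_iff)
  then show "periodic l (\<lambda>p. weak_dx l (limit_layer \<sigma> l) p = - nbar \<sigma> * square_wave l 0 (fst p))"
    by (simp add: periodic_def weak_dx_def square_wave_periodic[OF l])
qed

lemma limit_in_A_space:
  assumes l: "l > 0" and \<sigma>: "\<sigma> > 0"
  shows "(limit_director \<sigma> l, limit_layer \<sigma> l) \<in> A_space \<sigma> l"
proof -
  let ?n = "limit_director \<sigma> l" and ?g = "limit_layer \<sigma> l"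
  have nL: "?n \<in> L1 l" using limit_director_L1_sphere[OF l \<sigma>] by (simp add: L1_sphere_def)
  have comp: "(\<lambda>p. ?n p $ i) \<in> L1 l" for i
    using nL integrable_bounded_linear[OF bounded_linear_vec_nth, of "torus l" ?n i] measurable_vec_nth[of ?n borel i]
    by (auto simp: L1_iff periodic_def)
  have bv: "(\<lambda>p. ?n p $ i) \<in> BV l" for i
  proof -
    consider "i = 1" | "i = 2" | "i = 3" using exhaust_3[of i] by auto
    then show ?thesis
    proof cases
      case 1
      then show ?thesis using step_BV[OF l comp[of 1], of 0 "nbar \<sigma>"] by (simp add: limit_director_nth)
    next
      case 2
      then show ?thesis using step_BV[OF l comp[of 2], of 0 0] by (simp add: limit_director_nth)
    next
      case 3
      then show ?thesis using step_BV[OF l comp[of 3], of "A0 \<sigma>" 0] by (simp add: limit_director_nth)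
    qed
  qed
  have K: "AE p in lborel. ?n p \<in> {n_plus \<sigma>, n_minus \<sigma>}"
    using AE_torus_square_wave[OF l, of 0]
    by eventually_elim (auto simp: limit_director_eq_minus[OF \<sigma>] limit_director_eq_plus[OF \<sigma>])
  have gx: "AE p in lborel. weak_dx l ?g p = - nbar \<sigma> * square_wave l 0 (fst p)" by (rule weak_dx_limit_layer[OF l])
  have gL: "weak_dx l ?g \<in> L1 l"
    using L1_components(1)[OF L2_imp_L1[OF weak_grad_L2[OF l limit_layer_W12[OF l]]]] by (simp add: weak_dx_def[abs_def])
  have gBV: "weak_dx l ?g \<in> BV l"
    by (rule step_BV[OF l gL, of 0 "- nbar \<sigma>"]) (use AE_torus_lborel[OF gx] in simp)
  have g2: "AE p in lborel. weak_dx l ?g p \<in> {nbar \<sigma>, - nbar \<sigma>}"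
    using gx AE_torus_square_wave[OF l, of 0] by eventually_elim auto
  have g3: "AE p in lborel. weak_dx l ?g p + ?n p $ 1 = 0"
    using gx by eventually_elim (simp add: limit_director_nth)
  have ox: "only_x ?g" "only_x ?n"
    unfolding only_x_def limit_layer_def limit_director_def by (auto intro!: exI[of _ "\<lambda>x. - nbar \<sigma> * triangle_wave l x"]
        exI[of _ "\<lambda>x. vector [nbar \<sigma> * square_wave l 0 x, 0, A0 \<sigma>]"])
  have "(LINT p:cell l|lborel. ?n p $ 1) = (\<integral>p. ?n p $ 1 \<partial>torus l)"
    using comp[of 1] by (intro set_integral_cell) (simp add: L1_iff)
  also have "\<dots> = (\<integral>y. \<integral>x. ?n (x, y) $ 1 \<partial>circle l \<partial>circle l)"
    using comp[of 1] by (intro integral_torus_snd[symmetric]) (simp add: L1_iff)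
  also have "\<dots> = 0" using integral_square_wave[OF l, of 0] by (simp add: limit_director_nth)
  finally have mean: "(LINT p:cell l|lborel. ?n p $ 1) = 0" .
  show ?thesis
    unfolding A_space_def BV_vec_def
    using bv K gBV g2 g3 ox mean limit_layer_W12[OF l] by (simp add: limit_director_nth)
qed

lemma G0_limit:
  assumes l: "l > 0" and \<sigma>: "\<sigma> > 0"
  shows "G0_energy \<sigma> l (limit_director \<sigma> l, limit_layer \<sigma> l) = ereal (8 * c0 \<sigma> * l)"
  using limit_in_A_space[OF l \<sigma>] perimeter_limit[OF l \<sigma>] by (simp add: G0_energy_def)

section \<open>The energy and a competitor with linear walls\<close>

lemma square_integrable_add:
  fixes f g :: "'a \<Rightarrow> real"
  assumes [measurable]: "f \<in> borel_measurable M" "g \<in> borel_measurable M"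
    and "integrable M (\<lambda>x. (f x)\<^sup>2)" "integrable M (\<lambda>x. (g x)\<^sup>2)"
  shows "integrable M (\<lambda>x. (f x + g x)\<^sup>2)"
proof (rule Bochner_Integration.integrable_bound)
  show "integrable M (\<lambda>x. 2 * (f x)\<^sup>2 + 2 * (g x)\<^sup>2)" using assms by auto
  have "(a + b)\<^sup>2 \<le> 2 * a\<^sup>2 + 2 * b\<^sup>2" for a b :: real
    using zero_le_power2[of "a - b"] by (simp add: power2_eq_square algebra_simps)
  then show "AE x in M. norm ((f x + g x)\<^sup>2) \<le> norm (2 * (f x)\<^sup>2 + 2 * (g x)\<^sup>2)" by (intro AE_I2) simp
qed simp

text \<open>The integrand of \<open>F_energy\<close>, named so that it can be integrated along
  single slices.\<close>

definition energy_density where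
  "energy_density \<sigma> l \<epsilon> n g p = \<epsilon> * (\<Sum>i\<in>UNIV. (norm (weak_grad l (\<lambda>q. n q $ i) p))\<^sup>2)
        + 1 / \<epsilon> * W \<sigma> (n p) + 1 / \<epsilon> * (weak_dx l g p + n p $ 1)\<^sup>2 + 1 / \<epsilon> * (weak_dy l g p + n p $ (2::3))\<^sup>2"

lemma Y_space_components:
  assumes l: "l > 0" and z: "(n, g) \<in> Y_space l"
  shows "(\<lambda>p. n p $ i) \<in> W12 l" "(\<lambda>p. n p $ i) \<in> L2 l" "n \<in> borel_measurable borel" "periodic l n"
    "g \<in> W12 l" "g \<in> L2 l"
    "weak_grad l (\<lambda>q. n q $ i) \<in> L2 l" "weak_dx l g \<in> L2 l" "weak_dy l g \<in> L2 l"
    "AE p in torus l. n p \<in> sphere 0 1"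
proof -
  have w: "\<And>i. (\<lambda>p. n p $ i) \<in> W12 l" and g: "g \<in> W12 l" and s: "AE p in lborel. n p \<in> sphere 0 1"
    using z by (auto simp: Y_space_def W12_sphere_def)
  have n2: "(\<lambda>p. n p $ i) \<in> L2 l" for i using w[of i] by (simp add: W12_def)
  show "(\<lambda>p. n p $ i) \<in> W12 l" "(\<lambda>p. n p $ i) \<in> L2 l" "g \<in> W12 l" "g \<in> L2 l"
    using w n2 g by (auto simp: W12_def)
  show "n \<in> borel_measurable borel" using n2 by (intro measurable_real3) (simp add: L2_iff)
  show "periodic l n" using n2 unfolding L2_iff periodic_def by (simp add: vec_eq_iff)
  show "weak_grad l (\<lambda>q. n q $ i) \<in> L2 l" by (rule weak_grad_L2[OF l w])
  show "weak_dx l g \<in> L2 l" "weak_dy l g \<in> L2 l"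
    using L2_components[OF weak_grad_L2[OF l g]] by (simp_all add: weak_dx_def[abs_def] weak_dy_def[abs_def])
  show "AE p in torus l. n p \<in> sphere 0 1" by (rule AE_torus_lborel[OF s])
qed

text \<open>Integrability ensures that \<open>F_energy\<close> is the actual energy and not the
  default value zero of a divergent integral.\<close>

lemma
  assumes l: "l > 0" and z: "(n, g) \<in> Y_space l"
  shows energy_density_integrable: "integrable (torus l) (energy_density \<sigma> l \<epsilon> n g)"
    and F_energy_torus: "F_energy \<sigma> l \<epsilon> n g = (\<integral>p. energy_density \<sigma> l \<epsilon> n g p \<partial>torus l)"
proof -
  note Y = Y_space_components[OF l z]
  have m: "(\<lambda>p. n p $ i) \<in> borel_measurable (torus l)" and m2: "integrable (torus l) (\<lambda>p. (n p $ i)\<^sup>2)" for i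
    using Y(2)[of i] by (auto simp: L2_iff measurable_torus)
  have gm: "weak_dx l g \<in> borel_measurable (torus l)" "weak_dy l g \<in> borel_measurable (torus l)"
    "integrable (torus l) (\<lambda>p. (weak_dx l g p)\<^sup>2)" "integrable (torus l) (\<lambda>p. (weak_dy l g p)\<^sup>2)"
    using Y(8,9) by (auto simp: L2_iff measurable_torus)
  have w2: "integrable (torus l) (\<lambda>p. (norm (weak_grad l (\<lambda>q. n q $ i) p))\<^sup>2)" for i
    using Y(7)[of i] by (simp add: L2_iff)
  have A: "integrable (torus l) (\<lambda>p. (n p $ 3 - A0 \<sigma>)\<^sup>2)"
    using square_integrable_add[OF m[of 3] _ m2[of 3], of "\<lambda>_. - A0 \<sigma>"] by simp
  show i: "integrable (torus l) (energy_density \<sigma> l \<epsilon> n g)"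
    unfolding energy_density_def[abs_def] W_def
    using w2 A m2 square_integrable_add[OF gm(1) m[of 1] gm(3) m2] square_integrable_add[OF gm(2) m[of 2] gm(4) m2]
    by (intro Bochner_Integration.integrable_add integrable_mult_right integrable_sum) auto
  then have "energy_density \<sigma> l \<epsilon> n g \<in> borel_measurable borel"
    using borel_measurable_integrable[OF i] by (simp add: measurable_torus)
  from set_integral_cell[OF this, of l]
  show "F_energy \<sigma> l \<epsilon> n g = (\<integral>p. energy_density \<sigma> l \<epsilon> n g p \<partial>torus l)"
    unfolding F_energy_def energy_density_def .
qed

text \<open>Minimality is tested on \<open>L1_sphere l \<times> L2 l\<close>; a competitor from
  \<open>Y_space\<close> belongs to it because its director is bounded and the torus has finite
  measure.\<close>

lemma minimizer_energy_le:
  assumes l: "l > 0" and z: "(n, g) \<in> Y_space l" and z': "(n', g') \<in> Y_space l"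
    and min: "minimizes_G \<sigma> l \<epsilon> (n, g)"
  shows "F_energy \<sigma> l \<epsilon> n g \<le> F_energy \<sigma> l \<epsilon> n' g'"
proof -
  note Y = Y_space_components[OF l z']
  have "integrable (torus l) n'"
    by (rule torus_fin.integrable_const_bound[where B=1])
       (use Y(3,10) in \<open>auto simp: measurable_torus elim!: eventually_mono\<close>)
  then have "n' \<in> L1_sphere l"
    using Y(3,4) z' by (auto simp: L1_sphere_def L1_iff Y_space_def W12_sphere_def)
  then have "G_energy \<sigma> l \<epsilon> (n, g) \<le> G_energy \<sigma> l \<epsilon> (n', g')"
    using min Y(6) by (auto simp: minimizes_G_def)
  then show ?thesis using z z' by (simp add: G_energy_def)
qed

section \<open>The competitor and its energy\<close>

lemma triangle_wave_eq: "l > 0 \<Longrightarrow> \<bar>x\<bar> \<le> l / 2 \<Longrightarrow> triangle_wave l x = x"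
proof -
  assume l: "l > 0" and x: "\<bar>x\<bar> \<le> l / 2"
  have "\<bar>x\<bar> / l \<le> 1 / 2" using l x by (simp add: field_simps)
  then have "pi * (\<bar>x\<bar> / l) \<le> pi * (1 / 2)" by (rule mult_left_mono) simp
  then have "\<bar>pi * x / l\<bar> \<le> pi / 2" using l by (simp add: abs_mult)
  then have "arcsin (sin (pi * x / l)) = pi * x / l" by (intro arcsin_sin) linarith+
  then show ?thesis using l by (simp add: triangle_wave_def)
qed

text \<open>The modulus is the distance to the nearest multiple of \<open>l\<close>. The walls of
  the competitor are centred at these multiples.\<close>

lemma abs_triangle_wave:
  assumes l: "l > 0" and x: "x \<in> {-l..l}"
  shows "\<bar>triangle_wave l x\<bar> = (if \<bar>x\<bar> \<le> l / 2 then \<bar>x\<bar> else l - \<bar>x\<bar>)"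
proof (cases "\<bar>x\<bar> \<le> l / 2")
  case True then show ?thesis using triangle_wave_eq[OF l] by simp
next
  case False
  show ?thesis
  proof (cases "x \<ge> 0")
    case True
    then have "triangle_wave l (x - l) = x - l" using False x by (intro triangle_wave_eq[OF l]) auto
    then show ?thesis using triangle_wave_half_period[OF l, of "x - l"] False True x by auto
  next
    case neg: False
    then have "triangle_wave l (x + l) = x + l" using False x by (intro triangle_wave_eq[OF l]) auto
    then show ?thesis using triangle_wave_half_period[OF l, of x] False neg x by auto
  qed
qed

text \<open>
  In the walls the angle \<open>\<theta>\<close> of the director moves with slope \<open>k / \<epsilon>\<close>. As \<open>k\<^sup>2\<close> is the maximum of
  \<open>(cos \<theta> - A)\<^sup>2 / A\<close> between \<open>- \<alpha>\<close> and \<open>\<alpha>\<close>, the gradient and the potential each contribute at most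
  \<open>k\<^sup>2 / \<epsilon>\<close> to the density.
\<close>

lemma recovery_pair:
  assumes l: "l > 0" and \<sigma>: "\<sigma> > 0" and \<epsilon>: "\<epsilon> > 0"
    and small: "2 * alpha \<sigma> * \<epsilon> * sqrt (A0 \<sigma>) < l * (1 - A0 \<sigma>)"
  obtains n g where "(n, g) \<in> Y_space l"
    "F_energy \<sigma> l \<epsilon> n g \<le> 16 * l * (alpha \<sigma> * (1 - A0 \<sigma>) / sqrt (A0 \<sigma>))"
proof -
  \<comment> \<open>\<open>w\<close> is half the width of a wall: at slope
    \<open>k / \<epsilon>\<close> the angle passes from \<open>- \<alpha>\<close> to
    \<open>\<alpha>\<close> over the length \<open>2 * w\<close>. The smallness assumption says
    \<open>w < l / 2\<close>, so that neighbouring walls do not meet.\<close>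
  define A \<alpha> k w where "A = A0 \<sigma>" and "\<alpha> = alpha \<sigma>" and "k = (1 - A) / sqrt A" and "w = \<alpha> * \<epsilon> / k"
  have A: "0 < A" "A < 1" using A0_bounds[OF \<sigma>] by (auto simp: A_def)
  have \<alpha>: "0 < \<alpha>" "\<alpha> < pi / 2" "cos \<alpha> = A"
    using alpha_pos[OF \<sigma>] alpha_less[OF \<sigma>] cos_alpha[OF \<sigma>] by (auto simp: A_def \<alpha>_def)
  have k: "0 < k" using A by (simp add: k_def)
  have w: "0 < w" "w < l / 2"
    using \<alpha> \<epsilon> k small A by (auto simp: w_def k_def field_simps A_def \<alpha>_def)
  have kw: "k / \<epsilon> * w = \<alpha>" using k \<epsilon> by (simp add: w_def)
  define r where "r t = max (- w) (min w t)" for t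
  define \<theta> where "\<theta> x = k / \<epsilon> * r (triangle_wave l x)" for x
  define \<theta>' where "\<theta>' x = k / \<epsilon> * ((if \<bar>triangle_wave l x\<bar> < w then 1 else 0) * square_wave l 0 x)" for x
  note [measurable] = triangle_wave_measurable[OF l]
  have \<theta>c: "continuous_on S \<theta>" for S
    unfolding \<theta>_def r_def by (intro continuous_intros triangle_wave_continuous[OF l])
  have \<theta>half: "\<theta> (x + l) = - \<theta> x" for x
  proof -
    have "r (- t) = - r t" for t unfolding r_def using w by (auto simp: max_def min_def)
    then show ?thesis by (simp add: \<theta>_def triangle_wave_half_period[OF l])
  qed
  have \<theta>per: "\<theta> (x + 2 * l) = \<theta> x" for x
    using \<theta>half[of "x + l"] \<theta>half[of x] by (simp add: add.assoc)
  have \<theta>'per: "\<theta>' (x + 2 * l) = \<theta>' x" for x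
    by (simp add: \<theta>'_def triangle_wave_periodic[OF l] square_wave_periodic[OF l])
  have [measurable]: "\<theta> \<in> borel_measurable borel" by (rule borel_measurable_continuous_onI[OF \<theta>c])
  have [measurable]: "\<theta>' \<in> borel_measurable borel" unfolding \<theta>'_def by measurable
  \<comment> \<open>Points where the triangle wave turns or the clipping sets in; away from them the
    chain rule applies.\<close>
  define S where "S = {l / 2, - l / 2, w, - w, l - w, w - l}"
  have \<theta>d: "(\<theta> has_real_derivative \<theta>' x) (at x)" if x: "x \<in> {-l<..<l} - S" for x
  proof -
    have "(triangle_wave l has_real_derivative square_wave l 0 x) (at x)"
      using x by (intro triangle_wave_deriv[OF l] square_wave_nonzero[OF l]) (auto simp: S_def)
    moreover have "(r has_real_derivative (if \<bar>triangle_wave l x\<bar> < w then 1 else 0)) (at (triangle_wave l x))"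
    proof -
      define t where "t = triangle_wave l x"
      have "x \<in> {-l..l}" using x by auto
      from abs_triangle_wave[OF l this] have "\<bar>t\<bar> \<noteq> w"
        using x unfolding t_def[symmetric] by (auto simp: S_def abs_if split: if_splits)
      then have "\<bar>t\<bar> < w \<or> t > w \<or> t < - w" by linarith
      then consider "\<bar>t\<bar> < w" | "t > w" | "t < - w" by blast
      then have "(r has_real_derivative (if \<bar>t\<bar> < w then 1 else 0)) (at t)"
      proof cases
        case 1
        have "(r has_real_derivative 1) (at t)"
          by (rule DERIV_cong_ev[THEN iffD1, OF refl _ refl DERIV_ident])
             (use 1 in \<open>auto simp: r_def eventually_nhds intro!: exI[of _ "{- w<..<w}"]\<close>)
        then show ?thesis using 1 by simp
      next
        case 2
        have "(r has_real_derivative 0) (at t)"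
          by (rule DERIV_cong_ev[THEN iffD1, OF refl _ refl DERIV_const[of w]])
             (use 2 w in \<open>auto simp: r_def eventually_nhds intro!: exI[of _ "{w<..}"]\<close>)
        moreover have "\<not> \<bar>t\<bar> < w" using 2 by linarith
        ultimately show ?thesis by simp
      next
        case 3
        have "(r has_real_derivative 0) (at t)"
          by (rule DERIV_cong_ev[THEN iffD1, OF refl _ refl DERIV_const[of "- w"]])
             (use 3 w in \<open>auto simp: r_def eventually_nhds intro!: exI[of _ "{..< - w}"]\<close>)
        moreover have "\<not> \<bar>t\<bar> < w" using 3 by linarith
        ultimately show ?thesis by simp
      qed
      then show ?thesis by (simp add: t_def)
    qed
    ultimately show ?thesis
      unfolding \<theta>_def \<theta>'_def using DERIV_chain2[of r _ "triangle_wave l" x "square_wave l 0 x" UNIV]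
      by (intro DERIV_cmult) blast
  qed
  have fin: "finite S" by (simp add: S_def)
  have \<theta>'b: "\<bar>\<theta>' x\<bar> \<le> k / \<epsilon>" for x
  proof -
    have "\<bar>(if \<bar>triangle_wave l x\<bar> < w then 1 else 0) * square_wave l 0 x\<bar> \<le> 1"
      using square_wave_bound[of l 0 x] by simp
    then have "\<bar>k / \<epsilon>\<bar> * \<bar>(if \<bar>triangle_wave l x\<bar> < w then 1 else 0) * square_wave l 0 x\<bar> \<le> \<bar>k / \<epsilon>\<bar> * 1"
      by (rule mult_left_mono) simp
    then show ?thesis unfolding \<theta>'_def abs_mult[of "k / \<epsilon>"] using k \<epsilon> by simp
  qed
  have b1: "\<bar>cos (\<theta> x) * \<theta>' x\<bar> \<le> k / \<epsilon>" and b3: "\<bar>- sin (\<theta> x) * \<theta>' x\<bar> \<le> k / \<epsilon>" for x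
  proof -
    have "\<bar>c * \<theta>' x\<bar> \<le> k / \<epsilon>" if "\<bar>c\<bar> \<le> 1" for c
      using mult_mono[OF that \<theta>'b[of x]] by (simp add: abs_mult)
    from this[of "cos (\<theta> x)"] this[of "- sin (\<theta> x)"] show "\<bar>cos (\<theta> x) * \<theta>' x\<bar> \<le> k / \<epsilon>" "\<bar>- sin (\<theta> x) * \<theta>' x\<bar> \<le> k / \<epsilon>"
      by auto
  qed
  have c13: "continuous_on {-l..l} (\<lambda>x. sin (\<theta> x))" "continuous_on {-l..l} (\<lambda>x. cos (\<theta> x))"
    by (intro continuous_intros \<theta>c)+
  have d13: "((\<lambda>x. sin (\<theta> x)) has_real_derivative cos (\<theta> x) * \<theta>' x) (at x)"
    "((\<lambda>x. cos (\<theta> x)) has_real_derivative - sin (\<theta> x) * \<theta>' x) (at x)" if "x \<in> {-l<..<l} - S" for x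
    using DERIV_chain2[OF DERIV_sin \<theta>d[OF that]] DERIV_chain2[OF DERIV_cos \<theta>d[OF that]] by auto
  have m13: "(\<lambda>x. sin (\<theta> x)) \<in> borel_measurable borel" "(\<lambda>x. cos (\<theta> x) * \<theta>' x) \<in> borel_measurable borel"
    "(\<lambda>x. cos (\<theta> x)) \<in> borel_measurable borel" "(\<lambda>x. - sin (\<theta> x) * \<theta>' x) \<in> borel_measurable borel"
    by measurable
  have p13: "sin (\<theta> (x + 2 * l)) = sin (\<theta> x)" "cos (\<theta> (x + 2 * l)) * \<theta>' (x + 2 * l) = cos (\<theta> x) * \<theta>' x"
    "cos (\<theta> (x + 2 * l)) = cos (\<theta> x)" "- sin (\<theta> (x + 2 * l)) * \<theta>' (x + 2 * l) = - sin (\<theta> x) * \<theta>' x" for x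
    by (simp_all only: \<theta>per \<theta>'per)
  note W1 = has_weak_grad_of_fst[where u="\<lambda>x. sin (\<theta> x)" and u'="\<lambda>x. cos (\<theta> x) * \<theta>' x",
      OF l fin c13(1) d13(1) m13(1,2) b1 p13(1,2)]
  note W3 = has_weak_grad_of_fst[where u="\<lambda>x. cos (\<theta> x)" and u'="\<lambda>x. - sin (\<theta> x) * \<theta>' x",
      OF l fin c13(2) d13(2) m13(3,4) b3 p13(3,4)]
  have W2: "(\<lambda>p::real\<times>real. 0) \<in> W12 l" "has_weak_grad l (\<lambda>p. 0) (\<lambda>p. (0, 0))"
    using has_weak_grad_of_fst[OF l finite.emptyI, of "\<lambda>_. 0" "\<lambda>_. 0" 0] by auto
  \<comment> \<open>The angle changes sign under a shift by \<open>l\<close>, and so does the first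
    component. Its zero mean permits a periodic potential with
    \<open>g\<^sub>x = - n\<^sub>1\<close> exactly, so both terms of the energy that contain the
    gradient of g vanish.\<close>
  have mean: "(\<integral>x. sin (\<theta> x) \<partial>circle l) = 0"
  proof -
    have "(\<integral>x. sin (\<theta> (x + l)) \<partial>circle l) = (\<integral>x. sin (\<theta> x) \<partial>circle l)"
      by (rule integral_circle_shift[OF l]) (simp_all add: \<theta>per)
    then show ?thesis by (simp add: \<theta>half)
  qed
  obtain F where F: "C1_circle l F (\<lambda>x. sin (\<theta> x))"
    by (rule periodic_antiderivative[OF l _ _ mean]) (auto intro!: continuous_intros \<theta>c simp: \<theta>per)
  have WF: "(\<lambda>p. - F (fst p)) \<in> W12 l" "has_weak_grad l (\<lambda>p. - F (fst p)) (\<lambda>p. (- sin (\<theta> (fst p)), 0))"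
  proof -
    have "continuous_on {-l..l} (\<lambda>x. - F x)" by (intro continuous_intros C1_circle_continuous[OF F])
    moreover have "((\<lambda>x. - F x) has_real_derivative - sin (\<theta> x)) (at x)" for x
      using F by (intro DERIV_minus) (simp add: C1_circle_def)
    moreover have "(\<lambda>x. - F x) \<in> borel_measurable borel" using C1_circle_measurable[OF F] by simp
    moreover have "- F (x + 2 * l) = - F x" for x using F by (simp add: C1_circle_def)
    ultimately show "(\<lambda>p. - F (fst p)) \<in> W12 l" "has_weak_grad l (\<lambda>p. - F (fst p)) (\<lambda>p. (- sin (\<theta> (fst p)), 0))"
      using has_weak_grad_of_fst[OF l finite.emptyI, of "\<lambda>x. - F x" "\<lambda>x. - sin (\<theta> x)" 1] by (auto simp: \<theta>per)
  qed
  define n :: "real \<times> real \<Rightarrow> real^3" where "n p = vector [sin (\<theta> (fst p)), 0, cos (\<theta> (fst p))]" for p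
  define g where "g p = - F (fst p)" for p :: "real \<times> real"
  have n: "n p $ 1 = sin (\<theta> (fst p))" "n p $ 2 = 0" "n p $ 3 = cos (\<theta> (fst p))" for p
    by (simp_all add: n_def)
  have "(\<lambda>p. n p $ i) \<in> W12 l" for i
    using exhaust_3[of i] W1(1) W2(1) W3(1) by (auto simp: n)
  moreover have "norm (n p) = 1" for p by (simp add: norm_real3 n)
  ultimately have Y: "(n, g) \<in> Y_space l"
    using WF(1) by (simp add: Y_space_def W12_sphere_def g_def[abs_def])
  \<comment> \<open>Outside the walls the angle is constantly \<alpha> or - \<alpha>, where the
    potential is zero, so no energy remains there.\<close>
  define b where "b x = (if \<bar>triangle_wave l x\<bar> < w then 2 * k\<^sup>2 / \<epsilon> else 0)" for x
  have [measurable]: "b \<in> borel_measurable borel" unfolding b_def by measurable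
  have b0: "\<bar>b x\<bar> \<le> 2 * k\<^sup>2 / \<epsilon>" for x using \<epsilon> by (simp add: b_def)
  have point: "\<epsilon> * (\<theta>' x)\<^sup>2 + 1 / \<epsilon> * (1 / A * (cos (\<theta> x) - A)\<^sup>2) \<le> b x" for x
  proof (cases "\<bar>triangle_wave l x\<bar> < w")
    case True
    have "(\<theta>' x)\<^sup>2 \<le> (k / \<epsilon>)\<^sup>2" using \<theta>'b[of x] by (rule abs_le_square_iff[THEN iffD1, OF order_trans[OF _ abs_ge_self]])
    then have "\<epsilon> * (\<theta>' x)\<^sup>2 \<le> \<epsilon> * (k / \<epsilon>)\<^sup>2" using \<epsilon> by (intro mult_left_mono) auto
    also have "\<dots> = k\<^sup>2 / \<epsilon>" using \<epsilon> by (simp add: power2_eq_square field_simps)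
    finally have 1: "\<epsilon> * (\<theta>' x)\<^sup>2 \<le> k\<^sup>2 / \<epsilon>" .
    have "r (triangle_wave l x) = triangle_wave l x" using True by (auto simp: r_def)
    then have "\<bar>\<theta> x\<bar> = k / \<epsilon> * \<bar>triangle_wave l x\<bar>" using k \<epsilon> by (simp add: \<theta>_def abs_mult)
    also have "\<dots> \<le> k / \<epsilon> * w" using True k \<epsilon> by (intro mult_left_mono) auto
    finally have "\<bar>\<theta> x\<bar> \<le> \<alpha>" by (simp only: kw)
    then have "cos \<alpha> \<le> cos \<bar>\<theta> x\<bar>" using \<alpha> by (intro cos_monotone_0_pi_le) auto
    then have "0 \<le> cos (\<theta> x) - A" "cos (\<theta> x) - A \<le> 1 - A" using \<alpha> by auto
    then have "(cos (\<theta> x) - A)\<^sup>2 \<le> (1 - A)\<^sup>2" by (intro power_mono) auto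
    then have "1 / A * (cos (\<theta> x) - A)\<^sup>2 \<le> 1 / A * (1 - A)\<^sup>2" using A by (intro mult_left_mono) auto
    also have "\<dots> = k\<^sup>2" using A by (simp add: k_def power_divide)
    finally have "1 / \<epsilon> * (1 / A * (cos (\<theta> x) - A)\<^sup>2) \<le> 1 / \<epsilon> * k\<^sup>2" using \<epsilon> by (intro mult_left_mono) auto
    with 1 show ?thesis using True by (simp add: b_def)
  next
    case False
    then have "r (triangle_wave l x) = w \<or> r (triangle_wave l x) = - w" using w by (auto simp: r_def max_def min_def)
    then have "\<theta> x = \<alpha> \<or> \<theta> x = - \<alpha>" unfolding \<theta>_def using kw by auto
    then have "cos (\<theta> x) = A" using \<alpha> by auto
    then show ?thesis using False by (simp add: b_def \<theta>'_def)
  qed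
  have "AE p in torus l. energy_density \<sigma> l \<epsilon> n g p \<le> b (fst p)"
  proof -
    have "AE p in torus l. weak_grad l (\<lambda>q. n q $ 1) p = (cos (\<theta> (fst p)) * \<theta>' (fst p), 0)"
      "AE p in torus l. weak_grad l (\<lambda>q. n q $ 2) p = (0, 0)"
      "AE p in torus l. weak_grad l (\<lambda>q. n q $ 3) p = (- sin (\<theta> (fst p)) * \<theta>' (fst p), 0)"
      "AE p in torus l. weak_grad l g p = (- sin (\<theta> (fst p)), 0)"
      unfolding n g_def[abs_def]
      using weak_grad_AE_eq[OF l W1] weak_grad_AE_eq[OF l W2] weak_grad_AE_eq[OF l W3] weak_grad_AE_eq[OF l WF]
      by blast+
    then show ?thesis
    proof eventually_elim
      case (elim p)
      have "energy_density \<sigma> l \<epsilon> n g p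
          = \<epsilon> * ((cos (\<theta> (fst p)))\<^sup>2 * (\<theta>' (fst p))\<^sup>2 + (sin (\<theta> (fst p)))\<^sup>2 * (\<theta>' (fst p))\<^sup>2)
            + 1 / \<epsilon> * (1 / A * (cos (\<theta> (fst p)) - A)\<^sup>2)"
        unfolding energy_density_def sum_3 elim weak_dx_def weak_dy_def W_def
        by (simp add: n norm_pair_square power_mult_distrib A_def)
      also have "(cos (\<theta> (fst p)))\<^sup>2 * (\<theta>' (fst p))\<^sup>2 + (sin (\<theta> (fst p)))\<^sup>2 * (\<theta>' (fst p))\<^sup>2 = (\<theta>' (fst p))\<^sup>2"
        by (simp flip: distrib_right)
      finally show ?case using point[of "fst p"] by simp
    qed
  qed
  moreover have ib: "integrable (torus l) (\<lambda>p. b (fst p))"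
    by (rule integrable_torus_of_fst[OF integrable_circle_bounded[OF _ b0]]) simp
  ultimately have "F_energy \<sigma> l \<epsilon> n g \<le> (\<integral>p. b (fst p) \<partial>torus l)"
    unfolding F_energy_torus[OF l Y] by (intro integral_mono_AE energy_density_integrable[OF l Y])
  also have "\<dots> = 2 * l * (\<integral>x. b x \<partial>circle l)"
    using integral_torus_fst[OF ib] l by (simp add: measure_circle)
  also have "(\<integral>x. b x \<partial>circle l) \<le> 2 * k\<^sup>2 / \<epsilon> * (4 * w)"
  proof -
    define K where "K = 2 * k\<^sup>2 / \<epsilon>"
    have K0: "0 \<le> K" using \<epsilon> by (simp add: K_def)
    \<comment> \<open>The wall centred at the edge of the cell is cut in two, so the two walls
      appear as three intervals of total length \<open>4 * w\<close>.\<close>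
    define h where "h x = K * (indicator {-w..w} x + (indicator {l - w..l} x + indicator {-l..w - l} x))" for x :: real
    have "(\<integral>x. b x \<partial>circle l) = (\<integral>x. indicator {-l..<l} x * b x \<partial>lborel)"
      by (subst set_integral_circle[symmetric]) (auto simp: set_lebesgue_integral_def)
    also have "\<dots> \<le> (\<integral>x. h x \<partial>lborel)"
    proof (rule integral_mono)
      have "set_integrable lborel {-l..<l} b"
        unfolding set_integrable_circle[of b l, simplified] by (rule integrable_circle_bounded[OF _ b0]) simp
      then show "integrable lborel (\<lambda>x. indicator {-l..<l} x * b x)" by (simp add: set_integrable_def)
      show "integrable lborel h"
        unfolding h_def[abs_def]
        by (intro integrable_mult_right Bochner_Integration.integrable_add integrable_real_indicator)
           (auto simp: emeasure_lborel_Icc_eq)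
      fix x :: real
      show "indicator {-l..<l} x * b x \<le> h x"
      proof (cases "x \<in> {-l..<l} \<and> \<bar>triangle_wave l x\<bar> < w")
        case True
        then have "x \<in> {-w..w} \<or> x \<in> {l - w..l} \<or> x \<in> {-l..w - l}"
          using abs_triangle_wave[OF l, of x] by (auto simp: abs_if split: if_splits)
        then have "1 \<le> indicator {-w..w} x + (indicator {l - w..l} x + (indicator {-l..w - l} x :: real))"
          by (auto simp: indicator_def)
        then have "K * 1 \<le> h x" unfolding h_def by (intro mult_left_mono K0)
        then show ?thesis using True by (simp add: b_def K_def)
      next
        case False
        then have eq: "indicator {-l..<l} x * b x = 0" by (auto simp: b_def indicator_def)
        show ?thesis unfolding eq h_def using K0 by (intro mult_nonneg_nonneg) auto
      qed
    qed
    also have "\<dots> = K * (4 * w)"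
      unfolding h_def using w by (simp add: emeasure_lborel_Icc_eq)
    finally show ?thesis by (simp add: K_def)
  qed
  then have "2 * l * (\<integral>x. b x \<partial>circle l) \<le> 2 * l * (2 * k\<^sup>2 / \<epsilon> * (4 * w))" using l by (intro mult_left_mono) auto
  also have "\<dots> = 16 * l * k * (k / \<epsilon> * w)" by (simp add: power2_eq_square)
  also have "\<dots> = 16 * l * (\<alpha> * (1 - A) / sqrt A)" unfolding kw by (simp add: k_def)
  finally show ?thesis using Y by (intro that[of n g]) (simp_all add: A_def \<alpha>_def)
qed

section \<open>A good slice and its influence on the others\<close>

text \<open>Converts bounds on squares that are linear in \<open>\<epsilon> = \<delta> ^ 4\<close>
  into bounds of order \<open>\<delta>\<^sup>2\<close>.\<close>

lemma abs_le_of_square_le: "x\<^sup>2 \<le> C * \<delta> ^ 4 \<Longrightarrow> 0 \<le> C \<Longrightarrow> \<bar>x\<bar> \<le> sqrt C * \<delta>\<^sup>2" for x :: real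
proof -
  assume x: "x\<^sup>2 \<le> C * \<delta> ^ 4" and C: "0 \<le> C"
  have "sqrt (x\<^sup>2) \<le> sqrt (C * (\<delta>\<^sup>2)\<^sup>2)" using x by (intro real_sqrt_le_mono) simp
  then show ?thesis unfolding real_sqrt_mult real_sqrt_abs by simp
qed

text \<open>\<open>d\<close> is the energy density on the slice and \<open>h\<close> stands for
  \<open>g\<^sub>x + n\<^sub>1\<close> there. By \<open>2 * Q * \<bar>v\<bar> \<le> \<epsilon> *
  v\<^sup>2 + Q\<^sup>2 / \<epsilon>\<close> the transitions cost at most half the slice energy, so
  an energy below \<open>8 * (f s - f (- s))\<close> leaves no room for four of them. The potential
  term makes \<open>(nbar \<sigma>)\<^sup>2 - (U x)\<^sup>2\<close> small in L1, and the bound on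
  \<open>h\<close> makes the mean of \<open>U\<close> small; both errors are of order
  \<open>\<delta>\<^sup>2\<close> and are collected in \<open>K\<close>.\<close>

lemma slice_close_to_square_wave:
  assumes l: "l > 0" and \<sigma>: "\<sigma> > 0" and \<delta>: "\<delta> > 0"
    and f: "\<And>t. (f has_real_derivative reduced_root (A0 \<sigma>) t) (at t)" "mono f"
    and s: "0 < s" "s < nbar \<sigma>" and E: "E < 8 * (f s - f (- s))" "0 \<le> E"
    and U: "circle_primitive l U v" and le1: "AE x in circle l. \<bar>U x\<bar> \<le> 1"
    and d: "integrable (circle l) d" "(\<integral>x. d x \<partial>circle l) \<le> E"
    and h: "h \<in> borel_measurable borel" "(\<integral>x. h x \<partial>circle l) = (\<integral>x. U x \<partial>circle l)"
    and le: "AE x in circle l. \<delta> ^ 4 * (v x)\<^sup>2 + (sqrt (1 - (U x)\<^sup>2) - A0 \<sigma>)\<^sup>2 / (A0 \<sigma> * \<delta> ^ 4) + (h x)\<^sup>2 / \<delta> ^ 4 \<le> d x"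
  defines "K \<equiv> (1 / nbar \<sigma> + 2 / ((nbar \<sigma>)\<^sup>2 - s\<^sup>2)) * (2 * sqrt (2 * l * A0 \<sigma> * E)) + sqrt (2 * l * E)"
  assumes small: "K * \<delta>\<^sup>2 < 2 * l * nbar \<sigma>"
  shows "(\<integral>x. \<bar>h x\<bar> \<partial>circle l) \<le> sqrt (2 * l * E) * \<delta>\<^sup>2"
    and "\<exists>c. (\<integral>x. \<bar>U x - nbar \<sigma> * square_wave l c x\<bar> \<partial>circle l) \<le> 2 * (K * \<delta>\<^sup>2)"
proof -
  define A m \<epsilon> where "A = A0 \<sigma>" and "m = nbar \<sigma>" and "\<epsilon> = \<delta> ^ 4"
  have A: "0 < A" "A < 1" using A0_bounds[OF \<sigma>] by (auto simp: A_def)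
  have m: "0 < m" "m < 1" "m\<^sup>2 = 1 - A\<^sup>2"
    using nbar_pos[OF \<sigma>] nbar_less_1[OF \<sigma>] nbar_square[OF \<sigma>] by (auto simp: A_def m_def)
  have \<epsilon>: "0 < \<epsilon>" using \<delta> by (simp add: \<epsilon>_def)
  have vm [measurable]: "v \<in> borel_measurable borel" and vper: "\<And>x. v (x + 2 * l) = v x"
    and vi: "integrable (circle l) v" and per: "\<And>x. U (x + 2 * l) = U x"
    using U by (auto simp: circle_primitive_def)
  have Uc: "continuous_on S U" for S by (rule circle_primitive_continuous[OF l U])
  note [measurable] = borel_measurable_continuous_onI[OF Uc] h(1)
  have [measurable]: "d \<in> borel_measurable borel" using borel_measurable_integrable[OF d(1)] by (simp add: measurable_circle)
  have [measurable]: "reduced_root A \<in> borel_measurable borel"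
    by (intro borel_measurable_continuous_onI reduced_root_continuous A)
  \<comment> \<open>Signed deviation of \<open>sqrt (1 - (U x)\<^sup>2)\<close> from
    \<open>A\<close>. The minimum keeps it bounded at every point, as
    \<open>\<bar>U x\<bar> \<le> 1\<close> is given almost everywhere.\<close>
  define \<rho> where "\<rho> x = sqrt (1 - min 1 ((U x)\<^sup>2)) - A" for x
  have [measurable]: "\<rho> \<in> borel_measurable borel" unfolding \<rho>_def by measurable
  have \<rho>1: "\<bar>\<rho> x\<bar> \<le> 1" for x
  proof -
    have "0 \<le> sqrt (1 - min 1 ((U x)\<^sup>2))" "sqrt (1 - min 1 ((U x)\<^sup>2)) \<le> 1" by auto
    then show ?thesis unfolding \<rho>_def using A by linarith
  qed
  have q: "reduced_root A (U x) = max 0 (\<rho> x) / sqrt A" for x by (simp add: reduced_root_def \<rho>_def)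
  have q2: "(reduced_root A (U x))\<^sup>2 \<le> (\<rho> x)\<^sup>2 / A" for x
  proof -
    have "(max 0 (\<rho> x))\<^sup>2 \<le> (\<rho> x)\<^sup>2" by (simp add: max_def)
    then show ?thesis using A by (simp add: q power_divide divide_right_mono)
  qed
  have qb: "\<bar>reduced_root A (U x)\<bar> \<le> 1 / sqrt A" for x
    unfolding q using \<rho>1[of x] A by (auto simp: divide_right_mono)
  have split: "AE x in circle l. \<epsilon> * (v x)\<^sup>2 + (\<rho> x)\<^sup>2 / (A * \<epsilon>) + (h x)\<^sup>2 / \<epsilon> \<le> d x"
    using le le1
  proof eventually_elim
    case (elim x)
    then have "(U x)\<^sup>2 \<le> 1" by (simp add: abs_square_le_1)
    then show ?case using elim by (simp add: \<rho>_def A_def \<epsilon>_def min_def)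
  qed
  have h2: "AE x in circle l. (h x)\<^sup>2 \<le> \<epsilon> * d x" and \<rho>2: "AE x in circle l. (\<rho> x)\<^sup>2 \<le> A * \<epsilon> * d x"
    and w2: "AE x in circle l. \<bar>reduced_root A (U x)\<bar> * \<bar>v x\<bar> \<le> d x / 2"
  proof -
    have nn: "0 \<le> \<epsilon> * (v x)\<^sup>2" "0 \<le> (\<rho> x)\<^sup>2 / (A * \<epsilon>)" "0 \<le> (h x)\<^sup>2 / \<epsilon>" for x
      using A \<epsilon> by auto
    show "AE x in circle l. (h x)\<^sup>2 \<le> \<epsilon> * d x"
      using split
    proof eventually_elim
      case (elim x)
      then have "(h x)\<^sup>2 / \<epsilon> \<le> d x" using nn[of x] by linarith
      then show ?case using \<epsilon> by (simp add: field_simps)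
    qed
    show "AE x in circle l. (\<rho> x)\<^sup>2 \<le> A * \<epsilon> * d x"
      using split
    proof eventually_elim
      case (elim x)
      then have "(\<rho> x)\<^sup>2 / (A * \<epsilon>) \<le> d x" using nn[of x] by linarith
      then show ?case using \<epsilon> A by (simp add: divide_le_eq mult_ac)
    qed
    show "AE x in circle l. \<bar>reduced_root A (U x)\<bar> * \<bar>v x\<bar> \<le> d x / 2"
      using split
    proof eventually_elim
      case (elim x)
      define Q where "Q = \<bar>reduced_root A (U x)\<bar>"
      have "0 \<le> (\<epsilon> * \<bar>v x\<bar> - Q)\<^sup>2 / \<epsilon>" using \<epsilon> by simp
      also have "\<dots> = \<epsilon> * (v x)\<^sup>2 + Q\<^sup>2 / \<epsilon> - 2 * (Q * \<bar>v x\<bar>)"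
        using \<epsilon> by (simp add: power2_diff field_simps power2_eq_square)
      also have "Q\<^sup>2 / \<epsilon> \<le> (\<rho> x)\<^sup>2 / A / \<epsilon>" unfolding Q_def using q2[of x] \<epsilon> by (intro divide_right_mono) auto
      finally have "2 * (Q * \<bar>v x\<bar>) \<le> \<epsilon> * (v x)\<^sup>2 + (\<rho> x)\<^sup>2 / (A * \<epsilon>)" by simp
      then show ?case using elim nn(3)[of x] unfolding Q_def by linarith
    qed
  qed
  have h2i: "integrable (circle l) (\<lambda>x. (h x)\<^sup>2)"
    by (rule Bochner_Integration.integrable_bound[of _ "\<lambda>x. \<epsilon> * d x"])
       (use d h2 in \<open>auto simp: measurable_circle elim!: eventually_mono intro: order_trans[OF _ abs_ge_self]\<close>)
  have hi: "integrable (circle l) h"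
    by (rule integrable_of_square_integrable[OF finite_measure_circle]) (use h2i in \<open>auto simp: measurable_circle\<close>)
  have "(\<integral>x. \<bar>h x\<bar> \<partial>circle l)\<^sup>2 \<le> 2 * l * (\<integral>x. (h x)\<^sup>2 \<partial>circle l)"
    using integral_square_le[OF finite_measure_circle, of l "\<lambda>x. \<bar>h x\<bar>"] hi h2i l by (simp add: measure_circle)
  also have "\<dots> \<le> 2 * l * (\<integral>x. \<epsilon> * d x \<partial>circle l)"
    using l d h2 h2i by (intro mult_left_mono integral_mono_AE) auto
  also have "\<dots> \<le> 2 * l * (\<epsilon> * E)" using l d \<epsilon> by (intro mult_left_mono) auto
  finally have "(\<integral>x. \<bar>h x\<bar> \<partial>circle l)\<^sup>2 \<le> (2 * l * E) * \<delta> ^ 4" by (simp add: \<epsilon>_def mult_ac)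
  from abs_le_of_square_le[OF this] show hl: "(\<integral>x. \<bar>h x\<bar> \<partial>circle l) \<le> sqrt (2 * l * E) * \<delta>\<^sup>2"
    using l E by simp
  have "\<bar>\<integral>x. h x \<partial>circle l\<bar> \<le> (\<integral>x. \<bar>h x\<bar> \<partial>circle l)"
    using integral_norm_bound[of "circle l" h] by simp
  then have I: "\<bar>\<integral>x. U x \<partial>circle l\<bar> \<le> sqrt (2 * l * E) * \<delta>\<^sup>2" using hl h(2) by simp
  have \<rho>i: "integrable (circle l) \<rho>" by (rule integrable_circle_bounded[OF _ \<rho>1]) simp
  have \<rho>2i: "integrable (circle l) (\<lambda>x. (\<rho> x)\<^sup>2)"
    by (rule integrable_circle_bounded[of _ 1]) (use \<rho>1 in \<open>auto simp: abs_square_le_1\<close>)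
  have "(\<integral>x. \<bar>\<rho> x\<bar> \<partial>circle l)\<^sup>2 \<le> 2 * l * (\<integral>x. (\<rho> x)\<^sup>2 \<partial>circle l)"
    using integral_square_le[OF finite_measure_circle, of l "\<lambda>x. \<bar>\<rho> x\<bar>"] \<rho>i \<rho>2i l by (simp add: measure_circle)
  also have "\<dots> \<le> 2 * l * (\<integral>x. A * \<epsilon> * d x \<partial>circle l)"
    using l d \<rho>2 \<rho>2i by (intro mult_left_mono integral_mono_AE) auto
  also have "\<dots> \<le> 2 * l * (A * \<epsilon> * E)" using l d(2) \<epsilon> A by (intro mult_left_mono) (simp_all add: mult_left_mono)
  finally have "(\<integral>x. \<bar>\<rho> x\<bar> \<partial>circle l)\<^sup>2 \<le> (2 * l * A * E) * \<delta> ^ 4" by (simp add: \<epsilon>_def mult_ac)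
  from abs_le_of_square_le[OF this] have \<rho>l: "(\<integral>x. \<bar>\<rho> x\<bar> \<partial>circle l) \<le> sqrt (2 * l * A * E) * \<delta>\<^sup>2"
    using l E A by simp
  obtain B where B: "\<forall>x. \<bar>U x\<bar> \<le> B" by (rule periodic_continuous_bounded[OF l Uc per]) auto
  have "AE x in circle l. \<bar>m\<^sup>2 - (U x)\<^sup>2\<bar> \<le> 2 * \<bar>\<rho> x\<bar>"
    using le1
  proof eventually_elim
    case (elim x)
    then have u1: "(U x)\<^sup>2 \<le> 1" by (simp add: abs_square_le_1)
    define r where "r = sqrt (1 - (U x)\<^sup>2)"
    have r: "0 \<le> r" "r \<le> 1" "r\<^sup>2 = 1 - (U x)\<^sup>2" using u1 by (auto simp: r_def)
    \<comment> \<open>Both \<open>m\<^sup>2 + A\<^sup>2\<close> and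
      \<open>(U x)\<^sup>2 + r\<^sup>2\<close> are equal to one.\<close>
    have "m\<^sup>2 - (U x)\<^sup>2 = (r - A) * (r + A)" using r(3) m(3) by (simp add: power2_eq_square algebra_simps)
    then have "\<bar>m\<^sup>2 - (U x)\<^sup>2\<bar> = \<bar>r - A\<bar> * (r + A)" using r A by (simp add: abs_mult)
    also have "\<dots> \<le> \<bar>r - A\<bar> * 2" using r A by (intro mult_left_mono) auto
    also have "r - A = \<rho> x" using u1 by (simp add: \<rho>_def r_def min_def)
    finally show ?case by simp
  qed
  moreover have "integrable (circle l) (\<lambda>x. \<bar>m\<^sup>2 - (U x)\<^sup>2\<bar>)"
  proof (rule integrable_circle_bounded[of _ "m\<^sup>2 + B\<^sup>2"])
    fix x
    have "(U x)\<^sup>2 \<le> B\<^sup>2" using B power_mono[of "\<bar>U x\<bar>" B 2] by auto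
    then show "\<bar>\<bar>m\<^sup>2 - (U x)\<^sup>2\<bar>\<bar> \<le> m\<^sup>2 + B\<^sup>2"
      using zero_le_power2[of m] zero_le_power2[of "U x"] by linarith
  qed simp
  ultimately have "(\<integral>x. \<bar>m\<^sup>2 - (U x)\<^sup>2\<bar> \<partial>circle l) \<le> (\<integral>x. 2 * \<bar>\<rho> x\<bar> \<partial>circle l)"
    using \<rho>i by (intro integral_mono_AE) auto
  then have D: "(\<integral>x. \<bar>m\<^sup>2 - (U x)\<^sup>2\<bar> \<partial>circle l) \<le> 2 * sqrt (2 * l * A * E) * \<delta>\<^sup>2"
    using \<rho>l by simp
  define w where "w x = \<bar>reduced_root A (U x)\<bar> * \<bar>v x\<bar>" for x
  have [measurable]: "w \<in> borel_measurable borel" unfolding w_def by measurable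
  have wi: "integrable (circle l) w"
    unfolding w_def mult.commute[of "\<bar>reduced_root A (U _)\<bar>"]
    by (rule integrable_mult_bounded[where C="1 / sqrt A"]) (use vi qb in \<open>auto simp: measurable_circle\<close>)
  have "(\<integral>x. w x \<partial>circle l) \<le> (\<integral>x. d x / 2 \<partial>circle l)"
    using w2[folded w_def] wi d(1) by (intro integral_mono_AE) auto
  then have wE: "(\<integral>x. w x \<partial>circle l) < 4 * (f s - f (- s))" using d(2) E by simp
  define L where "L = 1 / m + 2 / (m\<^sup>2 - s\<^sup>2)"
  have "s\<^sup>2 < m\<^sup>2" using s by (intro power_strict_mono) (auto simp: m_def)
  then have L: "0 \<le> L" unfolding L_def using m by simp
  define R where "R = L * (\<integral>x. \<bar>m\<^sup>2 - (U x)\<^sup>2\<bar> \<partial>circle l) + \<bar>\<integral>x. U x \<partial>circle l\<bar>"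
  have "R \<le> L * (2 * sqrt (2 * l * A * E) * \<delta>\<^sup>2) + sqrt (2 * l * E) * \<delta>\<^sup>2"
    unfolding R_def by (intro add_mono mult_left_mono D I L)
  also have "\<dots> = K * \<delta>\<^sup>2" by (simp add: K_def L_def m_def A_def algebra_simps)
  finally have RK: "R \<le> K * \<delta>\<^sup>2" .
  have "\<exists>c. (\<integral>x. \<bar>U x - m * square_wave l c x\<bar> \<partial>circle l) \<le> 2 * R"
    unfolding R_def L_def
  proof (rule close_to_square_wave[OF l Uc per, where w=w and f=f and s=s])
    show "\<bar>f (U b) - f (U a)\<bar> \<le> (LINT x:{a..<b}|lborel. w x)" if "a \<le> b" "b \<le> a + 2 * l" for a b
      unfolding w_def A_def by (rule chain_inequality[OF l U that f(1) reduced_root_continuous]) (use A in \<open>simp add: A_def\<close>)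
    show "w (x + 2 * l) = w x" for x by (simp add: w_def per vper)
    show "(1 / m + 2 / (m\<^sup>2 - s\<^sup>2)) * (\<integral>x. \<bar>m\<^sup>2 - (U x)\<^sup>2\<bar> \<partial>circle l) + \<bar>\<integral>x. U x \<partial>circle l\<bar> < 2 * l * m"
      using RK small unfolding R_def L_def m_def by linarith
  qed (use wi wE f s m in \<open>auto simp: m_def\<close>)
  then show "\<exists>c. (\<integral>x. \<bar>U x - nbar \<sigma> * square_wave l c x\<bar> \<partial>circle l) \<le> 2 * (K * \<delta>\<^sup>2)"
    using RK unfolding m_def by (meson order_trans mult_left_mono zero_le_numeral)
qed

text \<open>All terms of the density are nonnegative, so each is dominated by the whole after
  multiplication by \<epsilon>. The bound on \<open>g\<^sub>y\<close> combines those on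
  \<open>g\<^sub>y + n\<^sub>2\<close> and on \<open>n\<^sub>2\<close>.\<close>

lemma energy_bounds:
  assumes l: "l > 0" and \<sigma>: "\<sigma> > 0" and \<epsilon>: "\<epsilon> > 0" and z: "(n, g) \<in> Y_space l"
    and F: "F_energy \<sigma> l \<epsilon> n g \<le> C"
  shows "(\<integral>p. (n p $ 2)\<^sup>2 \<partial>torus l) \<le> C / \<sigma> * \<epsilon>"
    and "(\<integral>p. (n p $ 3 - A0 \<sigma>)\<^sup>2 \<partial>torus l) \<le> C * \<epsilon>"
    and "(\<integral>p. (weak_dx l g p + n p $ 1)\<^sup>2 \<partial>torus l) \<le> C * \<epsilon>"
    and "(\<integral>p. (weak_dy l g p)\<^sup>2 \<partial>torus l) \<le> (2 * C + 2 * C / \<sigma>) * \<epsilon>"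
    and "integrable (torus l) (\<lambda>p. (n p $ i)\<^sup>2)" "integrable (torus l) (\<lambda>p. (n p $ 3 - A0 \<sigma>)\<^sup>2)"
    "integrable (torus l) (\<lambda>p. (weak_dx l g p + n p $ 1)\<^sup>2)" "integrable (torus l) (\<lambda>p. (weak_dy l g p)\<^sup>2)"
proof -
  note Y = Y_space_components[OF l z]
  have A: "0 < A0 \<sigma>" "A0 \<sigma> < 1" using A0_bounds[OF \<sigma>] by auto
  have m: "(\<lambda>p. n p $ i) \<in> borel_measurable (torus l)" and m2: "integrable (torus l) (\<lambda>p. (n p $ i)\<^sup>2)" for i
    using Y(2)[of i] by (auto simp: L2_iff measurable_torus)
  have gm: "weak_dx l g \<in> borel_measurable (torus l)" "weak_dy l g \<in> borel_measurable (torus l)"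
    and gi: "integrable (torus l) (\<lambda>p. (weak_dx l g p)\<^sup>2)" "integrable (torus l) (\<lambda>p. (weak_dy l g p)\<^sup>2)"
    using Y(8,9) by (auto simp: L2_iff measurable_torus)
  have i3: "integrable (torus l) (\<lambda>p. (n p $ 3 - A0 \<sigma>)\<^sup>2)"
    using square_integrable_add[OF m[of 3] _ m2[of 3], of "\<lambda>_. - A0 \<sigma>"] by simp
  note ix = square_integrable_add[OF gm(1) m[of 1] gi(1) m2] and iy = square_integrable_add[OF gm(2) m[of 2] gi(2) m2]
  show "integrable (torus l) (\<lambda>p. (n p $ i)\<^sup>2)" "integrable (torus l) (\<lambda>p. (n p $ 3 - A0 \<sigma>)\<^sup>2)"
    "integrable (torus l) (\<lambda>p. (weak_dx l g p + n p $ 1)\<^sup>2)" "integrable (torus l) (\<lambda>p. (weak_dy l g p)\<^sup>2)"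
    by (rule m2 i3 ix gi)+
  have part: "(\<integral>p. q p \<partial>torus l) \<le> C * \<epsilon>"
    if q: "integrable (torus l) q" and le: "\<And>p. q p \<le> \<epsilon> * energy_density \<sigma> l \<epsilon> n g p" for q
  proof -
    have "(\<integral>p. q p \<partial>torus l) \<le> (\<integral>p. \<epsilon> * energy_density \<sigma> l \<epsilon> n g p \<partial>torus l)"
      using energy_density_integrable[OF l z] by (intro integral_mono q le) auto
    also have "\<dots> \<le> \<epsilon> * C" using F \<epsilon> unfolding F_energy_torus[OF l z] by (simp add: mult_left_mono)
    finally show ?thesis by (simp add: mult.commute)
  qed
  have dens: "\<epsilon> * energy_density \<sigma> l \<epsilon> n g p = \<epsilon>\<^sup>2 * (\<Sum>i\<in>UNIV. (norm (weak_grad l (\<lambda>q. n q $ i) p))\<^sup>2)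
        + \<sigma> * (n p $ 2)\<^sup>2 + 1 / A0 \<sigma> * (n p $ 3 - A0 \<sigma>)\<^sup>2 + (weak_dx l g p + n p $ 1)\<^sup>2 + (weak_dy l g p + n p $ 2)\<^sup>2" for p
    using \<epsilon> by (simp add: energy_density_def W_def distrib_left power2_eq_square)
  have nn: "0 \<le> \<epsilon>\<^sup>2 * (\<Sum>i\<in>UNIV. (norm (weak_grad l (\<lambda>q. n q $ i) p))\<^sup>2)" "0 \<le> \<sigma> * (n p $ 2)\<^sup>2"
    "0 \<le> 1 / A0 \<sigma> * (n p $ 3 - A0 \<sigma>)\<^sup>2" for p
    using \<sigma> A by (auto intro!: mult_nonneg_nonneg sum_nonneg)
  have A1: "(n p $ 3 - A0 \<sigma>)\<^sup>2 \<le> 1 / A0 \<sigma> * (n p $ 3 - A0 \<sigma>)\<^sup>2" for p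
    using mult_right_mono[of 1 "1 / A0 \<sigma>" "(n p $ 3 - A0 \<sigma>)\<^sup>2"] A by simp
  have "(\<integral>p. \<sigma> * (n p $ 2)\<^sup>2 \<partial>torus l) \<le> C * \<epsilon>"
  proof (rule part)
    show "\<sigma> * (n p $ 2)\<^sup>2 \<le> \<epsilon> * energy_density \<sigma> l \<epsilon> n g p" for p
      unfolding dens using nn[of p] zero_le_power2[of "weak_dx l g p + n p $ 1"] zero_le_power2[of "weak_dy l g p + n p $ 2"] by linarith
  qed (use m2 in auto)
  then show b2: "(\<integral>p. (n p $ 2)\<^sup>2 \<partial>torus l) \<le> C / \<sigma> * \<epsilon>" using \<sigma> by (simp add: field_simps)
  show "(\<integral>p. (n p $ 3 - A0 \<sigma>)\<^sup>2 \<partial>torus l) \<le> C * \<epsilon>"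
  proof (rule part[OF i3])
    show "(n p $ 3 - A0 \<sigma>)\<^sup>2 \<le> \<epsilon> * energy_density \<sigma> l \<epsilon> n g p" for p
      unfolding dens using nn[of p] A1[of p] zero_le_power2[of "weak_dx l g p + n p $ 1"] zero_le_power2[of "weak_dy l g p + n p $ 2"] by linarith
  qed
  show "(\<integral>p. (weak_dx l g p + n p $ 1)\<^sup>2 \<partial>torus l) \<le> C * \<epsilon>"
  proof (rule part[OF ix])
    show "(weak_dx l g p + n p $ 1)\<^sup>2 \<le> \<epsilon> * energy_density \<sigma> l \<epsilon> n g p" for p
      unfolding dens using nn[of p] zero_le_power2[of "weak_dy l g p + n p $ 2"] by linarith
  qed
  have yb: "(\<integral>p. (weak_dy l g p + n p $ 2)\<^sup>2 \<partial>torus l) \<le> C * \<epsilon>"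
  proof (rule part[OF iy])
    show "(weak_dy l g p + n p $ 2)\<^sup>2 \<le> \<epsilon> * energy_density \<sigma> l \<epsilon> n g p" for p
      unfolding dens using nn[of p] zero_le_power2[of "weak_dx l g p + n p $ 1"] by linarith
  qed
  have "(\<integral>p. (weak_dy l g p)\<^sup>2 \<partial>torus l) \<le> (\<integral>p. 2 * (weak_dy l g p + n p $ 2)\<^sup>2 + 2 * (n p $ 2)\<^sup>2 \<partial>torus l)"
  proof (rule integral_mono[OF gi(2)])
    have "a\<^sup>2 \<le> 2 * (a + b)\<^sup>2 + 2 * b\<^sup>2" for a b :: real
      using zero_le_power2[of "a + 2 * b"] by (simp add: power2_eq_square algebra_simps)
    then show "(weak_dy l g p)\<^sup>2 \<le> 2 * (weak_dy l g p + n p $ 2)\<^sup>2 + 2 * (n p $ 2)\<^sup>2" for p .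
  qed (use iy m2 in auto)
  also have "\<dots> = 2 * (\<integral>p. (weak_dy l g p + n p $ 2)\<^sup>2 \<partial>torus l) + 2 * (\<integral>p. (n p $ 2)\<^sup>2 \<partial>torus l)"
    using iy m2 by simp
  also have "\<dots> \<le> 2 * (C * \<epsilon>) + 2 * (C / \<sigma> * \<epsilon>)" using b2 yb by (intro add_mono mult_left_mono) auto
  finally show "(\<integral>p. (weak_dy l g p)\<^sup>2 \<partial>torus l) \<le> (2 * C + 2 * C / \<sigma>) * \<epsilon>" by (simp add: algebra_simps)
qed

text \<open>Retains what is used on a horizontal slice; the full potential is replaced by the
  reduced one, a function of the first component alone.\<close>

lemma energy_density_ge:
  assumes \<sigma>: "\<sigma> > 0" and \<epsilon>: "\<epsilon> > 0" and s: "n p \<in> sphere 0 1"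
  shows "\<epsilon> * (fst (weak_grad l (\<lambda>q. n q $ 1) p))\<^sup>2 + (sqrt (1 - (n p $ 1)\<^sup>2) - A0 \<sigma>)\<^sup>2 / (A0 \<sigma> * \<epsilon>)
    + (weak_dx l g p + n p $ 1)\<^sup>2 / \<epsilon> \<le> energy_density \<sigma> l \<epsilon> n g p"
proof -
  have "(fst (weak_grad l (\<lambda>q. n q $ 1) p))\<^sup>2 \<le> (norm (weak_grad l (\<lambda>q. n q $ 1) p))\<^sup>2"
    by (simp add: norm_pair_square)
  also have "\<dots> \<le> (\<Sum>i\<in>UNIV. (norm (weak_grad l (\<lambda>q. n q $ i) p))\<^sup>2)"
    unfolding sum_3 by simp
  finally have 1: "\<epsilon> * (fst (weak_grad l (\<lambda>q. n q $ 1) p))\<^sup>2 \<le> \<epsilon> * (\<Sum>i\<in>UNIV. (norm (weak_grad l (\<lambda>q. n q $ i) p))\<^sup>2)"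
    using \<epsilon> by (intro mult_left_mono) auto
  have "(sqrt (1 - (n p $ 1)\<^sup>2) - A0 \<sigma>)\<^sup>2 / A0 \<sigma> / \<epsilon> \<le> W \<sigma> (n p) / \<epsilon>"
    using W_ge_reduced[OF \<sigma> s] \<epsilon> by (intro divide_right_mono) auto
  moreover have "0 \<le> (weak_dy l g p + n p $ 2)\<^sup>2 / \<epsilon>" using \<epsilon> by simp
  ultimately show ?thesis using 1 unfolding energy_density_def by simp
qed

text \<open>The square wave is constant on two half periods, so the integral is a difference of two
  increments of \<open>G\<close>, which are opposite by periodicity. Correlating
  \<open>g\<^sub>x\<close> with the wave thus amounts to comparing two point values of g.\<close>

lemma circle_primitive_square_wave:
  assumes l: "l > 0" and G: "circle_primitive l G w"
  shows "(\<integral>x. w x * square_wave l c x \<partial>circle l) = 2 * (G (c + l / 2) - G (c - l / 2))"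
proof -
  have wm [measurable]: "w \<in> borel_measurable borel" and wper: "\<And>x. w (x + 2 * l) = w x"
    and wi: "integrable (circle l) w" and Gper: "\<And>x. G (x + 2 * l) = G x"
    using G by (auto simp: circle_primitive_def)
  define a where "a = c - l / 2"
  have i: "integrable (circle l) (\<lambda>x. w x * square_wave l c x)"
    by (rule integrable_mult_bounded[OF wi, where C=1]) (use square_wave_bound in \<open>auto simp: measurable_circle\<close>)
  have m: "(\<lambda>x. w x * square_wave l c x) \<in> borel_measurable borel" by measurable
  have p: "w (x + 2 * l) * square_wave l c (x + 2 * l) = w x * square_wave l c x" for x
    by (simp add: wper square_wave_periodic[OF l])
  have si: "set_integrable lborel {a..<a + 2 * l} (\<lambda>x. w x * square_wave l c x)"
    using i by (simp add: set_integrable_period[OF l m p])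
  have "(\<integral>x. w x * square_wave l c x \<partial>circle l) = (LINT x:{a..<a + 2 * l}|lborel. w x * square_wave l c x)"
    by (rule integral_period[OF l m p, symmetric])
  also have "\<dots> = (LINT x:{a..<a + l}|lborel. w x * square_wave l c x)
      + (LINT x:{a + l..<a + 2 * l}|lborel. w x * square_wave l c x)"
    using l by (intro set_integral_split[OF si]) auto
  also have "(LINT x:{a..<a + l}|lborel. w x * square_wave l c x) = (LINT x:{a..<a + l}|lborel. w x)"
    unfolding set_lebesgue_integral_def
  proof (rule integral_cong_AE)
    show "AE x in lborel. indicat_real {a..<a + l} x *\<^sub>R (w x * square_wave l c x) = indicat_real {a..<a + l} x *\<^sub>R w x"
      using AE_lborel_singleton[of a]
    proof eventually_elim
      case (elim x)
      have "square_wave l c x = 1" if "x \<in> {a..<a + l}"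
        using that elim by (intro square_wave_eq_1[OF l]) (auto simp: a_def abs_if)
      then show ?case by (auto simp: indicator_def)
    qed
  qed auto
  also have "\<dots> = G (a + l) - G a"
    using l by (intro circle_primitive_diff[OF G, symmetric]) auto
  also have "(LINT x:{a + l..<a + 2 * l}|lborel. w x * square_wave l c x) = (LINT x:{a + l..<a + 2 * l}|lborel. - w x)"
    unfolding set_lebesgue_integral_def
  proof (rule integral_cong_AE)
    show "AE x in lborel. indicat_real {a + l..<a + 2 * l} x *\<^sub>R (w x * square_wave l c x)
        = indicat_real {a + l..<a + 2 * l} x *\<^sub>R (- w x)"
      using AE_lborel_singleton[of "a + l"]
    proof eventually_elim
      case (elim x)
      have "square_wave l c x = -1" if "x \<in> {a + l..<a + 2 * l}"
        using that elim l by (intro square_wave_eq_neg_1[OF l]) (auto simp: a_def abs_if)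
      then show ?case by (auto simp: indicator_def)
    qed
  qed auto
  also have "\<dots> = - (LINT x:{a + l..<a + 2 * l}|lborel. w x)"
    using set_integrable_circle_primitive[OF l G, of "a + 2 * l" "a + l"] l by (intro set_integral_uminus) auto
  also have "(LINT x:{a + l..<a + 2 * l}|lborel. w x) = G (a + 2 * l) - G (a + l)"
    using l by (intro circle_primitive_diff[OF G, symmetric]) auto
  finally show ?thesis using Gper[of a] by (simp add: a_def algebra_simps)
qed

text \<open>The waves differ by at most two, and only on two intervals of length \<open>s\<close>
  next to the jumps.\<close>

lemma square_wave_translation_L1:
  assumes l: "l > 0" and s: "0 \<le> s" "s \<le> l"
  shows "(\<integral>x. \<bar>square_wave l c x - square_wave l (c + s) x\<bar> \<partial>circle l) \<le> 4 * s"
proof -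
  define a where "a = c - l / 2"
  define h :: "real \<Rightarrow> real" where "h x = 2 * (indicator {a..a + s} x + indicator {a + l..a + l + s} x)" for x
  have m: "(\<lambda>x. \<bar>square_wave l c x - square_wave l (c + s) x\<bar>) \<in> borel_measurable borel" by measurable
  have p: "\<bar>square_wave l c (x + 2 * l) - square_wave l (c + s) (x + 2 * l)\<bar> = \<bar>square_wave l c x - square_wave l (c + s) x\<bar>" for x
    by (simp add: square_wave_periodic[OF l])
  have i: "integrable (circle l) (\<lambda>x. \<bar>square_wave l c x - square_wave l (c + s) x\<bar>)"
    using integrable_square_wave by auto
  have "(\<integral>x. \<bar>square_wave l c x - square_wave l (c + s) x\<bar> \<partial>circle l)
     = (\<integral>x. indicator {a..<a + 2 * l} x *\<^sub>R \<bar>square_wave l c x - square_wave l (c + s) x\<bar> \<partial>lborel)"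
    using integral_period[OF l m p, of a] by (simp add: set_lebesgue_integral_def)
  also have "\<dots> \<le> (\<integral>x. h x \<partial>lborel)"
  proof (rule integral_mono)
    show "integrable lborel (\<lambda>x. indicator {a..<a + 2 * l} x *\<^sub>R \<bar>square_wave l c x - square_wave l (c + s) x\<bar>)"
      using i set_integrable_period[OF l m p, of a] by (simp add: set_integrable_def)
    show "integrable lborel h"
      unfolding h_def[abs_def] by (intro integrable_mult_right Bochner_Integration.integrable_add integrable_real_indicator)
        (auto simp: emeasure_lborel_Icc_eq)
    fix x :: real
    show "indicator {a..<a + 2 * l} x *\<^sub>R \<bar>square_wave l c x - square_wave l (c + s) x\<bar> \<le> h x"
    proof (cases "x \<in> {a..a + s} \<or> x \<in> {a + l..a + l + s} \<or> x \<notin> {a..<a + 2 * l}")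
      case True
      have "\<bar>square_wave l c x - square_wave l (c + s) x\<bar> \<le> 2"
        using square_wave_bound[of l c x] square_wave_bound[of l "c + s" x] by linarith
      then show ?thesis using True by (auto simp: h_def indicator_def)
    next
      case False
      then consider "a + s < x" "x < a + l" | "a + l + s < x" "x < a + 2 * l" using s l by fastforce
      then have "square_wave l c x = square_wave l (c + s) x"
      proof cases
        case 1
        then have "\<bar>x - c\<bar> < l / 2" "\<bar>x - (c + s)\<bar> < l / 2" using s by (auto simp: a_def abs_if)
        then show ?thesis by (simp add: square_wave_eq_1[OF l])
      next
        case 2
        then have "l / 2 < \<bar>x - c\<bar>" "\<bar>x - c\<bar> < 3 * l / 2" "l / 2 < \<bar>x - (c + s)\<bar>" "\<bar>x - (c + s)\<bar> < 3 * l / 2"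
          using s l by (auto simp: a_def abs_if)
        then show ?thesis by (simp add: square_wave_eq_neg_1[OF l])
      qed
      then show ?thesis by (simp add: h_def)
    qed
  qed
  also have "\<dots> = 4 * s" unfolding h_def using s by (simp add: emeasure_lborel_Icc_eq)
  finally show ?thesis .
qed

lemma square_wave_to_circle: "l > 0 \<Longrightarrow> square_wave l (to_circle l c) x = square_wave l c x"
proof -
  assume l: "l > 0"
  have "pi * (x - (c + 2 * l)) / l = pi * (x - c) / l - 2 * pi" for c using l by (simp add: field_simps)
  then have "square_wave l (c + 2 * l) x = square_wave l c x" for c
    by (simp add: square_wave_def cos_diff)
  then show ?thesis by (rule periodic_to_circle)
qed

text \<open>Averaging over the window \<open>{0..\<delta>}\<close>, on which each translate of
  \<open>B\<close> has at most its full integral over the circle. The summand \<delta> supplies the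
  strict inequality for the contradiction.\<close>

lemma exists_good_shift:
  assumes l: "l > 0" and B: "B \<in> borel_measurable borel" "\<And>x. B (x + 2 * l) = B x" "integrable (circle l) B" "\<And>x. 0 \<le> B x"
    and \<delta>: "0 < \<delta>" "\<delta> < l" and good: "AE s in lborel. P s"
  obtains s where "P s" "0 \<le> s" "s \<le> \<delta>" "B (s + a) + B (s + b) \<le> 2 * (\<integral>x. B x \<partial>circle l) / \<delta> + \<delta>"
proof -
  define \<phi> where "\<phi> s = B (s + a) + B (s + b)" for s
  define I where "I = (\<integral>x. B x \<partial>circle l)"
  define T where "T = 2 * I / \<delta> + \<delta>"
  have i: "integrable (circle l) (\<lambda>s. B (s + d))" "(\<integral>s. B (s + d) \<partial>circle l) = I" for d
    using B unfolding I_def by (simp_all add: integrable_circle_shift[OF l] integral_circle_shift[OF l])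
  have \<phi>: "integrable (circle l) \<phi>" "(\<integral>s. \<phi> s \<partial>circle l) = 2 * I"
    unfolding \<phi>_def using i by auto
  have "\<exists>s. P s \<and> s \<in> {0..\<delta>} \<and> \<phi> s \<le> T"
  proof (rule ccontr)
    assume "\<not> ?thesis"
    then have neg: "T < \<phi> s" if "P s" "s \<in> {0..\<delta>}" for s using that by force
    have "(\<integral>s. T * indicator {0..\<delta>} s \<partial>circle l) \<le> (\<integral>s. \<phi> s \<partial>circle l)"
    proof (rule integral_mono_AE[OF _ \<phi>(1)])
      show "integrable (circle l) (\<lambda>s. T * indicator {0..\<delta>} s)"
        by (rule integrable_circle_bounded[of _ "\<bar>T\<bar>"]) (auto simp: indicator_def)
      show "AE s in circle l. T * indicator {0..\<delta>} s \<le> \<phi> s"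
        using AE_circle_lborel[OF good]
      proof eventually_elim
        case (elim s)
        have "0 \<le> \<phi> s" using B(4) by (simp add: \<phi>_def)
        then show ?case using neg[OF elim] by (auto simp: indicator_def)
      qed
    qed
    also have "(\<integral>s. T * indicator {0..\<delta>} s \<partial>circle l) = (LINT s:{-l..<l}|lborel. T * indicator {0..\<delta>} s)"
      by (rule set_integral_circle[symmetric]) simp
    also have "\<dots> = (\<integral>s. T * indicator {0..\<delta>} s \<partial>lborel)"
      unfolding set_lebesgue_integral_def using \<delta> l
      by (intro Bochner_Integration.integral_cong) (auto simp: indicator_def)
    also have "\<dots> = T * \<delta>" using \<delta> by (simp add: emeasure_lborel_Icc_eq)
    also have "\<dots> = 2 * I + \<delta> * \<delta>" using \<delta> by (simp add: T_def field_simps)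
    finally show False using \<phi>(2) mult_pos_pos[OF \<delta>(1) \<delta>(1)] by simp
  qed
  then show ?thesis using that unfolding T_def I_def \<phi>_def by auto
qed

text \<open>
  The slice \<open>y\<^sub>0\<close> fixes the position of the two walls. The other slices are compared with it through
  \<open>g\<close>: up to small errors \<open>n\<^sub>1 = - g\<^sub>x\<close>, so the correlation of \<open>n\<^sub>1\<close> with a square wave is the difference
  of \<open>g\<close> at the two jumps, and this hardly depends on \<open>y\<close> because \<open>g\<^sub>y\<close> is small.
\<close>

lemma correlation_with_square_wave:
  assumes l: "l > 0" and \<sigma>: "\<sigma> > 0" and \<delta>: "0 < \<delta>" "\<delta> < 1" "\<delta> < l"
    and f: "\<And>t. (f has_real_derivative reduced_root (A0 \<sigma>) t) (at t)" "mono f"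
    and s: "0 < s" "s < nbar \<sigma>" and E: "E < 8 * (f s - f (- s))" "0 \<le> E"
    and z: "(n, g) \<in> Y_space l" and F: "F_energy \<sigma> l (\<delta> ^ 4) n g \<le> 2 * l * E"
  defines "K \<equiv> (1 / nbar \<sigma> + 2 / ((nbar \<sigma>)\<^sup>2 - s\<^sup>2)) * (2 * sqrt (2 * l * A0 \<sigma> * E)) + sqrt (2 * l * E)"
  defines "C1 \<equiv> 2 * (2 * l * E) + 2 * (2 * l * E) / \<sigma>"
  defines "L \<equiv> 2 * l * (2 * K + 4 * nbar \<sigma>) + sqrt (4 * l\<^sup>2 * (2 * l * E)) + 2 * l * sqrt (2 * l * E)
      + 8 * l * (2 * sqrt (4 * l\<^sup>2 * C1) + 1)"
  assumes small: "K * \<delta>\<^sup>2 < 2 * l * nbar \<sigma>"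
  shows "\<exists>c\<in>{-l<..<l}. 4 * l\<^sup>2 * nbar \<sigma> - L * \<delta> \<le> (\<integral>z. n z $ 1 * square_wave l c (fst z) \<partial>torus l)"
proof -
  define m \<epsilon> where "m = nbar \<sigma>" and "\<epsilon> = \<delta> ^ 4"
  have m: "0 < m" "m < 1" using nbar_pos[OF \<sigma>] nbar_less_1[OF \<sigma>] by (auto simp: m_def)
  have \<epsilon>: "0 < \<epsilon>" using \<delta> by (simp add: \<epsilon>_def)
  note Y = Y_space_components[OF l z]
  note eb = energy_bounds[OF l \<sigma> \<epsilon> z F[folded \<epsilon>_def]]
  define u v p hh where "u = (\<lambda>z. n z $ 1)" and "v = (\<lambda>z. fst (weak_grad l u z))"
    and "p = weak_dx l g" and "hh = (\<lambda>z. p z + u z)"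
  have uW: "u \<in> W12 l" and u2: "u \<in> L2 l" using Y(1,2)[of 1] by (auto simp: u_def)
  have u1: "u \<in> L1 l" by (rule L2_imp_L1[OF u2])
  have g1: "g \<in> L1 l" by (rule L2_imp_L1[OF Y(6)])
  have p1: "p \<in> L1 l" unfolding p_def by (rule L2_imp_L1[OF Y(8)])
  have um: "u \<in> borel_measurable borel" and ui: "integrable (torus l) u" using u1 by (auto simp: L1_iff)
  have pm: "p \<in> borel_measurable borel" and pi: "integrable (torus l) p" using p1 by (auto simp: L1_iff)
  have gper: "g (x + 2 * l, y) = g (x, y)" for x y using g1 by (simp add: L1_iff periodic_def)
  have hm: "hh \<in> borel_measurable borel" unfolding hh_def using um pm by measurable
  have hi: "integrable (torus l) hh" unfolding hh_def using ui pi by auto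
  have h2i: "integrable (torus l) (\<lambda>z. (hh z)\<^sup>2)" and h2: "(\<integral>z. (hh z)\<^sup>2 \<partial>torus l) \<le> 2 * l * E * \<epsilon>"
    using eb(3,7) by (simp_all add: hh_def p_def u_def)
  have slm: "(\<lambda>x. q (x, y)) \<in> borel_measurable borel" if "q \<in> borel_measurable borel" for q :: "real \<times> real \<Rightarrow> real" and y
  proof -
    have "q \<in> borel_measurable (borel \<Otimes>\<^sub>M borel)" using that by (simp add: borel_prod)
    then show ?thesis by measurable
  qed
  obtain U where U: "AE y in circle l. circle_primitive l (U y) (\<lambda>x. v (x, y))" "AE z in torus l. u z = U (snd z) (fst z)"
    unfolding v_def by (rule weak_grad_slices[OF l u1 weak_grad_W12[OF l uW]])
  obtain G where G: "AE y in circle l. circle_primitive l (G y) (\<lambda>x. p (x, y))" "AE z in torus l. g z = G (snd z) (fst z)"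
    unfolding p_def weak_dx_def by (rule weak_grad_slices[OF l g1 weak_grad_W12[OF l Y(5)]])
  define B where "B x = (\<integral>t. \<bar>weak_dy l g (x, t)\<bar> \<partial>circle l)" for x
  \<comment> \<open>\<open>B x\<close> bounds the deviation of g along the vertical line at
    \<open>x\<close>, so \<open>k x\<close> serves as a common reference for all slices.\<close>
  obtain k where k: "AE z in torus l. \<bar>g z - k (fst z)\<bar> \<le> B (fst z)"
    unfolding B_def weak_dy_def by (rule weak_grad_oscillation[OF l g1 weak_grad_W12[OF l Y(5)]]) blast
  have wy: "weak_dy l g \<in> borel_measurable borel" "\<And>x y. weak_dy l g (x + 2 * l, y) = weak_dy l g (x, y)"
    using Y(9) by (auto simp: L2_iff periodic_def)
  have wsm: "(\<lambda>z. weak_dy l g (snd z, fst z)) \<in> borel_measurable borel"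
  proof -
    have "(\<lambda>z::real\<times>real. (snd z, fst z)) \<in> borel_measurable borel"
      by (auto intro!: borel_measurable_continuous_onI continuous_intros)
    from measurable_compose[OF this wy(1)] show ?thesis .
  qed
  note Bs = slice_L1_square[OF l wsm integrable_torus_swap[OF eb(8)], simplified fst_conv snd_conv, folded B_def]
  have Bm: "B \<in> borel_measurable borel" using borel_measurable_integrable[OF Bs(1)] by (simp add: measurable_circle)
  have Bper: "B (x + 2 * l) = B x" for x by (simp add: B_def wy(2))
  have B0: "0 \<le> B x" for x unfolding B_def by (rule integral_nonneg_AE) simp
  have C1: "0 \<le> C1" using l E \<sigma> by (simp add: C1_def)
  have Bint: "(\<integral>x. B x \<partial>circle l) \<le> sqrt (4 * l\<^sup>2 * C1) * \<delta>\<^sup>2"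
  proof -
    have "(\<integral>x. B x \<partial>circle l)\<^sup>2 \<le> 2 * l * (\<integral>x. (B x)\<^sup>2 \<partial>circle l)"
      using integral_square_le[OF finite_measure_circle Bs(1,2)] l by (simp add: measure_circle)
    also have "\<dots> \<le> 2 * l * (2 * l * (\<integral>z. (weak_dy l g (snd z, fst z))\<^sup>2 \<partial>torus l))"
      using Bs(3) l by (intro mult_left_mono) auto
    also have "(\<integral>z. (weak_dy l g (snd z, fst z))\<^sup>2 \<partial>torus l) = (\<integral>z. (weak_dy l g z)\<^sup>2 \<partial>torus l)"
      using integral_torus_swap[of "\<lambda>z. (weak_dy l g z)\<^sup>2" l] wy(1) by simp
    also have "2 * l * (2 * l * \<dots>) \<le> 2 * l * (2 * l * (C1 * \<epsilon>))"
      using eb(4) l by (intro mult_left_mono) (auto simp: C1_def)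
    finally have "(\<integral>x. B x \<partial>circle l)\<^sup>2 \<le> (4 * l\<^sup>2 * C1) * \<delta> ^ 4" by (simp add: \<epsilon>_def power2_eq_square mult_ac)
    from abs_le_of_square_le[OF this] show ?thesis using C1 by simp
  qed
  define e where "e z = energy_density \<sigma> l \<epsilon> n g z" for z
  have ei: "integrable (torus l) e" unfolding e_def[abs_def] by (rule energy_density_integrable[OF l z])
  have eE: "(\<integral>y. \<integral>x. e (x, y) \<partial>circle l \<partial>circle l) \<le> 2 * l * E"
  proof -
    have "(\<integral>y. \<integral>x. e (x, y) \<partial>circle l \<partial>circle l) = (\<integral>z. e z \<partial>torus l)" by (rule integral_torus_snd[OF ei])
    also have "\<dots> = F_energy \<sigma> l \<epsilon> n g" unfolding F_energy_torus[OF l z] e_def ..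
    also have "\<dots> \<le> 2 * l * E" by (rule F[folded \<epsilon>_def])
    finally show ?thesis .
  qed
  \<comment> \<open>The almost-everywhere properties of slices are bundled, so that the slice with
    at most average energy has all of them.\<close>
  define Q where "Q y \<longleftrightarrow> circle_primitive l (U y) (\<lambda>x. v (x, y)) \<and> (AE x in circle l. u (x, y) = U y x)
     \<and> circle_primitive l (G y) (\<lambda>x. p (x, y)) \<and> (AE x in circle l. g (x, y) = G y x \<and> \<bar>g (x, y) - k x\<bar> \<le> B x)
     \<and> (AE x in circle l. n (x, y) \<in> sphere 0 1) \<and> integrable (circle l) (\<lambda>x. e (x, y))
     \<and> integrable (circle l) (\<lambda>x. hh (x, y))" for y
  have gk: "AE z in torus l. g z = G (snd z) (fst z) \<and> \<bar>g z - k (fst z)\<bar> \<le> B (fst z)"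
    using G(2) k by eventually_elim simp
  have aeQ: "AE y in circle l. Q y"
    using U(1) AE_torus_pair(2)[OF U(2)] G(1) AE_torus_pair(2)[OF gk] AE_torus_pair(2)[OF Y(10)]
      AE_integrable_torus_snd[OF ei] AE_integrable_torus_snd[OF hi]
    unfolding Q_def by eventually_elim simp
  obtain y0 where Qy0: "Q y0" and y0': "(\<integral>x. e (x, y0) \<partial>circle l) \<le> (\<integral>y. \<integral>x. e (x, y) \<partial>circle l \<partial>circle l) / (2 * l)"
    by (rule exists_le_average[OF l integrable_torus_snd[OF ei] aeQ])
  have "(\<integral>y. \<integral>x. e (x, y) \<partial>circle l \<partial>circle l) / (2 * l) \<le> E"
    using eE l by (simp add: divide_le_eq mult.commute)
  with y0' have y0: "(\<integral>x. e (x, y0) \<partial>circle l) \<le> E" by linarith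
  from Qy0 have q0: "circle_primitive l (U y0) (\<lambda>x. v (x, y0))" "AE x in circle l. u (x, y0) = U y0 x"
      "circle_primitive l (G y0) (\<lambda>x. p (x, y0))" "AE x in circle l. g (x, y0) = G y0 x \<and> \<bar>g (x, y0) - k x\<bar> \<le> B x"
      "AE x in circle l. n (x, y0) \<in> sphere 0 1" "integrable (circle l) (\<lambda>x. e (x, y0))"
      "integrable (circle l) (\<lambda>x. hh (x, y0))"
    by (auto simp: Q_def)
  have Uc: "continuous_on S (U y0)" for S by (rule circle_primitive_continuous[OF l q0(1)])
  have Um: "U y0 \<in> borel_measurable borel" by (rule borel_measurable_continuous_onI[OF Uc])
  have Uper: "U y0 (x + 2 * l) = U y0 x" for x using q0(1) by (simp add: circle_primitive_def)
  obtain BU where BU: "\<forall>x. \<bar>U y0 x\<bar> \<le> BU" by (rule periodic_continuous_bounded[OF l Uc Uper]) auto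
  have Ui: "integrable (circle l) (U y0)" by (rule integrable_circle_bounded[OF Um, of BU]) (use BU in auto)
  \<comment> \<open>\<open>G y0\<close> is periodic, so \<open>g\<^sub>x\<close> has mean zero on
    this slice and \<open>hh\<close> has the same mean as \<open>n\<^sub>1\<close>.\<close>
  have hU: "(\<integral>x. hh (x, y0) \<partial>circle l) = (\<integral>x. U y0 x \<partial>circle l)"
  proof -
    have pi0: "integrable (circle l) (\<lambda>x. p (x, y0))" and pp0: "\<And>x. p (x + 2 * l, y0) = p (x, y0)"
      and G0per: "\<And>x. G y0 (x + 2 * l) = G y0 x"
      using q0(3) by (auto simp: circle_primitive_def)
    have "(\<integral>x. p (x, y0) \<partial>circle l) = (LINT x:{-l..<-l + 2 * l}|lborel. p (x, y0))"
      by (rule integral_period[OF l slm[OF pm] pp0, symmetric])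
    also have "\<dots> = G y0 (-l + 2 * l) - G y0 (-l)"
      using l by (intro circle_primitive_diff[OF q0(3), symmetric]) auto
    finally have p0: "(\<integral>x. p (x, y0) \<partial>circle l) = 0" by (simp only: G0per)
    have "(\<integral>x. hh (x, y0) \<partial>circle l) = (\<integral>x. p (x, y0) + U y0 x \<partial>circle l)"
    proof (rule integral_cong_AE)
      show "AE x in circle l. hh (x, y0) = p (x, y0) + U y0 x"
        using q0(2) by eventually_elim (simp add: hh_def)
    qed (use slm[OF hm] slm[OF pm] Um in \<open>auto simp: measurable_circle\<close>)
    then show ?thesis using pi0 Ui p0 by simp
  qed
  have U1: "AE x in circle l. \<bar>U y0 x\<bar> \<le> 1"
    using q0(2,5)
  proof eventually_elim
    case (elim x)
    have "(u (x, y0))\<^sup>2 \<le> 1"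
      using sphere_components[OF elim(2)] sum_power2_ge_zero[of "n (x, y0) $ 2" "n (x, y0) $ 3"] unfolding u_def by linarith
    then show ?case using elim(1) by (simp add: abs_square_le_1)
  qed
  have ge: "AE x in circle l. \<delta> ^ 4 * (v (x, y0))\<^sup>2 + (sqrt (1 - (U y0 x)\<^sup>2) - A0 \<sigma>)\<^sup>2 / (A0 \<sigma> * \<delta> ^ 4)
     + (hh (x, y0))\<^sup>2 / \<delta> ^ 4 \<le> e (x, y0)"
    using q0(2,5)
  proof eventually_elim
    case (elim x)
    from energy_density_ge[where p="(x, y0)" and n=n and g=g and l=l, OF \<sigma> \<epsilon> elim(2)] elim(1)
    show ?case by (simp add: v_def u_def hh_def p_def e_def \<epsilon>_def)
  qed
  note sl = slice_close_to_square_wave[OF l \<sigma> \<delta>(1) f s E q0(1) U1 q0(6) y0 slm[OF hm] hU ge small[unfolded K_def], folded K_def m_def]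
  obtain c1 where c1: "(\<integral>x. \<bar>U y0 x - m * square_wave l c1 x\<bar> \<partial>circle l) \<le> 2 * (K * \<delta>\<^sup>2)"
    using sl(2) by (rule exE)
  \<comment> \<open>The jumps may lie anywhere on the line, so the property is phrased to be
    invariant under shifts by a period. \<open>k\<close> is evaluated at the reduced point, since
    nothing is known of it off the cell, and agreement with \<open>G y\<close> is asked only for
    those \<open>y\<close> where \<open>G y\<close> is a primitive and hence periodic.\<close>
  define N where "N x \<longleftrightarrow> (AE y in circle l. (circle_primitive l (G y) (\<lambda>x. p (x, y)) \<longrightarrow> g (x, y) = G y x)
      \<and> \<bar>g (x, y) - k (to_circle l x)\<bar> \<le> B x)" for x
  define N0 where "N0 x \<longleftrightarrow> g (x, y0) = G y0 x \<and> \<bar>g (x, y0) - k (to_circle l x)\<bar> \<le> B x" for x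
  have Nae: "AE x in lborel. N x"
  proof (rule AE_lborel_periodic1[OF l])
    show "AE x in circle l. N x"
      using AE_torus_pair(1)[OF gk] AE_circle_segment
    proof eventually_elim
      case (elim x)
      then show ?case unfolding N_def to_circle_id[OF elim(2)] by (auto elim!: eventually_mono)
    qed
    show "N (x + 2 * l) = N x" for x
    proof -
      have "(circle_primitive l (G y) (\<lambda>x. p (x, y)) \<longrightarrow> g (x + 2 * l, y) = G y (x + 2 * l))
         \<longleftrightarrow> (circle_primitive l (G y) (\<lambda>x. p (x, y)) \<longrightarrow> g (x, y) = G y x)" for y
        using gper[of x y] by (auto simp: circle_primitive_def)
      then show ?thesis unfolding N_def by (simp only: gper to_circle_periodic[OF l] Bper)
    qed
  qed
  have N0ae: "AE x in lborel. N0 x"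
  proof (rule AE_lborel_periodic1[OF l])
    show "AE x in circle l. N0 x"
      using q0(4) AE_circle_segment unfolding N0_def by eventually_elim (auto simp: to_circle_id)
    show "N0 (x + 2 * l) = N0 x" for x
      using q0(3) unfolding N0_def circle_primitive_def by (simp only: gper to_circle_periodic[OF l] Bper)
  qed
  \<comment> \<open>The final shift has to lie in the open interval \<open>{-l<..<l}\<close>, so
    positions that reduce to the endpoint are avoided.\<close>
  have N2ae: "AE x in lborel. to_circle l x \<noteq> - l"
  proof (rule AE_lborel_periodic1[OF l])
    show "AE x in circle l. to_circle l x \<noteq> - l"
      using AE_circle_segment AE_circle_lborel[OF AE_lborel_singleton[of "-l"]] by eventually_elim (simp add: to_circle_id)
  qed (simp add: to_circle_periodic[OF l])
  define a b where "a = c1 - l / 2" and "b = c1 + l / 2"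
  have aeT: "AE t in lborel. N (a + t) \<and> N (b + t) \<and> N0 (a + t) \<and> N0 (b + t) \<and> to_circle l (c1 + t) \<noteq> - l"
    using AE_lborel_translate[OF Nae] AE_lborel_translate[OF N0ae] AE_lborel_translate[OF N2ae] by (simp add: AE_conj_iff)
  obtain t where t: "N (a + t)" "N (b + t)" "N0 (a + t)" "N0 (b + t)" "to_circle l (c1 + t) \<noteq> - l"
      "0 \<le> t" "t \<le> \<delta>" "B (t + a) + B (t + b) \<le> 2 * (\<integral>x. B x \<partial>circle l) / \<delta> + \<delta>"
    by (rule exists_good_shift[OF l Bm Bper Bs(1) B0 \<delta>(1,3) aeT, of a b]) blast
  define c where "c = c1 + t"
  have ab: "a + t = c - l / 2" "b + t = c + l / 2" by (auto simp: a_def b_def c_def)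
  define T where "T = B (c - l / 2) + B (c + l / 2)"
  \<comment> \<open>The integral of \<open>B\<close> is of order \<open>\<delta>\<^sup>2\<close>;
    dividing by the window length leaves order \<delta>, which matches the error from moving the
    wave by up to \<delta>.\<close>
  have T: "T \<le> (2 * sqrt (4 * l\<^sup>2 * C1) + 1) * \<delta>"
  proof -
    have "T \<le> 2 * (\<integral>x. B x \<partial>circle l) / \<delta> + \<delta>" using t(8) by (simp add: T_def ab[symmetric] add.commute)
    also have "\<dots> \<le> 2 * (sqrt (4 * l\<^sup>2 * C1) * \<delta>\<^sup>2) / \<delta> + \<delta>"
      using Bint \<delta>(1) by (intro add_mono divide_right_mono mult_left_mono) auto
    also have "\<dots> = (2 * sqrt (4 * l\<^sup>2 * C1) + 1) * \<delta>" using \<delta>(1) by (simp add: power2_eq_square algebra_simps)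
    finally show ?thesis .
  qed
  note N = t(1,2)[unfolded N_def ab] and N0 = t(3,4)[unfolded N0_def ab]
  define q where "q x = square_wave l c x" for x
  have qm [measurable]: "q \<in> borel_measurable borel" unfolding q_def[abs_def] by (rule square_wave_measurable)
  have q1: "\<bar>q x\<bar> \<le> 1" for x unfolding q_def by (rule square_wave_bound)
  have uq: "integrable (torus l) (\<lambda>z. u z * q (fst z))"
    by (rule integrable_mult_bounded[OF ui, where C=1]) (use q1 in \<open>auto simp: measurable_torus\<close>)
  define J H where "J y = (\<integral>x. u (x, y) * q x \<partial>circle l)" and "H y = (\<integral>x. \<bar>hh (x, y)\<bar> \<partial>circle l)" for y
  \<comment> \<open>\<open>n\<^sub>1\<close> is \<open>hh - g\<^sub>x\<close>. The first part
    contributes at most \<open>H y\<close>, the second a difference of two values of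
    \<open>G y\<close>.\<close>
  have pair: "\<bar>J y + 2 * (G y (c + l / 2) - G y (c - l / 2))\<bar> \<le> H y"
    if P: "circle_primitive l (G y) (\<lambda>x. p (x, y))" and h: "integrable (circle l) (\<lambda>x. hh (x, y))" for y
  proof -
    have ip: "integrable (circle l) (\<lambda>x. p (x, y))" using P by (simp add: circle_primitive_def)
    have i1: "integrable (circle l) (\<lambda>x. hh (x, y) * q x)" "integrable (circle l) (\<lambda>x. p (x, y) * q x)"
      by (rule integrable_mult_bounded[OF h, where C=1] integrable_mult_bounded[OF ip, where C=1];
          use q1 in \<open>auto simp: measurable_circle\<close>)+
    have "J y = (\<integral>x. hh (x, y) * q x - p (x, y) * q x \<partial>circle l)"
      by (simp add: J_def hh_def algebra_simps)
    also have "\<dots> = (\<integral>x. hh (x, y) * q x \<partial>circle l) - 2 * (G y (c + l / 2) - G y (c - l / 2))"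
      using i1 circle_primitive_square_wave[OF l P, of c] by (simp add: q_def)
    finally have "J y + 2 * (G y (c + l / 2) - G y (c - l / 2)) = (\<integral>x. hh (x, y) * q x \<partial>circle l)" by simp
    moreover have "\<bar>\<integral>x. hh (x, y) * q x \<partial>circle l\<bar> \<le> (\<integral>x. \<bar>hh (x, y) * q x\<bar> \<partial>circle l)"
      using integral_norm_bound[of "circle l" "\<lambda>x. hh (x, y) * q x"] by simp
    moreover have "\<dots> \<le> H y"
      unfolding H_def using i1(1) h q1 by (intro integral_mono integrable_abs) (auto simp: abs_mult mult_left_le)
    ultimately show ?thesis by linarith
  qed
  \<comment> \<open>On the chosen slice \<open>n\<^sub>1\<close> is close to \<open>m\<close> times
    the wave at \<open>c1\<close>. Replacing \<open>c1\<close> by \<open>c\<close> costs at most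
    \<open>4 * t\<close> in L1, multiplied by \<open>m\<close>.\<close>
  have J0: "2 * l * m - (2 * K + 4 * m) * \<delta> \<le> J y0"
  proof -
    have iUq: "integrable (circle l) (\<lambda>x. U y0 x * q x)"
      by (rule integrable_mult_bounded[OF Ui, where C=1]) (use q1 in \<open>auto simp: measurable_circle\<close>)
    have i1: "integrable (circle l) (\<lambda>x. \<bar>U y0 x - m * square_wave l c1 x\<bar>)" "integrable (circle l) (\<lambda>x. \<bar>square_wave l c1 x - q x\<bar>)"
      using Ui integrable_square_wave[of l c1] integrable_square_wave[of l c] by (auto simp: q_def)
    have "2 * l * m - (2 * (K * \<delta>\<^sup>2) + m * (4 * t))
       \<le> (\<integral>x. m - (\<bar>U y0 x - m * square_wave l c1 x\<bar> + m * \<bar>square_wave l c1 x - q x\<bar>) \<partial>circle l)"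
    proof -
      have "t \<le> l" using t(7) \<delta>(3) by simp
      then have "(\<integral>x. \<bar>square_wave l c1 x - q x\<bar> \<partial>circle l) \<le> 4 * t"
        using square_wave_translation_L1[OF l t(6), of c1] by (simp add: q_def c_def)
      then have "m * (\<integral>x. \<bar>square_wave l c1 x - q x\<bar> \<partial>circle l) \<le> m * (4 * t)"
        using m by (intro mult_left_mono) auto
      then show ?thesis using i1 c1 l by (simp add: measure_circle)
    qed
    also have "\<dots> \<le> (\<integral>x. U y0 x * q x \<partial>circle l)"
    proof (rule integral_mono_AE)
      show "AE x in circle l. m - (\<bar>U y0 x - m * square_wave l c1 x\<bar> + m * \<bar>square_wave l c1 x - q x\<bar>) \<le> U y0 x * q x"
        using AE_square_wave_square[OF l, of c]
      proof eventually_elim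
        case (elim x)
        then have qq: "q x * q x = 1" by (simp add: q_def power2_eq_square)
        have "m - U y0 x * q x = (m * q x - U y0 x) * q x" using qq by (simp add: algebra_simps)
        also have "\<dots> \<le> \<bar>m * q x - U y0 x\<bar> * \<bar>q x\<bar>" unfolding abs_mult[symmetric] by (rule abs_ge_self)
        also have "\<dots> \<le> \<bar>m * q x - U y0 x\<bar> * 1" using q1 by (intro mult_left_mono) auto
        also have "\<dots> \<le> \<bar>U y0 x - m * square_wave l c1 x\<bar> + \<bar>m * (square_wave l c1 x - q x)\<bar>"
          by (simp add: right_diff_distrib)
        also have "\<bar>m * (square_wave l c1 x - q x)\<bar> = m * \<bar>square_wave l c1 x - q x\<bar>" using m by (simp add: abs_mult)
        finally show ?case by simp
      qed
    qed (use i1 iUq in auto)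
    also have "\<dots> = J y0"
      unfolding J_def
    proof (rule integral_cong_AE)
      show "AE x in circle l. U y0 x * q x = u (x, y0) * q x" using q0(2) by eventually_elim simp
    qed (use Um slm[OF um] in \<open>auto simp: measurable_circle\<close>)
    finally have 1: "2 * l * m - (2 * (K * \<delta>\<^sup>2) + m * (4 * t)) \<le> J y0" .
    have "s\<^sup>2 < m\<^sup>2" using s by (intro power_strict_mono) (auto simp: m_def)
    then have "0 \<le> K" unfolding K_def m_def[symmetric] using m l E A0_bounds[OF \<sigma>] by simp
    moreover have "\<delta>\<^sup>2 \<le> \<delta>" using \<delta> by (simp add: power2_eq_square mult_left_le)
    ultimately have "K * \<delta>\<^sup>2 \<le> K * \<delta>" by (intro mult_left_mono)
    moreover have "m * (4 * t) \<le> m * (4 * \<delta>)" using m t(7) by (intro mult_left_mono) auto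
    ultimately show ?thesis using 1 by (simp add: algebra_simps)
  qed
  have H0: "H y0 \<le> sqrt (2 * l * E) * \<delta>\<^sup>2" unfolding H_def by (rule sl(1))
  \<comment> \<open>At a jump the values on both slices are within \<open>B\<close> of the same
    reference, so they differ by at most \<open>2 * B\<close>. The factor two in front of the
    difference of values makes this \<open>4 * T\<close> in total.\<close>
  have lower: "AE y in circle l. J y0 - H y0 - 4 * T - H y \<le> J y"
    using N(1,2) G(1) AE_integrable_torus_snd[OF hi]
  proof eventually_elim
    case (elim y)
    note a1 = pair[OF elim(3,4)] and a2 = pair[OF q0(3,7)]
    have "\<bar>G y (c + l / 2) - G y0 (c + l / 2)\<bar> \<le> 2 * B (c + l / 2)"
      using elim(2,3) N0(2) by linarith
    moreover have "\<bar>G y (c - l / 2) - G y0 (c - l / 2)\<bar> \<le> 2 * B (c - l / 2)"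
      using elim(1,3) N0(1) by linarith
    ultimately show ?case using a1 a2 unfolding T_def abs_le_iff by (simp add: algebra_simps)
  qed
  have Hi: "integrable (circle l) H" unfolding H_def
    using integrable_torus_snd[OF integrable_abs[OF hi]] by simp
  have Ji: "integrable (circle l) J" unfolding J_def using integrable_torus_snd[OF uq] by simp
  have Hint: "(\<integral>y. H y \<partial>circle l) \<le> sqrt (4 * l\<^sup>2 * (2 * l * E)) * \<delta>\<^sup>2"
  proof -
    have eq: "(\<integral>y. H y \<partial>circle l) = (\<integral>z. \<bar>hh z\<bar> \<partial>torus l)"
      unfolding H_def using integral_torus_snd[OF integrable_abs[OF hi]] by simp
    have "(\<integral>z. \<bar>hh z\<bar> \<partial>torus l)\<^sup>2 \<le> 4 * l\<^sup>2 * (\<integral>z. (hh z)\<^sup>2 \<partial>torus l)"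
      using integral_square_le[OF finite_measure_torus, of l "\<lambda>z. \<bar>hh z\<bar>"] hi h2i l by (simp add: measure_torus)
    also have "\<dots> \<le> 4 * l\<^sup>2 * (2 * l * E * \<epsilon>)" using h2 by (intro mult_left_mono) auto
    finally have "(\<integral>z. \<bar>hh z\<bar> \<partial>torus l)\<^sup>2 \<le> (4 * l\<^sup>2 * (2 * l * E)) * \<delta> ^ 4" by (simp add: \<epsilon>_def mult_ac)
    from abs_le_of_square_le[OF this] show ?thesis unfolding eq using l E by simp
  qed
  have "(\<integral>y. J y0 - H y0 - 4 * T - H y \<partial>circle l) \<le> (\<integral>y. J y \<partial>circle l)"
    using Hi Ji lower by (intro integral_mono_AE) auto
  then have "2 * l * (J y0 - H y0 - 4 * T) - (\<integral>y. H y \<partial>circle l) \<le> (\<integral>z. u z * q (fst z) \<partial>torus l)"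
    using Hi l integral_torus_snd[OF uq] by (simp add: measure_circle J_def)
  moreover have "2 * l * (2 * l * m - (2 * K + 4 * m) * \<delta> - sqrt (2 * l * E) * \<delta> - 4 * ((2 * sqrt (4 * l\<^sup>2 * C1) + 1) * \<delta>))
      \<le> 2 * l * (J y0 - H y0 - 4 * T)"
  proof (rule mult_left_mono)
    have "sqrt (2 * l * E) * \<delta>\<^sup>2 \<le> sqrt (2 * l * E) * \<delta>"
      using \<delta> l E by (intro mult_left_mono) (auto simp: power2_eq_square mult_left_le)
    then show "2 * l * m - (2 * K + 4 * m) * \<delta> - sqrt (2 * l * E) * \<delta> - 4 * ((2 * sqrt (4 * l\<^sup>2 * C1) + 1) * \<delta>) \<le> J y0 - H y0 - 4 * T"
      using J0 H0 T by linarith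
  qed (use l in simp)
  moreover have "(\<integral>y. H y \<partial>circle l) \<le> sqrt (4 * l\<^sup>2 * (2 * l * E)) * \<delta>"
  proof -
    have "sqrt (4 * l\<^sup>2 * (2 * l * E)) * \<delta>\<^sup>2 \<le> sqrt (4 * l\<^sup>2 * (2 * l * E)) * \<delta>"
      using \<delta> l E by (intro mult_left_mono) (auto simp: power2_eq_square mult_left_le)
    then show ?thesis using Hint by linarith
  qed
  moreover have "4 * l\<^sup>2 * m - L * \<delta>
     = 2 * l * (2 * l * m - (2 * K + 4 * m) * \<delta> - sqrt (2 * l * E) * \<delta> - 4 * ((2 * sqrt (4 * l\<^sup>2 * C1) + 1) * \<delta>))
       - sqrt (4 * l\<^sup>2 * (2 * l * E)) * \<delta>"
    unfolding L_def m_def[symmetric] by (simp add: algebra_simps power2_eq_square)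
  ultimately have "4 * l\<^sup>2 * m - L * \<delta> \<le> (\<integral>z. u z * q (fst z) \<partial>torus l)" by linarith
  moreover have "to_circle l c \<in> {-l<..<l}"
    using to_circle_in[OF l, of c] t(5) by (auto simp: c_def)
  ultimately show ?thesis
    unfolding q_def u_def m_def by (intro bexI[of _ "to_circle l c"]) (simp_all add: square_wave_to_circle[OF l])
qed

section \<open>Minimizers are close to the limit configuration\<close>

lemma integral_torus_abs_le:
  assumes l: "l > 0" and h: "h \<in> borel_measurable borel" "integrable (torus l) (\<lambda>z. (h z)\<^sup>2)"
    and le: "(\<integral>z. (h z)\<^sup>2 \<partial>torus l) \<le> C"
  shows "integrable (torus l) h" "(\<integral>z. \<bar>h z\<bar> \<partial>torus l) \<le> sqrt (4 * l\<^sup>2 * C)"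
proof -
  show hi: "integrable (torus l) h"
    by (rule integrable_of_square_integrable[OF finite_measure_torus]) (use h in \<open>auto simp: measurable_torus\<close>)
  have "(\<integral>z. \<bar>h z\<bar> \<partial>torus l)\<^sup>2 \<le> 4 * l\<^sup>2 * (\<integral>z. (h z)\<^sup>2 \<partial>torus l)"
    using integral_square_le[OF finite_measure_torus, of l "\<lambda>z. \<bar>h z\<bar>"] hi h l by (simp add: measure_torus)
  also have "\<dots> \<le> 4 * l\<^sup>2 * C" using le by (intro mult_left_mono) auto
  finally show "(\<integral>z. \<bar>h z\<bar> \<partial>torus l) \<le> sqrt (4 * l\<^sup>2 * C)" by (rule real_le_rsqrt)
qed

lemma pow4_le: "0 < \<delta> \<Longrightarrow> \<delta> < 1 \<Longrightarrow> \<delta> ^ 4 \<le> (\<delta> :: real)" "0 < \<delta> \<Longrightarrow> \<delta> < 1 \<Longrightarrow> \<delta>\<^sup>2 \<le> (\<delta> :: real)"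
  using power_decreasing[of 1 4 \<delta>] power_decreasing[of 1 2 \<delta>] by auto

text \<open>\<open>M1\<close> collects the two errors in the expansion of the square of
  \<open>n\<^sub>1 - m * q\<close>: the mixed term from the correlation, and the square of
  \<open>n\<^sub>1\<close> from \<open>n\<^sub>1\<^sup>2 \<le> m\<^sup>2 + 2 * \<bar>n\<^sub>3 -
  A\<bar>\<close>. The gradient of g minus the shifted limit has components
  \<open>(g\<^sub>x + n\<^sub>1) - (n\<^sub>1 - m * q)\<close> and \<open>g\<^sub>y\<close>, all of
  which are already under control.\<close>

lemma low_energy_close_to_limit:
  assumes l: "l > 0" and \<sigma>: "\<sigma> > 0" and \<delta>: "0 < \<delta>" "\<delta> < 1" and C: "0 \<le> C"
    and z: "(n, g) \<in> Y_space l" and F: "F_energy \<sigma> l (\<delta> ^ 4) n g \<le> C"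
    and c: "4 * l\<^sup>2 * nbar \<sigma> - L * \<delta> \<le> (\<integral>z. n z $ 1 * square_wave l c (fst z) \<partial>torus l)"
  defines "M1 \<equiv> 2 * L * nbar \<sigma> + 2 * sqrt (4 * l\<^sup>2 * C)"
  shows "L1_norm l (\<lambda>p. shift_x c n p - limit_director \<sigma> l p) \<le> sqrt (4 * l\<^sup>2 * (M1 + C / \<sigma> + C) * \<delta>)"
    and "L2_norm l (\<lambda>p. shift_x c (mean_free l g) p - limit_layer \<sigma> l p) \<le> sqrt (32 * l\<^sup>2 * (2 * M1 + 4 * C + 2 * C / \<sigma>) * \<delta>)"
proof -
  define m A \<epsilon> where "m = nbar \<sigma>" and "A = A0 \<sigma>" and "\<epsilon> = \<delta> ^ 4"
  have A: "0 < A" "A < 1" using A0_bounds[OF \<sigma>] by (auto simp: A_def)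
  have m: "0 < m" "m < 1" "m\<^sup>2 = 1 - A\<^sup>2"
    using nbar_pos[OF \<sigma>] nbar_less_1[OF \<sigma>] nbar_square[OF \<sigma>] by (auto simp: m_def A_def)
  have \<epsilon>: "0 < \<epsilon>" "\<epsilon> \<le> \<delta>" using \<delta> pow4_le by (auto simp: \<epsilon>_def)
  note Y = Y_space_components[OF l z]
  note eb = energy_bounds[OF l \<sigma> \<epsilon>(1) z F[folded \<epsilon>_def]]
  have nm: "(\<lambda>z. n z $ i) \<in> borel_measurable borel" for i using Y(2)[of i] by (simp add: L2_iff)
  have n3m: "(\<lambda>z. n z $ 3 - A) \<in> borel_measurable borel" using nm[of 3] by simp
  define q where "q z = square_wave l c (fst z)" for z :: "real \<times> real"
  have [measurable]: "q \<in> borel_measurable borel" unfolding q_def[abs_def] by measurable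
  have q1: "\<bar>q z\<bar> \<le> 1" for z unfolding q_def by (rule square_wave_bound)
  have q2: "AE z in torus l. (q z)\<^sup>2 = 1" unfolding q_def by (rule AE_torus_fst[OF AE_square_wave_square[OF l]])
  have ni: "integrable (torus l) (\<lambda>z. n z $ i)" for i
    using L2_imp_L1[OF Y(2)[of i]] by (simp add: L1_iff)
  have nq: "integrable (torus l) (\<lambda>z. n z $ 1 * q z)"
    by (rule integrable_mult_bounded[OF ni, where C=1]) (use q1 in \<open>auto simp: measurable_torus\<close>)
  have n3: "(\<integral>z. \<bar>n z $ 3 - A\<bar> \<partial>torus l) \<le> sqrt (4 * l\<^sup>2 * C) * \<delta>"
  proof -
    \<comment> \<open>Weakened to \<open>\<delta>\<^sup>2\<close> so that the square root taken
      below gives the common rate \<delta>.\<close>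
    have "C * \<epsilon> \<le> C * \<delta>\<^sup>2"
    proof (rule mult_left_mono[OF _ C])
      have "\<delta>\<^sup>2 * \<delta>\<^sup>2 \<le> \<delta>\<^sup>2 * 1" using \<delta> by (intro mult_left_mono) (auto simp: power_le_one)
      then show "\<epsilon> \<le> \<delta>\<^sup>2" by (simp add: \<epsilon>_def flip: power_add)
    qed
    then have "(\<integral>z. \<bar>n z $ 3 - A\<bar> \<partial>torus l) \<le> sqrt (4 * l\<^sup>2 * (C * \<delta>\<^sup>2))"
      using eb(2) by (intro integral_torus_abs_le[OF l n3m eb(6)[folded A_def]]) (simp add: A_def)
    also have "4 * l\<^sup>2 * (C * \<delta>\<^sup>2) = (4 * l\<^sup>2 * C) * \<delta>\<^sup>2" by simp
    finally show ?thesis using \<delta> unfolding real_sqrt_mult[of _ "\<delta>\<^sup>2"] by simp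
  qed
  have "(\<integral>z. (n z $ 1)\<^sup>2 \<partial>torus l) \<le> (\<integral>z. m\<^sup>2 + 2 * \<bar>n z $ 3 - A\<bar> \<partial>torus l)"
  proof (rule integral_mono_AE[OF eb(5)])
    show "AE z in torus l. (n z $ 1)\<^sup>2 \<le> m\<^sup>2 + 2 * \<bar>n z $ 3 - A\<bar>"
      using Y(10)
    proof eventually_elim
      case (elim z)
      have "(n z $ 1)\<^sup>2 \<le> 1 - (n z $ 3)\<^sup>2" using sphere_components[OF elim] zero_le_power2[of "n z $ 2"] by linarith
      also have "\<dots> = m\<^sup>2 - 2 * A * (n z $ 3 - A) - (n z $ 3 - A)\<^sup>2" using m(3) by (simp add: power2_eq_square algebra_simps)
      also have "\<dots> \<le> m\<^sup>2 + 2 * (A * \<bar>n z $ 3 - A\<bar>)"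
      proof -
        have "- (A * (n z $ 3 - A)) \<le> A * \<bar>n z $ 3 - A\<bar>"
          using mult_left_mono[OF abs_ge_minus_self less_imp_le[OF A(1)]] by (simp only: mult_minus_right)
        then show ?thesis using zero_le_power2[of "n z $ 3 - A"] by linarith
      qed
      also have "A * \<bar>n z $ 3 - A\<bar> \<le> \<bar>n z $ 3 - A\<bar>" using A by (simp add: mult_left_le_one_le)
      finally show ?case by simp
    qed
  qed (use ni[of 3] in auto)
  also have "\<dots> = 4 * l\<^sup>2 * m\<^sup>2 + 2 * (\<integral>z. \<bar>n z $ 3 - A\<bar> \<partial>torus l)"
    using ni[of 3] l by (simp add: measure_torus)
  finally have u2: "(\<integral>z. (n z $ 1)\<^sup>2 \<partial>torus l) \<le> 4 * l\<^sup>2 * m\<^sup>2 + 2 * (sqrt (4 * l\<^sup>2 * C) * \<delta>)" using n3 by linarith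
  define w where "w z = n z $ 1 - m * q z" for z
  have wm: "w \<in> borel_measurable borel" unfolding w_def using nm by measurable
  have qm2: "integrable (torus l) (\<lambda>z. (m * q z)\<^sup>2)"
  proof (rule torus_fin.integrable_const_bound[where B="m\<^sup>2"])
    have "(m * q z)\<^sup>2 \<le> m\<^sup>2" for z
      using mult_left_mono[of "(q z)\<^sup>2" 1 "m\<^sup>2"] q1[of z] by (simp add: power_mult_distrib abs_square_le_1)
    then show "AE z in torus l. norm ((m * q z)\<^sup>2) \<le> m\<^sup>2" by simp
    show "(\<lambda>z. (m * q z)\<^sup>2) \<in> borel_measurable (torus l)" using q1 by (simp add: measurable_torus)
  qed
  have w2i: "integrable (torus l) (\<lambda>z. (w z)\<^sup>2)"
    unfolding w_def using square_integrable_add[of "\<lambda>z. n z $ 1" "torus l" "\<lambda>z. - (m * q z)"] nm eb(5) qm2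
    by (simp add: measurable_torus)
  have w2: "(\<integral>z. (w z)\<^sup>2 \<partial>torus l) \<le> M1 * \<delta>"
  proof -
    have "(\<integral>z. (w z)\<^sup>2 \<partial>torus l) = (\<integral>z. (n z $ 1)\<^sup>2 - 2 * m * (n z $ 1 * q z) + m\<^sup>2 \<partial>torus l)"
    proof (rule integral_cong_AE)
      show "AE z in torus l. (w z)\<^sup>2 = (n z $ 1)\<^sup>2 - 2 * m * (n z $ 1 * q z) + m\<^sup>2"
        using q2 by eventually_elim (simp add: w_def power2_diff power_mult_distrib)
    qed (use wm nm in \<open>auto simp: measurable_torus\<close>)
    also have "\<dots> = (\<integral>z. (n z $ 1)\<^sup>2 \<partial>torus l) - 2 * m * (\<integral>z. n z $ 1 * q z \<partial>torus l) + m\<^sup>2 * (4 * l\<^sup>2)"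
      using eb(5)[of 1] nq l by (simp add: measure_torus)
    also have "\<dots> \<le> (4 * l\<^sup>2 * m\<^sup>2 + 2 * (sqrt (4 * l\<^sup>2 * C) * \<delta>)) - 2 * m * (4 * l\<^sup>2 * m - L * \<delta>) + m\<^sup>2 * (4 * l\<^sup>2)"
      using u2 c m(1) by (intro add_mono diff_mono mult_left_mono) (auto simp: q_def m_def)
    also have "\<dots> = M1 * \<delta>" by (simp add: M1_def m_def[symmetric] power2_eq_square algebra_simps)
    finally show ?thesis .
  qed
  have C\<delta>: "C * \<epsilon> \<le> C * \<delta>" "C / \<sigma> * \<epsilon> \<le> C / \<sigma> * \<delta>"
    using \<epsilon>(2) C \<sigma> by (intro mult_left_mono divide_nonneg_pos; simp)+
  \<comment> \<open>The limit is shifted instead of \<open>n\<close>; translation invariance of the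
    torus measure makes the norms agree.\<close>
  define N where "N p = norm (n p - limit_director \<sigma> l (fst p - c, snd p))" for p
  have dm: "limit_director \<sigma> l (fst p - c, snd p) $ 1 = m * q p" "limit_director \<sigma> l (fst p - c, snd p) $ 2 = 0"
    "limit_director \<sigma> l (fst p - c, snd p) $ 3 = A" for p
    by (simp_all add: limit_director_nth m_def A_def q_def square_wave_def)
  have N2: "(N p)\<^sup>2 = (w p)\<^sup>2 + (n p $ 2)\<^sup>2 + (n p $ 3 - A)\<^sup>2" for p
    unfolding N_def norm_real3 by (simp add: dm w_def)
  have "(\<lambda>p. n p - limit_director \<sigma> l (fst p - c, snd p)) \<in> borel_measurable borel"
  proof (rule measurable_real3)
    fix i :: 3
    show "(\<lambda>p. (n p - limit_director \<sigma> l (fst p - c, snd p)) $ i) \<in> borel_measurable borel"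
      using exhaust_3[of i] nm by (auto simp: dm)
  qed
  then have Nm: "N \<in> borel_measurable borel" unfolding N_def by measurable
  have N2i: "integrable (torus l) (\<lambda>p. (N p)\<^sup>2)"
    unfolding N2 using w2i eb(5,6) by (auto simp: A_def)
  have "(\<integral>p. (N p)\<^sup>2 \<partial>torus l) = (\<integral>p. (w p)\<^sup>2 \<partial>torus l) + (\<integral>p. (n p $ 2)\<^sup>2 \<partial>torus l) + (\<integral>p. (n p $ 3 - A)\<^sup>2 \<partial>torus l)"
    unfolding N2 using w2i eb(5)[of 2] eb(6) by (simp add: A_def)
  also have "\<dots> \<le> M1 * \<delta> + C / \<sigma> * \<delta> + C * \<delta>"
    using w2 eb(1,2) C\<delta> unfolding A_def by linarith
  finally have N2l: "(\<integral>p. (N p)\<^sup>2 \<partial>torus l) \<le> (M1 + C / \<sigma> + C) * \<delta>" by (simp add: algebra_simps)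
  have N_nonneg: "0 \<le> N p" for p by (simp add: N_def)
  have Nper: "periodic l N"
    unfolding periodic_def
  proof (intro allI conjI)
    fix x y
    have "limit_director \<sigma> l (x + 2 * l - c, y) = limit_director \<sigma> l (x - c, y)"
      using square_wave_periodic[OF l, of 0 "x - c"] by (simp add: limit_director_def algebra_simps)
    then show "N (x + 2 * l, y) = N (x, y)" using Y(4) by (simp add: N_def periodic_def)
    show "N (x, y + 2 * l) = N (x, y)" using Y(4) by (simp add: N_def periodic_def limit_director_def)
  qed
  have "L1_norm l (\<lambda>p. shift_x c n p - limit_director \<sigma> l p) = (LINT p:cell l|lborel. N (fst p + c, snd p))"
    unfolding L1_norm_def shift_x_def N_def by simp
  also have "\<dots> = (\<integral>p. N (fst p + c, snd p) \<partial>torus l)"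
  proof (rule set_integral_cell)
    have "(\<lambda>p::real\<times>real. (fst p + c, snd p)) \<in> borel_measurable borel"
      by (auto intro!: borel_measurable_continuous_onI continuous_intros)
    from measurable_compose[OF this Nm] show "(\<lambda>p. N (fst p + c, snd p)) \<in> borel_measurable borel" .
  qed
  also have "\<dots> = (\<integral>p. \<bar>N p\<bar> \<partial>torus l)"
    using integral_torus_shift[OF l Nm Nper] by (simp add: abs_of_nonneg[of "N _"] N_nonneg)
  also have "\<dots> \<le> sqrt (4 * l\<^sup>2 * ((M1 + C / \<sigma> + C) * \<delta>))"
    by (rule integral_torus_abs_le(2)[OF l Nm N2i N2l])
  finally show "L1_norm l (\<lambda>p. shift_x c n p - limit_director \<sigma> l p) \<le> sqrt (4 * l\<^sup>2 * (M1 + C / \<sigma> + C) * \<delta>)"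
    by (simp add: mult.assoc)

  define k where "k = (\<lambda>p::real\<times>real. - m * triangle_wave l (fst p + - c))"
  have kW: "k \<in> W12 l" and kV: "has_weak_grad l k (\<lambda>p. (- m * q p, 0))"
    using limit_layer_weak_grad[OF l, of m "- c"] by (simp_all add: k_def q_def)
  have k2: "k \<in> L2 l" using kW by (simp add: W12_def)
  note g1 = L2_imp_L1[OF Y(6)] and k1 = L2_imp_L1[OF k2]
  define V where "V = (\<lambda>p. weak_grad l g p - (- m * q p, 0))"
  note D = has_weak_grad_diff[OF g1 k1 weak_grad_W12[OF l Y(5)] kV, folded V_def]
  have V: "fst (V p) = (weak_dx l g p + n p $ 1) - w p" "snd (V p) = weak_dy l g p" for p
    by (simp_all add: V_def weak_dx_def weak_dy_def w_def)
  have h: "(\<lambda>p. weak_dx l g p + n p $ 1) \<in> borel_measurable borel"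
    using Y(8) nm[of 1] by (auto simp: L2_iff)
  have V1: "V \<in> L1 l" using D(2) by (simp add: has_weak_grad_def)
  have fV: "integrable (torus l) (\<lambda>p. (fst (V p))\<^sup>2)"
    using square_integrable_add[of "\<lambda>p. weak_dx l g p + n p $ 1" "torus l" "\<lambda>p. - w p"] h wm eb(7) w2i
    by (simp add: V(1) measurable_torus)
  have sV: "integrable (torus l) (\<lambda>p. (snd (V p))\<^sup>2)" using eb(8) by (simp add: V(2))
  have V2: "V \<in> L2 l" using V1 fV sV by (simp add: L1_iff L2_iff norm_pair_square)
  have "(\<integral>p. (fst (V p))\<^sup>2 \<partial>torus l) \<le> (\<integral>p. 2 * (weak_dx l g p + n p $ 1)\<^sup>2 + 2 * (w p)\<^sup>2 \<partial>torus l)"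
  proof (rule integral_mono[OF fV])
    have "(a - b)\<^sup>2 \<le> 2 * a\<^sup>2 + 2 * b\<^sup>2" for a b :: real
      using zero_le_power2[of "a + b"] by (simp add: power2_eq_square algebra_simps)
    then show "(fst (V p))\<^sup>2 \<le> 2 * (weak_dx l g p + n p $ 1)\<^sup>2 + 2 * (w p)\<^sup>2" for p unfolding V(1) .
  qed (use eb(7) w2i in auto)
  also have "\<dots> = 2 * (\<integral>p. (weak_dx l g p + n p $ 1)\<^sup>2 \<partial>torus l) + 2 * (\<integral>p. (w p)\<^sup>2 \<partial>torus l)"
    using eb(7) w2i by simp
  finally have "(\<integral>p. (norm (V p))\<^sup>2 \<partial>torus l)
     \<le> 2 * (\<integral>p. (weak_dx l g p + n p $ 1)\<^sup>2 \<partial>torus l) + 2 * (\<integral>p. (w p)\<^sup>2 \<partial>torus l) + (\<integral>p. (weak_dy l g p)\<^sup>2 \<partial>torus l)"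
    using fV sV by (simp add: norm_pair_square V(2))
  also have "\<dots> \<le> 2 * (C * \<delta>) + 2 * (M1 * \<delta>) + (2 * (C * \<delta>) + 2 * (C / \<sigma> * \<delta>))"
  proof -
    have "(2 * C + 2 * C / \<sigma>) * \<epsilon> = 2 * (C * \<epsilon>) + 2 * (C / \<sigma> * \<epsilon>)" by (simp add: algebra_simps)
    then show ?thesis using eb(3,4) w2 C\<delta> by linarith
  qed
  also have "\<dots> = (2 * M1 + 4 * C + 2 * C / \<sigma>) * \<delta>" by (simp add: algebra_simps)
  finally have VI: "(\<integral>p. (norm (V p))\<^sup>2 \<partial>torus l) \<le> (2 * M1 + 4 * C + 2 * C / \<sigma>) * \<delta>" .
  have gi: "integrable (torus l) g" and ki: "integrable (torus l) k" using g1 k1 by (auto simp: L1_iff)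
  have gm: "g \<in> borel_measurable borel" and km: "k \<in> borel_measurable borel" using g1 k1 by (auto simp: L1_iff)
  have gk2: "(\<lambda>p. g p - k p) \<in> L2 l"
    using D(1) square_integrable_add[of g "torus l" "\<lambda>p. - k p"] Y(6) k2 by (auto simp: L1_iff L2_iff measurable_torus)
  \<comment> \<open>The zigzag changes sign under a shift by \<open>l\<close>, so its mean vanishes,
    and the mean of \<open>g - k\<close> is exactly what \<open>mean_free\<close> subtracts.\<close>
  have kmean: "(\<integral>p. k p \<partial>torus l) = 0"
  proof -
    have tm: "(\<lambda>x. triangle_wave l (x + - c)) \<in> borel_measurable borel"
      using triangle_wave_measurable[OF l] by measurable
    have "(\<integral>x. triangle_wave l (x + l + - c) \<partial>circle l) = (\<integral>x. triangle_wave l (x + - c) \<partial>circle l)"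
      using integral_circle_shift[OF l tm, of l] triangle_wave_periodic[OF l, of "_ + - c"] by (simp add: algebra_simps)
    then have "(\<integral>x. triangle_wave l (x + - c) \<partial>circle l) = 0"
      using triangle_wave_half_period[OF l, of "_ + - c"] by (simp add: algebra_simps)
    then show ?thesis using integral_torus_snd[OF ki] by (simp add: k_def)
  qed
  have mean: "(\<integral>p. g p - k p \<partial>torus l) / (4 * l\<^sup>2) = torus_mean l g"
    using gi ki kmean set_integral_cell[OF gm, of l] by (simp add: torus_mean_def)
  have P: "(\<integral>p. (g p - k p - torus_mean l g)\<^sup>2 \<partial>torus l) \<le> 32 * l\<^sup>2 * ((2 * M1 + 4 * C + 2 * C / \<sigma>) * \<delta>)"
  proof -
    have "(\<integral>p. (g p - k p - torus_mean l g)\<^sup>2 \<partial>torus l) \<le> 32 * l\<^sup>2 * (\<integral>p. (norm (V p))\<^sup>2 \<partial>torus l)"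
      using torus_poincare[OF l gk2 D(2) V2] by (simp add: mean)
    also have "\<dots> \<le> 32 * l\<^sup>2 * ((2 * M1 + 4 * C + 2 * C / \<sigma>) * \<delta>)" using VI by (intro mult_left_mono) auto
    finally show ?thesis .
  qed
  define r where "r p = (g p - k p - torus_mean l g)\<^sup>2" for p
  have rm: "r \<in> borel_measurable borel" unfolding r_def using gm km by measurable
  have rper: "periodic l r" using g1 k1 by (simp add: r_def L1_iff periodic_def)
  have "(LINT p:cell l|lborel. (norm (shift_x c (mean_free l g) p - limit_layer \<sigma> l p))\<^sup>2)
      = (LINT p:cell l|lborel. r (fst p + c, snd p))"
    by (simp add: shift_x_def mean_free_def limit_layer_def r_def k_def m_def algebra_simps)
  also have "\<dots> = (\<integral>p. r (fst p + c, snd p) \<partial>torus l)"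
  proof (rule set_integral_cell)
    have "(\<lambda>p::real\<times>real. (fst p + c, snd p)) \<in> borel_measurable borel"
      by (auto intro!: borel_measurable_continuous_onI continuous_intros)
    from measurable_compose[OF this rm] show "(\<lambda>p. r (fst p + c, snd p)) \<in> borel_measurable borel" .
  qed
  also have "\<dots> = (\<integral>p. r p \<partial>torus l)" by (rule integral_torus_shift[OF l rm rper])
  finally have "L2_norm l (\<lambda>p. shift_x c (mean_free l g) p - limit_layer \<sigma> l p) = sqrt (\<integral>p. r p \<partial>torus l)"
    by (simp add: L2_norm_def)
  also have "\<dots> \<le> sqrt (32 * l\<^sup>2 * ((2 * M1 + 4 * C + 2 * C / \<sigma>) * \<delta>))"
    using P unfolding r_def by (rule real_sqrt_le_mono)
  finally show "L2_norm l (\<lambda>p. shift_x c (mean_free l g) p - limit_layer \<sigma> l p)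
      \<le> sqrt (32 * l\<^sup>2 * (2 * M1 + 4 * C + 2 * C / \<sigma>) * \<delta>)"
    by (simp add: mult.assoc)
qed

text \<open>\<open>E = 8 * \<kappa>\<close> because the competitor has energy at most
  \<open>16 * l * \<kappa> = 2 * l * E\<close>, so a minimizer has average slice energy at most
  \<open>E\<close>. The squared L2 errors are linear in
  \<open>\<delta> = sqrt (sqrt \<epsilon>)\<close>, and taking their root gives the stated
  rate.\<close>

lemma minimizers_close_to_limit:
  assumes l: "l > 0" and \<sigma>: "\<sigma> > 0"
  shows "\<exists>M \<epsilon>0. 0 < \<epsilon>0 \<and> (\<forall>\<epsilon> n g. 0 < \<epsilon> \<longrightarrow> \<epsilon> < \<epsilon>0 \<longrightarrow> (n, g) \<in> Y_space l \<longrightarrow> minimizes_G \<sigma> l \<epsilon> (n, g) \<longrightarrow>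
     (\<exists>c\<in>{-l<..<l}. L1_norm l (\<lambda>p. shift_x c n p - limit_director \<sigma> l p) \<le> sqrt (M * sqrt (sqrt \<epsilon>)) \<and>
        L2_norm l (\<lambda>p. shift_x c (mean_free l g) p - limit_layer \<sigma> l p) \<le> sqrt (M * sqrt (sqrt \<epsilon>))))"
proof -
  define \<kappa> where "\<kappa> = alpha \<sigma> * (1 - A0 \<sigma>) / sqrt (A0 \<sigma>)"
  have A: "0 < A0 \<sigma>" "A0 \<sigma> < 1" using A0_bounds[OF \<sigma>] by auto
  have \<kappa>: "0 < \<kappa>" unfolding \<kappa>_def using A alpha_pos[OF \<sigma>] by simp
  obtain f s where f: "\<And>t. (f has_real_derivative reduced_root (A0 \<sigma>) t) (at t)" "mono f"
    and s: "0 < s" "s < nbar \<sigma>" and gap: "\<kappa> < f s - f (- s)"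
    by (rule transition_potential[OF \<sigma>, folded \<kappa>_def]) (rule that)
  define E where "E = 8 * \<kappa>"
  have E: "E < 8 * (f s - f (- s))" "0 \<le> E" using gap \<kappa> by (auto simp: E_def)
  define K where "K = (1 / nbar \<sigma> + 2 / ((nbar \<sigma>)\<^sup>2 - s\<^sup>2)) * (2 * sqrt (2 * l * A0 \<sigma> * E)) + sqrt (2 * l * E)"
  define C1 where "C1 = 2 * (2 * l * E) + 2 * (2 * l * E) / \<sigma>"
  define L where "L = 2 * l * (2 * K + 4 * nbar \<sigma>) + sqrt (4 * l\<^sup>2 * (2 * l * E)) + 2 * l * sqrt (2 * l * E)
      + 8 * l * (2 * sqrt (4 * l\<^sup>2 * C1) + 1)"
  define C where "C = 2 * l * E"
  have C: "0 \<le> C" using l E by (simp add: C_def)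
  define M1 where "M1 = 2 * L * nbar \<sigma> + 2 * sqrt (4 * l\<^sup>2 * C)"
  define M where "M = max (4 * l\<^sup>2 * (M1 + C / \<sigma> + C)) (32 * l\<^sup>2 * (2 * M1 + 4 * C + 2 * C / \<sigma>))"
  \<comment> \<open>The four bounds ensure, in this order, \<open>\<delta> < 1\<close>,
    \<open>\<delta> < l\<close>, the smallness of \<open>K * \<delta>\<^sup>2\<close>, and room for
    the walls of the competitor.\<close>
  define \<epsilon>0 where "\<epsilon>0 = Min {1, l ^ 4, (2 * l * nbar \<sigma> / (\<bar>K\<bar> + 1))\<^sup>2, l * (1 - A0 \<sigma>) / (2 * alpha \<sigma> * sqrt (A0 \<sigma>))}"
  have "0 < \<epsilon>0"
    unfolding \<epsilon>0_def using l A alpha_pos[OF \<sigma>] nbar_pos[OF \<sigma>] by (auto simp: add_nonneg_pos)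
  moreover have "\<exists>c\<in>{-l<..<l}. L1_norm l (\<lambda>p. shift_x c n p - limit_director \<sigma> l p) \<le> sqrt (M * sqrt (sqrt \<epsilon>)) \<and>
        L2_norm l (\<lambda>p. shift_x c (mean_free l g) p - limit_layer \<sigma> l p) \<le> sqrt (M * sqrt (sqrt \<epsilon>))"
    if \<epsilon>: "0 < \<epsilon>" "\<epsilon> < \<epsilon>0" and z: "(n, g) \<in> Y_space l" and min: "minimizes_G \<sigma> l \<epsilon> (n, g)" for \<epsilon> n g
  proof -
    define \<delta> where "\<delta> = sqrt (sqrt \<epsilon>)"
    have \<delta>2: "\<delta>\<^sup>2 = sqrt \<epsilon>" using \<epsilon> by (simp add: \<delta>_def)
    have "\<delta> ^ 4 = (\<delta>\<^sup>2)\<^sup>2" by simp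
    then have \<delta>4: "\<delta> ^ 4 = \<epsilon>" unfolding \<delta>2 using \<epsilon> by simp
    have \<epsilon>b: "\<epsilon> < 1" "\<epsilon> < l ^ 4" "\<epsilon> < (2 * l * nbar \<sigma> / (\<bar>K\<bar> + 1))\<^sup>2"
      "\<epsilon> < l * (1 - A0 \<sigma>) / (2 * alpha \<sigma> * sqrt (A0 \<sigma>))"
      using \<epsilon>(2) unfolding \<epsilon>0_def by auto
    have \<delta>: "0 < \<delta>" "\<delta> < 1" using \<epsilon> \<epsilon>b by (auto simp: \<delta>_def)
    have \<delta>l: "\<delta> < l"
      using \<epsilon>b(2) l unfolding \<delta>4[symmetric] by (intro power_less_imp_less_base[of \<delta> 4 l]) auto
    have small: "K * \<delta>\<^sup>2 < 2 * l * nbar \<sigma>"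
    proof -
      have p: "0 < 2 * l * nbar \<sigma> / (\<bar>K\<bar> + 1)" using l nbar_pos[OF \<sigma>] by (simp add: add_nonneg_pos)
      have "sqrt \<epsilon> < 2 * l * nbar \<sigma> / (\<bar>K\<bar> + 1)"
        using real_sqrt_less_mono[OF \<epsilon>b(3)] p by simp
      then have "sqrt \<epsilon> * (\<bar>K\<bar> + 1) < 2 * l * nbar \<sigma>" by (simp add: less_divide_eq add_nonneg_pos)
      moreover have "K * sqrt \<epsilon> \<le> sqrt \<epsilon> * (\<bar>K\<bar> + 1)"
        using \<epsilon> by (simp add: mult.commute[of K] mult_left_mono)
      ultimately show ?thesis unfolding \<delta>2 by linarith
    qed
    have rec: "2 * alpha \<sigma> * \<epsilon> * sqrt (A0 \<sigma>) < l * (1 - A0 \<sigma>)"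
      using \<epsilon>b(4) alpha_pos[OF \<sigma>] A by (simp add: less_divide_eq mult_ac)
    obtain n' g' where z': "(n', g') \<in> Y_space l" "F_energy \<sigma> l \<epsilon> n' g' \<le> 16 * l * \<kappa>"
      by (rule recovery_pair[OF l \<sigma> \<epsilon>(1) rec, folded \<kappa>_def])
    have F: "F_energy \<sigma> l (\<delta> ^ 4) n g \<le> C"
      using minimizer_energy_le[OF l z z'(1) min] z'(2) by (simp add: \<delta>4 C_def E_def)
    obtain c where c: "c \<in> {-l<..<l}"
        "4 * l\<^sup>2 * nbar \<sigma> - L * \<delta> \<le> (\<integral>z. n z $ 1 * square_wave l c (fst z) \<partial>torus l)"
      using correlation_with_square_wave[OF l \<sigma> \<delta> \<delta>l f s E z F[unfolded C_def] small[unfolded K_def], folded K_def C1_def, folded L_def]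
      by (rule bexE)
    note lim = low_energy_close_to_limit[OF l \<sigma> \<delta> C z F c(2), folded M1_def]
    have M\<delta>: "4 * l\<^sup>2 * (M1 + C / \<sigma> + C) * \<delta> \<le> M * \<delta>" "32 * l\<^sup>2 * (2 * M1 + 4 * C + 2 * C / \<sigma>) * \<delta> \<le> M * \<delta>"
      using \<delta> by (auto simp: M_def intro!: mult_right_mono)
    show ?thesis
      using c(1) lim[THEN order_trans, OF real_sqrt_le_mono] M\<delta> unfolding \<delta>_def by blast
  qed
  ultimately show ?thesis by blast
qed

section \<open>Passage to the limit\<close>

lemma shift_x_L1:
  assumes l: "l > 0" and f: "f \<in> L1 l"
  shows "shift_x c f \<in> L1 l"
proof -
  have "(\<lambda>p::real\<times>real. (fst p + c, snd p)) \<in> borel_measurable borel"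
    by (auto intro!: borel_measurable_continuous_onI continuous_intros)
  moreover have "f (x + 2 * l + c, y) = f (x + c, y)" for x y
  proof -
    have "x + 2 * l + c = (x + c) + 2 * l" by simp
    then show ?thesis using f by (simp only: L1_iff periodic_def)
  qed
  ultimately show ?thesis
    using f integrable_torus_shift[OF l, of f c] measurable_compose[of _ borel borel f borel]
    by (auto simp: L1_iff shift_x_def periodic_def)
qed

lemma shift_x_L2:
  fixes f :: "real \<times> real \<Rightarrow> real"
  assumes l: "l > 0" and f: "f \<in> L2 l"
  shows "shift_x c f \<in> L2 l"
proof -
  have [measurable]: "f \<in> borel_measurable borel" using f by (simp add: L2_iff)
  have "(\<lambda>p. (f p)\<^sup>2) \<in> L1 l" using f by (simp add: L1_iff L2_iff periodic_def)
  from shift_x_L1[OF l this] shift_x_L1[OF l L2_imp_L1[OF f]] show ?thesis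
    by (simp add: L1_iff L2_iff shift_x_def)
qed

lemma mean_free_L2:
  assumes g: "g \<in> L2 l"
  shows "mean_free l g \<in> L2 l"
proof -
  have [measurable]: "g \<in> borel_measurable borel" using g by (simp add: L2_iff)
  have "integrable (torus l) (\<lambda>p. (g p + - torus_mean l g)\<^sup>2)"
    using g by (intro square_integrable_add) (auto simp: L2_iff measurable_torus)
  then show ?thesis using g by (simp add: L2_iff mean_free_def periodic_def)
qed

text \<open>Exceptions can occur only on the jump lines and on the edge of the cell, which are null
  sets.\<close>

lemma AE_cell_indicators:
  assumes l: "l > 0"
  shows "AE p in lborel. p \<in> cell l \<longrightarrow>
    indicator (L_plus l) (fst p) = (1 + square_wave l 0 (fst p)) / 2 \<and>
    indicator (L_minus l) (fst p) = (1 - square_wave l 0 (fst p)) / 2"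
proof -
  have "AE p in torus l. indicator (L_plus l) (fst p) = (1 + square_wave l 0 (fst p)) / 2 \<and>
    indicator (L_minus l) (fst p) = (1 - square_wave l 0 (fst p)) / 2"
    using AE_torus_cell AE_torus_neq_line[of "l / 2" l] AE_torus_neq_line[of "- (l / 2)" l] AE_torus_neq_line[of "- l" l]
  proof eventually_elim
    case (elim p)
    show ?case
    proof (cases "\<bar>fst p\<bar> < l / 2")
      case True
      then show ?thesis using square_wave_eq_1[OF l, of "fst p" 0] l by (simp add: L_plus_def L_minus_def)
    next
      case False
      then have "l / 2 < \<bar>fst p\<bar>" "\<bar>fst p\<bar> < l" using elim by (auto simp: abs_if split: if_splits)
      then have "square_wave l 0 (fst p) = - 1" using square_wave_eq_neg_1[OF l, of "fst p" 0] l by simp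
      then show ?thesis using \<open>l / 2 < \<bar>fst p\<bar>\<close> \<open>\<bar>fst p\<bar> < l\<close> by (simp add: L_plus_def L_minus_def)
    qed
  qed
  then show ?thesis by (simp only: AE_torus_iff)
qed

lemma tendsto_sqrt_bound:
  fixes h :: "real \<Rightarrow> real"
  assumes E: "E \<subseteq> {0<..}" and \<epsilon>0: "0 < \<epsilon>0" and nn: "\<And>\<epsilon>. 0 \<le> h \<epsilon>"
    and le: "\<And>\<epsilon>. \<epsilon> \<in> E \<Longrightarrow> \<epsilon> < \<epsilon>0 \<Longrightarrow> h \<epsilon> \<le> sqrt (M * sqrt (sqrt \<epsilon>))"
  shows "(h \<longlongrightarrow> 0) (at 0 within E)"
proof (rule tendsto_sandwich[OF _ _ tendsto_const])
  show "\<forall>\<^sub>F \<epsilon> in at 0 within E. 0 \<le> h \<epsilon>" by (simp add: nn)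
  show "\<forall>\<^sub>F \<epsilon> in at 0 within E. h \<epsilon> \<le> sqrt (M * sqrt (sqrt \<epsilon>))"
    unfolding eventually_at using \<epsilon>0 le E by (intro exI[of _ \<epsilon>0]) (auto simp: dist_real_def)
  have "((\<lambda>\<epsilon>. sqrt (M * sqrt (sqrt \<epsilon>))) \<longlongrightarrow> sqrt (M * sqrt (sqrt 0))) (at 0 within E)"
    by (intro tendsto_intros)
  then show "((\<lambda>\<epsilon>. sqrt (M * sqrt (sqrt \<epsilon>))) \<longlongrightarrow> 0) (at 0 within E)" by simp
qed

text \<open>A sequence of minimizers is encoded as a family over a set \<open>E\<close> of positive
  parameters, with limits along \<open>at 0 within E\<close>. The potentials enter through
  \<open>mean_free\<close>: adding a constant to g leaves the energy unchanged, so g itself need not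
  converge.\<close>

theorem theorem2p1:
  fixes \<sigma> l :: real
    and E :: "real set"
    and n :: "real \<Rightarrow> real \<times> real \<Rightarrow> real^3"
    and g :: "real \<Rightarrow> real \<times> real \<Rightarrow> real"
  assumes "\<sigma> > 0" and "l > 0"
    and "E \<subseteq> {0<..}"
    and "\<And>\<epsilon>. \<epsilon> \<in> E \<Longrightarrow> (n \<epsilon>, g \<epsilon>) \<in> Y_space l"
    and "\<And>\<epsilon>. \<epsilon> \<in> E \<Longrightarrow> minimizes_G \<sigma> l \<epsilon> (n \<epsilon>, g \<epsilon>)"
  shows "\<exists>(c :: real \<Rightarrow> real) n0 g0.
      (\<forall>\<epsilon>\<in>E. c \<epsilon> \<in> {-l<..<l}) \<and>
      n0 \<in> L1_sphere l \<and> g0 \<in> W12 l \<and>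
      (AE p in lborel. p \<in> cell l \<longrightarrow>
         n0 p = indicator (L_minus l) (fst p) *\<^sub>R n_minus \<sigma>
              + indicator (L_plus l) (fst p) *\<^sub>R n_plus \<sigma>) \<and>
      (AE p in lborel. p \<in> cell l \<longrightarrow>
         weak_dx l g0 p = nbar \<sigma> * indicator (L_minus l) (fst p)
                        - nbar \<sigma> * indicator (L_plus l) (fst p)) \<and>
      tendsto_L1 l (\<lambda>\<epsilon>. shift_x (c \<epsilon>) (n \<epsilon>)) n0 (at 0 within E) \<and>
      tendsto_L2 l (\<lambda>\<epsilon>. shift_x (c \<epsilon>) (mean_free l (g \<epsilon>))) g0 (at 0 within E) \<and>
      G0_energy \<sigma> l (n0, g0) = ereal (8 * c0 \<sigma> * l) \<and>
      c0 \<sigma> = 2 / sqrt (A0 \<sigma>) * (sin (alpha \<sigma>) - alpha \<sigma> * cos (alpha \<sigma>))"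
proof -
  have \<sigma>: "\<sigma> > 0" and l: "l > 0" and E: "E \<subseteq> {0<..}" using assms by auto
  obtain M \<epsilon>0 where \<epsilon>0: "0 < \<epsilon>0" and M: "\<forall>\<epsilon> n g. 0 < \<epsilon> \<longrightarrow> \<epsilon> < \<epsilon>0 \<longrightarrow> (n, g) \<in> Y_space l \<longrightarrow>
     minimizes_G \<sigma> l \<epsilon> (n, g) \<longrightarrow>
     (\<exists>c\<in>{-l<..<l}. L1_norm l (\<lambda>p. shift_x c n p - limit_director \<sigma> l p) \<le> sqrt (M * sqrt (sqrt \<epsilon>)) \<and>
        L2_norm l (\<lambda>p. shift_x c (mean_free l g) p - limit_layer \<sigma> l p) \<le> sqrt (M * sqrt (sqrt \<epsilon>)))"
    using minimizers_close_to_limit[OF l \<sigma>] by blast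
  have "\<forall>\<epsilon>. \<exists>c. \<epsilon> \<in> E \<longrightarrow> c \<in> {-l<..<l} \<and> (\<epsilon> < \<epsilon>0 \<longrightarrow>
      L1_norm l (\<lambda>p. shift_x c (n \<epsilon>) p - limit_director \<sigma> l p) \<le> sqrt (M * sqrt (sqrt \<epsilon>)) \<and>
      L2_norm l (\<lambda>p. shift_x c (mean_free l (g \<epsilon>)) p - limit_layer \<sigma> l p) \<le> sqrt (M * sqrt (sqrt \<epsilon>)))"
  proof
    fix \<epsilon>
    show "\<exists>c. \<epsilon> \<in> E \<longrightarrow> c \<in> {-l<..<l} \<and> (\<epsilon> < \<epsilon>0 \<longrightarrow>
      L1_norm l (\<lambda>p. shift_x c (n \<epsilon>) p - limit_director \<sigma> l p) \<le> sqrt (M * sqrt (sqrt \<epsilon>)) \<and>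
      L2_norm l (\<lambda>p. shift_x c (mean_free l (g \<epsilon>)) p - limit_layer \<sigma> l p) \<le> sqrt (M * sqrt (sqrt \<epsilon>)))"
    proof (cases "\<epsilon> \<in> E \<and> \<epsilon> < \<epsilon>0")
      case True
      then have "0 < \<epsilon>" using E by auto
      with M True assms(4,5) show ?thesis by blast
    next
      case False
      \<comment> \<open>For the remaining parameters nothing is asked beyond membership in the
        interval, which contains zero.\<close>
      then show ?thesis using l by (intro exI[of _ 0]) auto
    qed
  qed
  then obtain c where c: "\<forall>\<epsilon>. \<epsilon> \<in> E \<longrightarrow> c \<epsilon> \<in> {-l<..<l} \<and> (\<epsilon> < \<epsilon>0 \<longrightarrow>
      L1_norm l (\<lambda>p. shift_x (c \<epsilon>) (n \<epsilon>) p - limit_director \<sigma> l p) \<le> sqrt (M * sqrt (sqrt \<epsilon>)) \<and>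
      L2_norm l (\<lambda>p. shift_x (c \<epsilon>) (mean_free l (g \<epsilon>)) p - limit_layer \<sigma> l p) \<le> sqrt (M * sqrt (sqrt \<epsilon>)))"
    by (rule choice[THEN exE])
  have evE: "\<forall>\<^sub>F \<epsilon> in at 0 within E. \<epsilon> \<in> E" by (auto simp: eventually_at intro: exI[of _ 1])
  have n0: "limit_director \<sigma> l \<in> L1_sphere l" by (rule limit_director_L1_sphere[OF l \<sigma>])
  have g0: "limit_layer \<sigma> l \<in> W12 l" by (rule limit_layer_W12[OF l])
  have nAE: "AE p in lborel. p \<in> cell l \<longrightarrow>
         limit_director \<sigma> l p = indicator (L_minus l) (fst p) *\<^sub>R n_minus \<sigma>
              + indicator (L_plus l) (fst p) *\<^sub>R n_plus \<sigma>"
    using AE_cell_indicators[OF l]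
  proof eventually_elim
    case (elim p)
    show ?case
    proof
      assume "p \<in> cell l"
      with elim have I: "indicator (L_plus l) (fst p) = (1 + square_wave l 0 (fst p)) / 2"
        "indicator (L_minus l) (fst p) = (1 - square_wave l 0 (fst p)) / 2" by auto
      show "limit_director \<sigma> l p = indicator (L_minus l) (fst p) *\<^sub>R n_minus \<sigma>
              + indicator (L_plus l) (fst p) *\<^sub>R n_plus \<sigma>"
        unfolding I by (simp add: vec_eq_iff forall_3 limit_director_nth n_minus_def n_plus_def field_simps)
    qed
  qed
  have gAE: "AE p in lborel. p \<in> cell l \<longrightarrow>
         weak_dx l (limit_layer \<sigma> l) p = nbar \<sigma> * indicator (L_minus l) (fst p)
                        - nbar \<sigma> * indicator (L_plus l) (fst p)"
    using AE_cell_indicators[OF l] weak_dx_limit_layer[OF l, of \<sigma>]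
  proof eventually_elim
    case (elim p)
    show ?case
    proof
      assume "p \<in> cell l"
      with elim(1) have I: "indicator (L_plus l) (fst p) = (1 + square_wave l 0 (fst p)) / 2"
        "indicator (L_minus l) (fst p) = (1 - square_wave l 0 (fst p)) / 2" by auto
      show "weak_dx l (limit_layer \<sigma> l) p = nbar \<sigma> * indicator (L_minus l) (fst p)
                        - nbar \<sigma> * indicator (L_plus l) (fst p)"
        using elim(2) \<open>p \<in> cell l\<close> unfolding I by (simp add: field_simps)
    qed
  qed
  have "\<forall>\<^sub>F \<epsilon> in at 0 within E. shift_x (c \<epsilon>) (n \<epsilon>) \<in> L1 l"
    using evE
  proof eventually_elim
    case (elim \<epsilon>)
    have "n \<epsilon> \<in> L1 l" using assms(5)[OF elim] by (auto simp: minimizes_G_def L1_sphere_def)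
    then show ?case by (rule shift_x_L1[OF l])
  qed
  moreover have "((\<lambda>\<epsilon>. L1_norm l (\<lambda>p. shift_x (c \<epsilon>) (n \<epsilon>) p - limit_director \<sigma> l p)) \<longlongrightarrow> 0) (at 0 within E)"
    using c by (intro tendsto_sqrt_bound[OF E \<epsilon>0])
      (auto simp: L1_norm_def set_lebesgue_integral_def intro!: integral_nonneg_AE)
  ultimately have nT: "tendsto_L1 l (\<lambda>\<epsilon>. shift_x (c \<epsilon>) (n \<epsilon>)) (limit_director \<sigma> l) (at 0 within E)"
    using n0 by (simp add: tendsto_L1_def L1_sphere_def)
  have "\<forall>\<^sub>F \<epsilon> in at 0 within E. shift_x (c \<epsilon>) (mean_free l (g \<epsilon>)) \<in> L2 l"
    using evE
  proof eventually_elim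
    case (elim \<epsilon>)
    show ?case by (intro shift_x_L2[OF l] mean_free_L2 Y_space_components(6)[OF l assms(4)[OF elim]])
  qed
  moreover have "((\<lambda>\<epsilon>. L2_norm l (\<lambda>p. shift_x (c \<epsilon>) (mean_free l (g \<epsilon>)) p - limit_layer \<sigma> l p)) \<longlongrightarrow> 0) (at 0 within E)"
    using c by (intro tendsto_sqrt_bound[OF E \<epsilon>0])
      (auto simp: L2_norm_def set_lebesgue_integral_def intro!: integral_nonneg_AE)
  ultimately have gT: "tendsto_L2 l (\<lambda>\<epsilon>. shift_x (c \<epsilon>) (mean_free l (g \<epsilon>))) (limit_layer \<sigma> l) (at 0 within E)"
    using g0 by (simp add: tendsto_L2_def W12_def)
  show ?thesis
    using c n0 g0 nAE gAE nT gT G0_limit[OF l \<sigma>] c0_eq[OF \<sigma>]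
    by (intro exI[of _ c] exI[of _ "limit_director \<sigma> l"] exI[of _ "limit_layer \<sigma> l"]) blast
qed

end
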